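(* Let $k$ be a field. (1) There is a category $\underline{\mathrm{Mod}}$ enriched over comodules whose objects are modules (over arbitrary $k$-algebras) and whose hom-object $\underline{\mathrm{Mod}}({}_AM,{}_BN)$ is the universal measuring comodule $Q(M,N)$. (2) There is a category $\underline{\mathrm{Comod}}$ enriched over comodules whose objects are comodules (over arbitrary $k$-coalgebras) and whose hom-object $\underline{\mathrm{Comod}}({}_HX,{}_KY)$ is the universal measuring comodule $Q(X,Y)$. (3) Let $M,N$ be modules over algebras $A,B$ respectively. There are natural equivalences $$\underline{\mathrm{Comod}}(-,Q(M,N))\cong\underline{\mathrm{Mod}}(M,[-,N])\cong\underline{\mathrm{Mod}}(M\triangleleft-,N),$$ i.e. isomorphisms $Q(X,Q(M,N))\cong Q(M,[X,N])\cong Q(M\triangleleft X,N)$, natural in the comodule $X$ over a coalgebra $H$; these are isomorphisms of comodules over the coalgebras $P(H,P(A,B))\cong P(A,[H,B])\cong P(A\triangleleft H,B)$, identified by their canonical natural isomorphisms.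
   Context: Algebras are associative unital, coalgebras coassociative counital over $k$; modules and comodules are left ones. Write $\triangle h=\sum_{(h)}h_{(2)}\otimes h_{(1)}$ and $\triangle_X(x)=\sum_{(x)}x_{(1)}\otimes x_{(0)}\in H\otimes X$ for an $H$-comodule $X$. "Comodules", as the base of enrichment, means comodules over varying coalgebras with $\otimes_k$ (an $H$-comodule tensor a $K$-comodule is an $H\otimes K$-comodule). Algebras: a linear map $\rho:H\to\mathrm{Hom}_k(A,B)$ measures if $\rho(h)(aa')=\sum\rho(h_{(2)})(a)\rho(h_{(1)})(a')$ and $\rho(h)(1_A)=\epsilon(h)1_B$; $\pi:P(A,B)\to\mathrm{Hom}_k(A,B)$ is the (existing) universal one, through which every measuring $\rho$ factors by a unique coalgebra map. Coalgebras: a linear map $L\to\mathrm{Hom}_k(H,K)$ measures if $L\otimes H\to K$ is a coalgebra map; $P(H,K)$ is the (existing) universal one. Modules: for an $A$-module $M$, a $B$-module $N$ and a comodule $X$ over a coalgebra $H$ measuring via $\rho:H\to\mathrm{Hom}_k(A,B)$, a linear map $\gamma:X\to\mathrm{Hom}_k(M,N)$ measures if $\gamma(x)(am)=\sum\rho(x_{(1)})(a)\gamma(x_{(0)})(m)$. $Q(M,N)$ is the (existing) universal measuring comodule: a $P(A,B)$-comodule with a measuring map to $\mathrm{Hom}_k(M,N)$ through which every measuring comodule (regarded as a $P(A,B)$-comodule via $H\to P(A,B)$) factors by a unique comodule map. Comodules: for $X,Y$ over $H,K$ and a $P(H,K)$-comodule $Z$, a linear map $\theta:Z\to\mathrm{Hom}_k(X,Y)$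 measures if $\triangle_Y(\theta(z)(x))=\sum z_{(1)}(x_{(1)})\otimes\theta(z_{(0)})(x_{(0)})$, where $z_{(1)}\in P(H,K)$ acts via $P(H,K)\to\mathrm{Hom}_k(H,K)$; $Q(X,Y)$ is the (existing) universal such $P(H,K)$-comodule. Composition is induced from composition of linear maps by the universal properties. $[H,B]=\mathrm{Hom}_k(H,B)$ with product $(\alpha*\beta)(h)=\sum\alpha(h_{(2)})\beta(h_{(1)})$; $[X,N]=\mathrm{Hom}_k(X,N)$ is an $[H,B]$-module by $(\alpha*\zeta)(x)=\sum\alpha(x_{(1)})\zeta(x_{(0)})$. $A\triangleleft H=T(A\otimes H)/J$, with $J$ the two-sided ideal generated by $aa'\otimes h-\sum(a\otimes h_{(2)})\cdot(a'\otimes h_{(1)})$ and $1_A\otimes h-\epsilon(h)1$. $M\triangleleft X=(A\triangleleft H\otimes M\otimes X)/R$, with $R$ the $A\triangleleft H$-submodule generated by $1\otimes am\otimes x-\sum_{(x)}(a\otimes x_{(1)})\otimes m\otimes x_{(0)}$; it is an $A\triangleleft H$-module. The canonical isomorphisms $P(A\triangleleft H,B)\cong P(A,[H,B])\cong P(H,P(A,B))$ are those induced, for each coalgebra $C$, by the identifications (measuring maps being viewed as multilinear maps $C\otimes A\otimes H\to B$) of the sets of coalgebra maps from $C$ into them. *)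

theory Defs
  imports "HOL-Algebra.Module" "HOL-Algebra.QuotRing"
begin

text \<open>
  The ground field is a record \<open>k\<close> in the sense of HOL-Algebra and a vector space over it is a
  record \<open>V\<close> with \<open>module k V\<close>; the fields \<open>mult\<close> and \<open>one\<close> of a vector space carry no meaning
  unless it is an algebra.  Linear maps are extensional functions, so that equality of linear maps
  is equality of functions.
\<close>

section \<open>Linear algebra\<close>

definition Lin ::
    "('k,'r) ring_scheme \<Rightarrow> ('k,'v,'p) module_scheme \<Rightarrow> ('k,'w,'q) module_scheme \<Rightarrow> ('v \<Rightarrow> 'w) set" where
  "Lin k V W = {f \<in> carrier V \<rightarrow>\<^sub>E carrier W.
     (\<forall>x \<in> carrier V. \<forall>y \<in> carrier V. f (x \<oplus>\<^bsub>V\<^esub> y) = f x \<oplus>\<^bsub>W\<^esub> f y) \<and>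
     (\<forall>c \<in> carrier k. \<forall>x \<in> carrier V. f (c \<odot>\<^bsub>V\<^esub> x) = c \<odot>\<^bsub>W\<^esub> f x)}"

definition hom_space ::
    "('k,'r) ring_scheme \<Rightarrow> ('k,'v,'p) module_scheme \<Rightarrow> ('k,'w,'q) module_scheme \<Rightarrow> ('k,'v \<Rightarrow> 'w) module" where
  "hom_space k V W = \<lparr>
     carrier = Lin k V W,
     mult = undefined,
     one = undefined,
     zero = (\<lambda>x \<in> carrier V. \<zero>\<^bsub>W\<^esub>),
     add = (\<lambda>f g. \<lambda>x \<in> carrier V. f x \<oplus>\<^bsub>W\<^esub> g x),
     smult = (\<lambda>c f. \<lambda>x \<in> carrier V. c \<odot>\<^bsub>W\<^esub> f x)\<rparr>"

definition ground_space :: "('k,'r) ring_scheme \<Rightarrow> ('k,'k) module" where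
  "ground_space k = \<lparr>carrier = carrier k, mult = mult k, one = \<one>\<^bsub>k\<^esub>, zero = \<zero>\<^bsub>k\<^esub>, add = add k,
     smult = mult k\<rparr>"

text \<open>The quotient by a subspace, and also the quotient of an algebra by a two-sided ideal.\<close>

definition quot :: "('k,'v,'p) module_scheme \<Rightarrow> 'v set \<Rightarrow> ('k,'v set) module" where
  "quot V U = \<lparr>
     carrier = carrier (V Quot U),
     mult = mult (V Quot U),
     one = one (V Quot U),
     zero = zero (V Quot U),
     add = add (V Quot U),
     smult = (\<lambda>c T. \<Union>t \<in> T. U +>\<^bsub>V\<^esub> (c \<odot>\<^bsub>V\<^esub> t))\<rparr>"

definition subspace_gen :: "('k,'r) ring_scheme \<Rightarrow> ('k,'v,'p) module_scheme \<Rightarrow> 'v set \<Rightarrow> 'v set" where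
  "subspace_gen k V S = \<Inter>{U. submodule U k V \<and> S \<subseteq> U}"

definition basis_vec :: "('k,'r) ring_scheme \<Rightarrow> 's \<Rightarrow> 's \<Rightarrow> 'k" where
  "basis_vec k s = (\<lambda>t. if t = s then \<one>\<^bsub>k\<^esub> else \<zero>\<^bsub>k\<^esub>)"

definition free_space :: "('k,'r) ring_scheme \<Rightarrow> 's set \<Rightarrow> ('k,'s \<Rightarrow> 'k) module" where
  "free_space k S = \<lparr>
     carrier = {f. (\<forall>s. f s \<in> carrier k) \<and> {s. f s \<noteq> \<zero>\<^bsub>k\<^esub>} \<subseteq> S \<and> finite {s. f s \<noteq> \<zero>\<^bsub>k\<^esub>}},
     mult = undefined,
     one = undefined,
     zero = (\<lambda>s. \<zero>\<^bsub>k\<^esub>),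
     add = (\<lambda>f g s. f s \<oplus>\<^bsub>k\<^esub> g s),
     smult = (\<lambda>c f s. c \<otimes>\<^bsub>k\<^esub> f s)\<rparr>"

section \<open>Tensor products\<close>

type_synonym ('k,'v,'w) tensor = "('v \<times> 'w \<Rightarrow> 'k) set"

definition bilinear_relations ::
    "('k,'r) ring_scheme \<Rightarrow> ('k,'v,'p) module_scheme \<Rightarrow> ('k,'w,'q) module_scheme \<Rightarrow> ('v \<times> 'w \<Rightarrow> 'k) set" where
  "bilinear_relations k V W =
     (let F = free_space k (carrier V \<times> carrier W); e = (\<lambda>v w. basis_vec k (v, w)) in
       {e (v \<oplus>\<^bsub>V\<^esub> v') w \<ominus>\<^bsub>F\<^esub> (e v w \<oplus>\<^bsub>F\<^esub> e v' w) | v v' w.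
          v \<in> carrier V \<and> v' \<in> carrier V \<and> w \<in> carrier W}
     \<union> {e v (w \<oplus>\<^bsub>W\<^esub> w') \<ominus>\<^bsub>F\<^esub> (e v w \<oplus>\<^bsub>F\<^esub> e v w') | v w w'.
          v \<in> carrier V \<and> w \<in> carrier W \<and> w' \<in> carrier W}
     \<union> {e (c \<odot>\<^bsub>V\<^esub> v) w \<ominus>\<^bsub>F\<^esub> c \<odot>\<^bsub>F\<^esub> e v w | c v w.
          c \<in> carrier k \<and> v \<in> carrier V \<and> w \<in> carrier W}
     \<union> {e v (c \<odot>\<^bsub>W\<^esub> w) \<ominus>\<^bsub>F\<^esub> c \<odot>\<^bsub>F\<^esub> e v w | c v w.
          c \<in> carrier k \<and> v \<in> carrier V \<and> w \<in> carrier W})"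

definition tensor ::
    "('k,'r) ring_scheme \<Rightarrow> ('k,'v,'p) module_scheme \<Rightarrow> ('k,'w,'q) module_scheme \<Rightarrow>
      ('k,('k,'v,'w) tensor) module" where
  "tensor k V W =
     (let F = free_space k (carrier V \<times> carrier W)
      in quot F (subspace_gen k F (bilinear_relations k V W)))"

definition tens ::
    "('k,'r) ring_scheme \<Rightarrow> ('k,'v,'p) module_scheme \<Rightarrow> ('k,'w,'q) module_scheme \<Rightarrow>
      'v \<Rightarrow> 'w \<Rightarrow> ('k,'v,'w) tensor" where
  "tens k V W v w =
     (let F = free_space k (carrier V \<times> carrier W)
      in subspace_gen k F (bilinear_relations k V W) +>\<^bsub>F\<^esub> basis_vec k (v, w))"

text \<open>
  The linear map on \<open>V \<otimes> W\<close> given by a bilinear map \<open>\<beta>\<close>.  If \<open>t\<close> is \<open>\<Sum> t' \<otimes> t''\<close>, then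
  \<open>tlift k V W U \<beta> t\<close> is \<open>\<Sum> \<beta> t' t''\<close>; all Sweedler sums below are written in this way.  For
  \<open>\<triangle> h = \<Sum> h_(2) \<otimes> h_(1)\<close> the first argument of \<open>\<beta>\<close> is thus \<open>h_(2)\<close>, and for a comodule, with
  \<open>\<triangle> x = \<Sum> x_(1) \<otimes> x_(0)\<close>, it is \<open>x_(1)\<close>.
\<close>

definition tlift ::
    "('k,'r) ring_scheme \<Rightarrow> ('k,'v,'p) module_scheme \<Rightarrow> ('k,'w,'q) module_scheme \<Rightarrow>
      ('k,'u,'s) module_scheme \<Rightarrow> ('v \<Rightarrow> 'w \<Rightarrow> 'u) \<Rightarrow> ('k,'v,'w) tensor \<Rightarrow> 'u" where
  "tlift k V W U \<beta> = (THE f. f \<in> Lin k (tensor k V W) U \<and>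
     (\<forall>v \<in> carrier V. \<forall>w \<in> carrier W. f (tens k V W v w) = \<beta> v w))"

definition tmap ::
    "('k,'r) ring_scheme \<Rightarrow> ('k,'v,'p) module_scheme \<Rightarrow> ('k,'w,'q) module_scheme \<Rightarrow>
      ('k,'v1,'p1) module_scheme \<Rightarrow> ('k,'w1,'q1) module_scheme \<Rightarrow>
      ('v \<Rightarrow> 'v1) \<Rightarrow> ('w \<Rightarrow> 'w1) \<Rightarrow> ('k,'v,'w) tensor \<Rightarrow> ('k,'v1,'w1) tensor" where
  "tmap k V W V' W' f g = tlift k V W (tensor k V' W') (\<lambda>v w. tens k V' W' (f v) (g w))"

text \<open>\<open>(U \<otimes> V) \<otimes> W \<rightarrow> U \<otimes> (V \<otimes> W)\<close>\<close>

definition tassoc ::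
    "('k,'r) ring_scheme \<Rightarrow> ('k,'u,'o) module_scheme \<Rightarrow> ('k,'v,'p) module_scheme \<Rightarrow>
      ('k,'w,'q) module_scheme \<Rightarrow>
      ('k,('k,'u,'v) tensor,'w) tensor \<Rightarrow> ('k,'u,('k,'v,'w) tensor) tensor" where
  "tassoc k U V W =
     (let T = tensor k U (tensor k V W) in
      tlift k (tensor k U V) W T
        (\<lambda>t w. tlift k U V T (\<lambda>u v. tens k U (tensor k V W) u (tens k V W v w)) t))"

text \<open>\<open>(U \<otimes> V) \<otimes> (U' \<otimes> V') \<rightarrow> (U \<otimes> U') \<otimes> (V \<otimes> V')\<close>, exchanging the two middle factors\<close>

definition texchange ::
    "('k,'r) ring_scheme \<Rightarrow> ('k,'u,'o) module_scheme \<Rightarrow> ('k,'v,'p) module_scheme \<Rightarrow>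
      ('k,'u1,'o1) module_scheme \<Rightarrow> ('k,'v1,'p1) module_scheme \<Rightarrow>
      ('k,('k,'u,'v) tensor,('k,'u1,'v1) tensor) tensor \<Rightarrow>
      ('k,('k,'u,'u1) tensor,('k,'v,'v1) tensor) tensor" where
  "texchange k U V U' V' =
     (let T = tensor k (tensor k U U') (tensor k V V') in
      tlift k (tensor k U V) (tensor k U' V') T
        (\<lambda>s s'. tlift k U V T
          (\<lambda>u v. tlift k U' V' T
            (\<lambda>u' v'. tens k (tensor k U U') (tensor k V V') (tens k U U' u u') (tens k V V' v v')) s') s))"

section \<open>Algebras and modules\<close>

text \<open>The library's \<^locale>\<open>algebra\<close> is restricted to commutative algebras.\<close>

definition k_algebra :: "('k,'r) ring_scheme \<Rightarrow> ('k,'a) module \<Rightarrow> bool" where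
  "k_algebra k A \<longleftrightarrow> module k A \<and> ring A \<and>
     (\<forall>c \<in> carrier k. \<forall>x \<in> carrier A. \<forall>y \<in> carrier A.
        (c \<odot>\<^bsub>A\<^esub> x) \<otimes>\<^bsub>A\<^esub> y = c \<odot>\<^bsub>A\<^esub> (x \<otimes>\<^bsub>A\<^esub> y) \<and>
        x \<otimes>\<^bsub>A\<^esub> (c \<odot>\<^bsub>A\<^esub> y) = c \<odot>\<^bsub>A\<^esub> (x \<otimes>\<^bsub>A\<^esub> y))"

record ('k,'a,'m) alg_module = "('k,'m) module" +
  act :: "'a \<Rightarrow> 'm \<Rightarrow> 'm"

definition left_module :: "('k,'r) ring_scheme \<Rightarrow> ('k,'a) module \<Rightarrow> ('k,'a,'m) alg_module \<Rightarrow> bool" where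
  "left_module k A M \<longleftrightarrow> module k M \<and>
     (\<forall>a \<in> carrier A. \<forall>m \<in> carrier M. act M a m \<in> carrier M) \<and>
     (\<forall>a \<in> carrier A. \<forall>m \<in> carrier M. \<forall>m' \<in> carrier M.
        act M a (m \<oplus>\<^bsub>M\<^esub> m') = act M a m \<oplus>\<^bsub>M\<^esub> act M a m') \<and>
     (\<forall>a \<in> carrier A. \<forall>a' \<in> carrier A. \<forall>m \<in> carrier M.
        act M (a \<oplus>\<^bsub>A\<^esub> a') m = act M a m \<oplus>\<^bsub>M\<^esub> act M a' m) \<and>
     (\<forall>c \<in> carrier k. \<forall>a \<in> carrier A. \<forall>m \<in> carrier M.
        act M (c \<odot>\<^bsub>A\<^esub> a) m = c \<odot>\<^bsub>M\<^esub> act M a m \<and>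
        act M a (c \<odot>\<^bsub>M\<^esub> m) = c \<odot>\<^bsub>M\<^esub> act M a m) \<and>
     (\<forall>a \<in> carrier A. \<forall>a' \<in> carrier A. \<forall>m \<in> carrier M.
        act M (a \<otimes>\<^bsub>A\<^esub> a') m = act M a (act M a' m)) \<and>
     (\<forall>m \<in> carrier M. act M \<one>\<^bsub>A\<^esub> m = m)"

section \<open>Coalgebras and comodules\<close>

record ('k,'c) coalg = "('k,'c) module" +
  comult :: "'c \<Rightarrow> ('k,'c,'c) tensor"
  counit :: "'c \<Rightarrow> 'k"

definition coalgebra :: "('k,'r) ring_scheme \<Rightarrow> ('k,'c) coalg \<Rightarrow> bool" where
  "coalgebra k C \<longleftrightarrow> module k C \<and>
     comult C \<in> Lin k C (tensor k C C) \<and>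
     counit C \<in> Lin k C (ground_space k) \<and>
     (\<forall>c \<in> carrier C.
        tassoc k C C C (tmap k C C (tensor k C C) C (comult C) (\<lambda>x. x) (comult C c)) =
        tmap k C C C (tensor k C C) (\<lambda>x. x) (comult C) (comult C c)) \<and>
     (\<forall>c \<in> carrier C.
        tlift k C C C (\<lambda>x y. counit C x \<odot>\<^bsub>C\<^esub> y) (comult C c) = c \<and>
        tlift k C C C (\<lambda>x y. counit C y \<odot>\<^bsub>C\<^esub> x) (comult C c) = c)"

definition coalg_map :: "('k,'r) ring_scheme \<Rightarrow> ('k,'c) coalg \<Rightarrow> ('k,'d) coalg \<Rightarrow> ('c \<Rightarrow> 'd) \<Rightarrow> bool" where
  "coalg_map k C D f \<longleftrightarrow> f \<in> Lin k C D \<and>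
     (\<forall>c \<in> carrier C. comult D (f c) = tmap k C C D D f f (comult C c)) \<and>
     (\<forall>c \<in> carrier C. counit D (f c) = counit C c)"

record ('k,'h,'x) comod = "('k,'x) module" +
  coact :: "'x \<Rightarrow> ('k,'h,'x) tensor"

definition comodule :: "('k,'r) ring_scheme \<Rightarrow> ('k,'h) coalg \<Rightarrow> ('k,'h,'x) comod \<Rightarrow> bool" where
  "comodule k H X \<longleftrightarrow> module k X \<and>
     coact X \<in> Lin k X (tensor k H X) \<and>
     (\<forall>x \<in> carrier X.
        tassoc k H H X (tmap k H X (tensor k H H) X (comult H) (\<lambda>x. x) (coact X x)) =
        tmap k H X H (tensor k H X) (\<lambda>h. h) (coact X) (coact X x)) \<and>
     (\<forall>x \<in> carrier X. tlift k H X X (\<lambda>h y. counit H h \<odot>\<^bsub>X\<^esub> y) (coact X x) = x)"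

text \<open>A map of comodules along a map \<open>f\<close> of coalgebras, that is, a map of \<open>D\<close>-comodules
  from \<open>X\<close>, regarded as a \<open>D\<close>-comodule via \<open>f : C \<rightarrow> D\<close>, to \<open>Y\<close>.\<close>

definition comodule_map_along ::
    "('k,'r) ring_scheme \<Rightarrow> ('k,'c) coalg \<Rightarrow> ('k,'d) coalg \<Rightarrow> ('c \<Rightarrow> 'd) \<Rightarrow>
      ('k,'c,'x) comod \<Rightarrow> ('k,'d,'y) comod \<Rightarrow> ('x \<Rightarrow> 'y) \<Rightarrow> bool" where
  "comodule_map_along k C D f X Y \<phi> \<longleftrightarrow> \<phi> \<in> Lin k X Y \<and>
     (\<forall>x \<in> carrier X. coact Y (\<phi> x) = tmap k C X D Y f \<phi> (coact X x))"

definition tensor_coalg ::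
    "('k,'r) ring_scheme \<Rightarrow> ('k,'c) coalg \<Rightarrow> ('k,'d) coalg \<Rightarrow> ('k,('k,'c,'d) tensor) coalg" where
  "tensor_coalg k C D = module.extend (tensor k C D) (coalg.fields
     (compose (carrier (tensor k C D))
        (texchange k C C D D)
        (tmap k C D (tensor k C C) (tensor k D D) (comult C) (comult D)))
     (tlift k C D (ground_space k) (\<lambda>c d. counit C c \<otimes>\<^bsub>k\<^esub> counit D d)))"

definition tensor_comod ::
    "('k,'r) ring_scheme \<Rightarrow> ('k,'c) coalg \<Rightarrow> ('k,'d) coalg \<Rightarrow>
      ('k,'c,'x) comod \<Rightarrow> ('k,'d,'y) comod \<Rightarrow> ('k,('k,'c,'d) tensor,('k,'x,'y) tensor) comod" where
  "tensor_comod k C D X Y = module.extend (tensor k X Y) (comod.fields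
     (compose (carrier (tensor k X Y))
        (texchange k C X D Y)
        (tmap k X Y (tensor k C X) (tensor k D Y) (coact X) (coact Y))))"

definition ground_coalg :: "('k,'r) ring_scheme \<Rightarrow> ('k,'k) coalg" where
  "ground_coalg k = module.extend (ground_space k) (coalg.fields
     (\<lambda>c \<in> carrier k. tens k (ground_space k) (ground_space k) c \<one>\<^bsub>k\<^esub>)
     (\<lambda>c \<in> carrier k. c))"

definition ground_comod :: "('k,'r) ring_scheme \<Rightarrow> ('k,'k,'k) comod" where
  "ground_comod k = module.extend (ground_space k) (comod.fields
     (\<lambda>c \<in> carrier k. tens k (ground_space k) (ground_space k) \<one>\<^bsub>k\<^esub> c))"

section \<open>The monoidal category of comodules over varying coalgebras\<close>

text \<open>An object is a pair of a coalgebra \<open>C\<close> and a \<open>C\<close>-comodule; a morphism is a pair of a map of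
  coalgebras and a map of comodules along it.\<close>

type_synonym ('k,'c,'x) cobj = "('k,'c) coalg \<times> ('k,'c,'x) comod"
type_synonym ('c,'d,'x,'y) cmor = "('c \<Rightarrow> 'd) \<times> ('x \<Rightarrow> 'y)"

definition cobj :: "('k,'r) ring_scheme \<Rightarrow> ('k,'c,'x) cobj \<Rightarrow> bool" where
  "cobj k S \<longleftrightarrow> coalgebra k (fst S) \<and> comodule k (fst S) (snd S)"

definition cmor ::
    "('k,'r) ring_scheme \<Rightarrow> ('k,'c,'x) cobj \<Rightarrow> ('k,'d,'y) cobj \<Rightarrow> ('c,'d,'x,'y) cmor \<Rightarrow> bool" where
  "cmor k S T m \<longleftrightarrow> coalg_map k (fst S) (fst T) (fst m) \<and>
     comodule_map_along k (fst S) (fst T) (fst m) (snd S) (snd T) (snd m)"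

definition cid :: "('k,'c,'x) cobj \<Rightarrow> ('c,'c,'x,'x) cmor" where
  "cid S = (\<lambda>c \<in> carrier (fst S). c, \<lambda>x \<in> carrier (snd S). x)"

text \<open>\<open>ccomp S n m\<close> is \<open>n \<circ> m\<close>, where \<open>S\<close> is the domain of \<open>m\<close>.\<close>

definition ccomp ::
    "('k,'c,'x) cobj \<Rightarrow> ('d,'e,'y,'z) cmor \<Rightarrow> ('c,'d,'x,'y) cmor \<Rightarrow> ('c,'e,'x,'z) cmor" where
  "ccomp S n m = (compose (carrier (fst S)) (fst n) (fst m), compose (carrier (snd S)) (snd n) (snd m))"

definition ciso ::
    "('k,'r) ring_scheme \<Rightarrow> ('k,'c,'x) cobj \<Rightarrow> ('k,'d,'y) cobj \<Rightarrow> ('c,'d,'x,'y) cmor \<Rightarrow> bool" where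
  "ciso k S T m \<longleftrightarrow> cmor k S T m \<and>
     (\<exists>n. cmor k T S n \<and> ccomp S n m = cid S \<and> ccomp T m n = cid T)"

definition cunit :: "('k,'r) ring_scheme \<Rightarrow> ('k,'k,'k) cobj" where
  "cunit k = (ground_coalg k, ground_comod k)"

definition ctensor ::
    "('k,'r) ring_scheme \<Rightarrow> ('k,'c,'x) cobj \<Rightarrow> ('k,'d,'y) cobj \<Rightarrow>
      ('k,('k,'c,'d) tensor,('k,'x,'y) tensor) cobj" where
  "ctensor k S T = (tensor_coalg k (fst S) (fst T), tensor_comod k (fst S) (fst T) (snd S) (snd T))"

definition ctensor_mor ::
    "('k,'r) ring_scheme \<Rightarrow> ('k,'c,'x) cobj \<Rightarrow> ('k,'d,'y) cobj \<Rightarrow>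
      ('k,'c1,'x1) cobj \<Rightarrow> ('k,'d1,'y1) cobj \<Rightarrow> ('c,'c1,'x,'x1) cmor \<Rightarrow> ('d,'d1,'y,'y1) cmor \<Rightarrow>
      (('k,'c,'d) tensor,('k,'c1,'d1) tensor,('k,'x,'y) tensor,('k,'x1,'y1) tensor) cmor" where
  "ctensor_mor k S T S' T' m n =
     (tmap k (fst S) (fst T) (fst S') (fst T') (fst m) (fst n),
      tmap k (snd S) (snd T) (snd S') (snd T') (snd m) (snd n))"

definition cassoc ::
    "('k,'r) ring_scheme \<Rightarrow> ('k,'c,'x) cobj \<Rightarrow> ('k,'d,'y) cobj \<Rightarrow> ('k,'e,'z) cobj \<Rightarrow>
      (('k,('k,'c,'d) tensor,'e) tensor, ('k,'c,('k,'d,'e) tensor) tensor,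
       ('k,('k,'x,'y) tensor,'z) tensor, ('k,'x,('k,'y,'z) tensor) tensor) cmor" where
  "cassoc k S T U = (tassoc k (fst S) (fst T) (fst U), tassoc k (snd S) (snd T) (snd U))"

definition clunit ::
    "('k,'r) ring_scheme \<Rightarrow> ('k,'c,'x) cobj \<Rightarrow> (('k,'k,'c) tensor,'c,('k,'k,'x) tensor,'x) cmor" where
  "clunit k S =
     (tlift k (ground_space k) (fst S) (fst S) (smult (fst S)),
      tlift k (ground_space k) (snd S) (snd S) (smult (snd S)))"

definition crunit ::
    "('k,'r) ring_scheme \<Rightarrow> ('k,'c,'x) cobj \<Rightarrow> (('k,'c,'k) tensor,'c,('k,'x,'k) tensor,'x) cmor" where
  "crunit k S =
     (tlift k (fst S) (ground_space k) (fst S) (\<lambda>c s. s \<odot>\<^bsub>fst S\<^esub> c),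
      tlift k (snd S) (ground_space k) (snd S) (\<lambda>x s. s \<odot>\<^bsub>snd S\<^esub> x))"

locale comodule_enriched_category =
  fixes k :: "('k,'r) ring_scheme"
    and Ob :: "'i set"
    and hm :: "'i \<Rightarrow> 'i \<Rightarrow> ('k,'c,'x) cobj"
    and cmp :: "'i \<Rightarrow> 'i \<Rightarrow> 'i \<Rightarrow> (('k,'c,'c) tensor,'c,('k,'x,'x) tensor,'x) cmor"
    and idn :: "'i \<Rightarrow> ('k,'c,'k,'x) cmor"
  assumes hom_cobj: "\<lbrakk>u \<in> Ob; v \<in> Ob\<rbrakk> \<Longrightarrow> cobj k (hm u v)"
    and comp_cmor: "\<lbrakk>u \<in> Ob; v \<in> Ob; w \<in> Ob\<rbrakk> \<Longrightarrow>
      cmor k (ctensor k (hm v w) (hm u v)) (hm u w) (cmp u v w)"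
    and ident_cmor: "u \<in> Ob \<Longrightarrow> cmor k (cunit k) (hm u u) (idn u)"
    and comp_assoc: "\<lbrakk>u \<in> Ob; v \<in> Ob; w \<in> Ob; z \<in> Ob\<rbrakk> \<Longrightarrow>
      ccomp (ctensor k (ctensor k (hm w z) (hm v w)) (hm u v))
        (cmp u v z)
        (ctensor_mor k (ctensor k (hm w z) (hm v w)) (hm u v) (hm v z) (hm u v)
          (cmp v w z) (cid (hm u v))) =
      ccomp (ctensor k (ctensor k (hm w z) (hm v w)) (hm u v))
        (cmp u w z)
        (ccomp (ctensor k (ctensor k (hm w z) (hm v w)) (hm u v))
          (ctensor_mor k (hm w z) (ctensor k (hm v w) (hm u v)) (hm w z) (hm u w)
            (cid (hm w z)) (cmp u v w))
          (cassoc k (hm w z) (hm v w) (hm u v)))"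
    and comp_ident_left: "\<lbrakk>u \<in> Ob; v \<in> Ob\<rbrakk> \<Longrightarrow>
      ccomp (ctensor k (cunit k) (hm u v))
        (cmp u v v)
        (ctensor_mor k (cunit k) (hm u v) (hm v v) (hm u v) (idn v) (cid (hm u v))) =
      clunit k (hm u v)"
    and comp_ident_right: "\<lbrakk>u \<in> Ob; v \<in> Ob\<rbrakk> \<Longrightarrow>
      ccomp (ctensor k (hm u v) (cunit k))
        (cmp u u v)
        (ctensor_mor k (hm u v) (cunit k) (hm u v) (hm u u) (cid (hm u v)) (idn u)) =
      crunit k (hm u v)"

text \<open>
  Composition and identities of an enriched category are induced from those of linear maps.  Here
  \<open>ev u v\<close> consists of the structure maps of \<open>hm u v\<close> into spaces of linear maps, and \<open>us u\<close>
  consists of the underlying sets of the object \<open>u\<close> (of the algebra and the module, or of the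
  coalgebra and the comodule).
\<close>

definition induced_by_composition ::
    "('k,'r) ring_scheme \<Rightarrow> 'i set \<Rightarrow> ('i \<Rightarrow> 'a set \<times> 'm set) \<Rightarrow> ('i \<Rightarrow> 'i \<Rightarrow> ('k,'c,'x) cobj) \<Rightarrow>
      ('i \<Rightarrow> 'i \<Rightarrow> ('c \<Rightarrow> 'a \<Rightarrow> 'a) \<times> ('x \<Rightarrow> 'm \<Rightarrow> 'm)) \<Rightarrow>
      ('i \<Rightarrow> 'i \<Rightarrow> 'i \<Rightarrow> (('k,'c,'c) tensor,'c,('k,'x,'x) tensor,'x) cmor) \<Rightarrow>
      ('i \<Rightarrow> ('k,'c,'k,'x) cmor) \<Rightarrow> bool" where
  "induced_by_composition k Ob us hm ev cmp idn \<longleftrightarrow>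
     (\<forall>u \<in> Ob. \<forall>v \<in> Ob. \<forall>w \<in> Ob.
        (\<forall>q \<in> carrier (fst (hm v w)). \<forall>p \<in> carrier (fst (hm u v)).
           fst (ev u w) (fst (cmp u v w) (tens k (fst (hm v w)) (fst (hm u v)) q p)) =
           compose (fst (us u)) (fst (ev v w) q) (fst (ev u v) p)) \<and>
        (\<forall>q \<in> carrier (snd (hm v w)). \<forall>p \<in> carrier (snd (hm u v)).
           snd (ev u w) (snd (cmp u v w) (tens k (snd (hm v w)) (snd (hm u v)) q p)) =
           compose (snd (us u)) (snd (ev v w) q) (snd (ev u v) p))) \<and>
     (\<forall>u \<in> Ob. fst (ev u u) (fst (idn u) \<one>\<^bsub>k\<^esub>) = (\<lambda>a \<in> fst (us u). a) \<and>
               snd (ev u u) (snd (idn u) \<one>\<^bsub>k\<^esub>) = (\<lambda>m \<in> snd (us u). m))"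

section \<open>Measurings and universal measurings\<close>

definition measures_alg ::
    "('k,'r) ring_scheme \<Rightarrow> ('k,'a) module \<Rightarrow> ('k,'b) module \<Rightarrow> ('k,'h) coalg \<Rightarrow> ('h \<Rightarrow> 'a \<Rightarrow> 'b) \<Rightarrow> bool" where
  "measures_alg k A B H \<rho> \<longleftrightarrow> \<rho> \<in> Lin k H (hom_space k A B) \<and>
     (\<forall>h \<in> carrier H. \<forall>a \<in> carrier A. \<forall>a' \<in> carrier A.
        \<rho> h (a \<otimes>\<^bsub>A\<^esub> a') = tlift k H H B (\<lambda>x y. \<rho> x a \<otimes>\<^bsub>B\<^esub> \<rho> y a') (comult H h)) \<and>
     (\<forall>h \<in> carrier H. \<rho> h \<one>\<^bsub>A\<^esub> = counit H h \<odot>\<^bsub>B\<^esub> \<one>\<^bsub>B\<^esub>)"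

definition measures_coalg ::
    "('k,'r) ring_scheme \<Rightarrow> ('k,'h) coalg \<Rightarrow> ('k,'g) coalg \<Rightarrow> ('k,'l) coalg \<Rightarrow> ('l \<Rightarrow> 'h \<Rightarrow> 'g) \<Rightarrow> bool" where
  "measures_coalg k H K L \<sigma> \<longleftrightarrow> \<sigma> \<in> Lin k L (hom_space k H K) \<and>
     coalg_map k (tensor_coalg k L H) K (tlift k L H K \<sigma>)"

definition measures_mod ::
    "('k,'r) ring_scheme \<Rightarrow> ('k,'a) module \<Rightarrow> ('k,'a,'m) alg_module \<Rightarrow> ('k,'b,'n) alg_module \<Rightarrow>
      ('k,'h) coalg \<Rightarrow> ('h \<Rightarrow> 'a \<Rightarrow> 'b) \<Rightarrow> ('k,'h,'x) comod \<Rightarrow> ('x \<Rightarrow> 'm \<Rightarrow> 'n) \<Rightarrow> bool" where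
  "measures_mod k A M N H \<rho> X \<gamma> \<longleftrightarrow> \<gamma> \<in> Lin k X (hom_space k M N) \<and>
     (\<forall>x \<in> carrier X. \<forall>a \<in> carrier A. \<forall>m \<in> carrier M.
        \<gamma> x (act M a m) = tlift k H X N (\<lambda>h y. act N (\<rho> h a) (\<gamma> y m)) (coact X x))"

definition measures_comod ::
    "('k,'r) ring_scheme \<Rightarrow> ('k,'h) coalg \<Rightarrow> ('k,'h,'x) comod \<Rightarrow> ('k,'g) coalg \<Rightarrow> ('k,'g,'y) comod \<Rightarrow>
      ('k,'p) coalg \<Rightarrow> ('p \<Rightarrow> 'h \<Rightarrow> 'g) \<Rightarrow> ('k,'p,'z) comod \<Rightarrow> ('z \<Rightarrow> 'x \<Rightarrow> 'y) \<Rightarrow> bool" where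
  "measures_comod k H X K Y P \<pi> Z \<theta> \<longleftrightarrow> \<theta> \<in> Lin k Z (hom_space k X Y) \<and>
     (\<forall>z \<in> carrier Z. \<forall>x \<in> carrier X.
        coact Y (\<theta> z x) =
        tlift k P Z (tensor k K Y)
          (\<lambda>p w. tlift k H X (tensor k K Y) (\<lambda>h y. tens k K Y (\<pi> p h) (\<theta> w y)) (coact X x))
          (coact Z z))"

text \<open>
  The coalgebras and comodules against which universality is tested have their carriers in the type
  of the carrier of the universal object itself.  Every coalgebra is the directed union of its
  finite-dimensional subcoalgebras, and likewise for comodules.  Hence, if that type is infinite and
  the field embeds into it, the universal property for these test objects implies the one for
  arbitrary coalgebras and comodules.
\<close>

definition universal_alg ::
    "('k,'r) ring_scheme \<Rightarrow> ('k,'a) module \<Rightarrow> ('k,'b) module \<Rightarrow>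
      ('k,'u) coalg \<Rightarrow> ('u \<Rightarrow> 'a \<Rightarrow> 'b) \<Rightarrow> bool" where
  "universal_alg k A B P \<pi> \<longleftrightarrow> coalgebra k P \<and> measures_alg k A B P \<pi> \<and>
     (\<forall>(H :: ('k,'u) coalg) \<rho>. coalgebra k H \<and> measures_alg k A B H \<rho> \<longrightarrow>
        (\<exists>!f. coalg_map k H P f \<and> (\<forall>h \<in> carrier H. \<pi> (f h) = \<rho> h)))"

definition universal_coalg ::
    "('k,'r) ring_scheme \<Rightarrow> ('k,'h) coalg \<Rightarrow> ('k,'g) coalg \<Rightarrow>
      ('k,'u) coalg \<Rightarrow> ('u \<Rightarrow> 'h \<Rightarrow> 'g) \<Rightarrow> bool" where
  "universal_coalg k H K P \<pi> \<longleftrightarrow> coalgebra k P \<and> measures_coalg k H K P \<pi> \<and>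
     (\<forall>(L :: ('k,'u) coalg) \<sigma>. coalgebra k L \<and> measures_coalg k H K L \<sigma> \<longrightarrow>
        (\<exists>!f. coalg_map k L P f \<and> (\<forall>l \<in> carrier L. \<pi> (f l) = \<sigma> l)))"

definition universal_mod ::
    "('k,'r) ring_scheme \<Rightarrow> ('k,'a) module \<Rightarrow> ('k,'a,'m) alg_module \<Rightarrow>
      ('k,'b) module \<Rightarrow> ('k,'b,'n) alg_module \<Rightarrow> ('k,'u) coalg \<Rightarrow> ('u \<Rightarrow> 'a \<Rightarrow> 'b) \<Rightarrow>
      ('k,'u,'u) comod \<Rightarrow> ('u \<Rightarrow> 'm \<Rightarrow> 'n) \<Rightarrow> bool" where
  "universal_mod k A M B N P \<pi> Q \<kappa> \<longleftrightarrow> comodule k P Q \<and> measures_mod k A M N P \<pi> Q \<kappa> \<and>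
     (\<forall>(H :: ('k,'u) coalg) \<rho> (X :: ('k,'u,'u) comod) \<gamma> f.
        coalgebra k H \<and> measures_alg k A B H \<rho> \<and> comodule k H X \<and> measures_mod k A M N H \<rho> X \<gamma> \<and>
        coalg_map k H P f \<and> (\<forall>h \<in> carrier H. \<pi> (f h) = \<rho> h) \<longrightarrow>
        (\<exists>!\<phi>. comodule_map_along k H P f X Q \<phi> \<and> (\<forall>x \<in> carrier X. \<kappa> (\<phi> x) = \<gamma> x)))"

definition universal_comod ::
    "('k,'r) ring_scheme \<Rightarrow> ('k,'h) coalg \<Rightarrow> ('k,'h,'x) comod \<Rightarrow>
      ('k,'g) coalg \<Rightarrow> ('k,'g,'y) comod \<Rightarrow> ('k,'u) coalg \<Rightarrow> ('u \<Rightarrow> 'h \<Rightarrow> 'g) \<Rightarrow>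
      ('k,'u,'u) comod \<Rightarrow> ('u \<Rightarrow> 'x \<Rightarrow> 'y) \<Rightarrow> bool" where
  "universal_comod k H X K Y P \<pi> Q \<kappa> \<longleftrightarrow> comodule k P Q \<and> measures_comod k H X K Y P \<pi> Q \<kappa> \<and>
     (\<forall>(Z :: ('k,'u,'u) comod) \<theta>.
        comodule k P Z \<and> measures_comod k H X K Y P \<pi> Z \<theta> \<longrightarrow>
        (\<exists>!\<phi>. comodule_map_along k P P (\<lambda>p \<in> carrier P. p) Z Q \<phi> \<and>
              (\<forall>z \<in> carrier Z. \<kappa> (\<phi> z) = \<theta> z)))"

section \<open>Convolution\<close>

definition conv_alg :: "('k,'r) ring_scheme \<Rightarrow> ('k,'h) coalg \<Rightarrow> ('k,'b) module \<Rightarrow> ('k,'h \<Rightarrow> 'b) module" where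
  "conv_alg k H B = (hom_space k H B)
     \<lparr>mult := (\<lambda>\<alpha> \<beta>. \<lambda>h \<in> carrier H. tlift k H H B (\<lambda>x y. \<alpha> x \<otimes>\<^bsub>B\<^esub> \<beta> y) (comult H h)),
      one := (\<lambda>h \<in> carrier H. counit H h \<odot>\<^bsub>B\<^esub> \<one>\<^bsub>B\<^esub>)\<rparr>"

definition conv_mod ::
    "('k,'r) ring_scheme \<Rightarrow> ('k,'h) coalg \<Rightarrow> ('k,'h,'x) comod \<Rightarrow> ('k,'b,'n) alg_module \<Rightarrow>
      ('k,'h \<Rightarrow> 'b,'x \<Rightarrow> 'n) alg_module" where
  "conv_mod k H X N = module.extend (hom_space k X N) (alg_module.fields
     (\<lambda>\<alpha> \<zeta>. \<lambda>x \<in> carrier X. tlift k H X N (\<lambda>h y. act N (\<alpha> h) (\<zeta> y)) (coact X x)))"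

section \<open>The algebra \<open>A \<triangleleft> H\<close> and the module \<open>M \<triangleleft> X\<close>\<close>

definition word_alg :: "('k,'r) ring_scheme \<Rightarrow> 's set \<Rightarrow> ('k,'s list \<Rightarrow> 'k) module" where
  "word_alg k S = (free_space k (lists S))
     \<lparr>mult := (\<lambda>f g w. \<Oplus>\<^bsub>k\<^esub>i \<in> {..length w}. f (take i w) \<otimes>\<^bsub>k\<^esub> g (drop i w)),
      one := basis_vec k []\<rparr>"

text \<open>The tensor algebra of \<open>V\<close>: words in \<open>V\<close> modulo linearity in each letter.\<close>

definition linear_relations ::
    "('k,'r) ring_scheme \<Rightarrow> ('k,'v,'p) module_scheme \<Rightarrow> ('v list \<Rightarrow> 'k) set" where
  "linear_relations k V =
     (let F = word_alg k (carrier V); e = (\<lambda>v. basis_vec k [v]) in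
       {e (v \<oplus>\<^bsub>V\<^esub> v') \<ominus>\<^bsub>F\<^esub> (e v \<oplus>\<^bsub>F\<^esub> e v') | v v'. v \<in> carrier V \<and> v' \<in> carrier V}
     \<union> {e (c \<odot>\<^bsub>V\<^esub> v) \<ominus>\<^bsub>F\<^esub> c \<odot>\<^bsub>F\<^esub> e v | c v. c \<in> carrier k \<and> v \<in> carrier V})"

definition tensor_alg ::
    "('k,'r) ring_scheme \<Rightarrow> ('k,'v,'p) module_scheme \<Rightarrow> ('k,('v list \<Rightarrow> 'k) set) module" where
  "tensor_alg k V =
     (let F = word_alg k (carrier V) in quot F (Idl\<^bsub>F\<^esub> (linear_relations k V)))"

definition tensor_alg_gen ::
    "('k,'r) ring_scheme \<Rightarrow> ('k,'v,'p) module_scheme \<Rightarrow> 'v \<Rightarrow> ('v list \<Rightarrow> 'k) set" where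
  "tensor_alg_gen k V v =
     (let F = word_alg k (carrier V) in (Idl\<^bsub>F\<^esub> (linear_relations k V)) +>\<^bsub>F\<^esub> basis_vec k [v])"

type_synonym ('k,'a,'h) tri = "(('k,'a,'h) tensor list \<Rightarrow> 'k) set set"

definition tri_ideal ::
    "('k,'r) ring_scheme \<Rightarrow> ('k,'a) module \<Rightarrow> ('k,'h) coalg \<Rightarrow> (('k,'a,'h) tensor list \<Rightarrow> 'k) set set" where
  "tri_ideal k A H =
     (let T = tensor_alg k (tensor k A H);
          e = (\<lambda>a h. tensor_alg_gen k (tensor k A H) (tens k A H a h)) in
      Idl\<^bsub>T\<^esub> (
        {e (a \<otimes>\<^bsub>A\<^esub> a') h \<ominus>\<^bsub>T\<^esub> tlift k H H T (\<lambda>x y. e a x \<otimes>\<^bsub>T\<^esub> e a' y) (comult H h) | a a' h.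
           a \<in> carrier A \<and> a' \<in> carrier A \<and> h \<in> carrier H}
      \<union> {e \<one>\<^bsub>A\<^esub> h \<ominus>\<^bsub>T\<^esub> counit H h \<odot>\<^bsub>T\<^esub> \<one>\<^bsub>T\<^esub> | h. h \<in> carrier H}))"

definition tri_alg ::
    "('k,'r) ring_scheme \<Rightarrow> ('k,'a) module \<Rightarrow> ('k,'h) coalg \<Rightarrow> ('k,('k,'a,'h) tri) module" where
  "tri_alg k A H = quot (tensor_alg k (tensor k A H)) (tri_ideal k A H)"

definition tri_gen ::
    "('k,'r) ring_scheme \<Rightarrow> ('k,'a) module \<Rightarrow> ('k,'h) coalg \<Rightarrow> 'a \<Rightarrow> 'h \<Rightarrow> ('k,'a,'h) tri" where
  "tri_gen k A H a h =
     tri_ideal k A H +>\<^bsub>tensor_alg k (tensor k A H)\<^esub> tensor_alg_gen k (tensor k A H) (tens k A H a h)"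

definition tri_space ::
    "('k,'r) ring_scheme \<Rightarrow> ('k,'a) module \<Rightarrow> ('k,'h) coalg \<Rightarrow> ('k,'a,'m) alg_module \<Rightarrow>
      ('k,'h,'x) comod \<Rightarrow> ('k,('k,('k,('k,'a,'h) tri,'m) tensor,'x) tensor) module" where
  "tri_space k A H M X = tensor k (tensor k (tri_alg k A H) M) X"

definition tri_tens ::
    "('k,'r) ring_scheme \<Rightarrow> ('k,'a) module \<Rightarrow> ('k,'h) coalg \<Rightarrow> ('k,'a,'m) alg_module \<Rightarrow>
      ('k,'h,'x) comod \<Rightarrow> ('k,'a,'h) tri \<Rightarrow> 'm \<Rightarrow> 'x \<Rightarrow> ('k,('k,('k,'a,'h) tri,'m) tensor,'x) tensor" where
  "tri_tens k A H M X t m x =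
     tens k (tensor k (tri_alg k A H) M) X (tens k (tri_alg k A H) M t m) x"

definition tri_act ::
    "('k,'r) ring_scheme \<Rightarrow> ('k,'a) module \<Rightarrow> ('k,'h) coalg \<Rightarrow> ('k,'a,'m) alg_module \<Rightarrow>
      ('k,'h,'x) comod \<Rightarrow> ('k,'a,'h) tri \<Rightarrow>
      ('k,('k,('k,'a,'h) tri,'m) tensor,'x) tensor \<Rightarrow> ('k,('k,('k,'a,'h) tri,'m) tensor,'x) tensor" where
  "tri_act k A H M X r =
     (let W = tensor k (tri_alg k A H) M in
      tmap k W X W X
        (tmap k (tri_alg k A H) M (tri_alg k A H) M (\<lambda>t. r \<otimes>\<^bsub>tri_alg k A H\<^esub> t) (\<lambda>m. m)) (\<lambda>x. x))"

definition tri_relations ::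
    "('k,'r) ring_scheme \<Rightarrow> ('k,'a) module \<Rightarrow> ('k,'h) coalg \<Rightarrow> ('k,'a,'m) alg_module \<Rightarrow>
      ('k,'h,'x) comod \<Rightarrow> ('k,('k,('k,'a,'h) tri,'m) tensor,'x) tensor set" where
  "tri_relations k A H M X =
     (let V = tri_space k A H M X in
      \<Inter>{U. submodule U k V \<and>
            (\<forall>r \<in> carrier (tri_alg k A H). \<forall>u \<in> U. tri_act k A H M X r u \<in> U) \<and>
            {tri_tens k A H M X \<one>\<^bsub>tri_alg k A H\<^esub> (act M a m) x \<ominus>\<^bsub>V\<^esub>
               tlift k H X V (\<lambda>h y. tri_tens k A H M X (tri_gen k A H a h) m y) (coact X x) | a m x.
               a \<in> carrier A \<and> m \<in> carrier M \<and> x \<in> carrier X} \<subseteq> U})"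

definition tri_mod ::
    "('k,'r) ring_scheme \<Rightarrow> ('k,'a) module \<Rightarrow> ('k,'h) coalg \<Rightarrow> ('k,'a,'m) alg_module \<Rightarrow>
      ('k,'h,'x) comod \<Rightarrow>
      ('k,('k,'a,'h) tri,('k,('k,('k,'a,'h) tri,'m) tensor,'x) tensor set) alg_module" where
  "tri_mod k A H M X =
     (let V = tri_space k A H M X; R = tri_relations k A H M X in
      module.extend (quot V R) (alg_module.fields (\<lambda>r T. \<Union>t \<in> T. R +>\<^bsub>V\<^esub> tri_act k A H M X r t)))"

definition tri_mod_gen ::
    "('k,'r) ring_scheme \<Rightarrow> ('k,'a) module \<Rightarrow> ('k,'h) coalg \<Rightarrow> ('k,'a,'m) alg_module \<Rightarrow>
      ('k,'h,'x) comod \<Rightarrow> ('k,'a,'h) tri \<Rightarrow> 'm \<Rightarrow> 'x \<Rightarrow>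
      ('k,('k,('k,'a,'h) tri,'m) tensor,'x) tensor set" where
  "tri_mod_gen k A H M X t m x =
     tri_relations k A H M X +>\<^bsub>tri_space k A H M X\<^esub> tri_tens k A H M X t m x"

section \<open>Functoriality in the comodule\<close>

text \<open>The maps \<open>[H',B] \<rightarrow> [H,B]\<close> and \<open>[X',N] \<rightarrow> [X,N]\<close> given by a morphism
  \<open>m : (H,X) \<rightarrow> (H',X')\<close>.\<close>

definition conv_map ::
    "('k,'h,'x) cobj \<Rightarrow> ('h,'h1,'x,'x1) cmor \<Rightarrow> (('h1 \<Rightarrow> 'b) \<Rightarrow> 'h \<Rightarrow> 'b) \<times> (('x1 \<Rightarrow> 'n) \<Rightarrow> 'x \<Rightarrow> 'n)" where
  "conv_map S m =
     (\<lambda>\<beta>. compose (carrier (fst S)) \<beta> (fst m), \<lambda>\<zeta>. compose (carrier (snd S)) \<zeta> (snd m))"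

text \<open>The maps \<open>A \<triangleleft> H \<rightarrow> A \<triangleleft> H'\<close> and \<open>M \<triangleleft> X \<rightarrow> M \<triangleleft> X'\<close> given by \<open>m : (H,X) \<rightarrow> (H',X')\<close>.\<close>

definition tri_alg_map ::
    "('k,'r) ring_scheme \<Rightarrow> ('k,'a) module \<Rightarrow> ('k,'h) coalg \<Rightarrow> ('k,'h1) coalg \<Rightarrow> ('h \<Rightarrow> 'h1) \<Rightarrow>
      ('k,'a,'h) tri \<Rightarrow> ('k,'a,'h1) tri" where
  "tri_alg_map k A H H' f = (THE g.
     g \<in> Lin k (tri_alg k A H) (tri_alg k A H') \<and> g \<in> ring_hom (tri_alg k A H) (tri_alg k A H') \<and>
     (\<forall>a \<in> carrier A. \<forall>h \<in> carrier H. g (tri_gen k A H a h) = tri_gen k A H' a (f h)))"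

definition tri_map ::
    "('k,'r) ring_scheme \<Rightarrow> ('k,'a) module \<Rightarrow> ('k,'a,'m) alg_module \<Rightarrow>
      ('k,'h,'x) cobj \<Rightarrow> ('k,'h1,'x1) cobj \<Rightarrow> ('h,'h1,'x,'x1) cmor \<Rightarrow>
      (('k,'a,'h) tri, ('k,'a,'h1) tri,
       ('k,('k,('k,'a,'h) tri,'m) tensor,'x) tensor set,
       ('k,('k,('k,'a,'h1) tri,'m) tensor,'x1) tensor set) cmor" where
  "tri_map k A M S S' m =
     (tri_alg_map k A (fst S) (fst S') (fst m),
      THE g. g \<in> Lin k (tri_mod k A (fst S) M (snd S)) (tri_mod k A (fst S') M (snd S')) \<and>
        (\<forall>t \<in> carrier (tri_alg k A (fst S)). \<forall>y \<in> carrier M. \<forall>x \<in> carrier (snd S).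
           g (tri_mod_gen k A (fst S) M (snd S) t y x) =
           tri_mod_gen k A (fst S') M (snd S')
             (tri_alg_map k A (fst S) (fst S') (fst m) t) y (snd m x)))"

text \<open>The unique morphism \<open>S \<rightarrow> T\<close> through which a measuring \<open>\<mu>\<close> by \<open>S\<close> factors, where \<open>T\<close> is
  universal with structure maps \<open>ev\<close>.\<close>

definition factor ::
    "('k,'r) ring_scheme \<Rightarrow> ('k,'c,'x) cobj \<Rightarrow> ('k,'d,'y) cobj \<Rightarrow>
      ('d \<Rightarrow> 'i) \<times> ('y \<Rightarrow> 'j) \<Rightarrow> ('c \<Rightarrow> 'i) \<times> ('x \<Rightarrow> 'j) \<Rightarrow> ('c,'d,'x,'y) cmor" where
  "factor k S T ev \<mu> = (THE m. cmor k S T m \<and>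
     (\<forall>c \<in> carrier (fst S). fst ev (fst m c) = fst \<mu> c) \<and>
     (\<forall>x \<in> carrier (snd S). snd ev (snd m x) = snd \<mu> x))"

text \<open>The morphisms between universal measurings induced by precomposition and by postcomposition
  with \<open>m\<close>.  In both cases \<open>S\<close>, with structure maps \<open>e\<close>, is the domain, \<open>T\<close>, with structure maps
  \<open>ev\<close>, is the codomain, and \<open>D\<close> consists of the sets on which the linear maps are defined to which
  the elements of \<open>T\<close> are sent.\<close>

definition precomp ::
    "('k,'r) ring_scheme \<Rightarrow> ('k,'c,'x) cobj \<Rightarrow> ('c \<Rightarrow> 'a1 \<Rightarrow> 'b) \<times> ('x \<Rightarrow> 'm1 \<Rightarrow> 'n) \<Rightarrow>
      ('k,'d,'y) cobj \<Rightarrow> ('d \<Rightarrow> 'a \<Rightarrow> 'b) \<times> ('y \<Rightarrow> 'm \<Rightarrow> 'n) \<Rightarrow>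
      'a set \<times> 'm set \<Rightarrow> ('a \<Rightarrow> 'a1) \<times> ('m \<Rightarrow> 'm1) \<Rightarrow> ('c,'d,'x,'y) cmor" where
  "precomp k S e T ev D m = factor k S T ev
     (\<lambda>p. compose (fst D) (fst e p) (fst m), \<lambda>q. compose (snd D) (snd e q) (snd m))"

definition postcomp ::
    "('k,'r) ring_scheme \<Rightarrow> ('k,'c,'x) cobj \<Rightarrow> ('c \<Rightarrow> 'a \<Rightarrow> 'b1) \<times> ('x \<Rightarrow> 'm \<Rightarrow> 'n1) \<Rightarrow>
      ('k,'d,'y) cobj \<Rightarrow> ('d \<Rightarrow> 'a \<Rightarrow> 'b) \<times> ('y \<Rightarrow> 'm \<Rightarrow> 'n) \<Rightarrow>
      'a set \<times> 'm set \<Rightarrow> ('b1 \<Rightarrow> 'b) \<times> ('n1 \<Rightarrow> 'n) \<Rightarrow> ('c,'d,'x,'y) cmor" where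
  "postcomp k S e T ev D m = factor k S T ev
     (\<lambda>p. compose (fst D) (fst m) (fst e p), \<lambda>q. compose (snd D) (snd m) (snd e q))"

end

theory Submission
  imports Defs
begin

text \<open>
  A universal object is determined by the measurings it represents: a morphism into it is the same as
  a measuring by the source, and two such morphisms agree as soon as their composites with the
  structure maps agree.  Composites of measurings are measurings by the tensor product of the
  coalgebras (or comodules), which gives the enriched composition; the associativity and unit laws
  then hold because they hold for composition of linear maps.

  Measurings from \<open>A\<close> to \<open>B\<close> by \<open>C \<otimes> H\<close>, from \<open>A\<close> to \<open>[H,B]\<close> by \<open>C\<close> and from \<open>A \<triangleleft> H\<close> to \<open>B\<close> by \<open>C\<close> are
  the same trilinear maps \<open>C \<otimes> A \<otimes> H \<rightarrow> B\<close>, and likewise for modules.  So the three universal objects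
  represent the same functor of \<open>C\<close>, hence are isomorphic by the Yoneda lemma, and naturality can be
  checked after applying the structure maps.  The coalgebras and comodules that occur as test objects
  all have carriers that inject into \<open>'u\<close>, so the fundamental theorem of coalgebras is not needed.
\<close>

section \<open>Linear and bilinear maps\<close>

text \<open>What shapes the development is that maps are total functions of which only the values on
  a carrier matter. Calculations use \<open>lin\<close> and \<open>bilin\<close>, blind to values
  off the carrier; the extensional \<open>Lin\<close> is kept for equality and uniqueness. Sweedler
  sums become nested \<open>tlift\<close> terms governed by three rules: a linear map can be pushed
  inside, independent sums commute, and coassociativity holds with any trilinear integrand.

  Most calculations are done once, for modules or comodules. Algebras and coalgebras are the case of
  the regular module or comodule, up to a separate check of unit or counit.

  Size is the second concern. Universality is tested inside one type \<open>'u\<close>, while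
  composition is tested on triple tensor products of other types; these are transported along
  injections. No injection is available for \<open>A \<triangleleft> H\<close> and
  \<open>M \<triangleleft> X\<close>, but they occur only as sources of measurings, never as
  measuring objects. Their measurings are reached by transposition: a measuring by \<open>L\<close>
  into \<open>B\<close> is an algebra homomorphism into \<open>[L,B]\<close>, to which the universal
  property of the quotient defining \<open>A \<triangleleft> H\<close> applies.\<close>

definition lin ::
    "('k,'r) ring_scheme \<Rightarrow> ('k,'v,'p) module_scheme \<Rightarrow> ('k,'w,'q) module_scheme \<Rightarrow> ('v \<Rightarrow> 'w) \<Rightarrow> bool" where
  "lin k V W f \<longleftrightarrow> module k V \<and> module k W \<and> (\<forall>x \<in> carrier V. f x \<in> carrier W) \<and>
     (\<forall>x \<in> carrier V. \<forall>y \<in> carrier V. f (x \<oplus>\<^bsub>V\<^esub> y) = f x \<oplus>\<^bsub>W\<^esub> f y) \<and>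
     (\<forall>c \<in> carrier k. \<forall>x \<in> carrier V. f (c \<odot>\<^bsub>V\<^esub> x) = c \<odot>\<^bsub>W\<^esub> f x)"

text \<open>The module conditions on all three spaces belong to the predicate, so that this single
  premise carries the side conditions of the rules for \<open>tlift\<close>.\<close>

definition bilin ::
    "('k,'r) ring_scheme \<Rightarrow> ('k,'v,'p) module_scheme \<Rightarrow> ('k,'w,'q) module_scheme \<Rightarrow>
      ('k,'u,'s) module_scheme \<Rightarrow> ('v \<Rightarrow> 'w \<Rightarrow> 'u) \<Rightarrow> bool" where
  "bilin k V W U \<beta> \<longleftrightarrow> module k V \<and> module k W \<and> module k U \<and>
     (\<forall>w \<in> carrier W. lin k V U (\<lambda>v. \<beta> v w)) \<and> (\<forall>v \<in> carrier V. lin k W U (\<lambda>w. \<beta> v w))"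

lemma module_add_closed [simp]:
  "module k V \<Longrightarrow> x \<in> carrier V \<Longrightarrow> y \<in> carrier V \<Longrightarrow> x \<oplus>\<^bsub>V\<^esub> y \<in> carrier V"
  by (simp add: module_def abelian_group_def abelian_monoid.a_closed)

lemma module_smult_closed [simp]:
  "module k V \<Longrightarrow> c \<in> carrier k \<Longrightarrow> x \<in> carrier V \<Longrightarrow> c \<odot>\<^bsub>V\<^esub> x \<in> carrier V"
  by (rule module.smult_closed)

lemma module_zero_closed [simp]: "module k V \<Longrightarrow> \<zero>\<^bsub>V\<^esub> \<in> carrier V"
  by (simp add: module_def abelian_group_def abelian_monoid.zero_closed)

lemma linI:
  assumes "module k V" "module k W" "\<And>x. x \<in> carrier V \<Longrightarrow> f x \<in> carrier W"
    "\<And>x y. x \<in> carrier V \<Longrightarrow> y \<in> carrier V \<Longrightarrow> f (x \<oplus>\<^bsub>V\<^esub> y) = f x \<oplus>\<^bsub>W\<^esub> f y"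
    "\<And>c x. c \<in> carrier k \<Longrightarrow> x \<in> carrier V \<Longrightarrow> f (c \<odot>\<^bsub>V\<^esub> x) = c \<odot>\<^bsub>W\<^esub> f x"
  shows "lin k V W f"
  using assms by (simp add: lin_def)

lemma lin_closed: "lin k V W f \<Longrightarrow> x \<in> carrier V \<Longrightarrow> f x \<in> carrier W"
  by (simp add: lin_def)

lemma lin_add:
  "lin k V W f \<Longrightarrow> x \<in> carrier V \<Longrightarrow> y \<in> carrier V \<Longrightarrow> f (x \<oplus>\<^bsub>V\<^esub> y) = f x \<oplus>\<^bsub>W\<^esub> f y"
  by (simp add: lin_def)

lemma lin_smult:
  "lin k V W f \<Longrightarrow> c \<in> carrier k \<Longrightarrow> x \<in> carrier V \<Longrightarrow> f (c \<odot>\<^bsub>V\<^esub> x) = c \<odot>\<^bsub>W\<^esub> f x"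
  by (simp add: lin_def)

lemma lin_module:
  assumes "lin k V W f" shows "module k V" "module k W"
  using assms by (simp_all add: lin_def)

lemma lin_zero:
  assumes "lin k V W f" shows "f \<zero>\<^bsub>V\<^esub> = \<zero>\<^bsub>W\<^esub>"
proof -
  interpret V: module k V by (rule lin_module[OF assms])
  interpret W: module k W by (rule lin_module[OF assms])
  have "f (\<zero>\<^bsub>k\<^esub> \<odot>\<^bsub>V\<^esub> \<zero>\<^bsub>V\<^esub>) = \<zero>\<^bsub>k\<^esub> \<odot>\<^bsub>W\<^esub> f \<zero>\<^bsub>V\<^esub>"
    by (rule lin_smult[OF assms]) simp_all
  then show ?thesis using lin_closed[OF assms, of "\<zero>\<^bsub>V\<^esub>"] by simp
qed

lemma lin_uminus:
  assumes "lin k V W f" "x \<in> carrier V" shows "f (\<ominus>\<^bsub>V\<^esub> x) = \<ominus>\<^bsub>W\<^esub> f x"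
proof -
  interpret V: module k V by (rule lin_module[OF assms(1)])
  interpret W: module k W by (rule lin_module[OF assms(1)])
  have "f (\<ominus>\<^bsub>V\<^esub> x) \<oplus>\<^bsub>W\<^esub> f x = f (\<ominus>\<^bsub>V\<^esub> x \<oplus>\<^bsub>V\<^esub> x)"
    using assms by (simp add: lin_add)
  also have "\<dots> = \<zero>\<^bsub>W\<^esub>" using assms by (simp add: V.l_neg lin_zero)
  finally show ?thesis using assms
    by (simp add: W.minus_equality[symmetric] lin_closed)
qed

lemma lin_minus:
  assumes "lin k V W f" "x \<in> carrier V" "y \<in> carrier V"
  shows "f (x \<ominus>\<^bsub>V\<^esub> y) = f x \<ominus>\<^bsub>W\<^esub> f y"
proof -
  interpret V: module k V by (rule lin_module[OF assms(1)])
  show ?thesis using assms by (simp add: a_minus_def lin_add lin_uminus)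
qed

lemma module_minus_eq_zero:
  assumes "module k V" "x \<in> carrier V" "y \<in> carrier V"
  shows "x \<ominus>\<^bsub>V\<^esub> y = \<zero>\<^bsub>V\<^esub> \<longleftrightarrow> x = y"
proof -
  interpret V: module k V by fact
  show ?thesis using assms(2,3)
    by (metis V.M.add.inv_closed V.M.add.inv_equality V.M.minus_minus V.M.r_neg a_minus_def)
qed

text \<open>Values off the carrier are invisible to \<open>lin\<close>. Restrictions, which are
  needed for extensionality, can therefore be stripped by the simplifier.\<close>

lemma lin_cong:
  assumes "\<And>x. x \<in> carrier V \<Longrightarrow> f x = g x" shows "lin k V W f = lin k V W g"
  unfolding lin_def using assms by (safe; simp)

lemma lin_comp: "lin k V W f \<Longrightarrow> lin k S V g \<Longrightarrow> lin k S W (\<lambda>s. f (g s))"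
  by (simp add: lin_def)

lemma lin_id [simp]: "module k V \<Longrightarrow> lin k V V (\<lambda>x. x)"
  by (simp add: lin_def)

lemma lin_restrict [simp]: "lin k V W (restrict f (carrier V)) = lin k V W f"
  by (rule lin_cong) simp

lemma lin_if [simp]: "lin k V W (\<lambda>a. if a \<in> carrier V then f a else g a) = lin k V W f"
  by (rule lin_cong) simp

lemma Lin_iff:
  assumes "module k V" "module k W"
  shows "f \<in> Lin k V W \<longleftrightarrow> lin k V W f \<and> f \<in> extensional (carrier V)"
  using assms by (auto simp: Lin_def lin_def PiE_def Pi_def)

lemma LinD:
  assumes "f \<in> Lin k V W" "module k V" "module k W"
  shows "lin k V W f" "f \<in> extensional (carrier V)"
  using assms by (simp_all add: Lin_iff)

lemma bilinI:
  assumes "module k V" "module k W" "module k U"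
    "\<And>w. w \<in> carrier W \<Longrightarrow> lin k V U (\<lambda>v. \<beta> v w)" "\<And>v. v \<in> carrier V \<Longrightarrow> lin k W U (\<lambda>w. \<beta> v w)"
  shows "bilin k V W U \<beta>"
  using assms by (simp add: bilin_def)

text \<open>The carriers are variables, so that the simplifier normalizes them in the premises.\<close>

lemma bilinI_carrier [simp]:
  assumes "module k V" "module k W" "module k U" "carrier V = S" "carrier W = T"
    "\<And>w. w \<in> T \<Longrightarrow> lin k V U (\<lambda>v. \<beta> v w)" "\<And>v. v \<in> S \<Longrightarrow> lin k W U (\<lambda>w. \<beta> v w)"
  shows "bilin k V W U \<beta>"
  using assms by (simp add: bilin_def)

lemma bilin_module:
  assumes "bilin k V W U \<beta>" shows "module k V" "module k W" "module k U"
  using assms by (simp_all add: bilin_def)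

text \<open>The argument is \<open>g s\<close> with an arbitrary linear \<open>g\<close>: linearity
  of a nested term is then proved by descending, one bilinear operation at a time, to the place
  where the variable occurs.\<close>

lemma bilin_left:
  "bilin k V W U \<beta> \<Longrightarrow> w \<in> carrier W \<Longrightarrow> lin k S V g \<Longrightarrow> lin k S U (\<lambda>s. \<beta> (g s) w)"
  unfolding bilin_def by (blast intro: lin_comp[of k V U "\<lambda>v. \<beta> v w"])

lemma bilin_right:
  "bilin k V W U \<beta> \<Longrightarrow> v \<in> carrier V \<Longrightarrow> lin k S W g \<Longrightarrow> lin k S U (\<lambda>s. \<beta> v (g s))"
  unfolding bilin_def by (blast intro: lin_comp[of k W U "\<beta> v"])

lemma bilin_closed:
  "bilin k V W U \<beta> \<Longrightarrow> v \<in> carrier V \<Longrightarrow> w \<in> carrier W \<Longrightarrow> \<beta> v w \<in> carrier U"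
  unfolding bilin_def by (blast intro: lin_closed)

lemmas bilin_lin = bilin_left bilin_right bilin_closed

lemma bilin_cong:
  assumes "\<And>v w. v \<in> carrier V \<Longrightarrow> w \<in> carrier W \<Longrightarrow> \<beta> v w = \<beta>' v w"
  shows "bilin k V W U \<beta> = bilin k V W U \<beta>'"
  unfolding bilin_def using assms by (simp cong: lin_cong)

lemma bilin_restrict [simp]: "bilin k V W U (restrict \<beta> (carrier V)) = bilin k V W U \<beta>"
  by (rule bilin_cong) simp

lemma lin_const_zero [simp]: "module k V \<Longrightarrow> module k W \<Longrightarrow> lin k V W (\<lambda>x. \<zero>\<^bsub>W\<^esub>)"
  by (rule linI) (simp_all add: module.axioms abelian_group.axioms abelian_monoid.l_zero module.smult_r_null)

lemma lin_fun_add [simp]: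
  assumes "lin k V W f" "lin k V W g" shows "lin k V W (\<lambda>x. f x \<oplus>\<^bsub>W\<^esub> g x)"
proof -
  interpret V: module k V by (rule lin_module[OF assms(1)])
  interpret W: module k W by (rule lin_module[OF assms(1)])
  show ?thesis
    by (rule linI) (use assms in \<open>simp_all add: lin_closed lin_add lin_smult W.a_ac W.smult_r_distr
      V.module_axioms W.module_axioms\<close>)
qed

lemma lin_fun_smult [simp]:
  assumes "c \<in> carrier k" "lin k V W f" shows "lin k V W (\<lambda>x. c \<odot>\<^bsub>W\<^esub> f x)"
proof -
  interpret V: module k V by (rule lin_module[OF assms(2)])
  interpret W: module k W by (rule lin_module[OF assms(2)])
  show ?thesis
    by (rule linI) (use assms in \<open>simp_all add: lin_closed lin_add lin_smult W.smult_r_distr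
      W.smult_assoc1[symmetric] V.m_comm V.module_axioms W.module_axioms\<close>)
qed

lemma ground_module [simp]: "cring k \<Longrightarrow> module k (ground_space k)"
proof -
  assume "cring k"
  then interpret cring k .
  show ?thesis
    by (unfold_locales) (auto simp: ground_space_def a_ac m_ac l_distr r_distr Units_def
      intro: l_neg r_neg bexI[of _ "\<ominus>\<^bsub>k\<^esub> x" for x])
qed

lemma ground_simps [simp]:
  "carrier (ground_space k) = carrier k" "add (ground_space k) = add k"
  "smult (ground_space k) = mult k" "zero (ground_space k) = zero k"
  by (simp_all add: ground_space_def)

lemma lin_scalar [simp]:
  assumes "lin k V (ground_space k) f" "module k W" "w \<in> carrier W"
  shows "lin k V W (\<lambda>x. f x \<odot>\<^bsub>W\<^esub> w)"
proof -
  interpret V: module k V by (rule lin_module[OF assms(1)])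
  interpret W: module k W by fact
  have f: "f x \<in> carrier k" if "x \<in> carrier V" for x
    using lin_closed[OF assms(1) that] by simp
  show ?thesis
    by (rule linI) (use assms f lin_add[OF assms(1)] lin_smult[OF assms(1)] in
        \<open>simp_all add: V.module_axioms W.smult_l_distr W.smult_assoc1\<close>)
qed

section \<open>Quotients\<close>

lemma submodule_subgroup:
  assumes "module k V" "submodule U k V" shows "abelian_subgroup U V"
proof -
  interpret module k V by fact
  interpret submodule U k V by fact
  show ?thesis by (rule abelian_subgroupI3) (unfold_locales, auto intro: additive_subgroup.intro subgroup_axioms)
qed

lemma quot_carrier: "carrier (quot V U) = (\<lambda>v. U +>\<^bsub>V\<^esub> v) ` carrier V"
  by (auto simp: quot_def FactRing_def A_RCOSETS_defs a_r_coset_def)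

lemma coset_eq_iff:
  assumes "module k V" "submodule U k V" "v \<in> carrier V" "w \<in> carrier V"
  shows "U +>\<^bsub>V\<^esub> v = U +>\<^bsub>V\<^esub> w \<longleftrightarrow> v \<ominus>\<^bsub>V\<^esub> w \<in> U"
proof -
  interpret module k V by fact
  interpret abelian_subgroup U V by (rule submodule_subgroup) fact+
  show ?thesis using assms(3,4)
    by (metis a_minus_def a_rcos_module a_rcos_self a_repr_independence' a_subgroup a_rcos_module_imp additive_subgroup.a_subgroup)
qed

lemma coset_self:
  assumes "module k V" "submodule U k V" "v \<in> carrier V" shows "v \<in> U +>\<^bsub>V\<^esub> v"
  by (rule abelian_subgroup.a_rcos_self[OF submodule_subgroup]) fact+

lemma coset_memD:
  assumes "module k V" "submodule U k V" "v \<in> carrier V" "t \<in> U +>\<^bsub>V\<^esub> v"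
  shows "t \<in> carrier V" "U +>\<^bsub>V\<^esub> t = U +>\<^bsub>V\<^esub> v" "t \<ominus>\<^bsub>V\<^esub> v \<in> U"
proof -
  interpret module k V by fact
  interpret abelian_subgroup U V by (rule submodule_subgroup) fact+
  show t: "t \<in> carrier V" by (rule a_elemrcos_carrier[OF assms(3,4)])
  show "t \<ominus>\<^bsub>V\<^esub> v \<in> U" using a_rcos_module_imp[OF assms(3,4)] by (simp add: a_minus_def)
  then show "U +>\<^bsub>V\<^esub> t = U +>\<^bsub>V\<^esub> v" using coset_eq_iff[OF assms(1,2) t assms(3)] by simp
qed

text \<open>Operations on cosets are encoded as unions over all representatives. Stability of
  \<open>U\<close> under \<open>f\<close> makes all members of the union equal; this settles scalar
  multiplication here and the action on \<open>M \<triangleleft> X\<close> later.\<close>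

lemma Union_cosets:
  assumes "module k V" "submodule U k V" "v \<in> carrier V" "lin k V V f" "\<And>u. u \<in> U \<Longrightarrow> f u \<in> U"
  shows "(\<Union>t \<in> U +>\<^bsub>V\<^esub> v. U +>\<^bsub>V\<^esub> f t) = U +>\<^bsub>V\<^esub> f v"
proof -
  have "U +>\<^bsub>V\<^esub> f t = U +>\<^bsub>V\<^esub> f v" if "t \<in> U +>\<^bsub>V\<^esub> v" for t
  proof -
    note t = coset_memD[OF assms(1-3) that]
    have "f t \<ominus>\<^bsub>V\<^esub> f v \<in> U"
      using assms(5)[OF t(3)] lin_minus[OF assms(4) t(1) assms(3)] by simp
    then show ?thesis
      using coset_eq_iff[OF assms(1,2)] lin_closed[OF assms(4)] t(1) assms(3) by simp
  qed
  moreover have "v \<in> U +>\<^bsub>V\<^esub> v" by (rule coset_self) fact+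
  ultimately show ?thesis by blast
qed

lemma quot_add:
  assumes "module k V" "submodule U k V" "v \<in> carrier V" "w \<in> carrier V"
  shows "(U +>\<^bsub>V\<^esub> v) \<oplus>\<^bsub>quot V U\<^esub> (U +>\<^bsub>V\<^esub> w) = U +>\<^bsub>V\<^esub> (v \<oplus>\<^bsub>V\<^esub> w)"
  using abelian_subgroup.a_rcos_sum[OF submodule_subgroup[OF assms(1,2)] assms(3,4)]
  by (simp add: quot_def FactRing_def)

lemma quot_smult:
  assumes "module k V" "submodule U k V" "c \<in> carrier k" "v \<in> carrier V"
  shows "c \<odot>\<^bsub>quot V U\<^esub> (U +>\<^bsub>V\<^esub> v) = U +>\<^bsub>V\<^esub> (c \<odot>\<^bsub>V\<^esub> v)"
proof -
  have "lin k V V (\<lambda>v. c \<odot>\<^bsub>V\<^esub> v)" using assms by simp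
  from Union_cosets[OF assms(1,2,4) this] show ?thesis
    using submodule.smult_closed[OF assms(2,3)] by (simp add: quot_def)
qed

lemma quot_module [simp]:
  assumes "module k V" "submodule U k V" shows "module k (quot V U)"
proof -
  interpret module k V by fact
  interpret A: abelian_subgroup U V by (rule submodule_subgroup) fact+
  \<comment> \<open>The group axioms come from the additive factor group of the library; the record
    repeats its additive part, with placeholders in the multiplicative fields.\<close>
  interpret Q: abelian_group "\<lparr>carrier = a_rcosets\<^bsub>V\<^esub> U, mult = undefined, one = undefined, zero = U, add = set_add V\<rparr>"
    by (rule comm_group_abelian_groupI)
      (use A.a_factorgroup_is_comm_group in \<open>simp add: A_FactGroup_def'\<close>)
  have ag: "abelian_group (quot V U)"
  proof (rule abelian_groupI)
    fix x assume "x \<in> carrier (quot V U)"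
    then show "\<exists>y \<in> carrier (quot V U). y \<oplus>\<^bsub>quot V U\<^esub> x = \<zero>\<^bsub>quot V U\<^esub>"
      using Q.l_neg[of x] Q.a_inv_closed[of x] by (auto simp: quot_def FactRing_def)
  qed (use Q.a_closed Q.zero_closed Q.a_assoc Q.a_comm Q.l_zero in \<open>auto simp: quot_def FactRing_def\<close>)
  show ?thesis
  proof (rule moduleI)
    show "cring k" by unfold_locales
  qed (auto simp: ag quot_carrier quot_add[OF assms] quot_smult[OF assms] smult_l_distr smult_r_distr smult_assoc1)
qed

lemma lin_coset:
  assumes "module k V" "submodule U k V" shows "lin k V (quot V U) (\<lambda>v. U +>\<^bsub>V\<^esub> v)"
  using assms by (intro linI) (auto simp: quot_carrier quot_add[OF assms] quot_smult[OF assms])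

lemma quot_lift:
  assumes "submodule U k V" "lin k V W f" "\<And>u. u \<in> U \<Longrightarrow> f u = \<zero>\<^bsub>W\<^esub>"
  obtains g where "lin k (quot V U) W g" "\<And>v. v \<in> carrier V \<Longrightarrow> g (U +>\<^bsub>V\<^esub> v) = f v"
proof -
  have V: "module k V" and W: "module k W" using lin_module[OF assms(2)] by simp_all
  interpret W: module k W by fact
  \<comment> \<open>Any representative will do: two of them differ by an element of
    \<open>U\<close>, which \<open>f\<close> sends to zero.\<close>
  define g where "g T = f (SOME t. t \<in> T)" for T
  have g: "g (U +>\<^bsub>V\<^esub> v) = f v" if v: "v \<in> carrier V" for v
  proof -
    have "(SOME t. t \<in> U +>\<^bsub>V\<^esub> v) \<in> U +>\<^bsub>V\<^esub> v"
      by (rule someI) (rule coset_self[OF V assms(1) v])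
    note t = coset_memD[OF V assms(1) v this]
    have "f (SOME t. t \<in> U +>\<^bsub>V\<^esub> v) \<ominus>\<^bsub>W\<^esub> f v = \<zero>\<^bsub>W\<^esub>"
      using t v assms(3) lin_minus[OF assms(2)] by metis
    then show ?thesis using lin_closed[OF assms(2)] t v
      by (simp add: g_def module_minus_eq_zero[OF W])
  qed
  moreover have "lin k (quot V U) W g"
    by (rule linI)
      (use assms V W in \<open>auto simp: quot_carrier quot_add[OF V assms(1)] quot_smult[OF V assms(1)]
        g lin_closed lin_add lin_smult\<close>)
  ultimately show ?thesis using that by blast
qed

lemma kernel_submodule:
  assumes "lin k V W f" shows "submodule {v \<in> carrier V. f v = \<zero>\<^bsub>W\<^esub>} k V"
proof -
  interpret V: module k V by (rule lin_module[OF assms(1)])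
  interpret W: module k W by (rule lin_module[OF assms(1)])
  show ?thesis
    by (rule V.submoduleI) (use assms in \<open>auto simp: lin_zero lin_uminus lin_add lin_smult\<close>)
qed

text \<open>Nonemptiness keeps the intersection inside \<open>carrier V\<close>; in the applications
  \<open>carrier V\<close> itself is a member of the family.\<close>

lemma Inter_submodule:
  assumes "module k V" "\<And>U. U \<in> \<U> \<Longrightarrow> submodule U k V" "\<U> \<noteq> {}"
  shows "submodule (\<Inter>\<U>) k V"
proof -
  interpret V: module k V by fact
  note E = V.submoduleE[OF assms(2)]
  have z: "\<zero>\<^bsub>V\<^esub> \<in> U" if "U \<in> \<U>" for U
    using assms(2)[OF that] subgroup.one_closed[of U "add_monoid V"] by (simp add: submodule_def)
  show ?thesis
  proof (rule V.submoduleI)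
    show "\<Inter>\<U> \<subseteq> carrier V" using E(1) assms(3) by blast
    show "\<zero>\<^bsub>V\<^esub> \<in> \<Inter>\<U>" using z by blast
    show "\<ominus>\<^bsub>V\<^esub> a \<in> \<Inter>\<U>" if "a \<in> \<Inter>\<U>" for a using E(3) that by blast
    show "a \<oplus>\<^bsub>V\<^esub> b \<in> \<Inter>\<U>" if "a \<in> \<Inter>\<U>" "b \<in> \<Inter>\<U>" for a b using E(5) that by blast
    show "c \<odot>\<^bsub>V\<^esub> a \<in> \<Inter>\<U>" if "c \<in> carrier k" "a \<in> \<Inter>\<U>" for a c using E(4) that by blast
  qed
qed

lemma subspace_gen_submodule:
  assumes "module k V" "S \<subseteq> carrier V" shows "submodule (subspace_gen k V S) k V"
  unfolding subspace_gen_def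
  by (rule Inter_submodule) (use assms module.carrier_is_submodule in auto)

lemma subspace_gen_incl: "S \<subseteq> subspace_gen k V S"
  by (auto simp: subspace_gen_def)

lemma subspace_gen_least: "submodule U k V \<Longrightarrow> S \<subseteq> U \<Longrightarrow> subspace_gen k V S \<subseteq> U"
  by (auto simp: subspace_gen_def)

section \<open>Free modules\<close>

lemma free_carrierI:
  "(\<And>s. f s \<in> carrier k) \<Longrightarrow> (\<And>s. f s \<noteq> \<zero>\<^bsub>k\<^esub> \<Longrightarrow> s \<in> S) \<Longrightarrow> finite {s. f s \<noteq> \<zero>\<^bsub>k\<^esub>} \<Longrightarrow>
    f \<in> carrier (free_space k S)"
  by (auto simp: free_space_def)

lemma free_carrierD:
  assumes "f \<in> carrier (free_space k S)"
  shows "f s \<in> carrier k" "f s \<noteq> \<zero>\<^bsub>k\<^esub> \<Longrightarrow> s \<in> S" "finite {s. f s \<noteq> \<zero>\<^bsub>k\<^esub>}"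
  using assms by (auto simp: free_space_def)

lemma free_module [simp]:
  assumes "cring k" shows "module k (free_space k S)"
proof -
  interpret cring k by fact
  show ?thesis
  proof (rule moduleI)
    show "abelian_group (free_space k S)"
    proof (rule abelian_groupI)
      fix f g assume f: "f \<in> carrier (free_space k S)" and g: "g \<in> carrier (free_space k S)"
      have "{s. f s \<oplus>\<^bsub>k\<^esub> g s \<noteq> \<zero>\<^bsub>k\<^esub>} \<subseteq> {s. f s \<noteq> \<zero>\<^bsub>k\<^esub>} \<union> {s. g s \<noteq> \<zero>\<^bsub>k\<^esub>}" by auto
      then have "finite {s. f s \<oplus>\<^bsub>k\<^esub> g s \<noteq> \<zero>\<^bsub>k\<^esub>}"
        using free_carrierD(3)[OF f] free_carrierD(3)[OF g] finite_subset by blast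
      moreover have "s \<in> S" if "f s \<oplus>\<^bsub>k\<^esub> g s \<noteq> \<zero>\<^bsub>k\<^esub>" for s
        using that free_carrierD(2)[OF f, of s] free_carrierD(2)[OF g, of s] by (metis r_zero zero_closed)
      ultimately show "f \<oplus>\<^bsub>free_space k S\<^esub> g \<in> carrier (free_space k S)"
        using f g by (auto simp: free_space_def)
    next
      fix f assume f: "f \<in> carrier (free_space k S)"
      then have "(\<lambda>s. \<ominus>\<^bsub>k\<^esub> f s) \<in> carrier (free_space k S)"
        by (auto simp: free_space_def elim!: rev_finite_subset)
      moreover have "(\<lambda>s. \<ominus>\<^bsub>k\<^esub> f s) \<oplus>\<^bsub>free_space k S\<^esub> f = \<zero>\<^bsub>free_space k S\<^esub>"
        using f by (auto simp: free_space_def l_neg)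
      ultimately show "\<exists>g \<in> carrier (free_space k S). g \<oplus>\<^bsub>free_space k S\<^esub> f = \<zero>\<^bsub>free_space k S\<^esub>" by blast
    qed (auto simp: free_space_def a_ac intro!: ext)
  next
    fix a f assume "a \<in> carrier k" "f \<in> carrier (free_space k S)"
    then show "a \<odot>\<^bsub>free_space k S\<^esub> f \<in> carrier (free_space k S)"
      by (auto simp: free_space_def elim!: rev_finite_subset)
  qed (auto simp: is_cring free_space_def l_distr r_distr m_assoc intro!: ext)
qed

lemma basis_vec_apply: "basis_vec k s t = (if t = s then \<one>\<^bsub>k\<^esub> else \<zero>\<^bsub>k\<^esub>)"
  by (simp add: basis_vec_def)

lemma basis_vec_closed [simp]:
  assumes "cring k" "s \<in> S" shows "basis_vec k s \<in> carrier (free_space k S)"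
proof -
  interpret cring k by fact
  show ?thesis using assms(2)
    by (auto simp: free_space_def basis_vec_def intro!: finite_subset[of _ "{s}"])
qed

text \<open>Induction on the finite support, splitting off one basis vector at a time.\<close>

lemma free_induct [consumes 2, case_names zero add]:
  assumes "cring k" "f \<in> carrier (free_space k S)"
    and zero: "P \<zero>\<^bsub>free_space k S\<^esub>"
    and add: "\<And>c s g. c \<in> carrier k \<Longrightarrow> s \<in> S \<Longrightarrow> g \<in> carrier (free_space k S) \<Longrightarrow> P g \<Longrightarrow>
      P ((c \<odot>\<^bsub>free_space k S\<^esub> basis_vec k s) \<oplus>\<^bsub>free_space k S\<^esub> g)"
  shows "P f"
proof -
  interpret cring k by fact
  have "finite F \<Longrightarrow> f \<in> carrier (free_space k S) \<Longrightarrow> {s. f s \<noteq> \<zero>\<^bsub>k\<^esub>} = F \<Longrightarrow> P f" for F f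
  proof (induction F arbitrary: f rule: finite_induct)
    case empty
    then have "f = \<zero>\<^bsub>free_space k S\<^esub>" by (auto simp: free_space_def)
    with zero show ?case by simp
  next
    case (insert s F)
    define g where "g = f(s := \<zero>\<^bsub>k\<^esub>)"
    have s: "s \<in> S" using insert.prems free_carrierD(2)[of f k S s] by blast
    have gF: "{s. g s \<noteq> \<zero>\<^bsub>k\<^esub>} = F" using insert by (auto simp: g_def)
    have gc: "g \<in> carrier (free_space k S)"
    proof (rule free_carrierI)
      show "finite {s. g s \<noteq> \<zero>\<^bsub>k\<^esub>}" using gF insert by simp
    qed (use free_carrierD[OF insert.prems(1)] in \<open>auto simp: g_def split: if_splits\<close>)
    have fs: "f s \<in> carrier k" using free_carrierD[OF insert.prems(1)] by simp
    have "f = (f s \<odot>\<^bsub>free_space k S\<^esub> basis_vec k s) \<oplus>\<^bsub>free_space k S\<^esub> g"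
      using free_carrierD(1)[OF insert.prems(1)]
      by (auto simp: free_space_def basis_vec_def g_def)
    with add[OF fs s gc insert.IH[OF gc gF]] show ?case by simp
  qed
  from this[OF free_carrierD(3)[OF assms(2)] assms(2) refl] show ?thesis .
qed

lemma free_lin_eq:
  assumes "cring k" "lin k (free_space k S) W f" "lin k (free_space k S) W g"
    "\<And>s. s \<in> S \<Longrightarrow> f (basis_vec k s) = g (basis_vec k s)" "x \<in> carrier (free_space k S)"
  shows "f x = g x"
  using assms(1,5)
  by (induction rule: free_induct)
    (use assms(4) in \<open>simp_all add: assms(1) module_smult_closed[OF free_module[OF assms(1)]] lin_zero[OF assms(2)] lin_zero[OF assms(3)]
      lin_add[OF assms(2)] lin_add[OF assms(3)] lin_smult[OF assms(2)] lin_smult[OF assms(3)]\<close>)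

definition free_lift ::
    "('k,'r) ring_scheme \<Rightarrow> ('k,'u,'s) module_scheme \<Rightarrow> ('i \<Rightarrow> 'u) \<Rightarrow> ('i \<Rightarrow> 'k) \<Rightarrow> 'u" where
  "free_lift k U g f = finsum U (\<lambda>s. f s \<odot>\<^bsub>U\<^esub> g s) {s. f s \<noteq> \<zero>\<^bsub>k\<^esub>}"

text \<open>The sum in \<open>free_lift\<close> runs over a support that changes under addition and
  scaling. Extending it to a finite superset puts the sums that are to be compared over a common
  index set.\<close>

lemma free_lift_superset:
  assumes "module k U" "\<And>s. s \<in> S \<Longrightarrow> g s \<in> carrier U" "f \<in> carrier (free_space k S)"
    "finite F" "F \<subseteq> S" "{s. f s \<noteq> \<zero>\<^bsub>k\<^esub>} \<subseteq> F"
  shows "free_lift k U g f = finsum U (\<lambda>s. f s \<odot>\<^bsub>U\<^esub> g s) F"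
proof -
  interpret U: module k U by fact
  show ?thesis unfolding free_lift_def
    by (rule U.M.add.finprod_mono_neutral_cong_left)
      (use assms free_carrierD[OF assms(3)] in \<open>auto intro!: U.smult_closed\<close>)
qed

lemma free_lift:
  assumes "module k U" and g: "\<And>s. s \<in> S \<Longrightarrow> g s \<in> carrier U"
  shows "lin k (free_space k S) U (free_lift k U g)" 
    "\<And>s. s \<in> S \<Longrightarrow> free_lift k U g (basis_vec k s) = g s"
proof -
  interpret U: module k U by fact
  have k: "cring k" by unfold_locales
  note sup = free_lift_superset[OF assms(1) g]
  show "lin k (free_space k S) U (free_lift k U g)"
  proof (rule linI)
    fix f assume f: "f \<in> carrier (free_space k S)"
    show "free_lift k U g f \<in> carrier U"
      unfolding free_lift_def
      by (rule U.finsum_closed) (use free_carrierD[OF f] g in auto)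
    fix c assume c: "c \<in> carrier k"
    let ?F = "{s. f s \<noteq> \<zero>\<^bsub>k\<^esub>}"
    have cf: "c \<odot>\<^bsub>free_space k S\<^esub> f \<in> carrier (free_space k S)"
      using c f k by (meson free_module module_smult_closed)
    have F: "finite ?F" "?F \<subseteq> S" using free_carrierD[OF f] by auto
    have "free_lift k U g (c \<odot>\<^bsub>free_space k S\<^esub> f) = finsum U (\<lambda>s. (c \<odot>\<^bsub>free_space k S\<^esub> f) s \<odot>\<^bsub>U\<^esub> g s) ?F"
      by (rule sup[OF _ cf F]) (use c in \<open>auto simp: free_space_def\<close>)
    also have "\<dots> = finsum U (\<lambda>s. c \<odot>\<^bsub>U\<^esub> (f s \<odot>\<^bsub>U\<^esub> g s)) ?F"
      by (rule U.finsum_cong') (use c free_carrierD[OF f] g in \<open>auto simp: free_space_def U.smult_assoc1\<close>)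
    also have "\<dots> = c \<odot>\<^bsub>U\<^esub> free_lift k U g f"
      unfolding free_lift_def
      by (rule U.finsum_smult_ldistr[symmetric]) (use c free_carrierD[OF f] g F in auto)
    finally show "free_lift k U g (c \<odot>\<^bsub>free_space k S\<^esub> f) = c \<odot>\<^bsub>U\<^esub> free_lift k U g f" .
  next
    fix f f' assume f: "f \<in> carrier (free_space k S)" and f': "f' \<in> carrier (free_space k S)"
    let ?F = "{s. f s \<noteq> \<zero>\<^bsub>k\<^esub>} \<union> {s. f' s \<noteq> \<zero>\<^bsub>k\<^esub>}"
    have F: "finite ?F" "?F \<subseteq> S" using free_carrierD[OF f] free_carrierD[OF f'] by auto
    have ff': "f \<oplus>\<^bsub>free_space k S\<^esub> f' \<in> carrier (free_space k S)"
      using f f' k by (meson free_module module_add_closed)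
    have "free_lift k U g (f \<oplus>\<^bsub>free_space k S\<^esub> f') = finsum U (\<lambda>s. (f \<oplus>\<^bsub>free_space k S\<^esub> f') s \<odot>\<^bsub>U\<^esub> g s) ?F"
      by (rule sup[OF _ ff' F]) (auto simp: free_space_def)
    also have "\<dots> = finsum U (\<lambda>s. f s \<odot>\<^bsub>U\<^esub> g s \<oplus>\<^bsub>U\<^esub> f' s \<odot>\<^bsub>U\<^esub> g s) ?F"
      by (rule U.finsum_cong')
        (use F free_carrierD[OF f] free_carrierD[OF f'] g in \<open>auto simp: free_space_def U.smult_l_distr\<close>)
    also have "\<dots> = finsum U (\<lambda>s. f s \<odot>\<^bsub>U\<^esub> g s) ?F \<oplus>\<^bsub>U\<^esub> finsum U (\<lambda>s. f' s \<odot>\<^bsub>U\<^esub> g s) ?F"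
      by (rule U.finsum_addf)
        (use F free_carrierD[OF f] free_carrierD[OF f'] g in auto)
    also have "\<dots> = free_lift k U g f \<oplus>\<^bsub>U\<^esub> free_lift k U g f'"
      using sup[OF _ f F] sup[OF _ f' F] by simp
    finally show "free_lift k U g (f \<oplus>\<^bsub>free_space k S\<^esub> f') = free_lift k U g f \<oplus>\<^bsub>U\<^esub> free_lift k U g f'" .
  qed (simp_all add: k assms)
  fix s assume s: "s \<in> S"
  have "free_lift k U g (basis_vec k s) = finsum U (\<lambda>t. basis_vec k s t \<odot>\<^bsub>U\<^esub> g t) {s}"
    by (rule sup) (use s k in \<open>auto simp: basis_vec_apply\<close>)
  also have "\<dots> = g s" using g[OF s] by (simp add: basis_vec_def)
  finally show "free_lift k U g (basis_vec k s) = g s" .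
qed

section \<open>Tensor products\<close>

context
  fixes k :: "('k,'r) ring_scheme" and V :: "('k,'v,'p) module_scheme" and W :: "('k,'w,'q) module_scheme"
  assumes V: "module k V" and W: "module k W"
begin

private lemma cring_k: "cring k" using V by (simp add: module_def)

private abbreviation (input) "F \<equiv> free_space k (carrier V \<times> carrier W)"
private abbreviation (input) "Rel \<equiv> subspace_gen k F (bilinear_relations k V W)"

private lemma F_module: "module k F" by (rule free_module[OF cring_k])

private lemma Fminus: "x \<in> carrier F \<Longrightarrow> y \<in> carrier F \<Longrightarrow> x \<ominus>\<^bsub>F\<^esub> y \<in> carrier F"
  using F_module by (simp add: module_def abelian_group.minus_closed)

private lemma relations_subset: "bilinear_relations k V W \<subseteq> carrier F"
proof -
  note [simp] = module_add_closed[OF F_module] module_smult_closed[OF F_module] Fminus cring_k V W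
    module_add_closed[OF V] module_add_closed[OF W] module_smult_closed[OF V] module_smult_closed[OF W]
  show ?thesis unfolding bilinear_relations_def Let_def by (intro Un_least) auto
qed

private lemma R_submodule: "submodule Rel k F"
  by (rule subspace_gen_submodule[OF F_module relations_subset])

lemma tensor_module [simp]: "module k (tensor k V W)"
  unfolding tensor_def Let_def by (rule quot_module[OF F_module R_submodule])

private lemma relation_coset:
  assumes "r \<in> bilinear_relations k V W" "r = x \<ominus>\<^bsub>F\<^esub> y" "x \<in> carrier F" "y \<in> carrier F"
  shows "Rel +>\<^bsub>F\<^esub> x = Rel +>\<^bsub>F\<^esub> y"
  using assms subspace_gen_incl[of "bilinear_relations k V W" k F] coset_eq_iff[OF F_module R_submodule] by blast

lemma tens_bilin [simp]: "bilin k V W (tensor k V W) (tens k V W)"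
proof -
  note [simp] = module_add_closed[OF F_module] module_smult_closed[OF F_module] Fminus cring_k V W
    module_add_closed[OF V] module_add_closed[OF W] module_smult_closed[OF V] module_smult_closed[OF W]
  note defs = tens_def tensor_def Let_def
  have c: "tens k V W v w \<in> carrier (tensor k V W)" if "v \<in> carrier V" "w \<in> carrier W" for v w
    using that cring_k by (simp add: defs quot_carrier)
  show ?thesis
  proof (rule bilinI)
    fix w assume w: "w \<in> carrier W"
    show "lin k V (tensor k V W) (\<lambda>v. tens k V W v w)"
    proof (rule linI)
      fix v v' assume v: "v \<in> carrier V" "v' \<in> carrier V"
      have "Rel +>\<^bsub>F\<^esub> basis_vec k (v \<oplus>\<^bsub>V\<^esub> v', w) = Rel +>\<^bsub>F\<^esub> (basis_vec k (v, w) \<oplus>\<^bsub>F\<^esub> basis_vec k (v', w))"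
        by (rule relation_coset[OF _ refl], unfold bilinear_relations_def Let_def, use v w in blast)
          (use v w in simp_all)
      then show "tens k V W (v \<oplus>\<^bsub>V\<^esub> v') w = tens k V W v w \<oplus>\<^bsub>tensor k V W\<^esub> tens k V W v' w"
        using v w by (simp add: defs quot_add[OF F_module R_submodule])
    next
      fix c v assume v: "c \<in> carrier k" "v \<in> carrier V"
      have "Rel +>\<^bsub>F\<^esub> basis_vec k (c \<odot>\<^bsub>V\<^esub> v, w) = Rel +>\<^bsub>F\<^esub> (c \<odot>\<^bsub>F\<^esub> basis_vec k (v, w))"
        by (rule relation_coset[OF _ refl], unfold bilinear_relations_def Let_def, use v w in blast)
          (use v w in simp_all)
      then show "tens k V W (c \<odot>\<^bsub>V\<^esub> v) w = c \<odot>\<^bsub>tensor k V W\<^esub> tens k V W v w"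
        using v w by (simp add: defs quot_smult[OF F_module R_submodule])
    qed (use w c in simp_all)
  next
    fix v assume v: "v \<in> carrier V"
    show "lin k W (tensor k V W) (\<lambda>w. tens k V W v w)"
    proof (rule linI)
      fix w w' assume w: "w \<in> carrier W" "w' \<in> carrier W"
      have "Rel +>\<^bsub>F\<^esub> basis_vec k (v, w \<oplus>\<^bsub>W\<^esub> w') = Rel +>\<^bsub>F\<^esub> (basis_vec k (v, w) \<oplus>\<^bsub>F\<^esub> basis_vec k (v, w'))"
        by (rule relation_coset[OF _ refl], unfold bilinear_relations_def Let_def, use v w in blast)
          (use v w in simp_all)
      then show "tens k V W v (w \<oplus>\<^bsub>W\<^esub> w') = tens k V W v w \<oplus>\<^bsub>tensor k V W\<^esub> tens k V W v w'"
        using v w by (simp add: defs quot_add[OF F_module R_submodule])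
    next
      fix c w assume w: "c \<in> carrier k" "w \<in> carrier W"
      have "Rel +>\<^bsub>F\<^esub> basis_vec k (v, c \<odot>\<^bsub>W\<^esub> w) = Rel +>\<^bsub>F\<^esub> (c \<odot>\<^bsub>F\<^esub> basis_vec k (v, w))"
        by (rule relation_coset[OF _ refl], unfold bilinear_relations_def Let_def, use v w in blast)
          (use v w in simp_all)
      then show "tens k V W v (c \<odot>\<^bsub>W\<^esub> w) = c \<odot>\<^bsub>tensor k V W\<^esub> tens k V W v w"
        using v w by (simp add: defs quot_smult[OF F_module R_submodule])
    qed (use v c in simp_all)
  qed simp_all
qed

text \<open>The bilinear relations lie in the kernel of the linear extension of
  \<open>\<beta>\<close> to the free module. The kernel is a submodule, so it contains the subspace
  generated by them and the extension descends to the quotient.\<close>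

lemma tensor_lift_ex:
  assumes "bilin k V W U \<beta>"
  obtains f where "lin k (tensor k V W) U f"
    "\<And>v w. v \<in> carrier V \<Longrightarrow> w \<in> carrier W \<Longrightarrow> f (tens k V W v w) = \<beta> v w"
proof -
  note U = bilin_module(3)[OF assms]
  note [simp] = module_add_closed[OF F_module] module_smult_closed[OF F_module] Fminus cring_k V W U
    module_add_closed[OF V] module_add_closed[OF W] module_smult_closed[OF V] module_smult_closed[OF W]
    module_add_closed[OF U] module_smult_closed[OF U]
  define f where "f = free_lift k U (\<lambda>(v,w). \<beta> v w)"
  have b: "\<beta> v w \<in> carrier U" if "v \<in> carrier V" "w \<in> carrier W" for v w
    by (rule bilin_closed[OF assms that])
  have f: "lin k F U f" and fb: "\<And>v w. v \<in> carrier V \<Longrightarrow> w \<in> carrier W \<Longrightarrow> f (basis_vec k (v,w)) = \<beta> v w"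
    unfolding f_def using free_lift[OF U, of "carrier V \<times> carrier W" "\<lambda>(v,w). \<beta> v w"] b by auto
  have bl: "lin k V U (\<lambda>v. \<beta> v w)" if "w \<in> carrier W" for w
    using assms that by (simp add: bilin_def)
  have br: "lin k W U (\<beta> v)" if "v \<in> carrier V" for v
    using assms that by (simp add: bilin_def)
  have "bilinear_relations k V W \<subseteq> {x \<in> carrier F. f x = \<zero>\<^bsub>U\<^esub>}"
  proof
    fix r assume r: "r \<in> bilinear_relations k V W"
    have "f r = \<zero>\<^bsub>U\<^esub>"
      using r unfolding bilinear_relations_def Let_def
      by (auto simp: lin_minus[OF f] lin_add[OF f] lin_smult[OF f] fb module_minus_eq_zero[OF U]
          lin_add[OF bl] lin_add[OF br] lin_smult[OF bl] lin_smult[OF br] b)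
    then show "r \<in> {x \<in> carrier F. f x = \<zero>\<^bsub>U\<^esub>}" using r relations_subset by auto
  qed
  then have "Rel \<subseteq> {x \<in> carrier F. f x = \<zero>\<^bsub>U\<^esub>}"
    by (rule subspace_gen_least[OF kernel_submodule[OF f]])
  then obtain g where "lin k (quot F Rel) U g" "\<And>x. x \<in> carrier F \<Longrightarrow> g (Rel +>\<^bsub>F\<^esub> x) = f x"
    using quot_lift[OF R_submodule f] by blast
  then show thesis using that[of g] by (simp add: tensor_def tens_def Let_def fb)
qed

text \<open>Scalars of the free module are absorbed into the first tensor factor, so zero, pure
  tensors and sums exhaust the cases.\<close>

lemma tensor_induct:
  assumes "t \<in> carrier (tensor k V W)"
    and "P \<zero>\<^bsub>tensor k V W\<^esub>"
    and tens: "\<And>v w. v \<in> carrier V \<Longrightarrow> w \<in> carrier W \<Longrightarrow> P (tens k V W v w)"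
    and add: "\<And>s t. s \<in> carrier (tensor k V W) \<Longrightarrow> t \<in> carrier (tensor k V W) \<Longrightarrow> P s \<Longrightarrow> P t \<Longrightarrow>
      P (s \<oplus>\<^bsub>tensor k V W\<^esub> t)"
  shows "P t"
proof -
  have q: "tensor k V W = quot F Rel" by (simp add: tensor_def Let_def)
  have b: "Rel +>\<^bsub>F\<^esub> basis_vec k (v,w) = tens k V W v w" for v w by (simp add: tens_def Let_def)
  have l: "lin k F (tensor k V W) (\<lambda>f. Rel +>\<^bsub>F\<^esub> f)" unfolding q by (rule lin_coset[OF F_module R_submodule])
  have tc: "tens k V W v w \<in> carrier (tensor k V W)" if "v \<in> carrier V" "w \<in> carrier W" for v w
    by (rule bilin_closed[OF tens_bilin that])
  have "P (Rel +>\<^bsub>F\<^esub> f)" if "f \<in> carrier F" for f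
    using cring_k that
  proof (induction rule: free_induct)
    case zero
    then show ?case using assms(2) lin_zero[OF l] by simp
  next
    case (add c s g)
    then obtain v w where s: "s = (v,w)" "v \<in> carrier V" "w \<in> carrier W" by auto
    have bv: "basis_vec k s \<in> carrier F" using add cring_k by simp
    have "Rel +>\<^bsub>F\<^esub> (c \<odot>\<^bsub>F\<^esub> basis_vec k s) = c \<odot>\<^bsub>tensor k V W\<^esub> tens k V W v w"
      using lin_smult[OF l add(1) bv] by (simp add: s b)
    also have "\<dots> = tens k V W (c \<odot>\<^bsub>V\<^esub> v) w"
      using tens_bilin s add(1) by (simp add: bilin_def lin_def)
    finally have "P (Rel +>\<^bsub>F\<^esub> (c \<odot>\<^bsub>F\<^esub> basis_vec k s))"
      using tens s add(1) V by simp
    moreover have "c \<odot>\<^bsub>F\<^esub> basis_vec k s \<in> carrier F" by (rule module_smult_closed[OF F_module add(1) bv])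
    ultimately show ?case
      using assms(4) add by (simp add: lin_add[OF l] lin_closed[OF l])
  qed
  then show ?thesis using assms(1) by (auto simp: q quot_carrier)
qed

end

lemma tens_closed [simp]:
  "module k V \<Longrightarrow> module k W \<Longrightarrow> v \<in> carrier V \<Longrightarrow> w \<in> carrier W \<Longrightarrow> tens k V W v w \<in> carrier (tensor k V W)"
  by (rule bilin_closed[OF tens_bilin])

lemma tens_lin_left [simp]:
  "module k V \<Longrightarrow> module k W \<Longrightarrow> w \<in> carrier W \<Longrightarrow> lin k S V g \<Longrightarrow> lin k S (tensor k V W) (\<lambda>s. tens k V W (g s) w)"
  by (rule bilin_left[OF tens_bilin])

lemma tens_lin_right [simp]:
  "module k V \<Longrightarrow> module k W \<Longrightarrow> v \<in> carrier V \<Longrightarrow> lin k S W g \<Longrightarrow> lin k S (tensor k V W) (\<lambda>s. tens k V W v (g s))"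
  by (rule bilin_right[OF tens_bilin])

text \<open>Reduces identities to pure tensors, where \<open>tlift\<close> evaluates by rewriting.
  The codomain \<open>U\<close> does not occur in the conclusion and is therefore supplied
  explicitly at most uses.\<close>

lemma tensor_lin_eq:
  assumes "module k V" "module k W" "lin k (tensor k V W) U f" "lin k (tensor k V W) U g"
    "\<And>v w. v \<in> carrier V \<Longrightarrow> w \<in> carrier W \<Longrightarrow> f (tens k V W v w) = g (tens k V W v w)"
    "t \<in> carrier (tensor k V W)"
  shows "f t = g t"
  by (rule tensor_induct[OF assms(1,2,6)])
    (use assms(5) in \<open>simp_all add: lin_zero[OF assms(3)] lin_zero[OF assms(4)]
      lin_add[OF assms(3)] lin_add[OF assms(4)]\<close>)

text \<open>Justifies the definite description: existence is \<open>tensor_lift_ex\<close> followed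
  by restriction to the carrier, and uniqueness holds because \<open>Lin\<close> demands
  extensionality.\<close>

lemma tlift_Lin:
  assumes "bilin k V W U \<beta>"
  shows "tlift k V W U \<beta> \<in> Lin k (tensor k V W) U"
    and "\<And>v w. v \<in> carrier V \<Longrightarrow> w \<in> carrier W \<Longrightarrow> tlift k V W U \<beta> (tens k V W v w) = \<beta> v w"
proof -
  note m = bilin_module[OF assms]
  note T = tensor_module[OF m(1,2)]
  obtain f where f: "lin k (tensor k V W) U f"
    "\<And>v w. v \<in> carrier V \<Longrightarrow> w \<in> carrier W \<Longrightarrow> f (tens k V W v w) = \<beta> v w"
    using tensor_lift_ex[OF m(1,2) assms] by blast
  let ?P = "\<lambda>f. f \<in> Lin k (tensor k V W) U \<and>
     (\<forall>v \<in> carrier V. \<forall>w \<in> carrier W. f (tens k V W v w) = \<beta> v w)"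
  have "?P (restrict f (carrier (tensor k V W)))"
    using f m by (simp add: Lin_iff T)
  moreover have "g = restrict f (carrier (tensor k V W))" if "?P g" for g
  proof (rule extensionalityI[of _ "carrier (tensor k V W)"])
    fix t assume t: "t \<in> carrier (tensor k V W)"
    show "g t = restrict f (carrier (tensor k V W)) t"
      by (rule tensor_lin_eq[OF m(1,2) _ _ _ t, where U = U])
        (use that f m in \<open>simp_all add: Lin_iff T\<close>)
  qed (use that m in \<open>simp_all add: Lin_iff T\<close>)
  ultimately have "?P (tlift k V W U \<beta>)" unfolding tlift_def by (rule theI)
  then show "tlift k V W U \<beta> \<in> Lin k (tensor k V W) U"
    and "\<And>v w. v \<in> carrier V \<Longrightarrow> w \<in> carrier W \<Longrightarrow> tlift k V W U \<beta> (tens k V W v w) = \<beta> v w" by auto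
qed

text \<open>As a congruence rule it lets the simplifier work under the Sweedler binders with the
  knowledge that the bound variables lie in the carriers. The carriers are variables for the sake of
  normalization.\<close>

lemma tlift_cong [cong]:
  assumes "V = V'" "W = W'" "U = U'" "carrier V' = S" "carrier W' = T"
    "\<And>v w. v \<in> S \<Longrightarrow> w \<in> T \<Longrightarrow> \<beta> v w = \<beta>' v w"
  shows "tlift k V W U \<beta> = tlift k V' W' U' \<beta>'"
  using assms by (simp add: tlift_def)

lemma tlift_tens [simp]:
  "bilin k V W U \<beta> \<Longrightarrow> v \<in> carrier V \<Longrightarrow> w \<in> carrier W \<Longrightarrow> tlift k V W U \<beta> (tens k V W v w) = \<beta> v w"
  by (rule tlift_Lin(2))

lemma tlift_lin:
  assumes "bilin k V W U \<beta>" shows "lin k (tensor k V W) U (tlift k V W U \<beta>)"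
  using tlift_Lin(1)[OF assms] bilin_module[OF assms] by (simp add: Lin_iff)

lemma tlift_closed [simp]:
  "bilin k V W U \<beta> \<Longrightarrow> t \<in> carrier (tensor k V W) \<Longrightarrow> tlift k V W U \<beta> t \<in> carrier U"
  by (rule lin_closed[OF tlift_lin])

lemma tlift_lin_arg [simp]:
  "bilin k V W U \<beta> \<Longrightarrow> lin k S (tensor k V W) g \<Longrightarrow> lin k S U (\<lambda>s. tlift k V W U \<beta> (g s))"
  by (rule lin_comp[OF tlift_lin])

text \<open>A Sweedler sum depends linearly on a parameter of its integrand: for fixed parameters
  both sides of each linearity equation are linear in \<open>t\<close>, and they agree on pure
  tensors by the last hypothesis.\<close>

lemma tlift_lin_fun:
  assumes "module k S" "\<And>s. s \<in> carrier S \<Longrightarrow> bilin k V W U (\<beta> s)"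
    "t \<in> carrier (tensor k V W)"
    "\<And>v w. v \<in> carrier V \<Longrightarrow> w \<in> carrier W \<Longrightarrow> lin k S U (\<lambda>s. \<beta> s v w)"
  shows "lin k S U (\<lambda>s. tlift k V W U (\<beta> s) t)"
proof (rule linI)
  have z: "\<zero>\<^bsub>S\<^esub> \<in> carrier S" using assms(1) by simp
  show U: "module k U" by (rule bilin_module(3)[OF assms(2)[OF z]])
  note VW = bilin_module(1,2)[OF assms(2)[OF z]]
  fix s assume s: "s \<in> carrier S"
  show "tlift k V W U (\<beta> s) t \<in> carrier U" using s assms by simp
  fix c assume c: "c \<in> carrier k"
  have cs: "c \<odot>\<^bsub>S\<^esub> s \<in> carrier S" using c s assms(1) by simp
  show "tlift k V W U (\<beta> (c \<odot>\<^bsub>S\<^esub> s)) t = c \<odot>\<^bsub>U\<^esub> tlift k V W U (\<beta> s) t"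
    by (rule tensor_lin_eq[OF VW _ _ _ assms(3), where U = U])
      (use s c cs assms VW bilin_module(3)[OF assms(2)[OF z]] in
        \<open>simp_all add: tlift_lin lin_smult[OF assms(4)] bilin_lin[OF assms(2)]\<close>)
next
  have z: "\<zero>\<^bsub>S\<^esub> \<in> carrier S" using assms(1) by simp
  note VW = bilin_module(1,2)[OF assms(2)[OF z]]
  fix s s' assume s: "s \<in> carrier S" "s' \<in> carrier S"
  have ss': "s \<oplus>\<^bsub>S\<^esub> s' \<in> carrier S" using s assms(1) by simp
  show "tlift k V W U (\<beta> (s \<oplus>\<^bsub>S\<^esub> s')) t = tlift k V W U (\<beta> s) t \<oplus>\<^bsub>U\<^esub> tlift k V W U (\<beta> s') t"
    by (rule tensor_lin_eq[OF VW _ _ _ assms(3), where U = U])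
      (use s ss' assms VW bilin_module(3)[OF assms(2)[OF z]] in
        \<open>simp_all add: tlift_lin lin_add[OF assms(4)] bilin_lin[OF assms(2)]\<close>)
qed (use assms in simp)

lemma tlift_lin_fun_carrier [simp]:
  assumes "module k S" "carrier S = S'" "carrier V = V'" "carrier W = W'" "t \<in> carrier (tensor k V W)"
    "\<And>s. s \<in> S' \<Longrightarrow> bilin k V W U (\<beta> s)"
    "\<And>v w. v \<in> V' \<Longrightarrow> w \<in> W' \<Longrightarrow> lin k S U (\<lambda>s. \<beta> s v w)"
  shows "lin k S U (\<lambda>s. tlift k V W U (\<beta> s) t)"
  by (rule tlift_lin_fun) (use assms in blast)+

text \<open>The rule by which a linear map moves inside a Sweedler sum; both sides are linear in
  \<open>t\<close> and agree on pure tensors.\<close>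

lemma tlift_push:
  assumes "lin k U U' f" "bilin k V W U \<beta>" "t \<in> carrier (tensor k V W)"
  shows "f (tlift k V W U \<beta> t) = tlift k V W U' (\<lambda>v w. f (\<beta> v w)) t"
proof -
  note m = bilin_module[OF assms(2)] lin_module[OF assms(1)]
  have b: "bilin k V W U' (\<lambda>v w. f (\<beta> v w))"
    using assms(2) m by (auto simp: bilin_def intro: lin_comp[OF assms(1)])
  show ?thesis
    by (rule tensor_lin_eq[OF m(1,2) _ _ _ assms(3), where U = U'])
      (use assms b in \<open>simp_all add: lin_comp[OF assms(1)] tlift_lin\<close>)
qed

text \<open>Interchange of two independent Sweedler sums. On a pure tensor \<open>t\<close> the
  outer sum disappears, and what is left is linear in \<open>t\<close> by
  \<open>tlift_lin_fun\<close>.\<close>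

lemma tlift_swap:
  assumes "t \<in> carrier (tensor k V W)" "t' \<in> carrier (tensor k V' W')"
    "\<And>v w. v \<in> carrier V \<Longrightarrow> w \<in> carrier W \<Longrightarrow> bilin k V' W' U (\<tau> v w)"
    "\<And>v w. v \<in> carrier V' \<Longrightarrow> w \<in> carrier W' \<Longrightarrow> bilin k V W U (\<lambda>x y. \<tau> x y v w)"
    and m: "module k V" "module k W" "module k V'" "module k W'" "module k U"
  shows "tlift k V W U (\<lambda>v w. tlift k V' W' U (\<lambda>v' w'. \<tau> v w v' w') t') t =
    tlift k V' W' U (\<lambda>v' w'. tlift k V W U (\<lambda>v w. \<tau> v w v' w') t) t'"
proof -
  have l: "lin k V U (\<lambda>v. \<tau> v w v' w')" if "w \<in> carrier W" "v' \<in> carrier V'" "w' \<in> carrier W'" for w v' w'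
    using assms(4)[OF that(2,3)] that by (simp add: bilin_def)
  have r: "lin k W U (\<lambda>w. \<tau> v w v' w')" if "v \<in> carrier V" "v' \<in> carrier V'" "w' \<in> carrier W'" for v v' w'
    using assms(4)[OF that(2,3)] that by (simp add: bilin_def)
  have l': "lin k V' U (\<lambda>v'. \<tau> v w v' w')" if "v \<in> carrier V" "w \<in> carrier W" "w' \<in> carrier W'" for v w w'
    using assms(3)[OF that(1,2)] that by (simp add: bilin_def)
  have r': "lin k W' U (\<lambda>w'. \<tau> v w v' w')" if "v \<in> carrier V" "w \<in> carrier W" "v' \<in> carrier V'" for v w v'
    using assms(3)[OF that(1,2)] that by (simp add: bilin_def)
  show ?thesis
    by (rule tensor_lin_eq[OF m(1,2) _ _ _ assms(1), where U = U])
      (use assms l r l' r' in simp_all)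
qed

lemma tlift_tens_id:
  assumes "module k V" "module k W" "t \<in> carrier (tensor k V W)"
  shows "tlift k V W (tensor k V W) (tens k V W) t = t"
  by (rule tensor_lin_eq[OF assms(1,2) _ _ _ assms(3), where U = "tensor k V W"])
    (use assms in \<open>simp_all add: tlift_lin\<close>)

lemma tlift_ext:
  assumes "bilin k V W U \<beta>" shows "tlift k V W U \<beta> \<in> extensional (carrier (tensor k V W))"
  using tlift_Lin(1)[OF assms] bilin_module[OF assms] by (simp add: Lin_iff)

subsection \<open>Maps between tensor products\<close>

lemma tmap_bilin:
  assumes "lin k V V' f" "lin k W W' g"
  shows "bilin k V W (tensor k V' W') (\<lambda>v w. tens k V' W' (f v) (g w))"
  using assms lin_module[OF assms(1)] lin_module[OF assms(2)]
  by (intro bilinI) (simp_all add: lin_closed[OF assms(1)] lin_closed[OF assms(2)])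

lemma tmap_Lin:
  assumes "lin k V V' f" "lin k W W' g"
  shows "tmap k V W V' W' f g \<in> Lin k (tensor k V W) (tensor k V' W')"
  unfolding tmap_def by (rule tlift_Lin(1)[OF tmap_bilin]) fact+

lemma tmap_lin:
  assumes "lin k V V' f" "lin k W W' g"
  shows "lin k (tensor k V W) (tensor k V' W') (tmap k V W V' W' f g)"
  unfolding tmap_def by (rule tlift_lin[OF tmap_bilin]) fact+

lemma tmap_lin_arg [simp]:
  "lin k V V' f \<Longrightarrow> lin k W W' g \<Longrightarrow> lin k S (tensor k V W) h \<Longrightarrow>
    lin k S (tensor k V' W') (\<lambda>s. tmap k V W V' W' f g (h s))"
  by (rule lin_comp[OF tmap_lin])

lemma tmap_tens [simp]:
  assumes "lin k V V' f" "lin k W W' g" "v \<in> carrier V" "w \<in> carrier W"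
  shows "tmap k V W V' W' f g (tens k V W v w) = tens k V' W' (f v) (g w)"
  unfolding tmap_def by (rule tlift_tens[OF tmap_bilin]) fact+

lemma tmap_closed [simp]:
  "lin k V V' f \<Longrightarrow> lin k W W' g \<Longrightarrow> t \<in> carrier (tensor k V W) \<Longrightarrow>
    tmap k V W V' W' f g t \<in> carrier (tensor k V' W')"
  by (rule lin_closed[OF tmap_lin])

lemma tmap_cong [cong]:
  assumes "V = Y" "W = Z" "V' = Y'" "W' = Z'" "carrier Y = S" "carrier Z = T"
    "\<And>v. v \<in> S \<Longrightarrow> f v = f' v" "\<And>w. w \<in> T \<Longrightarrow> g w = g' w"
  shows "tmap k V W V' W' f g = tmap k Y Z Y' Z' f' g'"
  unfolding tmap_def by (rule tlift_cong[OF assms(1,2) _ assms(5,6)]) (simp_all only: assms(3,4,7,8))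

text \<open>Change of variables in a Sweedler sum.\<close>

lemma tlift_tmap:
  assumes "lin k V V' f" "lin k W W' g" "bilin k V' W' U \<beta>" "t \<in> carrier (tensor k V W)"
  shows "tlift k V' W' U \<beta> (tmap k V W V' W' f g t) = tlift k V W U (\<lambda>v w. \<beta> (f v) (g w)) t"
  unfolding tmap_def
  by (subst tlift_push[OF tlift_lin[OF assms(3)] tmap_bilin[OF assms(1,2)] assms(4)])
    (use assms lin_closed[OF assms(1)] lin_closed[OF assms(2)] in simp)

lemma tmap_comp:
  assumes "lin k V V' f" "lin k W W' g" "lin k V' V'' f'" "lin k W' W'' g'" "t \<in> carrier (tensor k V W)"
  shows "tmap k V' W' V'' W'' f' g' (tmap k V W V' W' f g t) =
    tmap k V W V'' W'' (\<lambda>v. f' (f v)) (\<lambda>w. g' (g w)) t"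
  unfolding tmap_def[of k V' W' V'' W'']
  by (subst tlift_tmap[OF assms(1,2) tmap_bilin[OF assms(3,4)] assms(5)]) (simp add: tmap_def)

lemma tmap_id:
  assumes "module k V" "module k W" "t \<in> carrier (tensor k V W)"
  shows "tmap k V W V W (\<lambda>v. v) (\<lambda>w. w) t = t"
  unfolding tmap_def by (rule tlift_tens_id[OF assms])

lemma tassoc_eq:
  "tassoc k U V W t = tlift k (tensor k U V) W (tensor k U (tensor k V W))
        (\<lambda>t w. tlift k U V (tensor k U (tensor k V W))
          (\<lambda>u v. tens k U (tensor k V W) u (tens k V W v w)) t) t"
  by (simp add: tassoc_def Let_def)

context
  fixes k :: "('k,'r) ring_scheme" and U :: "('k,'u,'o) module_scheme"
    and V :: "('k,'v,'p) module_scheme" and W :: "('k,'w,'q) module_scheme"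
  assumes m [simp]: "module k U" "module k V" "module k W"
begin

lemma tassoc_Lin: "tassoc k U V W \<in> Lin k (tensor k (tensor k U V) W) (tensor k U (tensor k V W))"
  unfolding tassoc_def Let_def by (rule tlift_Lin(1)) simp

lemma tassoc_lin: "lin k (tensor k (tensor k U V) W) (tensor k U (tensor k V W)) (tassoc k U V W)"
  using tassoc_Lin by (simp add: Lin_iff)

lemma tassoc_tens [simp]:
  assumes "u \<in> carrier U" "v \<in> carrier V" "w \<in> carrier W"
  shows "tassoc k U V W (tens k (tensor k U V) W (tens k U V u v) w) = tens k U (tensor k V W) u (tens k V W v w)"
  using assms by (simp add: tassoc_eq)

end

subsection \<open>Modules with the same underlying space\<close>

text \<open>Algebras, coalgebras, modules and comodules are records extending that of a vector space.  The
  linear constructions depend only on the part \<open>sp\<close>, and the simplifier uses this to replace a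
  structured object by its underlying space.\<close>

definition sp :: "('k,'v,'p) module_scheme \<Rightarrow> ('k,'v) module" where
  "sp V = \<lparr>carrier = carrier V, mult = undefined, one = undefined, zero = zero V, add = add V, smult = smult V\<rparr>"

lemma sp_module: "module k (sp V) = module k V"
  unfolding sp_def module_def module_axioms_def abelian_group_def abelian_monoid_def abelian_group_axioms_def
    comm_group_def group_def comm_monoid_def comm_monoid_axioms_def monoid_def group_axioms_def Units_def
  by simp

lemma lin_sp: "lin k (sp V) W = lin k V W" "lin k V (sp W) = lin k V W"
  unfolding lin_def[abs_def] sp_module by (simp_all add: sp_def)

lemma Lin_sp: "Lin k (sp V) W = Lin k V W" "Lin k V (sp W) = Lin k V W"
  unfolding Lin_def by (simp_all add: sp_def)

lemma hom_space_sp: "hom_space k (sp V) W = hom_space k V W" "hom_space k V (sp W) = hom_space k V W"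
  unfolding hom_space_def Lin_sp by (simp_all add: sp_def)

lemma bilinear_relations_sp:
  "bilinear_relations k (sp V) W = bilinear_relations k V W"
  "bilinear_relations k V (sp W) = bilinear_relations k V W"
  unfolding bilinear_relations_def by (simp_all add: sp_def)

lemma carrier_sp: "carrier (sp V) = carrier V" by (simp add: sp_def)

lemma tensor_sp: "tensor k (sp V) W = tensor k V W" "tensor k V (sp W) = tensor k V W"
  unfolding tensor_def bilinear_relations_sp carrier_sp by simp_all

lemma tens_sp: "tens k (sp V) W = tens k V W" "tens k V (sp W) = tens k V W"
  unfolding tens_def bilinear_relations_sp carrier_sp by simp_all

lemma tlift_sp: "tlift k (sp V) W U = tlift k V W U" "tlift k V (sp W) U = tlift k V W U"
  "tlift k V W (sp U) = tlift k V W U"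
  unfolding tlift_def tensor_sp tens_sp carrier_sp Lin_sp by simp_all

lemma tmap_sp: "tmap k (sp V) W V' W' = tmap k V W V' W'" "tmap k V (sp W) V' W' = tmap k V W V' W'"
  "tmap k V W (sp V') W' = tmap k V W V' W'" "tmap k V W V' (sp W') = tmap k V W V' W'"
  unfolding tmap_def tlift_sp tensor_sp tens_sp by simp_all

lemma tassoc_sp: "tassoc k (sp U) V W = tassoc k U V W" "tassoc k U (sp V) W = tassoc k U V W"
  "tassoc k U V (sp W) = tassoc k U V W"
  unfolding tassoc_def tlift_sp tensor_sp tens_sp by simp_all

lemma bilin_sp: "bilin k (sp V) W U = bilin k V W U" "bilin k V (sp W) U = bilin k V W U"
  "bilin k V W (sp U) = bilin k V W U"
  unfolding bilin_def[abs_def] lin_sp sp_module carrier_sp by simp_all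

lemma sp_fields: "carrier (sp V) = carrier V" "add (sp V) = add V" "smult (sp V) = smult V" "zero (sp V) = zero V"
  by (simp_all add: sp_def)

text \<open>Each construction is unchanged when an argument is replaced by its \<open>sp\<close>,
  hence depends on \<open>sp\<close> alone. Instantiated with a structured object on the left, these
  equations become rewrite rules to the plain space underneath.\<close>

lemma
  assumes "sp V = sp V'"
  shows sp_lin1: "lin k V W = lin k V' W" and sp_lin2: "lin k X V = lin k X V'"
    and sp_Lin1: "Lin k V W = Lin k V' W" and sp_Lin2: "Lin k X V = Lin k X V'"
    and sp_hom1: "hom_space k V W = hom_space k V' W" and sp_hom2: "hom_space k X V = hom_space k X V'"
    and sp_tensor1: "tensor k V W = tensor k V' W" and sp_tensor2: "tensor k X V = tensor k X V'"
    and sp_tens1: "tens k V W = tens k V' W" and sp_tens2: "tens k X V = tens k X V'"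
    and sp_tlift1: "tlift k V W U = tlift k V' W U" and sp_tlift2: "tlift k X V U = tlift k X V' U"
    and sp_tlift3: "tlift k X W V = tlift k X W V'"
    and sp_tmap1: "tmap k V W U Y = tmap k V' W U Y" and sp_tmap2: "tmap k X V U Y = tmap k X V' U Y"
    and sp_tmap3: "tmap k X W V Y = tmap k X W V' Y" and sp_tmap4: "tmap k X W Y V = tmap k X W Y V'"
    and sp_tassoc1: "tassoc k V W U = tassoc k V' W U" and sp_tassoc2: "tassoc k X V U = tassoc k X V' U"
    and sp_tassoc3: "tassoc k X W V = tassoc k X W V'"
    and sp_bilin1: "bilin k V W U = bilin k V' W U" and sp_bilin2: "bilin k X V U = bilin k X V' U"
    and sp_bilin3: "bilin k X W V = bilin k X W V'"
    and sp_mod: "module k V = module k V'"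
    and sp_carrier: "carrier V = carrier V'" and sp_add: "add V = add V'" and sp_smult: "smult V = smult V'"
    and sp_zero: "zero V = zero V'"
  apply (metis assms lin_sp(1))
  apply (metis assms lin_sp(2))
  apply (metis assms Lin_sp(1))
  apply (metis assms Lin_sp(2))
  apply (metis assms hom_space_sp(1))
  apply (metis assms hom_space_sp(2))
  apply (metis assms tensor_sp(1))
  apply (metis assms tensor_sp(2))
  apply (metis assms tens_sp(1))
  apply (metis assms tens_sp(2))
  apply (metis assms tlift_sp(1))
  apply (metis assms tlift_sp(2))
  apply (metis assms tlift_sp(3))
  apply (metis assms tmap_sp(1))
  apply (metis assms tmap_sp(2))
  apply (metis assms tmap_sp(3))
  apply (metis assms tmap_sp(4))
  apply (metis assms tassoc_sp(1))
  apply (metis assms tassoc_sp(2))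
  apply (metis assms tassoc_sp(3))
  apply (metis assms bilin_sp(1))
  apply (metis assms bilin_sp(2))
  apply (metis assms bilin_sp(3))
  apply (metis assms sp_module)
  apply (metis assms sp_fields(1))
  apply (metis assms sp_fields(2))
  apply (metis assms sp_fields(3))
  apply (metis assms sp_fields(4))
  done

lemmas sp_eqs = sp_lin1 sp_lin2 sp_Lin1 sp_Lin2 sp_hom1 sp_hom2 sp_tensor1 sp_tensor2 sp_tens1 sp_tens2
  sp_tlift1 sp_tlift2 sp_tlift3 sp_tmap1 sp_tmap2 sp_tmap3 sp_tmap4 sp_tassoc1 sp_tassoc2 sp_tassoc3
  sp_bilin1 sp_bilin2 sp_bilin3 sp_mod sp_carrier sp_add sp_smult sp_zero

section \<open>Spaces of linear maps\<close>

lemma hom_simps: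
  "carrier (hom_space k V W) = Lin k V W"
  "zero (hom_space k V W) = (\<lambda>x \<in> carrier V. \<zero>\<^bsub>W\<^esub>)"
  "f \<oplus>\<^bsub>hom_space k V W\<^esub> g = (\<lambda>x \<in> carrier V. f x \<oplus>\<^bsub>W\<^esub> g x)"
  "c \<odot>\<^bsub>hom_space k V W\<^esub> f = (\<lambda>x \<in> carrier V. c \<odot>\<^bsub>W\<^esub> f x)"
  by (simp_all add: hom_space_def)

lemma hom_module [simp]:
  assumes "module k V" "module k W" shows "module k (hom_space k V W)"
proof -
  interpret V: module k V by fact
  interpret W: module k W by fact
  note L = Lin_iff[OF assms]
  note ex = extensionalityI[of _ "carrier V"]
  have c: "f x \<in> carrier W" if "f \<in> Lin k V W" "x \<in> carrier V" for f x
    using that by (auto simp: L lin_closed)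
  show ?thesis
  proof (rule moduleI)
    show "abelian_group (hom_space k V W)"
    proof (rule abelian_groupI)
      fix f assume f: "f \<in> carrier (hom_space k V W)"
      have "lin k V W (\<lambda>x. (\<ominus>\<^bsub>k\<^esub> \<one>\<^bsub>k\<^esub>) \<odot>\<^bsub>W\<^esub> f x)" using f by (simp add: hom_simps L)
      moreover have "(\<ominus>\<^bsub>k\<^esub> \<one>\<^bsub>k\<^esub>) \<odot>\<^bsub>W\<^esub> f x \<oplus>\<^bsub>W\<^esub> f x = \<zero>\<^bsub>W\<^esub>" if "x \<in> carrier V" for x
        using c[of f x] f that by (simp add: hom_simps W.smult_l_minus W.l_neg)
      ultimately show "\<exists>g \<in> carrier (hom_space k V W). g \<oplus>\<^bsub>hom_space k V W\<^esub> f = \<zero>\<^bsub>hom_space k V W\<^esub>"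
        by (intro bexI[of _ "\<lambda>x \<in> carrier V. (\<ominus>\<^bsub>k\<^esub> \<one>\<^bsub>k\<^esub>) \<odot>\<^bsub>W\<^esub> f x"])
          (auto simp: hom_simps L intro!: ex)
    qed (use assms in \<open>auto simp: hom_simps L lin_closed W.a_ac intro!: ex\<close>)
  qed (use assms in \<open>auto simp: V.is_cring hom_simps L lin_closed W.smult_l_distr W.smult_r_distr W.smult_assoc1 intro!: ex\<close>)
qed

lemma hom_lin_eval:
  assumes "module k V" "module k W" "x \<in> carrier V" shows "lin k (hom_space k V W) W (\<lambda>f. f x)"
  by (rule linI) (use assms in \<open>auto simp: hom_simps Lin_iff lin_closed\<close>)

lemma hom_eval_lin:
  "module k V \<Longrightarrow> module k W \<Longrightarrow> x \<in> carrier V \<Longrightarrow> lin k S (hom_space k V W) g \<Longrightarrow> lin k S W (\<lambda>s. g s x)"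
  by (rule lin_comp[OF hom_lin_eval])

text \<open>Currying. Bilinearity says nothing about values off the carrier, whereas the elements of
  \<open>hom_space\<close> are extensional, so that condition appears separately.\<close>

lemma lin_hom_iff:
  assumes "module k X" "module k V" "module k W"
  shows "lin k X (hom_space k V W) \<gamma> \<longleftrightarrow> bilin k X V W \<gamma> \<and> (\<forall>x \<in> carrier X. \<gamma> x \<in> extensional (carrier V))"
    (is "?l \<longleftrightarrow> ?r")
proof
  assume l: ?l
  have c: "\<gamma> x \<in> Lin k V W" if "x \<in> carrier X" for x
    using lin_closed[OF l that] by (simp add: hom_simps)
  have "lin k X W (\<lambda>x. \<gamma> x v)" if "v \<in> carrier V" for v
    by (rule hom_eval_lin) (use assms that l in auto)
  with c show ?r using assms by (simp add: Lin_iff)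
next
  assume r: ?r
  have e: "\<gamma> x \<in> extensional (carrier V)" if "x \<in> carrier X" for x using r that by simp
  have l: "lin k X W (\<lambda>x. \<gamma> x v)" if "v \<in> carrier V" for v using r that by (simp add: bilin_def)
  show ?l
  proof (rule linI)
    fix x assume x: "x \<in> carrier X"
    show "\<gamma> x \<in> carrier (hom_space k V W)"
      using r x assms by (simp add: hom_simps Lin_iff bilin_def)
    fix c assume c: "c \<in> carrier k"
    show "\<gamma> (c \<odot>\<^bsub>X\<^esub> x) = c \<odot>\<^bsub>hom_space k V W\<^esub> \<gamma> x"
      by (rule extensionalityI[of _ "carrier V"])
        (use c x assms in \<open>auto simp: hom_simps e lin_smult[OF l]\<close>)
  next
    fix x y assume x: "x \<in> carrier X" "y \<in> carrier X"
    show "\<gamma> (x \<oplus>\<^bsub>X\<^esub> y) = \<gamma> x \<oplus>\<^bsub>hom_space k V W\<^esub> \<gamma> y"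
      by (rule extensionalityI[of _ "carrier V"])
        (use x assms in \<open>auto simp: hom_simps e lin_add[OF l]\<close>)
  qed (use assms in simp_all)
qed

lemma Lin_hom_iff:
  assumes "module k X" "module k V" "module k W"
  shows "\<gamma> \<in> Lin k X (hom_space k V W) \<longleftrightarrow> bilin k X V W \<gamma> \<and> \<gamma> \<in> extensional (carrier X) \<and>
    (\<forall>x \<in> carrier X. \<gamma> x \<in> extensional (carrier V))"
  using assms by (auto simp: Lin_iff lin_hom_iff)

section \<open>Coalgebras and comodules\<close>

lemma tlift_tlift:
  "bilin k U V T \<beta> \<Longrightarrow> bilin k V' W' (tensor k U V) \<gamma> \<Longrightarrow> t \<in> carrier (tensor k V' W') \<Longrightarrow>
    tlift k U V T \<beta> (tlift k V' W' (tensor k U V) \<gamma> t) = tlift k V' W' T (\<lambda>v w. tlift k U V T \<beta> (\<gamma> v w)) t"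
  by (rule tlift_push[OF tlift_lin])

lemma coalgebra_module [simp]: "coalgebra k C \<Longrightarrow> module k C"
  by (simp add: coalgebra_def)

lemma coalgebra_cring: "coalgebra k C \<Longrightarrow> cring k"
  using coalgebra_module module.axioms(1) by blast

lemma comodule_module: "comodule k H X \<Longrightarrow> module k X"
  by (simp add: comodule_def)

lemma comult_lin: "coalgebra k C \<Longrightarrow> lin k C (tensor k C C) (comult C)"
  by (rule LinD(1)) (simp_all, simp only: coalgebra_def)

lemma counit_lin: "coalgebra k C \<Longrightarrow> lin k C (ground_space k) (counit C)"
  by (rule LinD(1)) (simp_all add: coalgebra_cring, simp only: coalgebra_def)

lemma coact_lin: "coalgebra k H \<Longrightarrow> comodule k H X \<Longrightarrow> lin k X (tensor k H X) (coact X)"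
  by (rule LinD(1)) (simp_all add: comodule_module, simp only: comodule_def)

lemma comult_closed [simp]: "coalgebra k C \<Longrightarrow> c \<in> carrier C \<Longrightarrow> comult C c \<in> carrier (tensor k C C)"
  by (rule lin_closed[OF comult_lin])

lemma counit_closed [simp]: "coalgebra k C \<Longrightarrow> c \<in> carrier C \<Longrightarrow> counit C c \<in> carrier k"
  using lin_closed[OF counit_lin] by fastforce

lemma coact_closed [simp]:
  "coalgebra k H \<Longrightarrow> comodule k H X \<Longrightarrow> x \<in> carrier X \<Longrightarrow> coact X x \<in> carrier (tensor k H X)"
  by (rule lin_closed[OF coact_lin])

lemma comult_lin_arg [simp]:
  "coalgebra k C \<Longrightarrow> lin k S C g \<Longrightarrow> lin k S (tensor k C C) (\<lambda>s. comult C (g s))"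
  by (rule lin_comp[OF comult_lin])

lemma counit_lin_arg [simp]:
  "coalgebra k C \<Longrightarrow> lin k S C g \<Longrightarrow> lin k S (ground_space k) (\<lambda>s. counit C (g s))"
  by (rule lin_comp[OF counit_lin])

lemma coact_lin_arg [simp]:
  "coalgebra k H \<Longrightarrow> comodule k H X \<Longrightarrow> lin k S X g \<Longrightarrow> lin k S (tensor k H X) (\<lambda>s. coact X (g s))"
  by (rule lin_comp[OF coact_lin])

text \<open>Together with its companion this writes the two sides of a coassociativity axiom as
  double \<open>tlift\<close> terms, the shape in which a further linear map can be pushed
  inside.\<close>

lemma tensor_coassoc_lhs:
  assumes [simp]: "module k V" "module k W" "module k X"
    "lin k V (tensor k W X) f" "t \<in> carrier (tensor k V V')" "module k V'"
  shows "tassoc k W X V' (tmap k V V' (tensor k W X) V' f (\<lambda>x. x) t) =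
    tlift k V V' (tensor k W (tensor k X V'))
      (\<lambda>v z. tlift k W X (tensor k W (tensor k X V')) (\<lambda>x y. tens k W (tensor k X V') x (tens k X V' y z)) (f v)) t"
  unfolding tassoc_eq
  by (subst tlift_tmap) (use lin_comp[OF assms(4)] lin_closed[OF assms(4)] in simp_all)

lemma tensor_coassoc_rhs:
  assumes [simp]: "module k V" "module k W" "module k X"
    "lin k V' (tensor k W X) f" "t \<in> carrier (tensor k V V')" "module k V'"
  shows "tmap k V V' V (tensor k W X) (\<lambda>x. x) f t =
    tlift k V V' (tensor k V (tensor k W X))
      (\<lambda>v z. tlift k W X (tensor k V (tensor k W X)) (\<lambda>x y. tens k V (tensor k W X) v (tens k W X x y)) (f z)) t"
proof -
  have "tens k V (tensor k W X) v (f z) =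
      tlift k W X (tensor k V (tensor k W X)) (\<lambda>x y. tens k V (tensor k W X) v (tens k W X x y)) (f z)"
    if "v \<in> carrier V" "z \<in> carrier V'" for v z
  proof -
    have fz: "f z \<in> carrier (tensor k W X)" by (rule lin_closed[OF assms(4) that(2)])
    have "lin k (tensor k W X) (tensor k V (tensor k W X)) (\<lambda>s. tens k V (tensor k W X) v s)" using that by simp
    from tlift_push[OF this tens_bilin fz] show ?thesis by (simp add: tlift_tens_id[OF _ _ fz])
  qed
  then show ?thesis unfolding tmap_def by simp
qed

text \<open>The axiom equates two elements of \<open>H \<otimes> (H \<otimes> X)\<close>. Applying
  to both the linear map induced by the trilinear \<open>\<tau>\<close> yields coassociativity under
  an arbitrary integrand, which is how it is used in Sweedler calculations.\<close>

lemma coact_coassoc: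
  assumes H: "coalgebra k H" and X: "comodule k H X" and x: "x \<in> carrier X" and U: "module k U"
    and 1: "\<And>a b. a \<in> carrier H \<Longrightarrow> b \<in> carrier H \<Longrightarrow> lin k X U (\<lambda>y. \<tau> a b y)"
    and 2: "\<And>a y. a \<in> carrier H \<Longrightarrow> y \<in> carrier X \<Longrightarrow> lin k H U (\<lambda>b. \<tau> a b y)"
    and 3: "\<And>b y. b \<in> carrier H \<Longrightarrow> y \<in> carrier X \<Longrightarrow> lin k H U (\<lambda>a. \<tau> a b y)"
  shows "tlift k H X U (\<lambda>h y. tlift k H H U (\<lambda>a b. \<tau> a b y) (comult H h)) (coact X x) =
    tlift k H X U (\<lambda>h y. tlift k H X U (\<lambda>b z. \<tau> h b z) (coact X y)) (coact X x)"
proof -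
  note [simp] = H X x U 1 2 3 comodule_module[OF X]
  let ?\<beta> = "\<lambda>a s. tlift k H X U (\<lambda>b y. \<tau> a b y) s"
  have "tlift k H (tensor k H X) U ?\<beta> (tassoc k H H X (tmap k H X (tensor k H H) X (comult H) (\<lambda>x. x) (coact X x))) =
     tlift k H (tensor k H X) U ?\<beta> (tmap k H X H (tensor k H X) (\<lambda>h. h) (coact X) (coact X x))"
    using X x by (simp add: comodule_def)
  then show ?thesis
    by (simp add: tensor_coassoc_lhs tensor_coassoc_rhs tlift_tlift)
qed

lemma coact_counit:
  assumes H: "coalgebra k H" and X: "comodule k H X" and x: "x \<in> carrier X" and f: "lin k X U f"
  shows "tlift k H X U (\<lambda>h y. counit H h \<odot>\<^bsub>U\<^esub> f y) (coact X x) = f x"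
proof -
  note [simp] = H X x comodule_module[OF X] lin_module(2)[OF f]
  have b: "bilin k H X X (\<lambda>h y. counit H h \<odot>\<^bsub>X\<^esub> y)" by simp
  have "f x = f (tlift k H X X (\<lambda>h y. counit H h \<odot>\<^bsub>X\<^esub> y) (coact X x))"
    using X x by (simp add: comodule_def)
  also have "\<dots> = tlift k H X U (\<lambda>h y. counit H h \<odot>\<^bsub>U\<^esub> f y) (coact X x)"
    by (subst tlift_push[OF f b]) (simp_all add: lin_smult[OF f])
  finally show ?thesis ..
qed

text \<open>About \<open>H\<close> it asks for a linear comultiplication but no coalgebra axiom. It
  can thus be applied to \<open>regular C\<close> on the way to proving that \<open>C\<close> is a
  coalgebra.\<close>

lemma comoduleI:
  assumes H [simp]: "module k H" and cH: "lin k H (tensor k H H) (comult H)" and X [simp]: "module k X"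
    and l: "lin k X (tensor k H X) (coact X)" "coact X \<in> extensional (carrier X)"
    and co: "\<And>x. x \<in> carrier X \<Longrightarrow>
      tlift k H X (tensor k H (tensor k H X)) (\<lambda>h y. tlift k H H (tensor k H (tensor k H X))
         (\<lambda>a b. tens k H (tensor k H X) a (tens k H X b y)) (comult H h)) (coact X x) =
      tlift k H X (tensor k H (tensor k H X)) (\<lambda>h y. tlift k H X (tensor k H (tensor k H X))
         (\<lambda>b z. tens k H (tensor k H X) h (tens k H X b z)) (coact X y)) (coact X x)"
    and cu: "\<And>x. x \<in> carrier X \<Longrightarrow> tlift k H X X (\<lambda>h y. counit H h \<odot>\<^bsub>X\<^esub> y) (coact X x) = x"
  shows "comodule k H X"
  unfolding comodule_def
  by (intro conjI ballI)
    (use l cu in \<open>simp_all add: Lin_iff tensor_coassoc_lhs tensor_coassoc_rhs cH lin_closed[OF l(1)] co\<close>)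

text \<open>The coalgebra as a comodule over itself. Facts on coalgebras are read off from those on
  comodules through it, with the counit treated separately.\<close>

definition regular :: "('k,'c) coalg \<Rightarrow> ('k,'c,'c) comod" where
  "regular C = module.extend (module.truncate C) (comod.fields (comult C))"

lemma coact_regular [simp]: "coact (regular C) = comult C"
  by (simp add: regular_def module.defs comod.defs)

lemma sp_regular: "sp (regular C) = sp C"
  by (simp add: regular_def module.defs comod.defs sp_def)

lemmas [simp] = sp_eqs[OF sp_regular]

lemma coalgebra_regular:
  assumes "coalgebra k C" shows "comodule k C (regular C)"
  using assms by (simp add: coalgebra_def comodule_def)

text \<open>Coassociativity and the left counit law are the comodule axioms of
  \<open>regular C\<close>; the right counit law and the linearity of the counit remain.\<close>

lemma coalgebraI:
  assumes "comodule k C (regular C)" "counit C \<in> Lin k C (ground_space k)"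
    and "\<And>c. c \<in> carrier C \<Longrightarrow> tlift k C C C (\<lambda>x y. counit C y \<odot>\<^bsub>C\<^esub> x) (comult C c) = c"
  shows "coalgebra k C"
  using assms by (simp add: coalgebra_def comodule_def)

lemma comult_coassoc:
  assumes C: "coalgebra k C" and x: "x \<in> carrier C" and U: "module k U"
    and 1: "\<And>a b. a \<in> carrier C \<Longrightarrow> b \<in> carrier C \<Longrightarrow> lin k C U (\<lambda>y. \<tau> a b y)"
    and 2: "\<And>a y. a \<in> carrier C \<Longrightarrow> y \<in> carrier C \<Longrightarrow> lin k C U (\<lambda>b. \<tau> a b y)"
    and 3: "\<And>b y. b \<in> carrier C \<Longrightarrow> y \<in> carrier C \<Longrightarrow> lin k C U (\<lambda>a. \<tau> a b y)"
  shows "tlift k C C U (\<lambda>h y. tlift k C C U (\<lambda>a b. \<tau> a b y) (comult C h)) (comult C x) =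
    tlift k C C U (\<lambda>h y. tlift k C C U (\<lambda>b z. \<tau> h b z) (comult C y)) (comult C x)"
  using coact_coassoc[OF C coalgebra_regular[OF C] _ U, of x \<tau>] x 1 2 3 by simp

lemma comult_counit_left:
  assumes C: "coalgebra k C" and x: "x \<in> carrier C" and f: "lin k C U f"
  shows "tlift k C C U (\<lambda>h y. counit C h \<odot>\<^bsub>U\<^esub> f y) (comult C x) = f x"
  using coact_counit[OF C coalgebra_regular[OF C], of x U f] x f by simp

lemma comult_counit_right:
  assumes C: "coalgebra k C" and x: "x \<in> carrier C" and f: "lin k C U f"
  shows "tlift k C C U (\<lambda>h y. counit C y \<odot>\<^bsub>U\<^esub> f h) (comult C x) = f x"
proof -
  note [simp] = C x lin_module(2)[OF f]
  have b: "bilin k C C C (\<lambda>h y. counit C y \<odot>\<^bsub>C\<^esub> h)" by simp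
  have "f x = f (tlift k C C C (\<lambda>h y. counit C y \<odot>\<^bsub>C\<^esub> h) (comult C x))"
    using C x by (simp add: coalgebra_def)
  also have "\<dots> = tlift k C C U (\<lambda>h y. counit C y \<odot>\<^bsub>U\<^esub> f h) (comult C x)"
    by (subst tlift_push[OF f b]) (simp_all add: lin_smult[OF f])
  finally show ?thesis ..
qed

lemma comodule_map_alongI:
  assumes "comodule k C X" "comodule k D Y" "lin k X Y \<phi>" "\<phi> \<in> extensional (carrier X)"
    "\<And>x. x \<in> carrier X \<Longrightarrow> coact Y (\<phi> x) = tlift k C X (tensor k D Y) (\<lambda>h y. tens k D Y (f h) (\<phi> y)) (coact X x)"
  shows "comodule_map_along k C D f X Y \<phi>"
  using assms comodule_module[OF assms(1)] comodule_module[OF assms(2)]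
  by (simp add: comodule_map_along_def Lin_iff tmap_def)

lemma comodule_map_along_lin:
  assumes "comodule_map_along k C D f X Y \<phi>" "comodule k C X" "comodule k D Y"
  shows "lin k X Y \<phi>" "\<phi> \<in> extensional (carrier X)"
  using assms comodule_module[OF assms(2)] comodule_module[OF assms(3)]
  by (simp_all add: comodule_map_along_def Lin_iff)

lemma comodule_map_along_coact:
  "comodule_map_along k C D f X Y \<phi> \<Longrightarrow> x \<in> carrier X \<Longrightarrow>
    coact Y (\<phi> x) = tlift k C X (tensor k D Y) (\<lambda>h y. tens k D Y (f h) (\<phi> y)) (coact X x)"
  by (simp add: comodule_map_along_def tmap_def)

text \<open>The Sweedler form of being a comodule map: a sum over the coaction of
  \<open>\<phi> x\<close> becomes a sum over the coaction of \<open>x\<close>.\<close>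

lemma tlift_coact_map:
  assumes "comodule_map_along k C D f X Y \<phi>" "coalgebra k C" "coalgebra k D" "comodule k C X" "comodule k D Y"
    "lin k C D f" "bilin k D Y U \<beta>" "x \<in> carrier X"
  shows "tlift k D Y U \<beta> (coact Y (\<phi> x)) = tlift k C X U (\<lambda>h y. \<beta> (f h) (\<phi> y)) (coact X x)"
proof -
  have "coact Y (\<phi> x) = tmap k C X D Y f \<phi> (coact X x)"
    using assms by (simp add: comodule_map_along_def)
  then show ?thesis
    using tlift_tmap[OF assms(6) comodule_map_along_lin(1)[OF assms(1,4,5)] assms(7)] assms by simp
qed

lemma coalg_map_lin:
  assumes "coalg_map k C D f" "coalgebra k C" "coalgebra k D"
  shows "lin k C D f" "f \<in> extensional (carrier C)"
  using assms by (simp_all add: coalg_map_def Lin_iff)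

lemma coalg_map_regular:
  "coalg_map k C D f \<longleftrightarrow> comodule_map_along k C D f (regular C) (regular D) f \<and>
    (\<forall>c \<in> carrier C. counit D (f c) = counit C c)"
  by (simp add: coalg_map_def comodule_map_along_def)

lemma coalg_map_counit: "coalg_map k C D f \<Longrightarrow> c \<in> carrier C \<Longrightarrow> counit D (f c) = counit C c"
  by (simp add: coalg_map_def)

lemma tlift_comult_map:
  assumes "coalg_map k C D f" "coalgebra k C" "coalgebra k D" "bilin k D D U \<beta>" "x \<in> carrier C"
  shows "tlift k D D U \<beta> (comult D (f x)) = tlift k C C U (\<lambda>h y. \<beta> (f h) (f y)) (comult C x)"
  using tlift_coact_map[OF _ assms(2,3) coalgebra_regular coalgebra_regular, of f f U \<beta> x] assms
    coalg_map_lin[OF assms(1-3)] by (simp add: coalg_map_regular)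

lemma comodule_map_along_comp:
  assumes f: "lin k C D f" and g: "lin k D E g"
    and \<phi>: "comodule_map_along k C D f X Y \<phi>" and \<psi>: "comodule_map_along k D E g Y Z \<psi>"
    and [simp]: "coalgebra k C" "coalgebra k D" "coalgebra k E" "comodule k C X" "comodule k D Y" "comodule k E Z"
  shows "comodule_map_along k C E (compose (carrier C) g f) X Z (compose (carrier X) \<psi> \<phi>)"
proof -
  note l\<phi> = comodule_map_along_lin(1)[OF \<phi>, simplified]
  note l\<psi> = comodule_map_along_lin(1)[OF \<psi>, simplified]
  note [simp] = lin_comp[OF f] lin_comp[OF g] lin_comp[OF l\<phi>] lin_comp[OF l\<psi>] lin_closed[OF f] lin_closed[OF g]
    lin_closed[OF l\<phi>] lin_closed[OF l\<psi>] lin_module(1)[OF l\<phi>] lin_module[OF l\<psi>]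
  show ?thesis
    by (rule comodule_map_alongI)
      (simp_all add: compose_def comodule_map_along_coact[OF \<psi>] tlift_coact_map[OF \<phi>] f)
qed

lemma coalg_map_comp:
  assumes "coalg_map k C D f" "coalg_map k D E g" "coalgebra k C" "coalgebra k D" "coalgebra k E"
  shows "coalg_map k C E (compose (carrier C) g f)"
proof -
  note [simp] = assms coalg_map_lin[OF assms(1,3,4)] coalg_map_lin[OF assms(2,4,5)] coalgebra_regular
  have "comodule_map_along k C E (compose (carrier C) g f) (regular C) (regular E) (compose (carrier (regular C)) g f)"
    by (rule comodule_map_along_comp[where D = D and Y = "regular D"]) (use assms in \<open>simp_all add: coalg_map_regular\<close>)
  then show ?thesis
    using assms lin_closed[OF coalg_map_lin(1)[OF assms(1,3,4)]]
    by (simp add: coalg_map_regular compose_eq)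
qed

lemma comodule_map_along_id:
  assumes "coalgebra k C" "comodule k C X"
  shows "comodule_map_along k C C (\<lambda>c \<in> carrier C. c) X X (\<lambda>x \<in> carrier X. x)"
  by (rule comodule_map_alongI)
    (use assms comodule_module[OF assms(2)] in \<open>simp_all add: tlift_tens_id\<close>)

lemma coalg_map_id: "coalgebra k C \<Longrightarrow> coalg_map k C C (\<lambda>c \<in> carrier C. c)"
  using comodule_map_along_id[OF _ coalgebra_regular] by (simp add: coalg_map_regular)

subsection \<open>Transport along coalgebra maps and linear isomorphisms\<close>

definition transport_space :: "('k,'v,'p) module_scheme \<Rightarrow> ('v \<Rightarrow> 'w) \<Rightarrow> ('k,'w) module" where
  "transport_space V j = (let i = the_inv_into (carrier V) j in
     \<lparr>carrier = j ` carrier V, mult = undefined, one = undefined, zero = j (zero V),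
       add = (\<lambda>x y. j (add V (i x) (i y))), smult = (\<lambda>c x. j (smult V c (i x)))\<rparr>)"

lemma transport_space:
  assumes V: "module k V" and j: "inj_on j (carrier V)"
  shows "module k (transport_space V j)" "lin k V (transport_space V j) j"
    "lin k (transport_space V j) V (the_inv_into (carrier V) j)"
    "carrier (transport_space V j) = j ` carrier V"
proof -
  interpret V: module k V by fact
  define i where "i = the_inv_into (carrier V) j"
  have i [simp]: "i (j x) = x" if "x \<in> carrier V" for x
    using the_inv_into_f_f[OF j that] by (simp add: i_def)
  let ?W = "transport_space V j"
  have W: "carrier ?W = j ` carrier V" "zero ?W = j (zero V)" "add ?W = (\<lambda>x y. j (add V (i x) (i y)))"
    "smult ?W = (\<lambda>c x. j (smult V c (i x)))"
    by (simp_all add: transport_space_def Let_def i_def)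
  show c: "carrier ?W = j ` carrier V" by (rule W)
  show m: "module k ?W"
  proof (rule moduleI)
    show "abelian_group ?W"
    proof (rule abelian_groupI)
      fix x assume "x \<in> carrier ?W"
      then show "\<exists>y \<in> carrier ?W. y \<oplus>\<^bsub>?W\<^esub> x = \<zero>\<^bsub>?W\<^esub>"
        by (auto simp: W V.l_neg intro!: bexI[of _ "\<ominus>\<^bsub>V\<^esub> y" for y])
    qed (auto simp: W V.a_ac)
  qed (auto simp: W V.is_cring V.smult_l_distr V.smult_r_distr V.smult_assoc1)
  show "lin k V ?W j" by (rule linI[OF V m]) (auto simp: W)
  show "lin k ?W V (the_inv_into (carrier V) j)"
    unfolding i_def[symmetric] by (rule linI[OF m V]) (auto simp: W)
qed

text \<open>For \<open>j = id\<close> this is the \<open>D\<close>-comodule obtained from a \<open>C\<close>-comodule along \<open>f : C \<rightarrow> D\<close>; for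
  \<open>f = id\<close> it is transport of structure along the bijection \<open>j\<close>.\<close>

definition push_comod ::
    "('k,'r) ring_scheme \<Rightarrow> ('k,'c) coalg \<Rightarrow> ('k,'d) coalg \<Rightarrow> ('c \<Rightarrow> 'd) \<Rightarrow> ('k,'c,'x) comod \<Rightarrow>
      ('x \<Rightarrow> 'y) \<Rightarrow> ('k,'d,'y) comod" where
  "push_comod k C D f X j = module.extend (transport_space X j) (comod.fields
     (\<lambda>y \<in> j ` carrier X. tmap k C X D (transport_space X j) f j (coact X (the_inv_into (carrier X) j y))))"

text \<open>The last conclusion is the computation rule: it turns every Sweedler sum over the new
  comodule into one over \<open>X\<close>, so the definition need not be unfolded again.\<close>

lemma push_comod:
  assumes f: "coalg_map k C D f" and C [simp]: "coalgebra k C" and D [simp]: "coalgebra k D"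
    and X [simp]: "comodule k C X" and j: "inj_on j (carrier X)"
  defines "Y \<equiv> push_comod k C D f X j" and "i \<equiv> the_inv_into (carrier X) j"
  shows "comodule k D Y"
    and "comodule_map_along k C D f X Y (\<lambda>x \<in> carrier X. j x)"
    and "lin k Y X i" and "carrier Y = j ` carrier X"
    and "\<And>x. x \<in> carrier X \<Longrightarrow> i (j x) = x"
    and "\<And>y (U :: ('k,'e,'s) module_scheme) \<beta>. y \<in> carrier Y \<Longrightarrow> bilin k D Y U \<beta> \<Longrightarrow>
      tlift k D Y U \<beta> (coact Y y) = tlift k C X U (\<lambda>h z. \<beta> (f h) (j z)) (coact X (i y))"
proof -
  note Xm = comodule_module[OF X]
  note lf = coalg_map_lin(1)[OF f C D]
  show i [simp]: "i (j x) = x" if "x \<in> carrier X" for x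
    using the_inv_into_f_f[OF j that] by (simp add: i_def)
  define Y0 where "Y0 = transport_space X j"
  note Y0 = transport_space[OF Xm j, folded Y0_def i_def]
  have Y: "Y = module.extend Y0 (comod.fields (\<lambda>y \<in> carrier Y0. tmap k C X D Y0 f j (coact X (i y))))"
    unfolding Y_def push_comod_def Y0(4) Y0_def[symmetric] i_def[symmetric] by (rule refl)
  have "sp Y = sp Y0" by (simp add: Y module.defs sp_def)
  note [simp] = sp_eqs[OF this]
  note lj = Y0(2) and li = Y0(3)
  show "carrier Y = j ` carrier X" by (simp add: Y0)
  show "lin k Y X i" using li by simp
  note [simp] = lin_comp[OF lj] lin_comp[OF li] lin_comp[OF lf] lin_closed[OF lj] lin_closed[OF li] lin_closed[OF lf]
    Xm Y0(1) lf lj li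
  have co: "coact Y y = tmap k C X D Y0 f j (coact X (i y))" if "y \<in> carrier Y0" for y
    using that by (simp add: Y module.defs comod.defs)
  have ext: "coact Y \<in> extensional (carrier Y)"
    by (simp add: Y module.defs comod.defs)
  have l: "lin k Y0 (tensor k D Y0) (coact Y)"
    by (subst lin_cong[OF co]) simp_all
  have T: "tlift k D Y0 U \<beta> (coact Y y) = tlift k C X U (\<lambda>h z. \<beta> (f h) (j z)) (coact X (i y))"
    if "y \<in> carrier Y0" "bilin k D Y0 U \<beta>" for U :: "('k,'t,'ts) module_scheme" and \<beta> y
    using that by (simp add: co tlift_tmap)
  then show "\<And>y (U :: ('k,'e,'s) module_scheme) \<beta>. y \<in> carrier Y \<Longrightarrow> bilin k D Y U \<beta> \<Longrightarrow>
      tlift k D Y U \<beta> (coact Y y) = tlift k C X U (\<lambda>h z. \<beta> (f h) (j z)) (coact X (i y))" by simp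
  have iY: "\<exists>x \<in> carrier X. y = j x" if "y \<in> carrier Y0" for y using that by (auto simp: Y0)
  show "comodule k D Y"
  proof (rule comoduleI)
    fix y assume "y \<in> carrier Y"
    then have y: "y \<in> carrier Y0" by simp
    then have iy: "i y \<in> carrier X" by simp
    \<comment> \<open>With all sums moved to \<open>X\<close> and \<open>C\<close>, this is
      coassociativity of \<open>X\<close> under the integrand
      \<open>f a \<otimes> (f b \<otimes> j z)\<close>.\<close>
    show "tlift k D Y (tensor k D (tensor k D Y)) (\<lambda>h y. tlift k D D (tensor k D (tensor k D Y))
         (\<lambda>a b. tens k D (tensor k D Y) a (tens k D Y b y)) (comult D h)) (coact Y y) =
      tlift k D Y (tensor k D (tensor k D Y)) (\<lambda>h y. tlift k D Y (tensor k D (tensor k D Y))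
         (\<lambda>b z. tens k D (tensor k D Y) h (tens k D Y b z)) (coact Y y)) (coact Y y)"
      using y l lin_comp[OF l] lin_closed[OF l]
        coact_coassoc[OF C X iy, of "tensor k D (tensor k D Y0)" "\<lambda>a b z. tens k D (tensor k D Y0) (f a) (tens k D Y0 (f b) (j z))"]
      by (simp add: T tlift_comult_map[OF f])
    show "tlift k D Y Y (\<lambda>h y. counit D h \<odot>\<^bsub>Y\<^esub> y) (coact Y y) = y"
      using y iY[OF y] by (auto simp: T coalg_map_counit[OF f] coact_counit)
  qed (use l ext in simp_all)
  then show "comodule_map_along k C D f X Y (\<lambda>x \<in> carrier X. j x)"
    by (intro comodule_map_alongI) (simp_all add: co tmap_def)
qed

definition transport_coalg ::
    "('k,'r) ring_scheme \<Rightarrow> ('k,'c) coalg \<Rightarrow> ('c \<Rightarrow> 'd) \<Rightarrow> ('k,'d) coalg" where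
  "transport_coalg k C j = module.extend (transport_space C j) (coalg.fields
     (\<lambda>y \<in> j ` carrier C. tmap k C C (transport_space C j) (transport_space C j) j j (comult C (the_inv_into (carrier C) j y)))
     (\<lambda>y \<in> j ` carrier C. counit C (the_inv_into (carrier C) j y)))"

text \<open>Here both tensor factors of the structure map move along \<open>j\<close>, in contrast
  to \<open>push_comod\<close>. The two coalgebra maps are mutually inverse on the carriers, so
  measurings can be carried over and back.\<close>

lemma transport_coalg:
  fixes C :: "('k,'c) coalg"
  assumes C [simp]: "coalgebra k C" and j: "inj_on j (carrier C)"
  defines "D \<equiv> transport_coalg k C j" and "i \<equiv> the_inv_into (carrier C) j"
  shows "coalgebra k D" "coalg_map k C D (\<lambda>x \<in> carrier C. j x)" "coalg_map k D C (\<lambda>y \<in> carrier D. i y)"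
    "carrier D = j ` carrier C" "\<And>x. x \<in> carrier C \<Longrightarrow> i (j x) = x"
proof -
  show i [simp]: "i (j x) = x" if "x \<in> carrier C" for x
    using the_inv_into_f_f[OF j that] by (simp add: i_def)
  define Y0 where "Y0 = transport_space C j"
  note Y0 = transport_space[OF coalgebra_module[OF C] j, folded Y0_def i_def]
  have D: "D = module.extend Y0 (coalg.fields (\<lambda>y \<in> carrier Y0. tmap k C C Y0 Y0 j j (comult C (i y)))
      (\<lambda>y \<in> carrier Y0. counit C (i y)))"
    unfolding D_def transport_coalg_def Y0(4) Y0_def[symmetric] i_def[symmetric] by (rule refl)
  have "sp D = sp Y0" by (simp add: D module.defs sp_def)
  note [simp] = sp_eqs[OF this]
  note lj = Y0(2) and li = Y0(3)
  show "carrier D = j ` carrier C" by (simp add: Y0)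
  note [simp] = lin_comp[OF lj] lin_comp[OF li] lin_closed[OF lj] lin_closed[OF li] Y0(1) lj li
  have co: "comult D y = tmap k C C Y0 Y0 j j (comult C (i y))" if "y \<in> carrier Y0" for y
    using that by (simp add: D module.defs coalg.defs)
  have cu [simp]: "counit D y = counit C (i y)" if "y \<in> carrier Y0" for y
    using that by (simp add: D module.defs coalg.defs)
  have ext: "comult D \<in> extensional (carrier Y0)" "counit D \<in> extensional (carrier Y0)"
    by (simp_all add: D module.defs coalg.defs)
  have l: "lin k Y0 (tensor k Y0 Y0) (comult D)"
    by (subst lin_cong[OF co]) simp_all
  have lc: "lin k Y0 (ground_space k) (counit D)"
    by (subst lin_cong[OF cu]) simp_all
  have T: "tlift k Y0 Y0 U \<beta> (comult D y) = tlift k C C U (\<lambda>h z. \<beta> (j h) (j z)) (comult C (i y))"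
    if "y \<in> carrier Y0" "bilin k Y0 Y0 U \<beta>" for U :: "('k,'t,'ts) module_scheme" and \<beta> y
    using that by (simp add: co tlift_tmap)
  have iY: "\<exists>x \<in> carrier C. y = j x" if "y \<in> carrier Y0" for y using that by (auto simp: Y0)
  note [simp] = lin_comp[OF l] lin_closed[OF l] lin_comp[OF lc] lin_closed[OF lc, simplified] l lc
  have "comodule k D (regular D)"
  proof (rule comoduleI)
    fix y assume "y \<in> carrier (regular D)"
    then have y: "y \<in> carrier Y0" by simp
    then have iy: "i y \<in> carrier C" by simp
    show "tlift k D (regular D) (tensor k D (tensor k D (regular D))) (\<lambda>h y. tlift k D D (tensor k D (tensor k D (regular D)))
         (\<lambda>a b. tens k D (tensor k D (regular D)) a (tens k D (regular D) b y)) (comult D h)) (coact (regular D) y) =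
      tlift k D (regular D) (tensor k D (tensor k D (regular D))) (\<lambda>h y. tlift k D (regular D) (tensor k D (tensor k D (regular D)))
         (\<lambda>b z. tens k D (tensor k D (regular D)) h (tens k D (regular D) b z)) (coact (regular D) y)) (coact (regular D) y)"
      using y comult_coassoc[OF C iy, of "tensor k Y0 (tensor k Y0 Y0)" "\<lambda>a b z. tens k Y0 (tensor k Y0 Y0) (j a) (tens k Y0 Y0 (j b) (j z))"]
      by (simp add: T)
    show "tlift k D (regular D) (regular D) (\<lambda>h y. counit D h \<odot>\<^bsub>regular D\<^esub> y) (coact (regular D) y) = y"
      using y iY[OF y] by (auto simp: T comult_counit_left)
  qed (use ext in simp_all)
  moreover have "cring k" using coalgebra_cring[OF C] .
  moreover have "tlift k Y0 Y0 Y0 (\<lambda>x y. counit D y \<odot>\<^bsub>Y0\<^esub> x) (comult D y) = y" if "y \<in> carrier Y0" for y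
    using that iY[OF that] by (auto simp: T comult_counit_right)
  ultimately show D': "coalgebra k D"
    using ext by (intro coalgebraI) (simp_all add: Lin_iff)
  show "coalg_map k C D (\<lambda>x \<in> carrier C. j x)"
    using D' unfolding coalg_map_def by (simp add: Lin_iff co)
  show "coalg_map k D C (\<lambda>y \<in> carrier D. i y)"
    using D' unfolding coalg_map_def
    by (simp add: Lin_iff co tmap_comp tmap_id)
qed

section \<open>The monoidal structure\<close>

lemma lin_ground_mult [simp]:
  assumes "lin k S (ground_space k) f" "c \<in> carrier k"
  shows "lin k S (ground_space k) (\<lambda>s. f s \<otimes>\<^bsub>k\<^esub> c)" "lin k S (ground_space k) (\<lambda>s. c \<otimes>\<^bsub>k\<^esub> f s)"
  using lin_scalar[OF assms(1) lin_module(2)[OF assms(1)], of c] lin_fun_smult[OF assms(2,1)] assms(2) by simp_all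

lemma texchange_tens:
  assumes [simp]: "module k U" "module k V" "module k U'" "module k V'"
    and "s \<in> carrier (tensor k U V)" "s' \<in> carrier (tensor k U' V')"
  shows "texchange k U V U' V' (tens k (tensor k U V) (tensor k U' V') s s') =
    (let T = tensor k (tensor k U U') (tensor k V V') in
      tlift k U V T (\<lambda>u v. tlift k U' V' T
        (\<lambda>u' v'. tens k (tensor k U U') (tensor k V V') (tens k U U' u u') (tens k V V' v v')) s') s)"
  using assms(5,6) by (simp add: texchange_def Let_def)

lemma texchange_lin:
  assumes [simp]: "module k U" "module k V" "module k U'" "module k V'"
  shows "lin k (tensor k (tensor k U V) (tensor k U' V')) (tensor k (tensor k U U') (tensor k V V')) (texchange k U V U' V')"
  unfolding texchange_def Let_def by (rule tlift_lin) simp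

lemma sp_tensor_coalg: "sp (tensor_coalg k C D) = sp (tensor k C D)"
  by (simp add: tensor_coalg_def module.defs coalg.defs sp_def)

lemma sp_tensor_comod: "sp (tensor_comod k C D X Y) = sp (tensor k X Y)"
  by (simp add: tensor_comod_def module.defs comod.defs sp_def)

lemmas [simp] = sp_eqs[OF sp_tensor_coalg] sp_eqs[OF sp_tensor_comod]

text \<open>An equality of records, not merely an isomorphism, because both tensor products are
  defined by the same formula. It transfers results from tensor products of comodules to those of
  coalgebras.\<close>

lemma tensor_comod_regular:
  "tensor_comod k C D (regular C) (regular D) = regular (tensor_coalg k C D)"
  by (simp add: tensor_comod_def regular_def[of "tensor_coalg k C D"] texchange_def)
    (simp add: tensor_coalg_def module.defs coalg.defs texchange_def)

context
  fixes k :: "('k,'r) ring_scheme" and C :: "('k,'c) coalg" and D :: "('k,'d) coalg"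
    and X :: "('k,'c,'x) comod" and Y :: "('k,'d,'y) comod"
  assumes C [simp]: "coalgebra k C" and D [simp]: "coalgebra k D"
    and X [simp]: "comodule k C X" and Y [simp]: "comodule k D Y"
begin

private lemma m [simp]: "module k X" "module k Y"
  using X Y comodule_module by blast+

lemma coact_tensor:
  assumes "x \<in> carrier X" "y \<in> carrier Y"
  shows "coact (tensor_comod k C D X Y) (tens k X Y x y) =
    tlift k C X (tensor k (tensor k C D) (tensor k X Y))
      (\<lambda>u v. tlift k D Y (tensor k (tensor k C D) (tensor k X Y))
        (\<lambda>u' v'. tens k (tensor k C D) (tensor k X Y) (tens k C D u u') (tens k X Y v v')) (coact Y y)) (coact X x)"
  using assms
  by (simp add: tensor_comod_def module.defs comod.defs compose_eq texchange_tens Let_def coact_lin)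

lemma coact_tensor_lin:
  "lin k (tensor k X Y) (tensor k (tensor k C D) (tensor k X Y)) (coact (tensor_comod k C D X Y))"
  by (simp add: tensor_comod_def module.defs comod.defs compose_def lin_comp[OF texchange_lin] coact_lin)

lemma coact_tensor_ext: "coact (tensor_comod k C D X Y) \<in> extensional (carrier (tensor k X Y))"
  by (simp add: tensor_comod_def module.defs comod.defs compose_def)

text \<open>The Sweedler formula \<open>\<Sum> (x1 \<otimes> y1) \<otimes> (x0 \<otimes> y0)\<close>
  for the coaction on a pure tensor, inside an arbitrary bilinear integrand.\<close>

lemma tlift_coact_tensor:
  assumes "bilin k (tensor k C D) (tensor k X Y) U \<beta>" "x \<in> carrier X" "y \<in> carrier Y"
  shows "tlift k (tensor k C D) (tensor k X Y) U \<beta> (coact (tensor_comod k C D X Y) (tens k X Y x y)) =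
    tlift k C X U (\<lambda>u v. tlift k D Y U (\<lambda>u' v'. \<beta> (tens k C D u u') (tens k X Y v v')) (coact Y y)) (coact X x)"
proof -
  note [simp] = bilin_lin[OF assms(1)] bilin_module(3)[OF assms(1)]
  show ?thesis using assms by (simp add: coact_tensor tlift_tlift)
qed

end

lemma sp_ground_coalg: "sp (ground_coalg k) = sp (ground_space k)"
  by (simp add: ground_coalg_def module.defs coalg.defs sp_def)

lemma sp_ground_comod: "sp (ground_comod k) = sp (ground_space k)"
  by (simp add: ground_comod_def module.defs comod.defs sp_def)

lemmas [simp] = sp_eqs[OF sp_ground_coalg] sp_eqs[OF sp_ground_comod]

lemma tlift_comult_tensor:
  assumes "coalgebra k C" "coalgebra k D" "bilin k (tensor k C D) (tensor k C D) U \<beta>" "x \<in> carrier C" "y \<in> carrier D"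
  shows "tlift k (tensor k C D) (tensor k C D) U \<beta> (comult (tensor_coalg k C D) (tens k C D x y)) =
    tlift k C C U (\<lambda>u v. tlift k D D U (\<lambda>u' v'. \<beta> (tens k C D u u') (tens k C D v v')) (comult D y)) (comult C x)"
  using tlift_coact_tensor[OF assms(1,2) coalgebra_regular coalgebra_regular, of U \<beta> x y] assms
  by (simp add: tensor_comod_regular)

lemma comult_tensor_lin:
  assumes "coalgebra k C" "coalgebra k D"
  shows "lin k (tensor k C D) (tensor k (tensor k C D) (tensor k C D)) (comult (tensor_coalg k C D))"
  using coact_tensor_lin[OF assms coalgebra_regular coalgebra_regular] assms
  by (simp add: tensor_comod_regular)

lemma counit_tensor [simp]:
  assumes "coalgebra k C" "coalgebra k D" "c \<in> carrier C" "d \<in> carrier D"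
  shows "counit (tensor_coalg k C D) (tens k C D c d) = counit C c \<otimes>\<^bsub>k\<^esub> counit D d"
  using assms coalgebra_cring[OF assms(1)]
  by (simp add: tensor_coalg_def module.defs coalg.defs)

lemma counit_tensor_Lin:
  assumes "coalgebra k C" "coalgebra k D"
  shows "counit (tensor_coalg k C D) \<in> Lin k (tensor k C D) (ground_space k)"
proof -
  have "counit (tensor_coalg k C D) = tlift k C D (ground_space k) (\<lambda>c d. counit C c \<otimes>\<^bsub>k\<^esub> counit D d)"
    by (simp add: tensor_coalg_def module.defs coalg.defs)
  then show ?thesis using assms coalgebra_cring[OF assms(1)] by (simp add: tlift_Lin(1))
qed

lemma comult_tensor_lin_arg:
  assumes "coalgebra k C" "coalgebra k D" "lin k S (tensor k C D) g"
  shows "lin k S (tensor k (tensor k C D) (tensor k C D)) (\<lambda>s. comult (tensor_coalg k C D) (g s))"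
  by (rule lin_comp[OF comult_tensor_lin]) fact+

text \<open>The axioms are given in expanded form so that they can be read twice: for
  \<open>tensor_comod\<close>, and through \<open>regular\<close> for
  \<open>tensor_coalg\<close>.\<close>

lemma tensor_comodule_axioms:
  fixes C :: "('k,'c) coalg" and D :: "('k,'d) coalg" and X :: "('k,'c,'x) comod" and Y :: "('k,'d,'y) comod"
  assumes C [simp]: "coalgebra k C" and D [simp]: "coalgebra k D"
    and X [simp]: "comodule k C X" and Y [simp]: "comodule k D Y"
  shows "module k (tensor_comod k C D X Y) \<and>
     coact (tensor_comod k C D X Y) \<in> Lin k (tensor_comod k C D X Y) (tensor k (tensor_coalg k C D) (tensor_comod k C D X Y)) \<and>
     (\<forall>t \<in> carrier (tensor k X Y). 
        tlift k (tensor k C D) (tensor k X Y) (tensor k (tensor k C D) (tensor k (tensor k C D) (tensor k X Y)))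
          (\<lambda>h y. tlift k (tensor k C D) (tensor k C D) (tensor k (tensor k C D) (tensor k (tensor k C D) (tensor k X Y)))
            (\<lambda>a b. tens k (tensor k C D) (tensor k (tensor k C D) (tensor k X Y)) a (tens k (tensor k C D) (tensor k X Y) b y))
              (comult (tensor_coalg k C D) h)) (coact (tensor_comod k C D X Y) t) =
        tlift k (tensor k C D) (tensor k X Y) (tensor k (tensor k C D) (tensor k (tensor k C D) (tensor k X Y)))
          (\<lambda>h y. tlift k (tensor k C D) (tensor k X Y) (tensor k (tensor k C D) (tensor k (tensor k C D) (tensor k X Y)))
            (\<lambda>b z. tens k (tensor k C D) (tensor k (tensor k C D) (tensor k X Y)) h (tens k (tensor k C D) (tensor k X Y) b z))
              (coact (tensor_comod k C D X Y) y)) (coact (tensor_comod k C D X Y) t)) \<and>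
     (\<forall>t \<in> carrier (tensor k X Y). 
        tlift k (tensor k C D) (tensor k X Y) (tensor k X Y) (\<lambda>h y. counit (tensor_coalg k C D) h \<odot>\<^bsub>tensor k X Y\<^esub> y)
          (coact (tensor_comod k C D X Y) t) = t)"
proof -
  interpret K: cring k by (rule coalgebra_cring[OF C])
  note [simp] = comult_tensor_lin_arg lin_closed[OF comult_tensor_lin[OF C D]]
  let ?CD = "tensor k C D"
  have E: "lin k ?CD (ground_space k) (counit (tensor_coalg k C D))"
    using counit_tensor_Lin[OF C D] by (simp add: Lin_iff K.is_cring)
  note [simp] = lin_comp[OF E] lin_closed[OF E, simplified]
  note [simp] = comodule_module[OF X] comodule_module[OF Y]
  note L = coact_tensor_lin[OF C D X Y]
  note [simp] = lin_comp[OF L] lin_closed[OF L] 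
  note [simp] = tlift_coact_tensor tlift_comult_tensor
  let ?XY = "tensor k X Y" and ?T = "tensor k ?CD (tensor k ?CD (tensor k X Y))"
  let ?\<tau> = "\<lambda>a b a' b' v w. tens k ?CD (tensor k ?CD ?XY) (tens k C D a b) (tens k ?CD ?XY (tens k C D a' b') (tens k X Y v w))"
  \<comment> \<open>Coassociativity of a factor applies when the two sums belonging to that factor
    are adjacent. The sums are interchanged to bring them together, and interchanged back
    afterwards.\<close>
  have co: "tlift k C X ?T (\<lambda>u v. tlift k D Y ?T (\<lambda>u' w. tlift k C C ?T (\<lambda>a a'. tlift k D D ?T
        (\<lambda>b b'. ?\<tau> a b a' b' v w) (comult D u')) (comult C u)) (coact Y y)) (coact X x) =
      tlift k C X ?T (\<lambda>u v. tlift k D Y ?T (\<lambda>u' w. tlift k C X ?T (\<lambda>a' z. tlift k D Y ?T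
        (\<lambda>b' z'. ?\<tau> u u' a' b' z z') (coact Y w)) (coact X v)) (coact Y y)) (coact X x)"
    if [simp]: "x \<in> carrier X" "y \<in> carrier Y" for x y
  proof -
    have "tlift k C X ?T (\<lambda>u v. tlift k D Y ?T (\<lambda>u' w. tlift k C C ?T (\<lambda>a a'. tlift k D D ?T
        (\<lambda>b b'. ?\<tau> a b a' b' v w) (comult D u')) (comult C u)) (coact Y y)) (coact X x) =
      tlift k C X ?T (\<lambda>u v. tlift k C C ?T (\<lambda>a a'. tlift k D Y ?T (\<lambda>u' w. tlift k D D ?T
        (\<lambda>b b'. ?\<tau> a b a' b' v w) (comult D u')) (coact Y y)) (comult C u)) (coact X x)"
      by (rule fun_cong[OF tlift_cong], simp_all, rule tlift_swap) simp_all
    also have "\<dots> = tlift k C X ?T (\<lambda>u v. tlift k C X ?T (\<lambda>a' z. tlift k D Y ?T (\<lambda>u' w. tlift k D Y ?T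
        (\<lambda>b' z'. ?\<tau> u u' a' b' z z') (coact Y w)) (coact Y y)) (coact X v)) (coact X x)"
      by (simp add: coact_coassoc)
    also have "\<dots> = tlift k C X ?T (\<lambda>u v. tlift k D Y ?T (\<lambda>u' w. tlift k C X ?T (\<lambda>a' z. tlift k D Y ?T
        (\<lambda>b' z'. ?\<tau> u u' a' b' z z') (coact Y w)) (coact X v)) (coact Y y)) (coact X x)"
      by (rule fun_cong[OF tlift_cong], simp_all, rule tlift_swap) simp_all
    finally show ?thesis .
  qed
  have cu: "tlift k C X ?XY (\<lambda>u v. tlift k D Y ?XY (\<lambda>u' v'. (counit C u \<otimes>\<^bsub>k\<^esub> counit D u') \<odot>\<^bsub>?XY\<^esub> tens k X Y v v') (coact Y y)) (coact X x) =
      tens k X Y x y" if [simp]: "x \<in> carrier X" "y \<in> carrier Y" for x y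
  proof -
    \<comment> \<open>Splitting the product of scalars with the second one outside makes the inner
      sum an instance of the counit law of \<open>Y\<close>, after which that of \<open>X\<close>
      finishes.\<close>
    have eq: "(c \<otimes>\<^bsub>k\<^esub> d) \<odot>\<^bsub>?XY\<^esub> t = d \<odot>\<^bsub>?XY\<^esub> (c \<odot>\<^bsub>?XY\<^esub> t)"
      if "c \<in> carrier k" "d \<in> carrier k" "t \<in> carrier ?XY" for c d t
      using that K.m_comm[of c d] module.smult_assoc1[of k ?XY d c t] by simp
    show ?thesis
      by (simp add: eq coact_counit[OF D Y, where f = "\<lambda>v'. c \<odot>\<^bsub>?XY\<^esub> tens k X Y v v'" for c v]
          coact_counit[OF C X, where f = "\<lambda>v. tens k X Y v y"])
  qed
  show ?thesis
  proof (intro conjI ballI)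
    fix t assume t: "t \<in> carrier ?XY"
    show "tlift k ?CD ?XY ?T
        (\<lambda>h y. tlift k ?CD ?CD ?T (\<lambda>a b. tens k ?CD (tensor k ?CD ?XY) a (tens k ?CD ?XY b y))
            (comult (tensor_coalg k C D) h)) (coact (tensor_comod k C D X Y) t) =
      tlift k ?CD ?XY ?T
        (\<lambda>h y. tlift k ?CD ?XY ?T (\<lambda>b z. tens k ?CD (tensor k ?CD ?XY) h (tens k ?CD ?XY b z))
            (coact (tensor_comod k C D X Y) y)) (coact (tensor_comod k C D X Y) t)"
      by (rule tensor_lin_eq[OF _ _ _ _ _ t, where U = ?T]) (simp_all add: co)
    show "tlift k ?CD ?XY ?XY (\<lambda>h y. counit (tensor_coalg k C D) h \<odot>\<^bsub>?XY\<^esub> y)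
        (coact (tensor_comod k C D X Y) t) = t"
      by (rule tensor_lin_eq[OF _ _ _ _ _ t, where U = ?XY]) (simp_all add: cu)
  qed (simp_all add: Lin_iff L coact_tensor_ext)
qed

lemma coalgebra_tensor [simp]:
  assumes C [simp]: "coalgebra k C" and D [simp]: "coalgebra k D"
  shows "coalgebra k (tensor_coalg k C D)"
proof -
  interpret K: cring k by (rule coalgebra_cring[OF C])
  let ?CD = "tensor k C D"
  have E: "lin k ?CD (ground_space k) (counit (tensor_coalg k C D))"
    using counit_tensor_Lin[OF C D] by (simp add: Lin_iff K.is_cring)
  note [simp] = comult_tensor_lin_arg lin_closed[OF comult_tensor_lin[OF C D]] lin_comp[OF E] lin_closed[OF E, simplified]
  show ?thesis
  proof (rule coalgebraI)
    have "comodule k C (regular C)" "comodule k D (regular D)" by (simp_all add: coalgebra_regular)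
    note * = tensor_comodule_axioms[OF C D this, unfolded tensor_comod_regular, simplified]
    show "comodule k (tensor_coalg k C D) (regular (tensor_coalg k C D))"
      unfolding comodule_def
      using * comult_tensor_lin[OF C D] by (simp add: tensor_coassoc_lhs tensor_coassoc_rhs)
    show "counit (tensor_coalg k C D) \<in> Lin k (tensor_coalg k C D) (ground_space k)"
      using counit_tensor_Lin[OF C D] by simp
    fix t assume "t \<in> carrier (tensor_coalg k C D)"
    then have t: "t \<in> carrier ?CD" by simp
    have eq: "(c \<otimes>\<^bsub>k\<^esub> d) \<odot>\<^bsub>?CD\<^esub> t = d \<odot>\<^bsub>?CD\<^esub> (c \<odot>\<^bsub>?CD\<^esub> t)"
      if "c \<in> carrier k" "d \<in> carrier k" "t \<in> carrier ?CD" for c d t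
      using that K.m_comm[of c d] module.smult_assoc1[of k ?CD d c t] by simp
    have "tlift k ?CD ?CD ?CD (\<lambda>x y. counit (tensor_coalg k C D) y \<odot>\<^bsub>?CD\<^esub> x) (comult (tensor_coalg k C D) t) = t"
      by (rule tensor_lin_eq[OF _ _ _ _ _ t, where U = ?CD])
        (simp_all add: tlift_comult_tensor eq comult_counit_right[OF D, where f = "\<lambda>v'. c \<odot>\<^bsub>?CD\<^esub> tens k C D v v'" for c v]
            comult_counit_right[OF C, where f = "\<lambda>v. tens k C D v y" for y])
    then show "tlift k (tensor_coalg k C D) (tensor_coalg k C D) (tensor_coalg k C D)
        (\<lambda>x y. counit (tensor_coalg k C D) y \<odot>\<^bsub>tensor_coalg k C D\<^esub> x) (comult (tensor_coalg k C D) t) = t"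
      by simp
  qed
qed

lemma comodule_tensor:
  assumes "coalgebra k C" "coalgebra k D" "comodule k C X" "comodule k D Y"
  shows "comodule k (tensor_coalg k C D) (tensor_comod k C D X Y)"
  by (rule comoduleI)
    (use tensor_comodule_axioms[OF assms] comult_tensor_lin[OF assms(1,2)] assms in \<open>simp_all add: Lin_iff comodule_module\<close>)

text \<open>Links the equational definition of a measuring of comodules with morphisms out of a
  tensor product. For regular comodules it covers measurings of coalgebras too, and it is also the
  source of the unit isomorphisms.\<close>

lemma comodule_map_tensor_iff:
  assumes H [simp]: "coalgebra k H" and K [simp]: "coalgebra k K" and P [simp]: "coalgebra k P"
    and X [simp]: "comodule k H X" and Y [simp]: "comodule k K Y" and Z [simp]: "comodule k P Z"
    and p: "bilin k P H K \<pi>" and b: "bilin k Z X Y \<theta>"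
  shows "(\<forall>z \<in> carrier Z. \<forall>x \<in> carrier X.
     coact Y (\<theta> z x) =
        tlift k P Z (tensor k K Y)
          (\<lambda>p w. tlift k H X (tensor k K Y) (\<lambda>h y. tens k K Y (\<pi> p h) (\<theta> w y)) (coact X x))
          (coact Z z)) \<longleftrightarrow>
    comodule_map_along k (tensor_coalg k P H) K (tlift k P H K \<pi>) (tensor_comod k P H Z X) Y (tlift k Z X Y \<theta>)" (is "?l \<longleftrightarrow> ?r")
proof -
  note [simp] = comodule_module[OF X] comodule_module[OF Y] comodule_module[OF Z]
    bilin_lin[OF p] bilin_lin[OF b] p b tlift_coact_tensor comodule_tensor
    lin_comp[OF coact_tensor_lin] lin_closed[OF coact_tensor_lin]
  show ?thesis
  proof
    assume l: ?l
    have t: "coact Y (tlift k Z X Y \<theta> t) = tlift k (tensor k P H) (tensor k Z X) (tensor k K Y)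
       (\<lambda>h y. tens k K Y (tlift k P H K \<pi> h) (tlift k Z X Y \<theta> y)) (coact (tensor_comod k P H Z X) t)"
      if t: "t \<in> carrier (tensor k Z X)" for t
      by (rule tensor_lin_eq[OF _ _ _ _ _ t, where U = "tensor k K Y"]) (simp_all add: l)
    show ?r
      by (rule comodule_map_alongI) (use tlift_ext[OF b] tlift_lin[OF b] in \<open>simp_all add: t\<close>)
  next
    assume r: ?r
    show ?l
    proof (intro ballI)
      fix z x assume z: "z \<in> carrier Z" "x \<in> carrier X"
      show "coact Y (\<theta> z x) = tlift k P Z (tensor k K Y)
          (\<lambda>p w. tlift k H X (tensor k K Y) (\<lambda>h y. tens k K Y (\<pi> p h) (\<theta> w y)) (coact X x)) (coact Z z)"
        using comodule_map_along_coact[OF r, of "tens k Z X z x"] z by simp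
    qed
  qed
qed

subsection \<open>The unit\<close>

lemma coact_ground: "c \<in> carrier k \<Longrightarrow> coact (ground_comod k) c = tens k (ground_space k) (ground_space k) \<one>\<^bsub>k\<^esub> c"
  by (simp add: ground_comod_def module.defs comod.defs)

lemma counit_ground: "c \<in> carrier k \<Longrightarrow> counit (ground_coalg k) c = c"
  by (simp add: ground_coalg_def module.defs coalg.defs)

text \<open>The definition has \<open>c\<close> in the left factor. A scalar moves across the tensor
  sign, which gives the comultiplication the same form as the coaction in
  \<open>coact_ground\<close>.\<close>

lemma comult_ground:
  assumes "cring k" "c \<in> carrier k"
  shows "comult (ground_coalg k) c = tens k (ground_space k) (ground_space k) \<one>\<^bsub>k\<^esub> c"
proof -
  interpret K: cring k by fact
  let ?G = "ground_space k"
  have l: "lin k ?G (tensor k ?G ?G) (\<lambda>x. tens k ?G ?G x \<one>\<^bsub>k\<^esub>)" "lin k ?G (tensor k ?G ?G) (\<lambda>x. tens k ?G ?G \<one>\<^bsub>k\<^esub> x)"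
    using assms by simp_all
  have "tens k ?G ?G (c \<odot>\<^bsub>?G\<^esub> \<one>\<^bsub>k\<^esub>) \<one>\<^bsub>k\<^esub> = tens k ?G ?G \<one>\<^bsub>k\<^esub> (c \<odot>\<^bsub>?G\<^esub> \<one>\<^bsub>k\<^esub>)"
    using lin_smult[OF l(1) assms(2), of "\<one>\<^bsub>k\<^esub>"] lin_smult[OF l(2) assms(2), of "\<one>\<^bsub>k\<^esub>"] by simp
  then show ?thesis using assms by (simp add: ground_coalg_def module.defs coalg.defs)
qed

lemma coalgebra_ground [simp]: assumes "cring k" shows "coalgebra k (ground_coalg k)"
  and comodule_ground [simp]: "comodule k (ground_coalg k) (ground_comod k)"
proof -
  interpret K: cring k by fact
  let ?G = "ground_space k"
  have l: "lin k ?G (tensor k ?G ?G) (comult (ground_coalg k))"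
    by (subst lin_cong[where g = "\<lambda>x. tens k ?G ?G \<one>\<^bsub>k\<^esub> x"]) (simp_all add: assms comult_ground)
  have l': "lin k ?G (tensor k ?G ?G) (coact (ground_comod k))"
    by (subst lin_cong[where g = "\<lambda>x. tens k ?G ?G \<one>\<^bsub>k\<^esub> x"]) (simp_all add: assms coact_ground)
  have lc: "lin k ?G ?G (counit (ground_coalg k))"
    by (subst lin_cong[where g = "\<lambda>x. x"]) (simp_all add: assms counit_ground)
  note [simp] = lin_comp[OF l] lin_comp[OF lc] lin_closed[OF l] lin_closed[OF lc, simplified] lin_comp[OF l'] assms
    comult_ground counit_ground coact_ground
  have e: "comult (ground_coalg k) \<in> extensional (carrier k)"
    "coact (ground_comod k) \<in> extensional (carrier k)" "counit (ground_coalg k) \<in> extensional (carrier k)"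
    by (simp_all add: ground_coalg_def ground_comod_def module.defs coalg.defs comod.defs)
  have "comodule k (ground_coalg k) (regular (ground_coalg k))"
    by (rule comoduleI) (simp_all add: l e)
  then show "coalgebra k (ground_coalg k)"
    by (rule coalgebraI) (simp_all add: Lin_iff lc e K.m_comm)
  show "comodule k (ground_coalg k) (ground_comod k)"
    by (rule comoduleI) (simp_all add: l l' e)
qed

subsection \<open>Morphisms\<close>

lemma cobj_iff: "cobj k (C, X) \<longleftrightarrow> coalgebra k C \<and> comodule k C X"
  by (simp add: cobj_def)

lemma cobjD:
  assumes "cobj k S"
  shows "coalgebra k (fst S)" "comodule k (fst S) (snd S)" "module k (fst S)" "module k (snd S)"
  using assms comodule_module by (auto simp: cobj_def)

lemma cmorD:
  assumes "cmor k S T m" "cobj k S" "cobj k T"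
  shows "coalg_map k (fst S) (fst T) (fst m)"
    "comodule_map_along k (fst S) (fst T) (fst m) (snd S) (snd T) (snd m)"
    "lin k (fst S) (fst T) (fst m)" "lin k (snd S) (snd T) (snd m)"
    "fst m \<in> extensional (carrier (fst S))" "snd m \<in> extensional (carrier (snd S))"
  using assms coalg_map_lin comodule_map_along_lin by (auto simp: cobj_def cmor_def)

lemma cmor_comp:
  assumes "cmor k S T m" "cmor k T U n" "cobj k S" "cobj k T" "cobj k U"
  shows "cmor k S U (ccomp S n m)"
  using coalg_map_comp[OF cmorD(1)[OF assms(1,3,4)] cmorD(1)[OF assms(2,4,5)]]
    comodule_map_along_comp[OF cmorD(3)[OF assms(1,3,4)] cmorD(3)[OF assms(2,4,5)]
      cmorD(2)[OF assms(1,3,4)] cmorD(2)[OF assms(2,4,5)]] assms(3-5)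
  by (simp add: cmor_def ccomp_def cobj_def)

lemma cmor_id: "cobj k S \<Longrightarrow> cmor k S S (cid S)"
  by (simp add: cmor_def cid_def cobj_def coalg_map_id comodule_map_along_id)

lemma cobj_unit: "cring k \<Longrightarrow> cobj k (cunit k)"
  by (simp add: cunit_def cobj_def)

lemma cobj_tensor: "cobj k S \<Longrightarrow> cobj k T \<Longrightarrow> cobj k (ctensor k S T)"
  by (simp add: ctensor_def cobj_def comodule_tensor)

lemma comodule_map_tensor:
  assumes [simp]: "coalgebra k C" "coalgebra k D" "coalgebra k C'" "coalgebra k D'"
    and X [simp]: "comodule k C X" "comodule k D Y" "comodule k C' X'" "comodule k D' Y'"
    and f: "lin k C C' f" and g: "lin k D D' g"
    and \<phi>: "comodule_map_along k C C' f X X' \<phi>" and \<psi>: "comodule_map_along k D D' g Y Y' \<psi>"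
  shows "comodule_map_along k (tensor_coalg k C D) (tensor_coalg k C' D') (tmap k C D C' D' f g)
    (tensor_comod k C D X Y) (tensor_comod k C' D' X' Y') (tmap k X Y X' Y' \<phi> \<psi>)"
proof -
  note l\<phi> = comodule_map_along_lin(1)[OF \<phi> X(1,3)] and l\<psi> = comodule_map_along_lin(1)[OF \<psi> X(2,4)]
  note [simp] = comodule_module[OF X(1)] comodule_module[OF X(2)] comodule_module[OF X(3)] comodule_module[OF X(4)]
    comodule_tensor l\<phi> l\<psi> f g lin_comp[OF l\<phi>] lin_comp[OF l\<psi>] lin_comp[OF f] lin_comp[OF g]
    lin_closed[OF l\<phi>] lin_closed[OF l\<psi>] lin_closed[OF f] lin_closed[OF g]
  let ?T = "tensor k (tensor k C' D') (tensor k X' Y')"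
  show ?thesis
  proof (rule comodule_map_alongI)
    show "tmap k X Y X' Y' \<phi> \<psi> \<in> extensional (carrier (tensor_comod k C D X Y))"
      using tmap_Lin[OF l\<phi> l\<psi>] by (simp add: Lin_iff)
    fix t assume "t \<in> carrier (tensor_comod k C D X Y)"
    then have t: "t \<in> carrier (tensor k X Y)" by simp
    note [simp] = lin_comp[OF coact_tensor_lin] lin_closed[OF coact_tensor_lin]
    have "coact (tensor_comod k C' D' X' Y') (tmap k X Y X' Y' \<phi> \<psi> t) =
      tlift k (tensor k C D) (tensor k X Y) ?T
        (\<lambda>h y. tens k (tensor k C' D') (tensor k X' Y') (tmap k C D C' D' f g h) (tmap k X Y X' Y' \<phi> \<psi> y))
        (coact (tensor_comod k C D X Y) t)"
      by (rule tensor_lin_eq[OF _ _ _ _ _ t, where U = ?T])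
        (simp_all add: tlift_coact_tensor coact_tensor[of k C' D' X' Y'] tlift_coact_map[OF \<phi>] tlift_coact_map[OF \<psi>])
    then show "coact (tensor_comod k C' D' X' Y') (tmap k X Y X' Y' \<phi> \<psi> t) =
      tlift k (tensor_coalg k C D) (tensor_comod k C D X Y) (tensor k (tensor_coalg k C' D') (tensor_comod k C' D' X' Y'))
        (\<lambda>h y. tens k (tensor_coalg k C' D') (tensor_comod k C' D' X' Y') (tmap k C D C' D' f g h) (tmap k X Y X' Y' \<phi> \<psi> y))
        (coact (tensor_comod k C D X Y) t)" by simp
  qed (simp_all add: tmap_lin)
qed

lemma counit_tensor_lin:
  "coalgebra k C \<Longrightarrow> coalgebra k D \<Longrightarrow> lin k (tensor k C D) (ground_space k) (counit (tensor_coalg k C D))"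
  using counit_lin[OF coalgebra_tensor] by simp

lemma coalg_map_tensor:
  assumes [simp]: "coalgebra k C" "coalgebra k D" "coalgebra k C'" "coalgebra k D'"
    and f: "coalg_map k C C' f" and g: "coalg_map k D D' g"
  shows "coalg_map k (tensor_coalg k C D) (tensor_coalg k C' D') (tmap k C D C' D' f g)"
proof -
  note [simp] = coalg_map_lin(1)[OF f] coalg_map_lin(1)[OF g] coalgebra_regular
  note [simp] = lin_closed[OF coalg_map_lin(1)[OF f]] lin_closed[OF coalg_map_lin(1)[OF g]]
  have "counit (tensor_coalg k C' D') (tmap k C D C' D' f g t) = counit (tensor_coalg k C D) t"
    if t: "t \<in> carrier (tensor k C D)" for t
    by (rule tensor_lin_eq[OF _ _ _ _ _ t, where U = "ground_space k"])
      (simp_all add: coalg_map_counit[OF f] coalg_map_counit[OF g] counit_tensor_lin lin_comp[OF counit_tensor_lin])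
  moreover have "comodule_map_along k (tensor_coalg k C D) (tensor_coalg k C' D') (tmap k C D C' D' f g)
    (tensor_comod k C D (regular C) (regular D)) (tensor_comod k C' D' (regular C') (regular D'))
    (tmap k (regular C) (regular D) (regular C') (regular D') f g)"
    by (rule comodule_map_tensor) (use f g in \<open>simp_all add: coalg_map_regular\<close>)
  ultimately show ?thesis by (simp add: coalg_map_regular tensor_comod_regular)
qed

lemma cmor_tensor:
  assumes "cmor k S S' m" "cmor k T T' n" "cobj k S" "cobj k S'" "cobj k T" "cobj k T'"
  shows "cmor k (ctensor k S T) (ctensor k S' T') (ctensor_mor k S T S' T' m n)"
  using coalg_map_tensor[OF _ _ _ _ cmorD(1)[OF assms(1,3,4)] cmorD(1)[OF assms(2,5,6)]]
    comodule_map_tensor[OF _ _ _ _ _ _ _ _ cmorD(3)[OF assms(1,3,4)] cmorD(3)[OF assms(2,5,6)]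
      cmorD(2)[OF assms(1,3,4)] cmorD(2)[OF assms(2,5,6)]] assms(3-6)
  by (simp add: cmor_def ctensor_def ctensor_mor_def cobj_def)

lemma tensor3_lin_eq:
  assumes "module k U" "module k V" "module k W" "lin k (tensor k (tensor k U V) W) Z f" "lin k (tensor k (tensor k U V) W) Z g"
    "\<And>u v w. u \<in> carrier U \<Longrightarrow> v \<in> carrier V \<Longrightarrow> w \<in> carrier W \<Longrightarrow>
      f (tens k (tensor k U V) W (tens k U V u v) w) = g (tens k (tensor k U V) W (tens k U V u v) w)"
    "t \<in> carrier (tensor k (tensor k U V) W)"
  shows "f t = g t"
proof (rule tensor_lin_eq[OF _ _ assms(4,5) _ assms(7)])
  fix s w assume s: "s \<in> carrier (tensor k U V)" and w: "w \<in> carrier W"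
  show "f (tens k (tensor k U V) W s w) = g (tens k (tensor k U V) W s w)"
    by (rule tensor_lin_eq[OF assms(1,2) _ _ _ s, where U = Z])
      (use assms w in \<open>simp_all add: lin_comp[OF assms(4)] lin_comp[OF assms(5)]\<close>)
qed (use assms in simp_all)

lemma comodule_map_assoc:
  assumes [simp]: "coalgebra k C" "coalgebra k D" "coalgebra k E"
    and X [simp]: "comodule k C X" "comodule k D Y" "comodule k E Z"
  shows "comodule_map_along k (tensor_coalg k (tensor_coalg k C D) E) (tensor_coalg k C (tensor_coalg k D E)) (tassoc k C D E)
    (tensor_comod k (tensor_coalg k C D) E (tensor_comod k C D X Y) Z)
    (tensor_comod k C (tensor_coalg k D E) X (tensor_comod k D E Y Z)) (tassoc k X Y Z)"
proof -
  note [simp] = comodule_module[OF X(1)] comodule_module[OF X(2)] comodule_module[OF X(3)] comodule_tensor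
    lin_comp[OF tassoc_lin] lin_closed[OF tassoc_lin] tassoc_lin
  let ?A = "tensor k C (tensor k D E)" and ?B = "tensor k X (tensor k Y Z)" 
  let ?coact = "coact (tensor_comod k (tensor_coalg k C D) E (tensor_comod k C D X Y) Z)"
  \<comment> \<open>The rules for coactions on tensor products are restated with the iterated
    carriers reduced to plain tensor products, the form in which the simplifier meets them.\<close>
  have c1: "tlift k (tensor k (tensor k C D) E) (tensor k (tensor k X Y) Z) U \<beta> (?coact (tens k (tensor k X Y) Z s z)) =
     tlift k (tensor k C D) (tensor k X Y) U (\<lambda>u v. tlift k E Z U (\<lambda>u' v'. \<beta> (tens k (tensor k C D) E u u') (tens k (tensor k X Y) Z v v')) (coact Z z))
       (coact (tensor_comod k C D X Y) s)"
    if "bilin k (tensor k (tensor k C D) E) (tensor k (tensor k X Y) Z) U \<beta>" "s \<in> carrier (tensor k X Y)" "z \<in> carrier Z" for U :: "('a,'u,'uu) module_scheme" and \<beta> s z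
    using tlift_coact_tensor[of k "tensor_coalg k C D" E "tensor_comod k C D X Y" Z U \<beta> s z] that by simp
  have c2: "coact (tensor_comod k C (tensor_coalg k D E) X (tensor_comod k D E Y Z)) (tens k X (tensor k Y Z) x s) =
     tlift k C X (tensor k ?A ?B) (\<lambda>u v. tlift k (tensor k D E) (tensor k Y Z) (tensor k ?A ?B)
       (\<lambda>u' v'. tens k ?A ?B (tens k C (tensor k D E) u u') (tens k X (tensor k Y Z) v v')) (coact (tensor_comod k D E Y Z) s)) (coact X x)"
    if "s \<in> carrier (tensor k Y Z)" "x \<in> carrier X" for s x
    using coact_tensor[of k C "tensor_coalg k D E" X "tensor_comod k D E Y Z" x s] that by simp
  have l1: "lin k (tensor k (tensor k X Y) Z) (tensor k (tensor k (tensor k C D) E) (tensor k (tensor k X Y) Z)) ?coact"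
    using coact_tensor_lin[of k "tensor_coalg k C D" E "tensor_comod k C D X Y" Z] by simp
  have l2: "lin k ?B (tensor k ?A ?B) (coact (tensor_comod k C (tensor_coalg k D E) X (tensor_comod k D E Y Z)))"
    using coact_tensor_lin[of k C "tensor_coalg k D E" X "tensor_comod k D E Y Z"] by simp
  note [simp] = lin_comp[OF l1] lin_closed[OF l1] lin_comp[OF l2] lin_comp[OF coact_tensor_lin] lin_closed[OF coact_tensor_lin]
  show ?thesis
  proof (rule comodule_map_alongI)
    show "tassoc k X Y Z \<in> extensional (carrier (tensor_comod k (tensor_coalg k C D) E (tensor_comod k C D X Y) Z))"
      using tassoc_Lin[of k X Y Z] by (simp add: Lin_iff)
    fix t assume "t \<in> carrier (tensor_comod k (tensor_coalg k C D) E (tensor_comod k C D X Y) Z)"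
    then have t: "t \<in> carrier (tensor k (tensor k X Y) Z)" by simp
    have "coact (tensor_comod k C (tensor_coalg k D E) X (tensor_comod k D E Y Z)) (tassoc k X Y Z t) =
      tlift k (tensor k (tensor k C D) E) (tensor k (tensor k X Y) Z) (tensor k ?A ?B)
        (\<lambda>h y. tens k ?A ?B (tassoc k C D E h) (tassoc k X Y Z y)) (?coact t)"
      by (rule tensor3_lin_eq[OF _ _ _ _ _ _ t, where Z = "tensor k ?A ?B"])
        (simp_all add: c1 c2 tlift_coact_tensor)
    then show "coact (tensor_comod k C (tensor_coalg k D E) X (tensor_comod k D E Y Z)) (tassoc k X Y Z t) =
      tlift k (tensor_coalg k (tensor_coalg k C D) E) (tensor_comod k (tensor_coalg k C D) E (tensor_comod k C D X Y) Z)
        (tensor k (tensor_coalg k C (tensor_coalg k D E)) (tensor_comod k C (tensor_coalg k D E) X (tensor_comod k D E Y Z)))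
        (\<lambda>h y. tens k (tensor_coalg k C (tensor_coalg k D E)) (tensor_comod k C (tensor_coalg k D E) X (tensor_comod k D E Y Z))
          (tassoc k C D E h) (tassoc k X Y Z y)) (?coact t)" by simp
  qed simp_all
qed

lemma coalg_map_assoc:
  assumes [simp]: "coalgebra k C" "coalgebra k D" "coalgebra k E"
  shows "coalg_map k (tensor_coalg k (tensor_coalg k C D) E) (tensor_coalg k C (tensor_coalg k D E)) (tassoc k C D E)"
proof -
  interpret K: cring k by (rule coalgebra_cring[OF assms(1)])
  note [simp] = lin_comp[OF tassoc_lin] lin_closed[OF tassoc_lin]
  have "lin k (tensor k (tensor k C D) E) (ground_space k) (counit (tensor_coalg k (tensor_coalg k C D) E))"
    using counit_tensor_lin[of k "tensor_coalg k C D" E] by simp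
  moreover have "lin k (tensor k C (tensor k D E)) (ground_space k) (counit (tensor_coalg k C (tensor_coalg k D E)))"
    using counit_tensor_lin[of k C "tensor_coalg k D E"] by simp
  note l = this calculation
  have c: "counit (tensor_coalg k C (tensor_coalg k D E)) (tassoc k C D E t) = counit (tensor_coalg k (tensor_coalg k C D) E) t"
    if t: "t \<in> carrier (tensor k (tensor k C D) E)" for t
    by (rule tensor3_lin_eq[OF _ _ _ _ _ _ t, where Z = "ground_space k"])
      (use counit_tensor[of k "tensor_coalg k C D" E] counit_tensor[of k C "tensor_coalg k D E"] in
        \<open>simp_all add: l lin_comp[OF l(1)] K.m_assoc\<close>)
  have t: "tensor_comod k (tensor_coalg k C D) E (tensor_comod k C D (regular C) (regular D)) (regular E) =
      regular (tensor_coalg k (tensor_coalg k C D) E)"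
    "tensor_comod k C (tensor_coalg k D E) (regular C) (tensor_comod k D E (regular D) (regular E)) =
      regular (tensor_coalg k C (tensor_coalg k D E))"
    by (simp_all only: tensor_comod_regular)
  show ?thesis
    using comodule_map_assoc[OF assms coalgebra_regular coalgebra_regular coalgebra_regular] c
    by (simp add: coalg_map_regular t)
qed

lemma cmor_assoc:
  assumes "cobj k S" "cobj k T" "cobj k U"
  shows "cmor k (ctensor k (ctensor k S T) U) (ctensor k S (ctensor k T U)) (cassoc k S T U)"
  using assms by (simp add: cmor_def cobj_def ctensor_def cassoc_def coalg_map_assoc comodule_map_assoc)

lemma coact_smult:
  assumes C: "coalgebra k C" and X [simp]: "comodule k C X" and [simp]: "c \<in> carrier k" "x \<in> carrier X"
  shows "coact X (c \<odot>\<^bsub>X\<^esub> x) = tlift k C X (tensor k C X) (\<lambda>u v. tens k C X u (c \<odot>\<^bsub>X\<^esub> v)) (coact X x)"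
proof -
  note [simp] = C comodule_module[OF X]
  have "coact X (c \<odot>\<^bsub>X\<^esub> x) = c \<odot>\<^bsub>tensor k C X\<^esub> tlift k C X (tensor k C X) (tens k C X) (coact X x)"
    by (simp add: lin_smult[OF coact_lin[OF C X]] tlift_tens_id)
  also have "\<dots> = tlift k C X (tensor k C X) (\<lambda>u v. c \<odot>\<^bsub>tensor k C X\<^esub> tens k C X u v) (coact X x)"
    by (rule tlift_push) simp_all
  finally show ?thesis by (simp add: lin_smult[OF tens_lin_right, symmetric, of k C X _ X "\<lambda>v. v"])
qed

text \<open>By \<open>comodule_map_tensor_iff\<close> the claim unfolds to compatibility of the
  coaction with scalars, which is \<open>coact_smult\<close>.\<close>

lemma comodule_map_unit:
  assumes C [simp]: "coalgebra k C" and X [simp]: "comodule k C X"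
  shows "comodule_map_along k (tensor_coalg k (ground_coalg k) C) C (tlift k (ground_space k) C C (smult C))
    (tensor_comod k (ground_coalg k) C (ground_comod k) X) X (tlift k (ground_space k) X X (smult X))"
  and "comodule_map_along k (tensor_coalg k C (ground_coalg k)) C (tlift k C (ground_space k) C (\<lambda>c s. s \<odot>\<^bsub>C\<^esub> c))
    (tensor_comod k C (ground_coalg k) X (ground_comod k)) X (tlift k X (ground_space k) X (\<lambda>c s. s \<odot>\<^bsub>X\<^esub> c))"
proof -
  interpret K: cring k by (rule coalgebra_cring[OF C])
  note [simp] = comodule_module[OF X] K.is_cring coact_ground
    module_smult_closed[OF comodule_module[OF X]] module_smult_closed[OF coalgebra_module[OF C]]
    module.smult_one[OF comodule_module[OF X]] module.smult_one[OF coalgebra_module[OF C]]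
  have "comodule_map_along k (tensor_coalg k (ground_coalg k) C) C (tlift k (ground_coalg k) C C (smult C))
    (tensor_comod k (ground_coalg k) C (ground_comod k) X) X (tlift k (ground_comod k) X X (smult X))"
    by (rule iffD1[OF comodule_map_tensor_iff]; (intro ballI)?) (simp_all add: coact_smult[OF C X])
  then show "comodule_map_along k (tensor_coalg k (ground_coalg k) C) C (tlift k (ground_space k) C C (smult C))
    (tensor_comod k (ground_coalg k) C (ground_comod k) X) X (tlift k (ground_space k) X X (smult X))" by simp
  have "comodule_map_along k (tensor_coalg k C (ground_coalg k)) C (tlift k C (ground_coalg k) C (\<lambda>c s. s \<odot>\<^bsub>C\<^esub> c))
    (tensor_comod k C (ground_coalg k) X (ground_comod k)) X (tlift k X (ground_comod k) X (\<lambda>c s. s \<odot>\<^bsub>X\<^esub> c))"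
    by (rule iffD1[OF comodule_map_tensor_iff]; (intro ballI)?) (simp_all add: coact_smult[OF C X])
  then show "comodule_map_along k (tensor_coalg k C (ground_coalg k)) C (tlift k C (ground_space k) C (\<lambda>c s. s \<odot>\<^bsub>C\<^esub> c))
    (tensor_comod k C (ground_coalg k) X (ground_comod k)) X (tlift k X (ground_space k) X (\<lambda>c s. s \<odot>\<^bsub>X\<^esub> c))" by simp
qed

text \<open>Makes the unit laws for coalgebras instances of \<open>comodule_map_unit\<close> for
  regular comodules.\<close>

lemma regular_ground: "cring k \<Longrightarrow> regular (ground_coalg k) = ground_comod k"
proof -
  assume k: "cring k"
  have "comult (ground_coalg k) = (\<lambda>c \<in> carrier k. tens k (ground_space k) (ground_space k) \<one>\<^bsub>k\<^esub> c)"
  proof (rule extensionalityI[of _ "carrier k"])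
    show "comult (ground_coalg k) \<in> extensional (carrier k)"
      by (simp add: ground_coalg_def module.defs coalg.defs)
  qed (simp_all add: comult_ground[OF k])
  then show ?thesis
    by (simp add: regular_def ground_comod_def) (simp add: ground_coalg_def module.defs coalg.defs comod.defs)
qed

lemma coalg_map_unit:
  assumes C [simp]: "coalgebra k C"
  shows "coalg_map k (tensor_coalg k (ground_coalg k) C) C (tlift k (ground_space k) C C (smult C))" (is ?l)
  and "coalg_map k (tensor_coalg k C (ground_coalg k)) C (tlift k C (ground_space k) C (\<lambda>c s. s \<odot>\<^bsub>C\<^esub> c))" (is ?r)
proof -
  interpret K: cring k by (rule coalgebra_cring[OF C])
  have L1: "lin k (tensor k (ground_space k) C) (ground_space k) (counit (tensor_coalg k (ground_coalg k) C))"
    using counit_tensor_lin[of k "ground_coalg k" C] by (simp add: K.is_cring)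
  have L2: "lin k (tensor k C (ground_space k)) (ground_space k) (counit (tensor_coalg k C (ground_coalg k)))"
    using counit_tensor_lin[of k C "ground_coalg k"] by (simp add: K.is_cring)
  have ct: "counit (tensor_coalg k (ground_coalg k) C) (tens k (ground_space k) C s c) = s \<otimes>\<^bsub>k\<^esub> counit C c"
    "counit (tensor_coalg k C (ground_coalg k)) (tens k C (ground_space k) c s) = s \<otimes>\<^bsub>k\<^esub> counit C c"
    if "s \<in> carrier k" "c \<in> carrier C" for s c
    using counit_tensor[of k "ground_coalg k" C s c] counit_tensor[of k C "ground_coalg k" c s] that
    by (simp_all add: K.is_cring counit_ground K.m_comm)
  note [simp] = K.is_cring module_smult_closed[OF coalgebra_module[OF C]] lin_smult[OF counit_lin[OF C]] L1 L2 ct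
  have "counit C (tlift k (ground_space k) C C (smult C) t) = counit (tensor_coalg k (ground_coalg k) C) t"
    if t: "t \<in> carrier (tensor k (ground_space k) C)" for t
    by (rule tensor_lin_eq[OF _ _ _ _ _ t, where U = "ground_space k"]) simp_all
  then show ?l
    using comodule_map_unit(1)[OF C coalgebra_regular[OF C]]
    by (simp add: coalg_map_regular regular_ground[symmetric] tensor_comod_regular)
  have "counit C (tlift k C (ground_space k) C (\<lambda>c s. s \<odot>\<^bsub>C\<^esub> c) t) = counit (tensor_coalg k C (ground_coalg k)) t"
    if t: "t \<in> carrier (tensor k C (ground_space k))" for t
    by (rule tensor_lin_eq[OF _ _ _ _ _ t, where U = "ground_space k"]) simp_all
  then show ?r
    using comodule_map_unit(2)[OF C coalgebra_regular[OF C]]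
    by (simp add: coalg_map_regular regular_ground[symmetric] tensor_comod_regular)
qed

lemma cmor_unit:
  assumes "cobj k S"
  shows "cmor k (ctensor k (cunit k) S) S (clunit k S)" "cmor k (ctensor k S (cunit k)) S (crunit k S)"
  using assms coalg_map_unit[of k "fst S"] comodule_map_unit[of k "fst S" "snd S"]
  by (simp_all add: cmor_def cobj_def cunit_def ctensor_def clunit_def crunit_def)

section \<open>Enriched categories from universal objects\<close>

text \<open>On \<open>(r \<otimes> q) \<otimes> p\<close> both sides become the composite of
  \<open>eR r\<close>, \<open>eQ q\<close> and \<open>eP p\<close>. It is phrased for bare spaces
  since it is applied both to the coalgebra component and to the comodule component of a
  morphism.\<close>

lemma composite_assoc:
  assumes [simp]: "module k R" "module k Q" "module k P" "module k A" "module k A'" "module k A''" "module k A3"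
    and e: "lin k R (hom_space k A'' A3) eR" "lin k Q (hom_space k A' A'') eQ" "lin k P (hom_space k A A') eP"
      "lin k RQ (hom_space k A' A3) eRQ" "lin k QP (hom_space k A A'') eQP" "lin k Z (hom_space k A A3) eZ"
    and c: "lin k (tensor k R Q) RQ c1" "lin k (tensor k RQ P) Z c2" "lin k (tensor k Q P) QP c3" "lin k (tensor k R QP) Z c4"
    and E: "\<And>r q. r \<in> carrier R \<Longrightarrow> q \<in> carrier Q \<Longrightarrow> eRQ (c1 (tens k R Q r q)) = compose (carrier A') (eR r) (eQ q)"
      "\<And>s p. s \<in> carrier RQ \<Longrightarrow> p \<in> carrier P \<Longrightarrow> eZ (c2 (tens k RQ P s p)) = compose (carrier A) (eRQ s) (eP p)"
      "\<And>q p. q \<in> carrier Q \<Longrightarrow> p \<in> carrier P \<Longrightarrow> eQP (c3 (tens k Q P q p)) = compose (carrier A) (eQ q) (eP p)"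
      "\<And>r s. r \<in> carrier R \<Longrightarrow> s \<in> carrier QP \<Longrightarrow> eZ (c4 (tens k R QP r s)) = compose (carrier A) (eR r) (eQP s)"
    and t: "t \<in> carrier (tensor k (tensor k R Q) P)"
  shows "eZ (c2 (tmap k (tensor k R Q) P RQ P c1 (\<lambda>p \<in> carrier P. p) t)) =
    eZ (c4 (tmap k R (tensor k Q P) R QP (\<lambda>r \<in> carrier R. r) c3 (tassoc k R Q P t)))"
proof -
  have [simp]: "module k RQ" "module k QP" by (rule lin_module[OF e(4)], rule lin_module[OF e(5)])
  note [simp] = c lin_comp[OF tassoc_lin] lin_comp[OF c(1)] lin_comp[OF c(2)] lin_comp[OF c(3)] lin_comp[OF c(4)] lin_comp[OF e(6)]
    lin_closed[OF c(1)] lin_closed[OF c(3)]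
  \<comment> \<open>\<open>compose\<close> restricts to a carrier, so its associativity depends on
    the innermost map landing in the carrier of the next one.\<close>
  have "eP p a \<in> carrier A'" if "p \<in> carrier P" "a \<in> carrier A" for p a
    using e(3) that by (auto simp: lin_hom_iff bilin_closed)
  then have "compose (carrier A) (compose (carrier A') (eR r) (eQ q)) (eP p) =
      compose (carrier A) (eR r) (compose (carrier A) (eQ q) (eP p))" if "p \<in> carrier P" for r q p
    using that by (auto simp: compose_def intro!: restrict_ext)
  then have "eZ (c2 (tmap k (tensor k R Q) P RQ P c1 (\<lambda>p \<in> carrier P. p) (tens k (tensor k R Q) P (tens k R Q r q) p))) =
      eZ (c4 (tmap k R (tensor k Q P) R QP (\<lambda>r \<in> carrier R. r) c3
        (tassoc k R Q P (tens k (tensor k R Q) P (tens k R Q r q) p))))"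
    if "r \<in> carrier R" "q \<in> carrier Q" "p \<in> carrier P" for r q p
    using that by (simp add: E)
  then show ?thesis
    by (intro tensor3_lin_eq[OF _ _ _ _ _ _ t, where Z = "hom_space k A A3"
        and f = "\<lambda>t. eZ (c2 (tmap k (tensor k R Q) P RQ P c1 (\<lambda>p \<in> carrier P. p) t))"
        and g = "\<lambda>t. eZ (c4 (tmap k R (tensor k Q P) R QP (\<lambda>r \<in> carrier R. r) c3 (tassoc k R Q P t)))"]) simp_all
qed

text \<open>A linear map from the ground space is determined by the image of \<open>1\<close>. As
  this is sent to the identity map, a scalar \<open>s\<close> is sent to scaling by
  \<open>s\<close>, and composing with it is multiplication by \<open>s\<close>.\<close>

lemma composite_unit:
  assumes [simp]: "module k P" "module k A" "module k A'"
    and e: "lin k P (hom_space k A A') eP" "lin k E (hom_space k A A) eE" "lin k E' (hom_space k A' A') eE'"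
    and i: "lin k (ground_space k) E i" "lin k (ground_space k) E' i'"
    and c: "lin k (tensor k E' P) P c" "lin k (tensor k P E) P d"
    and E: "\<And>x p. x \<in> carrier E' \<Longrightarrow> p \<in> carrier P \<Longrightarrow> eP (c (tens k E' P x p)) = compose (carrier A) (eE' x) (eP p)"
      "\<And>x p. x \<in> carrier E \<Longrightarrow> p \<in> carrier P \<Longrightarrow> eP (d (tens k P E p x)) = compose (carrier A) (eP p) (eE x)"
      "eE (i \<one>\<^bsub>k\<^esub>) = (\<lambda>a \<in> carrier A. a)" "eE' (i' \<one>\<^bsub>k\<^esub>) = (\<lambda>a \<in> carrier A'. a)"
  shows "t \<in> carrier (tensor k (ground_space k) P) \<Longrightarrow>
    eP (c (tmap k (ground_space k) P E' P i' (\<lambda>p \<in> carrier P. p) t)) = eP (tlift k (ground_space k) P P (smult P) t)"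
    and "t' \<in> carrier (tensor k P (ground_space k)) \<Longrightarrow>
    eP (d (tmap k P (ground_space k) P E (\<lambda>p \<in> carrier P. p) i t')) = eP (tlift k P (ground_space k) P (\<lambda>p s. s \<odot>\<^bsub>P\<^esub> p) t')"
proof -
  interpret P: module k P by fact
  have k [simp]: "cring k" by unfold_locales
  note [simp] = lin_module[OF i(1)] lin_module[OF i(2)] c i lin_comp[OF c(1)] lin_comp[OF c(2)] lin_comp[OF e(1)]
    lin_comp[OF i(1)] lin_comp[OF i(2)] lin_closed[OF i(1)] lin_closed[OF i(2)]
  have eP: "eP p a \<in> carrier A'" if "p \<in> carrier P" "a \<in> carrier A" for p a
    using e(1) that by (auto simp: lin_hom_iff bilin_closed)
  have eext: "eP p \<in> extensional (carrier A)" if "p \<in> carrier P" for p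
    using e(1) that by (auto simp: lin_hom_iff)
  have ii: "i s = s \<odot>\<^bsub>E\<^esub> i \<one>\<^bsub>k\<^esub>" "i' s = s \<odot>\<^bsub>E'\<^esub> i' \<one>\<^bsub>k\<^esub>" if "s \<in> carrier k" for s
    using lin_smult[OF i(1), of s "\<one>\<^bsub>k\<^esub>"] lin_smult[OF i(2), of s "\<one>\<^bsub>k\<^esub>"] that by simp_all
  have eE: "eE (i s) = (\<lambda>a \<in> carrier A. s \<odot>\<^bsub>A\<^esub> a)" "eE' (i' s) = (\<lambda>a \<in> carrier A'. s \<odot>\<^bsub>A'\<^esub> a)" if s: "s \<in> carrier k" for s
    unfolding ii[OF s] using s by (auto simp: lin_smult[OF e(2)] lin_smult[OF e(3)] E hom_simps intro!: restrict_ext)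
  have ePs: "eP (s \<odot>\<^bsub>P\<^esub> p) = (\<lambda>a \<in> carrier A. s \<odot>\<^bsub>A'\<^esub> eP p a)" if "s \<in> carrier k" "p \<in> carrier P" for s p
    using lin_smult[OF e(1) that] by (simp add: hom_simps)
  have ePa: "eP p (s \<odot>\<^bsub>A\<^esub> a) = s \<odot>\<^bsub>A'\<^esub> eP p a" if "s \<in> carrier k" "p \<in> carrier P" "a \<in> carrier A" for s p a
    using e(1) that lin_smult[of k A A' "eP p" s a] by (simp add: lin_hom_iff bilin_def)
  show "eP (c (tmap k (ground_space k) P E' P i' (\<lambda>p \<in> carrier P. p) t)) = eP (tlift k (ground_space k) P P (smult P) t)"
    if "t \<in> carrier (tensor k (ground_space k) P)"
    by (rule tensor_lin_eq[OF _ _ _ _ _ that, where U = "hom_space k A A'"])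
      (auto simp: E eE ePs compose_def eP intro!: restrict_ext)
  show "eP (d (tmap k P (ground_space k) P E (\<lambda>p \<in> carrier P. p) i t')) = eP (tlift k P (ground_space k) P (\<lambda>p s. s \<odot>\<^bsub>P\<^esub> p) t')"
    if "t' \<in> carrier (tensor k P (ground_space k))"
    by (rule tensor_lin_eq[OF _ _ _ _ _ that, where U = "hom_space k A A'"])
      (auto simp: E eE ePs ePa compose_def eP intro!: restrict_ext)
qed

lemma ccomp_apply:
  "c \<in> carrier (fst S) \<Longrightarrow> fst (ccomp S n m) c = fst n (fst m c)"
  "x \<in> carrier (snd S) \<Longrightarrow> snd (ccomp S n m) x = snd n (snd m x)"
  by (simp_all add: ccomp_def compose_eq)

lemma ctensor_simps [simp]:
  "carrier (fst (ctensor k S T)) = carrier (tensor k (fst S) (fst T))"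
  "carrier (snd (ctensor k S T)) = carrier (tensor k (snd S) (snd T))"
  "tensor k (fst (ctensor k S T)) V = tensor k (tensor k (fst S) (fst T)) V"
  "tensor k (snd (ctensor k S T)) V = tensor k (tensor k (snd S) (snd T)) V"
  "tensor k V (fst (ctensor k S T)) = tensor k V (tensor k (fst S) (fst T))"
  "tensor k V (snd (ctensor k S T)) = tensor k V (tensor k (snd S) (snd T))"
  by (simp_all add: ctensor_def)

text \<open>The common part of both enriched categories. The hypotheses \<open>uniq3\<close>,
  \<open>uniql\<close> and \<open>uniqr\<close> say that structure maps separate morphisms; they are
  three because the sources in the associativity law and the two unit laws have three different
  types, and a hypothesis cannot be polymorphic. The predicates \<open>small3\<close>,
  \<open>smalll\<close> and \<open>smallr\<close> stand for the size restriction on these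
  sources.\<close>

lemma enriched_categoryI:
  fixes k :: "('k,'r) ring_scheme" and hm :: "'i \<Rightarrow> 'i \<Rightarrow> ('k,'c,'x) cobj"
    and AA :: "'i \<Rightarrow> ('k,'a,'p) module_scheme" and MM :: "'i \<Rightarrow> ('k,'m,'q) module_scheme"
    and ev :: "'i \<Rightarrow> 'i \<Rightarrow> ('c \<Rightarrow> 'a \<Rightarrow> 'a) \<times> ('x \<Rightarrow> 'm \<Rightarrow> 'm)"
  assumes k: "cring k"
    and hm: "\<And>u v. u \<in> Ob \<Longrightarrow> v \<in> Ob \<Longrightarrow> cobj k (hm u v)"
    and AA: "\<And>u. u \<in> Ob \<Longrightarrow> module k (AA u)" and MM: "\<And>u. u \<in> Ob \<Longrightarrow> module k (MM u)"
    and ev: "\<And>u v. u \<in> Ob \<Longrightarrow> v \<in> Ob \<Longrightarrow> lin k (fst (hm u v)) (hom_space k (AA u) (AA v)) (fst (ev u v)) \<and>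
      lin k (snd (hm u v)) (hom_space k (MM u) (MM v)) (snd (ev u v))"
    and comp: "\<And>u v w. u \<in> Ob \<Longrightarrow> v \<in> Ob \<Longrightarrow> w \<in> Ob \<Longrightarrow> \<exists>m. cmor k (ctensor k (hm v w) (hm u v)) (hm u w) m \<and>
      (\<forall>q \<in> carrier (fst (hm v w)). \<forall>p \<in> carrier (fst (hm u v)).
           fst (ev u w) (fst m (tens k (fst (hm v w)) (fst (hm u v)) q p)) =
           compose (carrier (AA u)) (fst (ev v w) q) (fst (ev u v) p)) \<and>
      (\<forall>q \<in> carrier (snd (hm v w)). \<forall>p \<in> carrier (snd (hm u v)).
           snd (ev u w) (snd m (tens k (snd (hm v w)) (snd (hm u v)) q p)) =
           compose (carrier (MM u)) (snd (ev v w) q) (snd (ev u v) p))"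
    and ident: "\<And>u. u \<in> Ob \<Longrightarrow> \<exists>m. cmor k (cunit k) (hm u u) m \<and>
      fst (ev u u) (fst m \<one>\<^bsub>k\<^esub>) = (\<lambda>a \<in> carrier (AA u). a) \<and> snd (ev u u) (snd m \<one>\<^bsub>k\<^esub>) = (\<lambda>a \<in> carrier (MM u). a)"
    and uniq3: "\<And>u v (S :: ('k, ('k,('k,'c,'c) tensor,'c) tensor, ('k,('k,'x,'x) tensor,'x) tensor) cobj) m n.
      u \<in> Ob \<Longrightarrow> v \<in> Ob \<Longrightarrow> small3 S \<Longrightarrow> cobj k S \<Longrightarrow> cmor k S (hm u v) m \<Longrightarrow> cmor k S (hm u v) n \<Longrightarrow>
      (\<And>c. c \<in> carrier (fst S) \<Longrightarrow> fst (ev u v) (fst m c) = fst (ev u v) (fst n c)) \<Longrightarrow>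
      (\<And>x. x \<in> carrier (snd S) \<Longrightarrow> snd (ev u v) (snd m x) = snd (ev u v) (snd n x)) \<Longrightarrow> m = n"
    and uniql: "\<And>u v (S :: ('k, ('k,'k,'c) tensor, ('k,'k,'x) tensor) cobj) m n.
      u \<in> Ob \<Longrightarrow> v \<in> Ob \<Longrightarrow> smalll S \<Longrightarrow> cobj k S \<Longrightarrow> cmor k S (hm u v) m \<Longrightarrow> cmor k S (hm u v) n \<Longrightarrow>
      (\<And>c. c \<in> carrier (fst S) \<Longrightarrow> fst (ev u v) (fst m c) = fst (ev u v) (fst n c)) \<Longrightarrow>
      (\<And>x. x \<in> carrier (snd S) \<Longrightarrow> snd (ev u v) (snd m x) = snd (ev u v) (snd n x)) \<Longrightarrow> m = n"
    and uniqr: "\<And>u v (S :: ('k, ('k,'c,'k) tensor, ('k,'x,'k) tensor) cobj) m n.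
      u \<in> Ob \<Longrightarrow> v \<in> Ob \<Longrightarrow> smallr S \<Longrightarrow> cobj k S \<Longrightarrow> cmor k S (hm u v) m \<Longrightarrow> cmor k S (hm u v) n \<Longrightarrow>
      (\<And>c. c \<in> carrier (fst S) \<Longrightarrow> fst (ev u v) (fst m c) = fst (ev u v) (fst n c)) \<Longrightarrow>
      (\<And>x. x \<in> carrier (snd S) \<Longrightarrow> snd (ev u v) (snd m x) = snd (ev u v) (snd n x)) \<Longrightarrow> m = n"
    and small: "\<And>u v w z. u \<in> Ob \<Longrightarrow> v \<in> Ob \<Longrightarrow> w \<in> Ob \<Longrightarrow> z \<in> Ob \<Longrightarrow> small3 (ctensor k (ctensor k (hm w z) (hm v w)) (hm u v))"
      "\<And>u v. u \<in> Ob \<Longrightarrow> v \<in> Ob \<Longrightarrow> smalll (ctensor k (cunit k) (hm u v))"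
      "\<And>u v. u \<in> Ob \<Longrightarrow> v \<in> Ob \<Longrightarrow> smallr (ctensor k (hm u v) (cunit k))"
  shows "\<exists>cmp idn. comodule_enriched_category k Ob hm cmp idn \<and>
    induced_by_composition k Ob (\<lambda>u. (carrier (AA u), carrier (MM u))) hm ev cmp idn"
proof -
  define cmp where "cmp u v w = (SOME m. cmor k (ctensor k (hm v w) (hm u v)) (hm u w) m \<and>
      (\<forall>q \<in> carrier (fst (hm v w)). \<forall>p \<in> carrier (fst (hm u v)).
           fst (ev u w) (fst m (tens k (fst (hm v w)) (fst (hm u v)) q p)) =
           compose (carrier (AA u)) (fst (ev v w) q) (fst (ev u v) p)) \<and>
      (\<forall>q \<in> carrier (snd (hm v w)). \<forall>p \<in> carrier (snd (hm u v)).
           snd (ev u w) (snd m (tens k (snd (hm v w)) (snd (hm u v)) q p)) =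
           compose (carrier (MM u)) (snd (ev v w) q) (snd (ev u v) p)))" for u v w
  define idn where "idn u = (SOME m. cmor k (cunit k) (hm u u) m \<and>
      fst (ev u u) (fst m \<one>\<^bsub>k\<^esub>) = (\<lambda>a \<in> carrier (AA u). a) \<and> snd (ev u u) (snd m \<one>\<^bsub>k\<^esub>) = (\<lambda>a \<in> carrier (MM u). a))" for u
  note cmp = someI_ex[OF comp, folded cmp_def]
  note idn = someI_ex[OF ident, folded idn_def]
  note c = cmp[THEN conjunct1] and i = idn[THEN conjunct1]
  have cE: "fst (ev u w) (fst (cmp u v w) (tens k (fst (hm v w)) (fst (hm u v)) q p)) =
           compose (carrier (AA u)) (fst (ev v w) q) (fst (ev u v) p)"
    if "u \<in> Ob" "v \<in> Ob" "w \<in> Ob" "q \<in> carrier (fst (hm v w))" "p \<in> carrier (fst (hm u v))" for u v w q p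
    using cmp[OF that(1-3)] that by blast
  have cE': "snd (ev u w) (snd (cmp u v w) (tens k (snd (hm v w)) (snd (hm u v)) q p)) =
           compose (carrier (MM u)) (snd (ev v w) q) (snd (ev u v) p)"
    if "u \<in> Ob" "v \<in> Ob" "w \<in> Ob" "q \<in> carrier (snd (hm v w))" "p \<in> carrier (snd (hm u v))" for u v w q p
    using cmp[OF that(1-3)] that by blast
  note hT = cobj_tensor[OF hm hm] 
  have lc: "lin k (tensor k (fst (hm v w)) (fst (hm u v))) (fst (hm u w)) (fst (cmp u v w))"
    "lin k (tensor k (snd (hm v w)) (snd (hm u v))) (snd (hm u w)) (snd (cmp u v w))"
    if "u \<in> Ob" "v \<in> Ob" "w \<in> Ob" for u v w
    using cmorD(3,4)[OF c[OF that] hT hm] that by (simp_all add: ctensor_def)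
  have li: "lin k (ground_space k) (fst (hm u u)) (fst (idn u))" "lin k (ground_space k) (snd (hm u u)) (snd (idn u))"
    if "u \<in> Ob" for u
    using cmorD(3,4)[OF i[OF that] cobj_unit[OF k] hm] that by (simp_all add: cunit_def)
  note m = cobjD(3,4)[OF hm]
  note cid = cmor_id[OF hm]
  have "comodule_enriched_category k Ob hm cmp idn"
  proof (rule comodule_enriched_category.intro)
    fix u v w z assume o: "u \<in> Ob" "v \<in> Ob" "w \<in> Ob" "z \<in> Ob"
    let ?S = "ctensor k (ctensor k (hm w z) (hm v w)) (hm u v)"
    let ?m = "ctensor_mor k (ctensor k (hm w z) (hm v w)) (hm u v) (hm v z) (hm u v) (cmp v w z) (cid (hm u v))"
    let ?n = "ctensor_mor k (hm w z) (ctensor k (hm v w) (hm u v)) (hm w z) (hm u w) (cid (hm w z)) (cmp u v w)"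
    have S: "cobj k ?S" by (intro cobj_tensor hm o)
    have m1: "cmor k ?S (ctensor k (hm v z) (hm u v)) ?m"
      by (intro cmor_tensor c cid o hT hm)
    have m2: "cmor k (ctensor k (hm w z) (ctensor k (hm v w) (hm u v))) (ctensor k (hm w z) (hm u w)) ?n"
      by (intro cmor_tensor c cid o hT hm)
    have m3: "cmor k ?S (ctensor k (hm w z) (hm u w)) (ccomp ?S ?n (cassoc k (hm w z) (hm v w) (hm u v)))"
      by (rule cmor_comp[OF cmor_assoc m2]) (intro hm o cobj_tensor)+
    show "ccomp ?S (cmp u v z) ?m = ccomp ?S (cmp u w z) (ccomp ?S ?n (cassoc k (hm w z) (hm v w) (hm u v)))"
    proof (rule uniq3[OF o(1,4)])
      show "cmor k ?S (hm u z) (ccomp ?S (cmp u v z) ?m)"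
        by (rule cmor_comp[OF m1 c]) (intro o S hT hm)+
      show "cmor k ?S (hm u z) (ccomp ?S (cmp u w z) (ccomp ?S ?n (cassoc k (hm w z) (hm v w) (hm u v))))"
        by (rule cmor_comp[OF m3 c]) (intro o S hT hm)+
      fix t assume t: "t \<in> carrier (fst ?S)"
      then show "fst (ev u z) (fst (ccomp ?S (cmp u v z) ?m) t) =
          fst (ev u z) (fst (ccomp ?S (cmp u w z) (ccomp ?S ?n (cassoc k (hm w z) (hm v w) (hm u v)))) t)"
        using composite_assoc[OF m(1)[OF o(3,4)] m(1)[OF o(2,3)] m(1)[OF o(1,2)] AA[OF o(1)] AA[OF o(2)] AA[OF o(3)] AA[OF o(4)]
          ev[OF o(3,4), THEN conjunct1] ev[OF o(2,3), THEN conjunct1] ev[OF o(1,2), THEN conjunct1]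
          ev[OF o(2,4), THEN conjunct1] ev[OF o(1,3), THEN conjunct1] ev[OF o(1,4), THEN conjunct1]
          lc(1)[OF o(2,3,4)] lc(1)[OF o(1,2,4)] lc(1)[OF o(1,2,3)] lc(1)[OF o(1,3,4)], OF cE[OF o(2,3,4)] cE[OF o(1,2,4)] cE[OF o(1,2,3)] cE[OF o(1,3,4)], of t] o
        by (simp add: ccomp_apply ctensor_mor_def cid_def cassoc_def ctensor_def)
    next
      fix t assume t: "t \<in> carrier (snd ?S)"
      then show "snd (ev u z) (snd (ccomp ?S (cmp u v z) ?m) t) =
          snd (ev u z) (snd (ccomp ?S (cmp u w z) (ccomp ?S ?n (cassoc k (hm w z) (hm v w) (hm u v)))) t)"
        using composite_assoc[OF m(2)[OF o(3,4)] m(2)[OF o(2,3)] m(2)[OF o(1,2)] MM[OF o(1)] MM[OF o(2)] MM[OF o(3)] MM[OF o(4)]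
          ev[OF o(3,4), THEN conjunct2] ev[OF o(2,3), THEN conjunct2] ev[OF o(1,2), THEN conjunct2]
          ev[OF o(2,4), THEN conjunct2] ev[OF o(1,3), THEN conjunct2] ev[OF o(1,4), THEN conjunct2]
          lc(2)[OF o(2,3,4)] lc(2)[OF o(1,2,4)] lc(2)[OF o(1,2,3)] lc(2)[OF o(1,3,4)], OF cE'[OF o(2,3,4)] cE'[OF o(1,2,4)] cE'[OF o(1,2,3)] cE'[OF o(1,3,4)], of t] o
        by (simp add: ccomp_apply ctensor_mor_def cid_def cassoc_def ctensor_def)
    qed (intro S small o)+
  next
    fix u v assume o: "u \<in> Ob" "v \<in> Ob"
    let ?S = "ctensor k (cunit k) (hm u v)"
    let ?m = "ctensor_mor k (cunit k) (hm u v) (hm v v) (hm u v) (idn v) (cid (hm u v))"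
    have S: "cobj k ?S" by (intro cobj_tensor cobj_unit k hm o)
    have m1: "cmor k ?S (ctensor k (hm v v) (hm u v)) ?m"
      by (intro cmor_tensor i cid o hm cobj_unit k)
    show "ccomp ?S (cmp u v v) ?m = clunit k (hm u v)"
    proof (rule uniql[OF o])
      show "cmor k ?S (hm u v) (ccomp ?S (cmp u v v) ?m)"
        by (rule cmor_comp[OF m1 c]) (intro o S hT hm)+
      show "cmor k ?S (hm u v) (clunit k (hm u v))" by (intro cmor_unit hm o)
      fix t assume t: "t \<in> carrier (fst ?S)"
      then show "fst (ev u v) (fst (ccomp ?S (cmp u v v) ?m) t) = fst (ev u v) (fst (clunit k (hm u v)) t)"
        using composite_unit(1)[OF m(1)[OF o] AA[OF o(1)] AA[OF o(2)]
          ev[OF o, THEN conjunct1] ev[OF o(1,1), THEN conjunct1] ev[OF o(2,2), THEN conjunct1]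
          li(1)[OF o(1)] li(1)[OF o(2)] lc(1)[OF o(1,2,2)] lc(1)[OF o(1,1,2)], OF cE[OF o(1,2,2)] cE[OF o(1,1,2)] idn[OF o(1), THEN conjunct2, THEN conjunct1] idn[OF o(2), THEN conjunct2, THEN conjunct1], of t] o
        by (simp add: ccomp_apply ctensor_mor_def cid_def clunit_def ctensor_def cunit_def)
    next
      fix t assume t: "t \<in> carrier (snd ?S)"
      then show "snd (ev u v) (snd (ccomp ?S (cmp u v v) ?m) t) = snd (ev u v) (snd (clunit k (hm u v)) t)"
        using composite_unit(1)[OF m(2)[OF o] MM[OF o(1)] MM[OF o(2)]
          ev[OF o, THEN conjunct2] ev[OF o(1,1), THEN conjunct2] ev[OF o(2,2), THEN conjunct2]
          li(2)[OF o(1)] li(2)[OF o(2)] lc(2)[OF o(1,2,2)] lc(2)[OF o(1,1,2)], OF cE'[OF o(1,2,2)] cE'[OF o(1,1,2)] idn[OF o(1), THEN conjunct2, THEN conjunct2] idn[OF o(2), THEN conjunct2, THEN conjunct2], of t] o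
        by (simp add: ccomp_apply ctensor_mor_def cid_def clunit_def ctensor_def cunit_def)
    qed (intro S small o)+
  next
    fix u v assume o: "u \<in> Ob" "v \<in> Ob"
    let ?S = "ctensor k (hm u v) (cunit k)"
    let ?m = "ctensor_mor k (hm u v) (cunit k) (hm u v) (hm u u) (cid (hm u v)) (idn u)"
    have S: "cobj k ?S" by (intro cobj_tensor cobj_unit k hm o)
    have m1: "cmor k ?S (ctensor k (hm u v) (hm u u)) ?m"
      by (intro cmor_tensor i cid o hm cobj_unit k)
    show "ccomp ?S (cmp u u v) ?m = crunit k (hm u v)"
    proof (rule uniqr[OF o])
      show "cmor k ?S (hm u v) (ccomp ?S (cmp u u v) ?m)"
        by (rule cmor_comp[OF m1 c]) (intro o S hT hm)+
      show "cmor k ?S (hm u v) (crunit k (hm u v))" by (intro cmor_unit hm o)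
      fix t assume t: "t \<in> carrier (fst ?S)"
      then show "fst (ev u v) (fst (ccomp ?S (cmp u u v) ?m) t) = fst (ev u v) (fst (crunit k (hm u v)) t)"
        using composite_unit(2)[OF m(1)[OF o] AA[OF o(1)] AA[OF o(2)]
          ev[OF o, THEN conjunct1] ev[OF o(1,1), THEN conjunct1] ev[OF o(2,2), THEN conjunct1]
          li(1)[OF o(1)] li(1)[OF o(2)] lc(1)[OF o(1,2,2)] lc(1)[OF o(1,1,2)], OF cE[OF o(1,2,2)] cE[OF o(1,1,2)] idn[OF o(1), THEN conjunct2, THEN conjunct1] idn[OF o(2), THEN conjunct2, THEN conjunct1], of t] o
        by (simp add: ccomp_apply ctensor_mor_def cid_def crunit_def ctensor_def cunit_def)
    next
      fix t assume t: "t \<in> carrier (snd ?S)"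
      then show "snd (ev u v) (snd (ccomp ?S (cmp u u v) ?m) t) = snd (ev u v) (snd (crunit k (hm u v)) t)"
        using composite_unit(2)[OF m(2)[OF o] MM[OF o(1)] MM[OF o(2)]
          ev[OF o, THEN conjunct2] ev[OF o(1,1), THEN conjunct2] ev[OF o(2,2), THEN conjunct2]
          li(2)[OF o(1)] li(2)[OF o(2)] lc(2)[OF o(1,2,2)] lc(2)[OF o(1,1,2)], OF cE'[OF o(1,2,2)] cE'[OF o(1,1,2)] idn[OF o(1), THEN conjunct2, THEN conjunct2] idn[OF o(2), THEN conjunct2, THEN conjunct2], of t] o
        by (simp add: ccomp_apply ctensor_mor_def cid_def crunit_def ctensor_def cunit_def)
    qed (intro S small o)+
  qed (intro hm c i; assumption)+
  moreover have "induced_by_composition k Ob (\<lambda>u. (carrier (AA u), carrier (MM u))) hm ev cmp idn"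
    unfolding induced_by_composition_def using cE cE' idn by auto
  ultimately show ?thesis by blast
qed

section \<open>Measurings\<close>

lemma k_algebra_module [simp]: "k_algebra k A \<Longrightarrow> module k A"
  by (simp add: k_algebra_def)

lemma k_algebra_one [simp]: "k_algebra k A \<Longrightarrow> \<one>\<^bsub>A\<^esub> \<in> carrier A"
  by (simp add: k_algebra_def ring.ring_simprules)

lemma k_algebra_bilin: "k_algebra k A \<Longrightarrow> bilin k A A A (mult A)"
  by (intro bilinI linI) (simp_all add: k_algebra_def ring.ring_simprules)

lemmas k_algebra_lin [simp] = bilin_lin[OF k_algebra_bilin]

lemma left_module_module: "left_module k A M \<Longrightarrow> module k M"
  by (simp add: left_module_def)

lemma left_module_bilin: "k_algebra k A \<Longrightarrow> left_module k A M \<Longrightarrow> bilin k A M M (act M)"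
  by (intro bilinI linI) (simp_all add: left_module_def)

lemmas left_module_lin = bilin_lin[OF left_module_bilin]

lemma measures_alg_bilin:
  assumes "measures_alg k A B H \<rho>" "coalgebra k H" "module k A" "module k B"
  shows "bilin k H A B \<rho>" "\<rho> \<in> extensional (carrier H)" "h \<in> carrier H \<Longrightarrow> \<rho> h \<in> extensional (carrier A)"
  using assms by (auto simp: measures_alg_def Lin_hom_iff)

lemma measures_coalg_bilin:
  assumes "measures_coalg k H K L \<sigma>" "coalgebra k H" "coalgebra k K" "coalgebra k L"
  shows "bilin k L H K \<sigma>" "\<sigma> \<in> extensional (carrier L)" "l \<in> carrier L \<Longrightarrow> \<sigma> l \<in> extensional (carrier H)"
  using assms by (auto simp: measures_coalg_def Lin_hom_iff)

lemma measures_mod_bilin: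
  assumes "measures_mod k A M N H \<rho> X \<gamma>" "comodule k H X" "module k M" "module k N"
  shows "bilin k X M N \<gamma>" "\<gamma> \<in> extensional (carrier X)" "x \<in> carrier X \<Longrightarrow> \<gamma> x \<in> extensional (carrier M)"
  using assms comodule_module[OF assms(2)] by (auto simp: measures_mod_def Lin_hom_iff)

lemma measures_comod_bilin:
  assumes "measures_comod k H X K Y P \<pi> Z \<theta>" "comodule k H X" "comodule k K Y" "comodule k P Z"
  shows "bilin k Z X Y \<theta>" "\<theta> \<in> extensional (carrier Z)" "z \<in> carrier Z \<Longrightarrow> \<theta> z \<in> extensional (carrier X)"
  using assms comodule_module[OF assms(2)] comodule_module[OF assms(3)] comodule_module[OF assms(4)]
  by (auto simp: measures_comod_def Lin_hom_iff)

lemma measures_algI: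
  assumes "module k H" "module k A" "module k B" "bilin k H A B \<rho>" "\<rho> \<in> extensional (carrier H)"
    "\<And>h. h \<in> carrier H \<Longrightarrow> \<rho> h \<in> extensional (carrier A)"
    "\<And>h a a'. h \<in> carrier H \<Longrightarrow> a \<in> carrier A \<Longrightarrow> a' \<in> carrier A \<Longrightarrow>
        \<rho> h (a \<otimes>\<^bsub>A\<^esub> a') = tlift k H H B (\<lambda>x y. \<rho> x a \<otimes>\<^bsub>B\<^esub> \<rho> y a') (comult H h)"
    "\<And>h. h \<in> carrier H \<Longrightarrow> \<rho> h \<one>\<^bsub>A\<^esub> = counit H h \<odot>\<^bsub>B\<^esub> \<one>\<^bsub>B\<^esub>"
  shows "measures_alg k A B H \<rho>"
  unfolding measures_alg_def Lin_hom_iff[OF assms(1-3)] using assms by blast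

lemma measures_modI:
  assumes "module k X" "module k M" "module k N" "bilin k X M N \<gamma>" "\<gamma> \<in> extensional (carrier X)"
    "\<And>x. x \<in> carrier X \<Longrightarrow> \<gamma> x \<in> extensional (carrier M)"
    "\<And>x a m. x \<in> carrier X \<Longrightarrow> a \<in> carrier A \<Longrightarrow> m \<in> carrier M \<Longrightarrow>
        \<gamma> x (act M a m) = tlift k H X N (\<lambda>h y. act N (\<rho> h a) (\<gamma> y m)) (coact X x)"
  shows "measures_mod k A M N H \<rho> X \<gamma>"
  unfolding measures_mod_def Lin_hom_iff[OF assms(1-3)] using assms by blast

lemma measures_comodI:
  assumes "module k Z" "module k X" "module k Y" "bilin k Z X Y \<theta>" "\<theta> \<in> extensional (carrier Z)"
    "\<And>x. x \<in> carrier Z \<Longrightarrow> \<theta> x \<in> extensional (carrier X)"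
    "\<And>z x. z \<in> carrier Z \<Longrightarrow> x \<in> carrier X \<Longrightarrow>
        coact Y (\<theta> z x) =
        tlift k P Z (tensor k K Y)
          (\<lambda>p w. tlift k H X (tensor k K Y) (\<lambda>h y. tens k K Y (\<pi> p h) (\<theta> w y)) (coact X x))
          (coact Z z)"
  shows "measures_comod k H X K Y P \<pi> Z \<theta>"
  unfolding measures_comod_def Lin_hom_iff[OF assms(1-3)] using assms by blast

definition self_module :: "('k,'a) module \<Rightarrow> ('k,'a,'a) alg_module" where
  "self_module A = module.extend (module.truncate A) (alg_module.fields (mult A))"

lemma act_self_module [simp]: "act (self_module A) = mult A"
  by (simp add: self_module_def module.defs alg_module.defs)

lemma sp_self_module: "sp (self_module A) = sp A"
  by (simp add: self_module_def module.defs alg_module.defs sp_def)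

lemmas [simp] = sp_eqs[OF sp_self_module]

lemma left_module_self [simp]: "k_algebra k A \<Longrightarrow> left_module k A (self_module A)"
  by (simp add: left_module_def k_algebra_def ring.ring_simprules monoid.m_assoc[OF ring.is_monoid])

text \<open>Algebras and coalgebras are modules and comodules over themselves, which reduces statements
  about their measurings to those for modules and comodules.\<close>

lemma measures_alg_iff:
  "measures_alg k A B H \<rho> \<longleftrightarrow> measures_mod k A (self_module A) (self_module B) H \<rho> (regular H) \<rho> \<and>
    (\<forall>h \<in> carrier H. \<rho> h \<one>\<^bsub>A\<^esub> = counit H h \<odot>\<^bsub>B\<^esub> \<one>\<^bsub>B\<^esub>)"
  by (simp add: measures_alg_def measures_mod_def conj_assoc)

text \<open>The comultiplication part of the coalgebra map condition is
  \<open>comodule_map_tensor_iff\<close> for regular comodules; the counit part is compared on pure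
  tensors.\<close>

lemma measures_coalg_iff:
  assumes H [simp]: "coalgebra k H" and K [simp]: "coalgebra k K" and L [simp]: "coalgebra k L"
  shows "measures_coalg k H K L \<sigma> \<longleftrightarrow> measures_comod k H (regular H) K (regular K) L \<sigma> (regular L) \<sigma> \<and>
    (\<forall>l \<in> carrier L. \<forall>h \<in> carrier H. counit K (\<sigma> l h) = counit L l \<otimes>\<^bsub>k\<^esub> counit H h)"
proof (cases "\<sigma> \<in> Lin k L (hom_space k H K)")
  case True
  then have b [simp]: "bilin k L H K \<sigma>" by (simp add: Lin_hom_iff)
  have "counit K (tlift k L H K \<sigma> t) = counit (tensor_coalg k L H) t"
    if "\<forall>l \<in> carrier L. \<forall>h \<in> carrier H. counit K (\<sigma> l h) = counit L l \<otimes>\<^bsub>k\<^esub> counit H h" and t: "t \<in> carrier (tensor k L H)" for t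
    by (rule tensor_lin_eq[OF _ _ _ _ _ t, where U = "ground_space k"])
      (use that(1) in \<open>simp_all add: counit_tensor_lin tlift_lin\<close>)
  moreover have "counit K (\<sigma> l h) = counit L l \<otimes>\<^bsub>k\<^esub> counit H h"
    if "\<forall>t \<in> carrier (tensor k L H). counit K (tlift k L H K \<sigma> t) = counit (tensor_coalg k L H) t"
      "l \<in> carrier L" "h \<in> carrier H" for l h
    using bspec[OF that(1), of "tens k L H l h"] that(2,3) by simp
  ultimately have "(\<forall>t \<in> carrier (tensor k L H). counit K (tlift k L H K \<sigma> t) = counit (tensor_coalg k L H) t) \<longleftrightarrow>
    (\<forall>l \<in> carrier L. \<forall>h \<in> carrier H. counit K (\<sigma> l h) = counit L l \<otimes>\<^bsub>k\<^esub> counit H h)" by blast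
  then show ?thesis
    using True comodule_map_tensor_iff[OF H K L coalgebra_regular[OF H] coalgebra_regular[OF K] coalgebra_regular[OF L], of \<sigma> \<sigma>]
    by (simp add: measures_coalg_def measures_comod_def coalg_map_regular tensor_comod_regular)
qed (simp add: measures_coalg_def measures_comod_def)

subsection \<open>Composition with morphisms\<close>

text \<open>Measurings form a contravariant functor of the measuring object; the universal object
  represents it.\<close>

lemma measures_mod_comp:
  assumes g: "measures_mod k A M N H \<rho> X \<gamma>" and f: "lin k L H f" and \<phi>: "comodule_map_along k L H f Z X \<phi>"
    and r: "bilin k H A B \<rho>" and [simp]: "k_algebra k B" "left_module k B N" "module k M" "coalgebra k H" "coalgebra k L"
      and X [simp]: "comodule k H X" "comodule k L Z"
  shows "measures_mod k A M N L (compose (carrier L) \<rho> f) Z (compose (carrier Z) \<gamma> \<phi>)"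
proof -
  note [simp] = left_module_module[OF \<open>left_module k B N\<close>]
  note b = measures_mod_bilin[OF g, simplified]
  note l = comodule_map_along_lin(1)[OF \<phi>, simplified]
  note [simp] = lin_comp[OF f] lin_comp[OF l] bilin_lin[OF b(1)] bilin_lin[OF r] lin_closed[OF f] lin_closed[OF l]
     lin_module[OF l] left_module_lin[of k B N]
  show ?thesis
    by (rule measures_modI)
      (use g b in \<open>simp_all add: measures_mod_def compose_def tlift_coact_map[OF \<phi>] f\<close>)
qed

lemma measures_comod_comp:
  assumes g: "measures_comod k H X K Y P \<pi> Z \<theta>" and f: "lin k L P f" and \<phi>: "comodule_map_along k L P f W Z \<phi>"
    and p: "bilin k P H K \<pi>" and [simp]: "coalgebra k H" "coalgebra k K" "coalgebra k P" "coalgebra k L"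
    and X [simp]: "comodule k H X" "comodule k K Y" "comodule k P Z" "comodule k L W"
  shows "measures_comod k H X K Y L (compose (carrier L) \<pi> f) W (compose (carrier W) \<theta> \<phi>)"
proof -
  note [simp] = comodule_module[OF X(1)] comodule_module[OF X(2)]
  note b = measures_comod_bilin[OF g, simplified]
  note l = comodule_map_along_lin(1)[OF \<phi>, simplified]
  note [simp] = lin_comp[OF f] lin_comp[OF l] bilin_lin[OF b(1)] bilin_lin[OF p] lin_closed[OF f] lin_closed[OF l]
     lin_module[OF l]
  show ?thesis
    by (rule measures_comodI)
      (use g b in \<open>simp_all add: measures_comod_def compose_def tlift_coact_map[OF \<phi>] f\<close>)
qed

lemma measures_alg_comp:
  assumes r: "measures_alg k A B H \<rho>" and f: "coalg_map k L H f"
    and [simp]: "coalgebra k H" "coalgebra k L" "module k A" "k_algebra k B"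
  shows "measures_alg k A B L (compose (carrier L) \<rho> f)"
proof -
  note l = coalg_map_lin(1)[OF f, simplified]
  have "measures_mod k A (self_module A) (self_module B) L (compose (carrier L) \<rho> f) (regular L) (compose (carrier (regular L)) \<rho> f)"
    by (rule measures_mod_comp[where B = B and H = H and X = "regular H"])
      (use r f l measures_alg_bilin(1)[OF r] in \<open>simp_all add: measures_alg_iff coalg_map_regular coalgebra_regular\<close>)
  then show ?thesis
    using r lin_closed[OF l] by (simp add: measures_alg_iff compose_eq coalg_map_counit[OF f])
qed

lemma measures_coalg_comp:
  assumes r: "measures_coalg k H K L \<sigma>" and f: "coalg_map k L' L f"
    and [simp]: "coalgebra k H" "coalgebra k K" "coalgebra k L" "coalgebra k L'"
  shows "measures_coalg k H K L' (compose (carrier L') \<sigma> f)"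
proof -
  note l = coalg_map_lin(1)[OF f, simplified]
  have "measures_comod k H (regular H) K (regular K) L' (compose (carrier L') \<sigma> f) (regular L') (compose (carrier (regular L')) \<sigma> f)"
    by (rule measures_comod_comp[where P = L and Z = "regular L"])
      (use r f l measures_coalg_bilin(1)[OF r] in \<open>simp_all add: measures_coalg_iff coalg_map_regular coalgebra_regular\<close>)
  then show ?thesis
    using r lin_closed[OF l] by (simp add: measures_coalg_iff compose_eq coalg_map_counit[OF f])
qed

section \<open>Universality with respect to small coalgebras and comodules\<close>

text \<open>Universality is assumed only for test objects with carriers in the type \<open>'u\<close> of the universal
  object.  It follows for all test objects whose carriers inject into \<open>'u\<close>, and these are closed under
  tensor products because \<open>'u\<close> is infinite.\<close>

definition fits :: "'u itself \<Rightarrow> 'v set \<Rightarrow> bool" where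
  "fits u S \<longleftrightarrow> (\<exists>j :: 'v \<Rightarrow> 'u. inj_on j S)"

lemma fits_self: "fits TYPE('u) (S :: 'u set)"
  unfolding fits_def by (rule exI[of _ "\<lambda>x. x"]) simp

lemma infinite_list_inj:
  assumes "infinite (UNIV :: 'u set)" shows "\<exists>e :: 'u list \<Rightarrow> 'u. inj e"
proof -
  have "(card_of ((UNIV :: 'u set) \<times> (UNIV :: 'u set)), card_of (UNIV :: 'u set)) \<in> ordIso"
    by (rule card_of_Times_same_infinite[OF assms])
  then obtain p :: "'u \<times> 'u \<Rightarrow> 'u" where p: "inj p"
    unfolding card_of_ordIso[symmetric] by (auto simp: bij_betw_def)
  obtain n :: "nat \<Rightarrow> 'u" where n: "inj n"
    using assms infinite_countable_subset by blast
  \<comment> \<open>Folding a list with the pairing \<open>p\<close> is injective among lists of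
    equal length, so the final code stores the length, through \<open>n\<close>, as well.\<close>
  define c where "c = rec_list (n 0) (\<lambda>x _ r. p (x, r))"
  have c: "c [] = n 0" "\<And>x xs. c (x # xs) = p (x, c xs)" by (simp_all add: c_def)
  have cc: "length xs = length ys \<Longrightarrow> c xs = c ys \<Longrightarrow> xs = ys" for xs ys
    by (induction xs ys rule: list_induct2) (simp_all add: c inj_eq[OF p])
  have "inj (\<lambda>xs. p (n (length xs), c xs))"
    by (rule injI) (use cc in \<open>simp add: inj_eq[OF p] inj_eq[OF n]\<close>)
  then show ?thesis by blast
qed

text \<open>An element of a tensor product is a finite sum of pure tensors. Choosing one such sum
  for each element injects the carrier into finite lists of pairs, and lists over the infinite type
  \<open>'u\<close> embed into \<open>'u\<close>.\<close>

lemma fits_tensor: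
  assumes inf: "infinite (UNIV :: 'u set)" and [simp]: "module k V" "module k W"
    and "fits TYPE('u) (carrier V)" "fits TYPE('u) (carrier W)"
  shows "fits TYPE('u) (carrier (tensor k V W))"
proof -
  interpret T: module k "tensor k V W" by simp
  obtain i j :: "_ \<Rightarrow> 'u" where i: "inj_on i (carrier V)" and j: "inj_on j (carrier W)"
    using assms by (auto simp: fits_def)
  obtain e :: "'u list \<Rightarrow> 'u" where e: "inj e" using infinite_list_inj[OF inf] by blast
  define F where "F = foldr (\<lambda>(v,w) s. tens k V W v w \<oplus>\<^bsub>tensor k V W\<^esub> s)"
  have Fa: "F xs \<zero>\<^bsub>tensor k V W\<^esub> \<in> carrier (tensor k V W) \<and>
      F (xs @ ys) \<zero>\<^bsub>tensor k V W\<^esub> = F xs \<zero>\<^bsub>tensor k V W\<^esub> \<oplus>\<^bsub>tensor k V W\<^esub> F ys \<zero>\<^bsub>tensor k V W\<^esub>"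
    if "set xs \<subseteq> carrier V \<times> carrier W" "F ys \<zero>\<^bsub>tensor k V W\<^esub> \<in> carrier (tensor k V W)" for xs ys
    using that by (induction xs) (auto simp: F_def T.a_assoc)
  have "\<exists>xs. set xs \<subseteq> carrier V \<times> carrier W \<and> F xs \<zero>\<^bsub>tensor k V W\<^esub> = t" if "t \<in> carrier (tensor k V W)" for t
  proof (rule tensor_induct[OF _ _ that])
    show "\<exists>xs. set xs \<subseteq> carrier V \<times> carrier W \<and> F xs \<zero>\<^bsub>tensor k V W\<^esub> = \<zero>\<^bsub>tensor k V W\<^esub>"
      by (rule exI[of _ "[]"]) (simp add: F_def)
    show "\<exists>xs. set xs \<subseteq> carrier V \<times> carrier W \<and> F xs \<zero>\<^bsub>tensor k V W\<^esub> = tens k V W v w"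
      if "v \<in> carrier V" "w \<in> carrier W" for v w
      by (rule exI[of _ "[(v,w)]"]) (use that in \<open>simp add: F_def\<close>)
    fix s t assume "s \<in> carrier (tensor k V W)" "t \<in> carrier (tensor k V W)"
      "\<exists>xs. set xs \<subseteq> carrier V \<times> carrier W \<and> F xs \<zero>\<^bsub>tensor k V W\<^esub> = s"
      "\<exists>xs. set xs \<subseteq> carrier V \<times> carrier W \<and> F xs \<zero>\<^bsub>tensor k V W\<^esub> = t"
    then obtain xs ys where "set xs \<subseteq> carrier V \<times> carrier W" "F xs \<zero>\<^bsub>tensor k V W\<^esub> = s"
      "set ys \<subseteq> carrier V \<times> carrier W" "F ys \<zero>\<^bsub>tensor k V W\<^esub> = t" by blast
    then show "\<exists>xs. set xs \<subseteq> carrier V \<times> carrier W \<and> F xs \<zero>\<^bsub>tensor k V W\<^esub> = s \<oplus>\<^bsub>tensor k V W\<^esub> t"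
      using Fa[of xs ys] \<open>t \<in> carrier (tensor k V W)\<close> by (intro exI[of _ "xs @ ys"]) auto
  qed simp_all
  then obtain g where g: "\<And>t. t \<in> carrier (tensor k V W) \<Longrightarrow> set (g t) \<subseteq> carrier V \<times> carrier W \<and> F (g t) \<zero>\<^bsub>tensor k V W\<^esub> = t"
    by metis
  define c where "c t = (e (map (i \<circ> fst) (g t)), e (map (j \<circ> snd) (g t)))" for t
  have "inj_on c (carrier (tensor k V W))"
  proof (rule inj_onI)
    fix s t assume s: "s \<in> carrier (tensor k V W)" and t: "t \<in> carrier (tensor k V W)" and "c s = c t"
    then have eq: "map i (map fst (g s)) = map i (map fst (g t))" "map j (map snd (g s)) = map j (map snd (g t))"
      using e by (auto simp: c_def inj_def)
    have "map fst (g s) = map fst (g t)"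
      by (rule map_inj_on[OF eq(1)]) (rule inj_on_subset[OF i], use g[OF s] g[OF t] in auto)
    moreover have "map snd (g s) = map snd (g t)"
      by (rule map_inj_on[OF eq(2)]) (rule inj_on_subset[OF j], use g[OF s] g[OF t] in auto)
    ultimately have "g s = g t" by (metis zip_map_fst_snd)
    then show "s = t" using g s t by metis
  qed
  then have "inj_on (\<lambda>t. e [fst (c t), snd (c t)]) (carrier (tensor k V W))"
    using e by (auto simp: inj_on_def prod_eq_iff dest: injD)
  then show ?thesis unfolding fits_def by blast
qed

text \<open>An isomorphic copy \<open>D\<close> of \<open>H\<close> with carrier in
  \<open>'u\<close> is an admissible test object; both halves of its universal property are carried
  back along the isomorphism.\<close>

lemma universal_alg_small:
  fixes P :: "('k,'u) coalg"
  assumes U: "universal_alg k A B P \<pi>" and [simp]: "module k A" "k_algebra k B" "coalgebra k H"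
    and "fits TYPE('u) (carrier H)" and m: "measures_alg k A B H \<rho>"
  shows "\<exists>!f. coalg_map k H P f \<and> (\<forall>h \<in> carrier H. \<pi> (f h) = \<rho> h)"
proof -
  obtain j :: "_ \<Rightarrow> 'u" where j: "inj_on j (carrier H)" using assms by (auto simp: fits_def)
  define D where "D = transport_coalg k H j"
  define i where "i = the_inv_into (carrier H) j"
  note D [simp] = transport_coalg[OF \<open>coalgebra k H\<close> j, folded D_def i_def]
  have P [simp]: "coalgebra k P" using U by (simp add: universal_alg_def)
  have m': "measures_alg k A B D (compose (carrier D) \<rho> (\<lambda>y \<in> carrier D. i y))"
    by (rule measures_alg_comp[OF m D(3)]) simp_all
  have "\<exists>!f. coalg_map k D P f \<and> (\<forall>h \<in> carrier D. \<pi> (f h) = compose (carrier D) \<rho> (\<lambda>y \<in> carrier D. i y) h)"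
    using U m' D(1) unfolding universal_alg_def by blast
  then obtain f where f: "coalg_map k D P f" "\<And>h. h \<in> carrier D \<Longrightarrow> \<pi> (f h) = compose (carrier D) \<rho> (\<lambda>y \<in> carrier D. i y) h"
    and u: "\<And>f'. coalg_map k D P f' \<Longrightarrow> (\<forall>h \<in> carrier D. \<pi> (f' h) = compose (carrier D) \<rho> (\<lambda>y \<in> carrier D. i y) h) \<Longrightarrow> f' = f"
    by blast
  let ?f = "compose (carrier H) f (\<lambda>x \<in> carrier H. j x)"
  show ?thesis
  proof (rule ex1I[of _ ?f])
    show "coalg_map k H P ?f \<and> (\<forall>h \<in> carrier H. \<pi> (?f h) = \<rho> h)"
      using f(2) by (intro conjI coalg_map_comp[OF D(2) f(1)]) (simp_all add: compose_eq)
    fix g assume g: "coalg_map k H P g \<and> (\<forall>h \<in> carrier H. \<pi> (g h) = \<rho> h)"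
    \<comment> \<open>A competitor \<open>g\<close> on \<open>H\<close> is moved to
      \<open>D\<close>, where it must agree with \<open>f\<close>.\<close>
    have "compose (carrier D) g (\<lambda>y \<in> carrier D. i y) = f"
      using g by (intro u coalg_map_comp[OF D(3)]) (auto simp: compose_eq)
    then have "g h = ?f h" if "h \<in> carrier H" for h
      using that by (auto simp: compose_eq)
    then show "g = ?f"
      using coalg_map_lin(2)[of k H P g] g by (intro extensionalityI[of _ "carrier H"]) auto
  qed
qed

lemma universal_coalg_small:
  fixes P :: "('k,'u) coalg"
  assumes U: "universal_coalg k K L P \<pi>" and [simp]: "coalgebra k K" "coalgebra k L" "coalgebra k H"
    and "fits TYPE('u) (carrier H)" and m: "measures_coalg k K L H \<rho>"
  shows "\<exists>!f. coalg_map k H P f \<and> (\<forall>h \<in> carrier H. \<pi> (f h) = \<rho> h)"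
proof -
  obtain j :: "_ \<Rightarrow> 'u" where j: "inj_on j (carrier H)" using assms by (auto simp: fits_def)
  define D where "D = transport_coalg k H j"
  define i where "i = the_inv_into (carrier H) j"
  note D [simp] = transport_coalg[OF \<open>coalgebra k H\<close> j, folded D_def i_def]
  have P [simp]: "coalgebra k P" using U by (simp add: universal_coalg_def)
  have m': "measures_coalg k K L D (compose (carrier D) \<rho> (\<lambda>y \<in> carrier D. i y))"
    by (rule measures_coalg_comp[OF m D(3)]) simp_all
  have "\<exists>!f. coalg_map k D P f \<and> (\<forall>h \<in> carrier D. \<pi> (f h) = compose (carrier D) \<rho> (\<lambda>y \<in> carrier D. i y) h)"
    using U m' D(1) unfolding universal_coalg_def by blast
  then obtain f where f: "coalg_map k D P f" "\<And>h. h \<in> carrier D \<Longrightarrow> \<pi> (f h) = compose (carrier D) \<rho> (\<lambda>y \<in> carrier D. i y) h"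
    and u: "\<And>f'. coalg_map k D P f' \<Longrightarrow> (\<forall>h \<in> carrier D. \<pi> (f' h) = compose (carrier D) \<rho> (\<lambda>y \<in> carrier D. i y) h) \<Longrightarrow> f' = f"
    by blast
  let ?f = "compose (carrier H) f (\<lambda>x \<in> carrier H. j x)"
  show ?thesis
  proof (rule ex1I[of _ ?f])
    show "coalg_map k H P ?f \<and> (\<forall>h \<in> carrier H. \<pi> (?f h) = \<rho> h)"
      using f(2) by (intro conjI coalg_map_comp[OF D(2) f(1)]) (simp_all add: compose_eq)
    fix g assume g: "coalg_map k H P g \<and> (\<forall>h \<in> carrier H. \<pi> (g h) = \<rho> h)"
    have "compose (carrier D) g (\<lambda>y \<in> carrier D. i y) = f"
      using g by (intro u coalg_map_comp[OF D(3)]) (auto simp: compose_eq)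
    then have "g h = ?f h" if "h \<in> carrier H" for h
      using that by (auto simp: compose_eq)
    then show "g = ?f"
      using coalg_map_lin(2)[of k H P g] g by (intro extensionalityI[of _ "carrier H"]) auto
  qed
qed

text \<open>\<open>push_comod\<close> does two things at once: it regards the
  \<open>C\<close>-comodule \<open>X\<close> as a comodule over \<open>P\<close> and moves its
  carrier along \<open>j\<close>. Maps over \<open>P\<close> from the result correspond to maps
  along \<open>f\<close> from \<open>X\<close>, so testing over \<open>P\<close> is enough.\<close>

lemma push_universal:
  fixes Q :: "('k,'u,'y) comod" and X :: "('k,'c,'x) comod"
  assumes f: "coalg_map k C P f" and [simp]: "coalgebra k C" "coalgebra k P" "comodule k C X" "comodule k P Q"
    and j: "inj_on j (carrier X)"
  defines "Z \<equiv> push_comod k C P f X j"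
  assumes U: "\<exists>!\<phi>. comodule_map_along k P P (\<lambda>p \<in> carrier P. p) Z Q \<phi> \<and>
    (\<forall>z \<in> carrier Z. \<kappa> (\<phi> z) = \<gamma> (the_inv_into (carrier X) j z))"
  shows "\<exists>!\<phi>. comodule_map_along k C P f X Q \<phi> \<and> (\<forall>x \<in> carrier X. \<kappa> (\<phi> x) = \<gamma> x)"
proof -
  define i where "i = the_inv_into (carrier X) j"
  note Z = push_comod[OF f _ _ _ j, folded Z_def i_def, simplified]
  note [simp] = Z(1,4,5) comodule_module[OF \<open>comodule k C X\<close>] comodule_module[OF \<open>comodule k P Q\<close>]
    lin_module(1)[OF Z(3)] lin_closed[OF Z(3)]
  note lf = coalg_map_lin(1)[OF f]
  obtain \<phi> where p: "comodule_map_along k P P (\<lambda>p \<in> carrier P. p) Z Q \<phi>" "\<And>z. z \<in> carrier Z \<Longrightarrow> \<kappa> (\<phi> z) = \<gamma> (i z)"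
    and u: "\<And>\<psi>. comodule_map_along k P P (\<lambda>p \<in> carrier P. p) Z Q \<psi> \<Longrightarrow> (\<forall>z \<in> carrier Z. \<kappa> (\<psi> z) = \<gamma> (i z)) \<Longrightarrow> \<psi> = \<phi>"
    using U unfolding i_def by blast
  let ?\<phi> = "compose (carrier X) \<phi> (\<lambda>x \<in> carrier X. j x)"
  \<comment> \<open>The composite produced below is along the restricted identity after
    \<open>f\<close>; extensionality of \<open>f\<close> identifies that with \<open>f\<close>
    itself.\<close>
  have e: "compose (carrier C) (\<lambda>p \<in> carrier P. p) f = f"
    using coalg_map_lin[OF f] by (intro extensionalityI[of _ "carrier C"]) (auto simp: compose_def lin_closed)
  show ?thesis
  proof (rule ex1I[of _ ?\<phi>])
    have "comodule_map_along k C P (compose (carrier C) (\<lambda>p \<in> carrier P. p) f) X Q ?\<phi>"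
      by (rule comodule_map_along_comp[OF _ _ Z(2) p(1)]) (use lf in simp_all)
    then show "comodule_map_along k C P f X Q ?\<phi> \<and> (\<forall>x \<in> carrier X. \<kappa> (?\<phi> x) = \<gamma> x)"
      using p(2) e by (auto simp: compose_eq)
    fix \<psi> assume s: "comodule_map_along k C P f X Q \<psi> \<and> (\<forall>x \<in> carrier X. \<kappa> (\<psi> x) = \<gamma> x)"
    note l = comodule_map_along_lin[OF s[THEN conjunct1], simplified]
    note [simp] = lin_closed[OF l(1)] lin_comp[OF l(1)] lin_comp[OF Z(3)] 
    have lZ: "lin k Z Q (\<lambda>z. \<psi> (i z))" by (simp add: Z(3))
    have "comodule_map_along k P P (\<lambda>p \<in> carrier P. p) Z Q (\<lambda>z \<in> carrier Z. \<psi> (i z))"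
    proof (rule comodule_map_alongI)
      fix z assume z: "z \<in> carrier Z"
      then have "i z \<in> carrier X" by simp
      then show "coact Q ((\<lambda>z \<in> carrier Z. \<psi> (i z)) z) = tlift k P Z (tensor k P Q)
          (\<lambda>h y. tens k P Q ((\<lambda>p \<in> carrier P. p) h) ((\<lambda>z \<in> carrier Z. \<psi> (i z)) y)) (coact Z z)"
        using z lin_closed[OF lf] by (simp add: comodule_map_along_coact[OF s[THEN conjunct1]] Z(6) del: Z(4))
    qed (simp_all del: Z(4) add: lZ)
    then have eq: "(\<lambda>z \<in> carrier Z. \<psi> (i z)) = \<phi>"
      using s by (intro u) auto
    have "\<psi> x = ?\<phi> x" if "x \<in> carrier X" for x
      using fun_cong[OF eq, of "j x"] that by (simp add: compose_eq)
    then show "\<psi> = ?\<phi>" using l(2) by (intro extensionalityI[of _ "carrier X"]) auto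
  qed
qed

lemma ex1_unique: "\<exists>!x. P x \<Longrightarrow> P a \<Longrightarrow> P b \<Longrightarrow> a = b"
  by blast

text \<open>The comodule component of a morphism is unique relative to its coalgebra component,
  which is found beforehand.\<close>

lemma ex1_pair:
  assumes "\<exists>!f. P f" "\<And>f. P f \<Longrightarrow> \<exists>!g. Q f g"
  shows "\<exists>!m. P (fst m) \<and> Q (fst m) (snd m)"
  using assms by (metis fst_conv snd_conv prod.collapse)

text \<open>Merges the two universal properties into one for objects \<open>(C,X)\<close>: the
  coalgebra map comes from \<open>universal_alg_small\<close>, and the comodule map along it from
  \<open>push_universal\<close>.\<close>

lemma mod_factor:
  fixes P :: "('k,'u) coalg" and S :: "('k,'c,'x) cobj"
  assumes UA: "universal_alg k A B P \<pi>" and UM: "universal_mod k A M B N P \<pi> Q \<kappa>"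
    and [simp]: "k_algebra k A" "k_algebra k B" "left_module k A M" "left_module k B N"
    and S: "cobj k S" "fits TYPE('u) (carrier (fst S))" "fits TYPE('u) (carrier (snd S))"
    and r: "measures_alg k A B (fst S) \<rho>" and g: "measures_mod k A M N (fst S) \<rho> (snd S) \<gamma>"
  shows "\<exists>!m. cmor k S (P, Q) m \<and> (\<forall>c \<in> carrier (fst S). \<pi> (fst m c) = \<rho> c) \<and> (\<forall>x \<in> carrier (snd S). \<kappa> (snd m x) = \<gamma> x)"
proof -
  define C X where "C = fst S" and "X = snd S"
  have C [simp]: "coalgebra k C" and X [simp]: "comodule k C X" using S by (simp_all add: C_def X_def cobj_def)
  have P [simp]: "coalgebra k P" and Q [simp]: "comodule k P Q" and mP: "measures_alg k A B P \<pi>"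
    using UA UM by (simp_all add: universal_alg_def universal_mod_def)
  note [simp] = left_module_module[OF \<open>left_module k A M\<close>] left_module_module[OF \<open>left_module k B N\<close>]
  have ex: "\<exists>!f. coalg_map k C P f \<and> (\<forall>h \<in> carrier C. \<pi> (f h) = \<rho> h)"
    by (rule universal_alg_small[OF UA]) (use S(2) r C in \<open>simp_all add: C_def\<close>)
  have ex': "\<exists>!\<phi>. comodule_map_along k C P f X Q \<phi> \<and> (\<forall>x \<in> carrier X. \<kappa> (\<phi> x) = \<gamma> x)"
    if f: "coalg_map k C P f \<and> (\<forall>h \<in> carrier C. \<pi> (f h) = \<rho> h)" for f
  proof -
    obtain j :: "_ \<Rightarrow> 'u" where j: "inj_on j (carrier X)" using S by (auto simp: fits_def X_def)
    define i where "i = the_inv_into (carrier X) j"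
    define Z where "Z = push_comod k C P f X j"
    note Z = push_comod[OF f[THEN conjunct1] C P X j, folded Z_def i_def]
    note b = measures_mod_bilin[OF g[folded C_def X_def], simplified]
    note c = measures_alg_bilin[OF mP, simplified]
    note [simp] = Z(1) lin_module(1)[OF Z(3)] lin_comp[OF Z(3)] lin_closed[OF Z(3)] bilin_lin[OF b(1)] bilin_lin[OF c(1)]
      left_module_lin[of k B N]
    have "measures_mod k A M N P \<pi> Z (\<lambda>z \<in> carrier Z. \<gamma> (i z))"
      by (rule measures_modI)
        (use b g f in \<open>simp_all add: Z(6) measures_mod_def C_def[symmetric] X_def[symmetric] Z(4)[symmetric] Z(5)\<close>)
    \<comment> \<open>\<open>universal_mod\<close> is tested on the coalgebra \<open>P\<close>
      itself with the identity map, since \<open>Z\<close> is already a comodule over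
      \<open>P\<close> with carrier in \<open>'u\<close>.\<close>
    then have "coalgebra k P \<and> measures_alg k A B P \<pi> \<and> comodule k P Z \<and> measures_mod k A M N P \<pi> Z (\<lambda>z \<in> carrier Z. \<gamma> (i z)) \<and>
        coalg_map k P P (\<lambda>p \<in> carrier P. p) \<and> (\<forall>h \<in> carrier P. \<pi> ((\<lambda>p \<in> carrier P. p) h) = \<pi> h)"
      using mP Z(1) by (simp add: coalg_map_id)
    then have "\<exists>!\<phi>. comodule_map_along k P P (\<lambda>p \<in> carrier P. p) Z Q \<phi> \<and> (\<forall>z \<in> carrier Z. \<kappa> (\<phi> z) = (\<lambda>z \<in> carrier Z. \<gamma> (i z)) z)"
      using UM unfolding universal_mod_def by blast
    then have "\<exists>!\<phi>. comodule_map_along k P P (\<lambda>p \<in> carrier P. p) Z Q \<phi> \<and> (\<forall>z \<in> carrier Z. \<kappa> (\<phi> z) = \<gamma> (i z))"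
      by simp
    then show ?thesis unfolding i_def Z_def by (rule push_universal[OF f[THEN conjunct1] C P X Q j])
  qed
  show ?thesis
    using ex1_pair[OF ex ex'] unfolding cmor_def C_def[symmetric] X_def[symmetric] fst_conv snd_conv
    by (simp add: conj_ac)
qed

lemma comod_factor:
  fixes P :: "('k,'u) coalg" and S :: "('k,'c,'x) cobj"
  assumes UA: "universal_coalg k H K P \<pi>" and UM: "universal_comod k H X K Y P \<pi> Q \<kappa>"
    and [simp]: "coalgebra k H" "coalgebra k K" "comodule k H X" "comodule k K Y"
    and S: "cobj k S" "fits TYPE('u) (carrier (fst S))" "fits TYPE('u) (carrier (snd S))"
    and r: "measures_coalg k H K (fst S) \<rho>" and g: "measures_comod k H X K Y (fst S) \<rho> (snd S) \<gamma>"
  shows "\<exists>!m. cmor k S (P, Q) m \<and> (\<forall>c \<in> carrier (fst S). \<pi> (fst m c) = \<rho> c) \<and> (\<forall>x \<in> carrier (snd S). \<kappa> (snd m x) = \<gamma> x)"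
proof -
  define C W where "C = fst S" and "W = snd S"
  have C [simp]: "coalgebra k C" and W [simp]: "comodule k C W" using S by (simp_all add: C_def W_def cobj_def)
  have P [simp]: "coalgebra k P" and Q [simp]: "comodule k P Q" and mP: "measures_coalg k H K P \<pi>"
    using UA UM by (simp_all add: universal_coalg_def universal_comod_def)
  note [simp] = comodule_module[OF \<open>comodule k H X\<close>] comodule_module[OF \<open>comodule k K Y\<close>]
  have ex: "\<exists>!f. coalg_map k C P f \<and> (\<forall>h \<in> carrier C. \<pi> (f h) = \<rho> h)"
    by (rule universal_coalg_small[OF UA]) (use S(2) r C in \<open>simp_all add: C_def\<close>)
  have ex': "\<exists>!\<phi>. comodule_map_along k C P f W Q \<phi> \<and> (\<forall>x \<in> carrier W. \<kappa> (\<phi> x) = \<gamma> x)"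
    if f: "coalg_map k C P f \<and> (\<forall>h \<in> carrier C. \<pi> (f h) = \<rho> h)" for f
  proof -
    obtain j :: "_ \<Rightarrow> 'u" where j: "inj_on j (carrier W)" using S by (auto simp: fits_def W_def)
    define i where "i = the_inv_into (carrier W) j"
    define Z where "Z = push_comod k C P f W j"
    note Z = push_comod[OF f[THEN conjunct1] C P W j, folded Z_def i_def]
    note b = measures_comod_bilin[OF g[folded C_def W_def], simplified]
    note c = measures_coalg_bilin[OF mP, simplified]
    note [simp] = Z(1) lin_module(1)[OF Z(3)] lin_comp[OF Z(3)] lin_closed[OF Z(3)] bilin_lin[OF b(1)] bilin_lin[OF c(1)]
    have "measures_comod k H X K Y P \<pi> Z (\<lambda>z \<in> carrier Z. \<gamma> (i z))"
      by (rule measures_comodI)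
        (use b g f in \<open>simp_all add: Z(6) measures_comod_def C_def[symmetric] W_def[symmetric] Z(4)[symmetric] Z(5)\<close>)
    then have "\<exists>!\<phi>. comodule_map_along k P P (\<lambda>p \<in> carrier P. p) Z Q \<phi> \<and> (\<forall>z \<in> carrier Z. \<kappa> (\<phi> z) = (\<lambda>z \<in> carrier Z. \<gamma> (i z)) z)"
      using UM Z(1) unfolding universal_comod_def by blast
    then have "\<exists>!\<phi>. comodule_map_along k P P (\<lambda>p \<in> carrier P. p) Z Q \<phi> \<and> (\<forall>z \<in> carrier Z. \<kappa> (\<phi> z) = \<gamma> (i z))"
      by simp
    then show ?thesis unfolding i_def Z_def by (rule push_universal[OF f[THEN conjunct1] C P W Q j])
  qed
  show ?thesis
    using ex1_pair[OF ex ex'] unfolding cmor_def C_def[symmetric] W_def[symmetric] fst_conv snd_conv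
    by (simp add: conj_ac)
qed

text \<open>Pulling the universal measuring back along \<open>m\<close> gives a measuring by
  \<open>S\<close>, and both \<open>m\<close> and \<open>n\<close> are factorizations of it.\<close>

lemma mod_unique:
  fixes P :: "('k,'u) coalg" and S :: "('k,'c,'x) cobj"
  assumes UA: "universal_alg k A B P \<pi>" and UM: "universal_mod k A M B N P \<pi> Q \<kappa>"
    and a [simp]: "k_algebra k A" "k_algebra k B" "left_module k A M" "left_module k B N"
    and S: "cobj k S" "fits TYPE('u) (carrier (fst S))" "fits TYPE('u) (carrier (snd S))"
    and m: "cmor k S (P, Q) m" "cmor k S (P, Q) n"
    and e: "\<And>c. c \<in> carrier (fst S) \<Longrightarrow> \<pi> (fst m c) = \<pi> (fst n c)"
      "\<And>x. x \<in> carrier (snd S) \<Longrightarrow> \<kappa> (snd m x) = \<kappa> (snd n x)"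
  shows "m = n"
proof -
  have P [simp]: "coalgebra k P" and Q [simp]: "comodule k P Q" and mP: "measures_alg k A B P \<pi>" "measures_mod k A M N P \<pi> Q \<kappa>"
    using UA UM by (simp_all add: universal_alg_def universal_mod_def)
  have PQ: "cobj k (P, Q)" by (simp add: cobj_def)
  note [simp] = cobjD[OF S(1)] left_module_module[OF a(3)]
  note c = cmorD[OF m(1) S(1) PQ, simplified]
  have r: "measures_alg k A B (fst S) (compose (carrier (fst S)) \<pi> (fst m))"
    by (rule measures_alg_comp[OF mP(1) c(1)]) simp_all
  have g: "measures_mod k A M N (fst S) (compose (carrier (fst S)) \<pi> (fst m)) (snd S) (compose (carrier (snd S)) \<kappa> (snd m))"
    by (rule measures_mod_comp[OF mP(2) c(3,2) measures_alg_bilin(1)[OF mP(1)]]) simp_all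
  show ?thesis
    by (rule ex1_unique[OF mod_factor[OF UA UM a S r g]]) (use m e in \<open>simp_all add: compose_eq\<close>)
qed

lemma comod_unique:
  fixes P :: "('k,'u) coalg" and S :: "('k,'c,'x) cobj"
  assumes UA: "universal_coalg k H K P \<pi>" and UM: "universal_comod k H X K Y P \<pi> Q \<kappa>"
    and a [simp]: "coalgebra k H" "coalgebra k K" "comodule k H X" "comodule k K Y"
    and S: "cobj k S" "fits TYPE('u) (carrier (fst S))" "fits TYPE('u) (carrier (snd S))"
    and m: "cmor k S (P, Q) m" "cmor k S (P, Q) n"
    and e: "\<And>c. c \<in> carrier (fst S) \<Longrightarrow> \<pi> (fst m c) = \<pi> (fst n c)"
      "\<And>x. x \<in> carrier (snd S) \<Longrightarrow> \<kappa> (snd m x) = \<kappa> (snd n x)"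
  shows "m = n"
proof -
  have P [simp]: "coalgebra k P" and Q [simp]: "comodule k P Q" and mP: "measures_coalg k H K P \<pi>" "measures_comod k H X K Y P \<pi> Q \<kappa>"
    using UA UM by (simp_all add: universal_coalg_def universal_comod_def)
  have PQ: "cobj k (P, Q)" by (simp add: cobj_def)
  note [simp] = cobjD[OF S(1)]
  note c = cmorD[OF m(1) S(1) PQ, simplified]
  have r: "measures_coalg k H K (fst S) (compose (carrier (fst S)) \<pi> (fst m))"
    by (rule measures_coalg_comp[OF mP(1) c(1)]) simp_all
  have g: "measures_comod k H X K Y (fst S) (compose (carrier (fst S)) \<pi> (fst m)) (snd S) (compose (carrier (snd S)) \<kappa> (snd m))"
    by (rule measures_comod_comp[OF mP(2) c(3,2) measures_coalg_bilin(1)[OF mP(1)]]) simp_all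
  show ?thesis
    by (rule ex1_unique[OF comod_factor[OF UA UM a S r g]]) (use m e in \<open>simp_all add: compose_eq\<close>)
qed

section \<open>Composites of measurings and the enriched categories\<close>

text \<open>The measuring that sends \<open>l \<otimes> h\<close> to \<open>\<sigma> l\<close> after
  \<open>\<rho> h\<close>; the restrictions in both arguments are there because measurings have to
  be extensional.\<close>

definition composite ::
    "('k,'r) ring_scheme \<Rightarrow> ('k,'l,'lm) module_scheme \<Rightarrow> ('k,'h,'hm) module_scheme \<Rightarrow> 'a set \<Rightarrow> ('k,'c,'cm) module_scheme \<Rightarrow>
      ('l \<Rightarrow> 'b \<Rightarrow> 'c) \<Rightarrow> ('h \<Rightarrow> 'a \<Rightarrow> 'b) \<Rightarrow> ('k,'l,'h) tensor \<Rightarrow> 'a \<Rightarrow> 'c" where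
  "composite k L H A C \<sigma> \<rho> = (\<lambda>t \<in> carrier (tensor k L H). \<lambda>a \<in> A. tlift k L H C (\<lambda>l h. \<sigma> l (\<rho> h a)) t)"

lemma composite_bilin:
  assumes "bilin k L B C \<sigma>" "bilin k H A B \<rho>"
  shows "bilin k (tensor k L H) A C (composite k L H (carrier A) C \<sigma> \<rho>)"
proof -
  note [simp] = bilin_lin[OF assms(1)] bilin_lin[OF assms(2)] bilin_module[OF assms(1)] bilin_module[OF assms(2)]
  have "bilin k (tensor k L H) A C (\<lambda>t a. tlift k L H C (\<lambda>l h. \<sigma> l (\<rho> h a)) t)" by simp
  then show ?thesis by (rule iffD1[OF bilin_cong, rotated]) (simp add: composite_def)
qed

lemma composite_tens:
  assumes "bilin k L B C \<sigma>" "bilin k H A B \<rho>" "l \<in> carrier L" "h \<in> carrier H"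
  shows "composite k L H (carrier A) C \<sigma> \<rho> (tens k L H l h) = compose (carrier A) (\<sigma> l) (\<rho> h)"
proof -
  note [simp] = bilin_lin[OF assms(1)] bilin_lin[OF assms(2)] bilin_module[OF assms(1)] bilin_module[OF assms(2)]
  show ?thesis using assms(3,4) by (simp add: composite_def compose_def cong: restrict_cong)
qed

lemma composite_ext: "composite k L H A C \<sigma> \<rho> \<in> extensional (carrier (tensor k L H))"
  "t \<in> carrier (tensor k L H) \<Longrightarrow> composite k L H A C \<sigma> \<rho> t \<in> extensional A"
  by (simp_all add: composite_def)

lemma measures_mod_composite:
  assumes g: "measures_mod k B N R L \<sigma> Y \<delta>" and d: "measures_mod k A M N H \<rho> X \<gamma>"
    and s: "bilin k L B C \<sigma>" and r: "bilin k H A B \<rho>"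
    and a [simp]: "coalgebra k H" "coalgebra k L" "k_algebra k A" "k_algebra k B" "k_algebra k C"
       "left_module k A M" "left_module k B N" "left_module k C R"
    and X [simp]: "comodule k H X" "comodule k L Y"
  shows "measures_mod k A M R (tensor_coalg k L H) (composite k L H (carrier A) C \<sigma> \<rho>)
    (tensor_comod k L H Y X) (composite k Y X (carrier M) R \<delta> \<gamma>)"
proof -
  note [simp] = comodule_module[OF X(1)] comodule_module[OF X(2)]
    left_module_module[OF a(6)] left_module_module[OF a(7)] left_module_module[OF a(8)]
  note b = measures_mod_bilin[OF g, simplified] and c = measures_mod_bilin[OF d, simplified]
  note cb = composite_bilin[OF b(1) c(1)] and sb = composite_bilin[OF s r]
  note [simp] = bilin_lin[OF b(1)] bilin_lin[OF c(1)] bilin_lin[OF cb] bilin_lin[OF s] bilin_lin[OF r] bilin_lin[OF sb]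
    left_module_lin[of k A M] left_module_lin[of k B N] left_module_lin[of k C R]
  note [simp] = lin_comp[OF coact_tensor_lin] lin_closed[OF coact_tensor_lin]
  have l: "lin k N R (\<delta> y)" if "y \<in> carrier Y" for y using b(1) that by (simp add: bilin_def)
  have p: "\<delta> l (tlift k H X N \<beta> t) = tlift k H X R (\<lambda>x y. \<delta> l (\<beta> x y)) t"
    if "l \<in> carrier Y" "bilin k H X N \<beta>" "t \<in> carrier (tensor k H X)" for l \<beta> t
    by (rule tlift_push[OF l]) fact+
  \<comment> \<open>Applying \<open>\<gamma>\<close> before \<open>\<delta>\<close> leaves the sum
    over \<open>X\<close> outside; it is interchanged with the sum over \<open>Y\<close> to match
    the coaction on the tensor product of \<open>Y\<close> and \<open>X\<close>.\<close>
  have mult: "\<delta> y (\<gamma> x (act M a m)) = tlift k L Y R (\<lambda>u v. tlift k H X R (\<lambda>h z. act R (\<sigma> u (\<rho> h a)) (\<delta> v (\<gamma> z m))) (coact X x)) (coact Y y)"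
    if [simp]: "y \<in> carrier Y" "x \<in> carrier X" "a \<in> carrier A" "m \<in> carrier M" for y x a m
  proof -
    have "\<delta> y (\<gamma> x (act M a m)) = tlift k H X R (\<lambda>h z. tlift k L Y R (\<lambda>u v. act R (\<sigma> u (\<rho> h a)) (\<delta> v (\<gamma> z m))) (coact Y y)) (coact X x)"
      using d g by (simp add: measures_mod_def p)
    also have "\<dots> = tlift k L Y R (\<lambda>u v. tlift k H X R (\<lambda>h z. act R (\<sigma> u (\<rho> h a)) (\<delta> v (\<gamma> z m))) (coact X x)) (coact Y y)"
      by (rule tlift_swap) simp_all
    finally show ?thesis .
  qed
  show ?thesis
  proof (rule measures_modI)
    fix t a m assume "t \<in> carrier (tensor_comod k L H Y X)" and [simp]: "a \<in> carrier A" "m \<in> carrier M"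
    then have t: "t \<in> carrier (tensor k Y X)" by simp
    have "composite k Y X (carrier M) R \<delta> \<gamma> t (act M a m) =
       tlift k (tensor k L H) (tensor k Y X) R (\<lambda>h y. act R (composite k L H (carrier A) C \<sigma> \<rho> h a) (composite k Y X (carrier M) R \<delta> \<gamma> y m))
         (coact (tensor_comod k L H Y X) t)"
      by (rule tensor_lin_eq[OF _ _ _ _ _ t, where U = R])
        (simp_all add: tlift_coact_tensor composite_tens[OF b(1) c(1)] composite_tens[OF s r] compose_def mult)
    then show "composite k Y X (carrier M) R \<delta> \<gamma> t (act M a m) =
       tlift k (tensor_coalg k L H) (tensor_comod k L H Y X) R (\<lambda>h y. act R (composite k L H (carrier A) C \<sigma> \<rho> h a) (composite k Y X (carrier M) R \<delta> \<gamma> y m))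
         (coact (tensor_comod k L H Y X) t)" by simp
  qed (simp_all add: cb composite_ext)
qed

lemma composite_regular:
  "composite k (regular L) (regular H) A (self_module C) \<sigma> \<rho> = composite k L H A C \<sigma> \<rho>"
  "composite k (regular L) (regular H) A (regular E) \<sigma> \<rho> = composite k L H A E \<sigma> \<rho>"
  by (simp_all add: composite_def)

lemma measures_alg_composite:
  assumes s: "measures_alg k B C L \<sigma>" and r: "measures_alg k A B H \<rho>"
    and [simp]: "coalgebra k H" "coalgebra k L" "k_algebra k A" "k_algebra k B" "k_algebra k C"
  shows "measures_alg k A C (tensor_coalg k L H) (composite k L H (carrier A) C \<sigma> \<rho>)"
proof -
  interpret K: cring k by (rule coalgebra_cring[OF \<open>coalgebra k H\<close>])
  note b = measures_alg_bilin(1)[OF s, simplified] and c = measures_alg_bilin(1)[OF r, simplified]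
  have m: "measures_mod k A (self_module A) (self_module C) (tensor_coalg k L H) (composite k L H (carrier A) C \<sigma> \<rho>)
    (tensor_comod k L H (regular L) (regular H)) (composite k (regular L) (regular H) (carrier (self_module A)) (self_module C) \<sigma> \<rho>)"
    by (rule measures_mod_composite[where N = "self_module B", OF _ _ b c])
      (use s r in \<open>simp_all add: measures_alg_iff coalgebra_regular\<close>)
  note [simp] = bilin_lin[OF b] bilin_lin[OF composite_bilin[OF b c]]
    k_algebra_one[OF \<open>k_algebra k A\<close>] k_algebra_one[OF \<open>k_algebra k B\<close>] k_algebra_one[OF \<open>k_algebra k C\<close>]
  have one: "\<sigma> l (\<rho> h \<one>\<^bsub>A\<^esub>) = (counit L l \<otimes>\<^bsub>k\<^esub> counit H h) \<odot>\<^bsub>C\<^esub> \<one>\<^bsub>C\<^esub>"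
    if [simp]: "l \<in> carrier L" "h \<in> carrier H" for l h
    using r s lin_smult[of k B C "\<sigma> l"] b by (simp add: measures_alg_def bilin_def K.m_comm[of "counit L l" "counit H h"]
      module.smult_assoc1[OF k_algebra_module])
  have "composite k L H (carrier A) C \<sigma> \<rho> t \<one>\<^bsub>A\<^esub> = counit (tensor_coalg k L H) t \<odot>\<^bsub>C\<^esub> \<one>\<^bsub>C\<^esub>"
    if t: "t \<in> carrier (tensor k L H)" for t
    by (rule tensor_lin_eq[OF _ _ _ _ _ t, where U = C])
      (simp_all add: composite_tens[OF b c] compose_def one counit_tensor_lin)
  then show ?thesis using m by (simp add: measures_alg_iff tensor_comod_regular composite_regular)
qed

lemma measures_comod_composite:
  assumes g: "measures_comod k K Y G T L \<sigma> V \<delta>" and d: "measures_comod k H X K Y E \<rho> W \<gamma>"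
    and s: "bilin k L K G \<sigma>" and r: "bilin k E H K \<rho>"
    and [simp]: "coalgebra k H" "coalgebra k K" "coalgebra k G" "coalgebra k L" "coalgebra k E"
    and X [simp]: "comodule k H X" "comodule k K Y" "comodule k G T" "comodule k L V" "comodule k E W"
  shows "measures_comod k H X G T (tensor_coalg k L E) (composite k L E (carrier H) G \<sigma> \<rho>)
    (tensor_comod k L E V W) (composite k V W (carrier X) T \<delta> \<gamma>)"
proof -
  note [simp] = comodule_module[OF X(1)] comodule_module[OF X(2)] comodule_module[OF X(3)] comodule_module[OF X(4)] comodule_module[OF X(5)]
  note b = measures_comod_bilin[OF g, simplified] and c = measures_comod_bilin[OF d, simplified]
  note cb = composite_bilin[OF b(1) c(1)] and sb = composite_bilin[OF s r]
  note [simp] = bilin_lin[OF b(1)] bilin_lin[OF c(1)] bilin_lin[OF cb] bilin_lin[OF s] bilin_lin[OF r] bilin_lin[OF sb]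
  note [simp] = lin_comp[OF coact_tensor_lin] lin_closed[OF coact_tensor_lin]
  have co: "coact T (\<delta> v y) = tlift k L V (tensor k G T) (\<lambda>p w. tlift k K Y (tensor k G T) (\<lambda>h y. tens k G T (\<sigma> p h) (\<delta> w y)) (coact Y y)) (coact V v)"
    if "v \<in> carrier V" "y \<in> carrier Y" for v y
    using g that by (simp add: measures_comod_def)
  \<comment> \<open>The measuring equation for \<open>\<gamma>\<close> under an arbitrary bilinear
    integrand, as required for replacing a coaction that stands inside further sums.\<close>
  have co': "tlift k K Y U \<beta> (coact Y (\<gamma> w x)) = tlift k E W U (\<lambda>p w. tlift k H X U (\<lambda>h y. \<beta> (\<rho> p h) (\<gamma> w y)) (coact X x)) (coact W w)"
    if "w \<in> carrier W" "x \<in> carrier X" and \<beta>: "bilin k K Y U \<beta>" for U :: "('a,'t,'s) module_scheme" and \<beta> w x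
  proof -
    note [simp] = bilin_lin[OF \<beta>] \<beta> bilin_module(3)[OF \<beta>]
    have "coact Y (\<gamma> w x) = tlift k E W (tensor k K Y) (\<lambda>p w. tlift k H X (tensor k K Y) (\<lambda>h y. tens k K Y (\<rho> p h) (\<gamma> w y)) (coact X x)) (coact W w)"
      using d that by (simp add: measures_comod_def)
    then show ?thesis using that by (simp add: tlift_tlift)
  qed
  show ?thesis
  proof (rule measures_comodI)
    fix t x assume "t \<in> carrier (tensor_comod k L E V W)" and [simp]: "x \<in> carrier X"
    then have t: "t \<in> carrier (tensor k V W)" by simp
    have "coact T (composite k V W (carrier X) T \<delta> \<gamma> t x) =
      tlift k (tensor k L E) (tensor k V W) (tensor k G T) (\<lambda>p w. tlift k H X (tensor k G T)
        (\<lambda>h y. tens k G T (composite k L E (carrier H) G \<sigma> \<rho> p h) (composite k V W (carrier X) T \<delta> \<gamma> w y)) (coact X x))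
        (coact (tensor_comod k L E V W) t)"
      by (rule tensor_lin_eq[OF _ _ _ _ _ t, where U = "tensor k G T"])
        (simp_all add: tlift_coact_tensor composite_tens[OF b(1) c(1)] composite_tens[OF s r] compose_def co co')
    then show "coact T (composite k V W (carrier X) T \<delta> \<gamma> t x) =
      tlift k (tensor_coalg k L E) (tensor_comod k L E V W) (tensor k G T) (\<lambda>p w. tlift k H X (tensor k G T)
        (\<lambda>h y. tens k G T (composite k L E (carrier H) G \<sigma> \<rho> p h) (composite k V W (carrier X) T \<delta> \<gamma> w y)) (coact X x))
        (coact (tensor_comod k L E V W) t)" by simp
  qed (simp_all add: cb composite_ext)
qed

lemma measures_coalg_composite:
  assumes s: "measures_coalg k K G L \<sigma>" and r: "measures_coalg k H K E \<rho>"
    and [simp]: "coalgebra k H" "coalgebra k K" "coalgebra k G" "coalgebra k L" "coalgebra k E"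
  shows "measures_coalg k H G (tensor_coalg k L E) (composite k L E (carrier H) G \<sigma> \<rho>)"
proof -
  interpret K: cring k by (rule coalgebra_cring[OF \<open>coalgebra k H\<close>])
  note b = measures_coalg_bilin(1)[OF s, simplified] and c = measures_coalg_bilin(1)[OF r, simplified]
  have m: "measures_comod k H (regular H) G (regular G) (tensor_coalg k L E) (composite k L E (carrier H) G \<sigma> \<rho>)
    (tensor_comod k L E (regular L) (regular E)) (composite k (regular L) (regular E) (carrier (regular H)) (regular G) \<sigma> \<rho>)"
    by (rule measures_comod_composite[where Y = "regular K", OF _ _ b c])
      (use s r in \<open>simp_all add: measures_coalg_iff coalgebra_regular\<close>)
  note [simp] = bilin_lin[OF b] bilin_lin[OF c] bilin_lin[OF composite_bilin[OF b c]]
  have "counit G (composite k L E (carrier H) G \<sigma> \<rho> t h) = counit (tensor_coalg k L E) t \<otimes>\<^bsub>k\<^esub> counit H h"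
    if t: "t \<in> carrier (tensor k L E)" and [simp]: "h \<in> carrier H" for t h
    by (rule tensor_lin_eq[OF _ _ _ _ _ t, where U = "ground_space k"])
      (use s r in \<open>simp_all add: composite_tens[OF b c] compose_def measures_coalg_iff K.m_assoc counit_tensor_lin\<close>)
  then show ?thesis using m by (simp add: measures_coalg_iff tensor_comod_regular composite_regular)
qed

text \<open>A measuring by the ground coalgebra that sends \<open>1\<close> to the identity map. Its
  factorization through the universal object is the identity morphism of the enriched
  category.\<close>

definition scaling :: "('k,'r) ring_scheme \<Rightarrow> ('k,'v,'p) module_scheme \<Rightarrow> 'k \<Rightarrow> 'v \<Rightarrow> 'v" where
  "scaling k V = (\<lambda>c \<in> carrier k. \<lambda>v \<in> carrier V. c \<odot>\<^bsub>V\<^esub> v)"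

lemma scaling_bilin:
  assumes "module k V" shows "bilin k (ground_space k) V V (scaling k V)"
proof -
  interpret module k V by fact
  have k: "cring k" by unfold_locales
  have "bilin k (ground_space k) V V (smult V)"
  proof (rule bilinI)
    show "lin k V V (smult V v)" if "v \<in> carrier (ground_space k)" for v
      using lin_fun_smult[of v k V V "\<lambda>x. x"] that by (simp add: assms)
    show "lin k (ground_space k) V (\<lambda>v. v \<odot>\<^bsub>V\<^esub> w)" if "w \<in> carrier V" for w
      using lin_scalar[of k "ground_space k" "\<lambda>x. x" V w] that by (simp add: assms k)
  qed (simp_all add: assms k)
  then show ?thesis by (rule iffD1[OF bilin_cong, rotated]) (simp add: scaling_def)
qed

lemma scaling_apply: "c \<in> carrier k \<Longrightarrow> v \<in> carrier V \<Longrightarrow> scaling k V c v = c \<odot>\<^bsub>V\<^esub> v"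
  by (simp add: scaling_def)

lemma tlift_scaling: "tlift k (ground_space k) V V (scaling k V) = tlift k (ground_space k) V V (smult V)"
  by (simp add: scaling_def)

lemma scaling_ext: "scaling k V \<in> extensional (carrier k)" "c \<in> carrier k \<Longrightarrow> scaling k V c \<in> extensional (carrier V)"
  by (simp_all add: scaling_def)

lemma scaling_regular: "scaling k (self_module A) = scaling k A" "scaling k (regular H) = scaling k H"
  by (simp_all add: scaling_def)

lemma scaling_one: "module k V \<Longrightarrow> scaling k V \<one>\<^bsub>k\<^esub> = (\<lambda>v \<in> carrier V. v)"
  by (auto simp: scaling_def module.smult_one module_def cring_def ring.ring_simprules intro!: restrict_ext)

lemma measures_scaling_mod:
  assumes A [simp]: "k_algebra k A" and M [simp]: "left_module k A M"
  shows "measures_mod k A M M (ground_coalg k) (scaling k A) (ground_comod k) (scaling k M)"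
proof -
  interpret M: module k M by (rule left_module_module[OF M])
  note [simp] = scaling_apply M.is_cring coact_ground left_module_lin[of k A M] M.module_axioms
  note [simp] = module_smult_closed[OF k_algebra_module[OF A]] bilin_lin[OF scaling_bilin[OF k_algebra_module[OF A]]]
     bilin_lin[OF scaling_bilin[OF M.module_axioms]]
  have m: "act M (c \<odot>\<^bsub>A\<^esub> x) y = c \<odot>\<^bsub>M\<^esub> act M x y" "act M x (c \<odot>\<^bsub>M\<^esub> y) = c \<odot>\<^bsub>M\<^esub> act M x y"
    if "c \<in> carrier k" "x \<in> carrier A" "y \<in> carrier M" for c x y using M that by (simp_all add: left_module_def)
  show ?thesis
    by (rule measures_modI) (simp_all add: scaling_bilin scaling_ext m)
qed

text \<open>This is \<open>comodule_map_unit\<close> read backwards through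
  \<open>comodule_map_tensor_iff\<close>.\<close>

lemma measures_scaling_comod:
  assumes H [simp]: "coalgebra k H" and X [simp]: "comodule k H X"
  shows "measures_comod k H X H X (ground_coalg k) (scaling k H) (ground_comod k) (scaling k X)"
proof -
  interpret X: module k X by (rule comodule_module[OF X])
  note [simp] = X.is_cring X.module_axioms
  show ?thesis
    using comodule_map_tensor_iff[of k H H "ground_coalg k" X X "ground_comod k" "scaling k H" "scaling k X"] comodule_map_unit(1)[OF H X]
    by (simp add: measures_comod_def Lin_hom_iff scaling_bilin scaling_ext tlift_scaling)
qed

lemma measures_scaling_alg:
  assumes A [simp]: "k_algebra k A" shows "measures_alg k A A (ground_coalg k) (scaling k A)"
proof -
  interpret module k A by simp
  show ?thesis
    using measures_scaling_mod[OF A left_module_self[OF A]] k_algebra_one[OF A]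
    by (simp add: measures_alg_iff regular_ground is_cring scaling_regular scaling_apply counit_ground)
qed

lemma measures_scaling_coalg:
  assumes H [simp]: "coalgebra k H" shows "measures_coalg k H H (ground_coalg k) (scaling k H)"
proof -
  interpret module k H by simp
  show ?thesis
    using measures_scaling_comod[OF H coalgebra_regular[OF H]] lin_smult[OF counit_lin[OF H]]
    by (simp add: measures_coalg_iff regular_ground is_cring scaling_regular scaling_apply counit_ground)
qed

section \<open>The enriched category of modules\<close>

lemma modules_enriched:
  fixes k :: "('k,'r) ring_scheme"
    and P :: "('k,'a) module \<Rightarrow> ('k,'a) module \<Rightarrow> ('k,'u) coalg"
    and Q :: "('k,'a) module \<times> ('k,'a,'m) alg_module \<Rightarrow> ('k,'a) module \<times> ('k,'a,'m) alg_module \<Rightarrow> ('k,'u,'u) comod"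
  assumes k: "cring k" and inf: "infinite (UNIV :: 'u set)" and kf: "\<exists>\<iota> :: 'k \<Rightarrow> 'u. inj \<iota>"
    and UA: "\<And>A B. k_algebra k A \<Longrightarrow> k_algebra k B \<Longrightarrow> universal_alg k A B (P A B) (\<pi> A B)"
    and UM: "\<And>A M B N. k_algebra k A \<Longrightarrow> left_module k A M \<Longrightarrow> k_algebra k B \<Longrightarrow> left_module k B N \<Longrightarrow>
          universal_mod k A M B N (P A B) (\<pi> A B) (Q (A,M) (B,N)) (\<kappa> (A,M) (B,N))"
  shows "\<exists>cmp idn.
          comodule_enriched_category k {(A,M). k_algebra k A \<and> left_module k A M}
            (\<lambda>u v. (P (fst u) (fst v), Q u v)) cmp idn \<and>
          induced_by_composition k {(A,M). k_algebra k A \<and> left_module k A M}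
            (\<lambda>u. (carrier (fst u), carrier (snd u)))
            (\<lambda>u v. (P (fst u) (fst v), Q u v)) (\<lambda>u v. (\<pi> (fst u) (fst v), \<kappa> u v)) cmp idn"
proof -
  let ?Ob = "{(A :: ('k,'a) module, M :: ('k,'a,'m) alg_module). k_algebra k A \<and> left_module k A M}"
  let ?hm = "\<lambda>u v. (P (fst u) (fst v), Q u v)"
  let ?fits = "\<lambda>S. fits TYPE('u) (carrier (fst S)) \<and> fits TYPE('u) (carrier (snd S))"
  have o: "k_algebra k (fst u)" "left_module k (fst u) (snd u)" if "u \<in> ?Ob" for u using that by auto
  have ua: "universal_alg k (fst u) (fst v) (P (fst u) (fst v)) (\<pi> (fst u) (fst v))"
    and um: "universal_mod k (fst u) (snd u) (fst v) (snd v) (P (fst u) (fst v)) (\<pi> (fst u) (fst v)) (Q u v) (\<kappa> u v)"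
    if "u \<in> ?Ob" "v \<in> ?Ob" for u v
    using that UA UM by auto
  have hm: "cobj k (?hm u v)" and ma: "measures_alg k (fst u) (fst v) (P (fst u) (fst v)) (\<pi> (fst u) (fst v))"
    and mm: "measures_mod k (fst u) (snd u) (snd v) (P (fst u) (fst v)) (\<pi> (fst u) (fst v)) (Q u v) (\<kappa> u v)"
    if "u \<in> ?Ob" "v \<in> ?Ob" for u v
    using ua[OF that] um[OF that] by (simp_all add: universal_alg_def universal_mod_def cobj_def)
  \<comment> \<open>The unit object has carrier \<open>k\<close>; the embedding of the field admits
    it, and its tensor products with hom-objects, as test objects.\<close>
  have fk: "fits TYPE('u) (carrier k)" using kf unfolding fits_def by (meson inj_on_subset subset_UNIV)
  note ft = fits_tensor[OF inf]
  have mb: "bilin k (P (fst u) (fst v)) (fst u) (fst v) (\<pi> (fst u) (fst v))"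
    "bilin k (Q u v) (snd u) (snd v) (\<kappa> u v)" if uv: "u \<in> ?Ob" "v \<in> ?Ob" for u v
    using measures_alg_bilin(1)[OF ma[OF uv]] measures_mod_bilin(1)[OF mm[OF uv]]
      o[OF uv(1)] o[OF uv(2)] hm[OF uv] left_module_module by (auto simp: cobj_def)
  show ?thesis
  \<comment> \<open>One size predicate serves for all three shapes of sources, each time at another
    type.\<close>
  proof (rule enriched_categoryI[where AA = fst and MM = snd and ?small3.0 = ?fits and smalll = ?fits and smallr = ?fits])
    fix u v assume uv: "u \<in> ?Ob" "v \<in> ?Ob"
    note h = cobjD[OF hm[OF uv], simplified]
    note left_module_module[OF o(2)[OF uv(1)]] left_module_module[OF o(2)[OF uv(2)]]
    then show "lin k (fst (?hm u v)) (hom_space k (fst u) (fst v)) (fst (\<pi> (fst u) (fst v), \<kappa> u v)) \<and>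
      lin k (snd (?hm u v)) (hom_space k (snd u) (snd v)) (snd (\<pi> (fst u) (fst v), \<kappa> u v))"
      using ma[OF uv] mm[OF uv] o[OF uv(1)] o[OF uv(2)] h by (auto simp: measures_alg_def measures_mod_def intro: LinD(1))
    fix w assume w: "w \<in> ?Ob"
    have "\<exists>!m. cmor k (ctensor k (?hm v w) (?hm u v)) (P (fst u) (fst w), Q u w) m \<and>
        (\<forall>c \<in> carrier (fst (ctensor k (?hm v w) (?hm u v))). \<pi> (fst u) (fst w) (fst m c) =
          composite k (P (fst v) (fst w)) (P (fst u) (fst v)) (carrier (fst u)) (fst w) (\<pi> (fst v) (fst w)) (\<pi> (fst u) (fst v)) c) \<and>
        (\<forall>c \<in> carrier (snd (ctensor k (?hm v w) (?hm u v))). \<kappa> u w (snd m c) =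
          composite k (Q v w) (Q u v) (carrier (snd u)) (snd w) (\<kappa> v w) (\<kappa> u v) c)"
    proof (rule mod_factor[OF ua[OF uv(1) w] um[OF uv(1) w]])
      show "measures_alg k (fst u) (fst w) (fst (ctensor k (?hm v w) (?hm u v)))
        (composite k (P (fst v) (fst w)) (P (fst u) (fst v)) (carrier (fst u)) (fst w) (\<pi> (fst v) (fst w)) (\<pi> (fst u) (fst v)))"
        using measures_alg_composite[OF ma[OF uv(2) w] ma[OF uv]] o uv w cobjD[OF hm] by (simp add: ctensor_def)
      show "measures_mod k (fst u) (snd u) (snd w) (fst (ctensor k (?hm v w) (?hm u v)))
        (composite k (P (fst v) (fst w)) (P (fst u) (fst v)) (carrier (fst u)) (fst w) (\<pi> (fst v) (fst w)) (\<pi> (fst u) (fst v)))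
        (snd (ctensor k (?hm v w) (?hm u v))) (composite k (Q v w) (Q u v) (carrier (snd u)) (snd w) (\<kappa> v w) (\<kappa> u v))"
        using measures_mod_composite[OF mm[OF uv(2) w] mm[OF uv] mb(1)[OF uv(2) w] mb(1)[OF uv]]
          o[OF uv(1)] o[OF uv(2)] o[OF w] cobjD(1,2)[OF hm[OF uv]] cobjD(1,2)[OF hm[OF uv(2) w]]
        by (simp add: ctensor_def)
    qed (use o[OF uv(1)] o[OF w] cobj_tensor[OF hm[OF uv(2) w] hm[OF uv]] cobjD(3,4)[OF hm[OF uv]] cobjD(3,4)[OF hm[OF uv(2) w]]
        in \<open>simp_all add: ft fits_self\<close>)
    then obtain m where m: "cmor k (ctensor k (?hm v w) (?hm u v)) (P (fst u) (fst w), Q u w) m"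
      "\<And>c. c \<in> carrier (tensor k (P (fst v) (fst w)) (P (fst u) (fst v))) \<Longrightarrow> \<pi> (fst u) (fst w) (fst m c) =
          composite k (P (fst v) (fst w)) (P (fst u) (fst v)) (carrier (fst u)) (fst w) (\<pi> (fst v) (fst w)) (\<pi> (fst u) (fst v)) c"
      "\<And>c. c \<in> carrier (tensor k (Q v w) (Q u v)) \<Longrightarrow> \<kappa> u w (snd m c) =
          composite k (Q v w) (Q u v) (carrier (snd u)) (snd w) (\<kappa> v w) (\<kappa> u v) c"
      by auto
    show "\<exists>m. cmor k (ctensor k (?hm v w) (?hm u v)) (?hm u w) m \<and>
      (\<forall>q \<in> carrier (fst (?hm v w)). \<forall>p \<in> carrier (fst (?hm u v)).
           fst (\<pi> (fst u) (fst w), \<kappa> u w) (fst m (tens k (fst (?hm v w)) (fst (?hm u v)) q p)) =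
           compose (carrier (fst u)) (fst (\<pi> (fst v) (fst w), \<kappa> v w) q) (fst (\<pi> (fst u) (fst v), \<kappa> u v) p)) \<and>
      (\<forall>q \<in> carrier (snd (?hm v w)). \<forall>p \<in> carrier (snd (?hm u v)).
           snd (\<pi> (fst u) (fst w), \<kappa> u w) (snd m (tens k (snd (?hm v w)) (snd (?hm u v)) q p)) =
           compose (carrier (snd u)) (snd (\<pi> (fst v) (fst w), \<kappa> v w) q) (snd (\<pi> (fst u) (fst v), \<kappa> u v) p))"
      using m cobjD(3,4)[OF hm[OF uv]] cobjD(3,4)[OF hm[OF uv(2) w]]
        composite_tens[OF mb(1)[OF uv(2) w] mb(1)[OF uv]] composite_tens[OF mb(2)[OF uv(2) w] mb(2)[OF uv]]
      by (intro exI[of _ m]) simp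
  next
    fix u assume u: "u \<in> ?Ob"
    have m: "module k (fst u)" "module k (snd u)" using o[OF u] left_module_module by auto
    have "\<exists>!m. cmor k (cunit k) (P (fst u) (fst u), Q u u) m \<and>
        (\<forall>c \<in> carrier (fst (cunit k)). \<pi> (fst u) (fst u) (fst m c) = scaling k (fst u) c) \<and>
        (\<forall>c \<in> carrier (snd (cunit k)). \<kappa> u u (snd m c) = scaling k (snd u) c)"
      by (rule mod_factor[OF ua[OF u u] um[OF u u]])
        (use o[OF u] cobj_unit[OF k] fk in \<open>simp_all add: cunit_def measures_scaling_alg measures_scaling_mod\<close>)
    then obtain m where "cmor k (cunit k) (P (fst u) (fst u), Q u u) m"
      "\<forall>c \<in> carrier k. \<pi> (fst u) (fst u) (fst m c) = scaling k (fst u) c"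
      "\<forall>c \<in> carrier k. \<kappa> u u (snd m c) = scaling k (snd u) c"
      by (auto simp: cunit_def)
    then show "\<exists>m. cmor k (cunit k) (?hm u u) m \<and>
      fst (\<pi> (fst u) (fst u), \<kappa> u u) (fst m \<one>\<^bsub>k\<^esub>) = (\<lambda>a \<in> carrier (fst u). a) \<and>
      snd (\<pi> (fst u) (fst u), \<kappa> u u) (snd m \<one>\<^bsub>k\<^esub>) = (\<lambda>a \<in> carrier (snd u). a)"
      using k m by (intro exI[of _ m]) (simp add: scaling_one cring.cring_simprules)
  next
    fix u v w z assume "u \<in> ?Ob" "v \<in> ?Ob" "w \<in> ?Ob" "z \<in> ?Ob"
    then show "?fits (ctensor k (ctensor k (?hm w z) (?hm v w)) (?hm u v))"
      using cobjD(3,4)[OF hm] by (simp add: ft fits_self)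
  next
    fix u v assume "u \<in> ?Ob" "v \<in> ?Ob"
    then show "?fits (ctensor k (cunit k) (?hm u v))" "?fits (ctensor k (?hm u v) (cunit k))"
      using cobjD(3,4)[OF hm] k fk by (simp_all add: ft fits_self cunit_def)
  next
    fix u assume "u \<in> ?Ob"
    then show "module k (fst u)" "module k (snd u)" using o left_module_module by auto
  qed (rule k hm mod_unique[OF ua um], (assumption | rule o | erule conjunct1 conjunct2 | simp)+)+
qed

section \<open>The enriched category of comodules\<close>

lemma comodules_enriched:
  fixes k :: "('k,'r) ring_scheme"
    and P :: "('k,'h) coalg \<Rightarrow> ('k,'h) coalg \<Rightarrow> ('k,'u) coalg"
    and Q :: "('k,'h,'x) cobj \<Rightarrow> ('k,'h,'x) cobj \<Rightarrow> ('k,'u,'u) comod"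
  assumes k: "cring k" and inf: "infinite (UNIV :: 'u set)" and kf: "\<exists>\<iota> :: 'k \<Rightarrow> 'u. inj \<iota>"
    and UA: "\<And>H K. coalgebra k H \<Longrightarrow> coalgebra k K \<Longrightarrow> universal_coalg k H K (P H K) (\<pi> H K)"
    and UM: "\<And>H X K Y. coalgebra k H \<Longrightarrow> comodule k H X \<Longrightarrow> coalgebra k K \<Longrightarrow> comodule k K Y \<Longrightarrow>
          universal_comod k H X K Y (P H K) (\<pi> H K) (Q (H,X) (K,Y)) (\<kappa> (H,X) (K,Y))"
  shows "\<exists>cmp idn.
          comodule_enriched_category k {(H,X). coalgebra k H \<and> comodule k H X}
            (\<lambda>u v. (P (fst u) (fst v), Q u v)) cmp idn \<and>
          induced_by_composition k {(H,X). coalgebra k H \<and> comodule k H X}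
            (\<lambda>u. (carrier (fst u), carrier (snd u)))
            (\<lambda>u v. (P (fst u) (fst v), Q u v)) (\<lambda>u v. (\<pi> (fst u) (fst v), \<kappa> u v)) cmp idn"
proof -
  let ?Ob = "{(H :: ('k,'h) coalg, X :: ('k,'h,'x) comod). coalgebra k H \<and> comodule k H X}"
  let ?hm = "\<lambda>u v. (P (fst u) (fst v), Q u v)"
  let ?fits = "\<lambda>S. fits TYPE('u) (carrier (fst S)) \<and> fits TYPE('u) (carrier (snd S))"
  have o: "coalgebra k (fst u)" "comodule k (fst u) (snd u)" if "u \<in> ?Ob" for u using that by auto
  have ua: "universal_coalg k (fst u) (fst v) (P (fst u) (fst v)) (\<pi> (fst u) (fst v))"
    and um: "universal_comod k (fst u) (snd u) (fst v) (snd v) (P (fst u) (fst v)) (\<pi> (fst u) (fst v)) (Q u v) (\<kappa> u v)"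
    if "u \<in> ?Ob" "v \<in> ?Ob" for u v
    using that UA UM by auto
  have hm: "cobj k (?hm u v)" and ma: "measures_coalg k (fst u) (fst v) (P (fst u) (fst v)) (\<pi> (fst u) (fst v))"
    and mm: "measures_comod k (fst u) (snd u) (fst v) (snd v) (P (fst u) (fst v)) (\<pi> (fst u) (fst v)) (Q u v) (\<kappa> u v)"
    if "u \<in> ?Ob" "v \<in> ?Ob" for u v
    using ua[OF that] um[OF that] by (simp_all add: universal_coalg_def universal_comod_def cobj_def)
  have fk: "fits TYPE('u) (carrier k)" using kf unfolding fits_def by (meson inj_on_subset subset_UNIV)
  note ft = fits_tensor[OF inf]
  have mb: "bilin k (P (fst u) (fst v)) (fst u) (fst v) (\<pi> (fst u) (fst v))"
    "bilin k (Q u v) (snd u) (snd v) (\<kappa> u v)" if uv: "u \<in> ?Ob" "v \<in> ?Ob" for u v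
    using measures_coalg_bilin(1)[OF ma[OF uv]] measures_comod_bilin(1)[OF mm[OF uv]]
      o[OF uv(1)] o[OF uv(2)] hm[OF uv] comodule_module by (auto simp: cobj_def)
  show ?thesis
  proof (rule enriched_categoryI[where AA = fst and MM = snd and ?small3.0 = ?fits and smalll = ?fits and smallr = ?fits])
    fix u v assume uv: "u \<in> ?Ob" "v \<in> ?Ob"
    note h = cobjD[OF hm[OF uv], simplified]
    note comodule_module[OF o(2)[OF uv(1)]] comodule_module[OF o(2)[OF uv(2)]]
    then show "lin k (fst (?hm u v)) (hom_space k (fst u) (fst v)) (fst (\<pi> (fst u) (fst v), \<kappa> u v)) \<and>
      lin k (snd (?hm u v)) (hom_space k (snd u) (snd v)) (snd (\<pi> (fst u) (fst v), \<kappa> u v))"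
      using ma[OF uv] mm[OF uv] o[OF uv(1)] o[OF uv(2)] h by (auto simp: measures_coalg_def measures_comod_def intro: LinD(1))
    fix w assume w: "w \<in> ?Ob"
    have "\<exists>!m. cmor k (ctensor k (?hm v w) (?hm u v)) (P (fst u) (fst w), Q u w) m \<and>
        (\<forall>c \<in> carrier (fst (ctensor k (?hm v w) (?hm u v))). \<pi> (fst u) (fst w) (fst m c) =
          composite k (P (fst v) (fst w)) (P (fst u) (fst v)) (carrier (fst u)) (fst w) (\<pi> (fst v) (fst w)) (\<pi> (fst u) (fst v)) c) \<and>
        (\<forall>c \<in> carrier (snd (ctensor k (?hm v w) (?hm u v))). \<kappa> u w (snd m c) =
          composite k (Q v w) (Q u v) (carrier (snd u)) (snd w) (\<kappa> v w) (\<kappa> u v) c)"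
    proof (rule comod_factor[OF ua[OF uv(1) w] um[OF uv(1) w]])
      show "measures_coalg k (fst u) (fst w) (fst (ctensor k (?hm v w) (?hm u v)))
        (composite k (P (fst v) (fst w)) (P (fst u) (fst v)) (carrier (fst u)) (fst w) (\<pi> (fst v) (fst w)) (\<pi> (fst u) (fst v)))"
        using measures_coalg_composite[OF ma[OF uv(2) w] ma[OF uv]] o uv w cobjD[OF hm] by (simp add: ctensor_def)
      show "measures_comod k (fst u) (snd u) (fst w) (snd w) (fst (ctensor k (?hm v w) (?hm u v)))
        (composite k (P (fst v) (fst w)) (P (fst u) (fst v)) (carrier (fst u)) (fst w) (\<pi> (fst v) (fst w)) (\<pi> (fst u) (fst v)))
        (snd (ctensor k (?hm v w) (?hm u v))) (composite k (Q v w) (Q u v) (carrier (snd u)) (snd w) (\<kappa> v w) (\<kappa> u v))"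
        using measures_comod_composite[OF mm[OF uv(2) w] mm[OF uv] mb(1)[OF uv(2) w] mb(1)[OF uv]]
          o[OF uv(1)] o[OF uv(2)] o[OF w] cobjD(1,2)[OF hm[OF uv]] cobjD(1,2)[OF hm[OF uv(2) w]]
        by (simp add: ctensor_def)
    qed (use o[OF uv(1)] o[OF w] cobj_tensor[OF hm[OF uv(2) w] hm[OF uv]] cobjD(3,4)[OF hm[OF uv]] cobjD(3,4)[OF hm[OF uv(2) w]]
        in \<open>simp_all add: ft fits_self\<close>)
    then obtain m where m: "cmor k (ctensor k (?hm v w) (?hm u v)) (P (fst u) (fst w), Q u w) m"
      "\<And>c. c \<in> carrier (tensor k (P (fst v) (fst w)) (P (fst u) (fst v))) \<Longrightarrow> \<pi> (fst u) (fst w) (fst m c) =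
          composite k (P (fst v) (fst w)) (P (fst u) (fst v)) (carrier (fst u)) (fst w) (\<pi> (fst v) (fst w)) (\<pi> (fst u) (fst v)) c"
      "\<And>c. c \<in> carrier (tensor k (Q v w) (Q u v)) \<Longrightarrow> \<kappa> u w (snd m c) =
          composite k (Q v w) (Q u v) (carrier (snd u)) (snd w) (\<kappa> v w) (\<kappa> u v) c"
      by auto
    show "\<exists>m. cmor k (ctensor k (?hm v w) (?hm u v)) (?hm u w) m \<and>
      (\<forall>q \<in> carrier (fst (?hm v w)). \<forall>p \<in> carrier (fst (?hm u v)).
           fst (\<pi> (fst u) (fst w), \<kappa> u w) (fst m (tens k (fst (?hm v w)) (fst (?hm u v)) q p)) =
           compose (carrier (fst u)) (fst (\<pi> (fst v) (fst w), \<kappa> v w) q) (fst (\<pi> (fst u) (fst v), \<kappa> u v) p)) \<and>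
      (\<forall>q \<in> carrier (snd (?hm v w)). \<forall>p \<in> carrier (snd (?hm u v)).
           snd (\<pi> (fst u) (fst w), \<kappa> u w) (snd m (tens k (snd (?hm v w)) (snd (?hm u v)) q p)) =
           compose (carrier (snd u)) (snd (\<pi> (fst v) (fst w), \<kappa> v w) q) (snd (\<pi> (fst u) (fst v), \<kappa> u v) p))"
      using m cobjD(3,4)[OF hm[OF uv]] cobjD(3,4)[OF hm[OF uv(2) w]]
        composite_tens[OF mb(1)[OF uv(2) w] mb(1)[OF uv]] composite_tens[OF mb(2)[OF uv(2) w] mb(2)[OF uv]]
      by (intro exI[of _ m]) simp
  next
    fix u assume u: "u \<in> ?Ob"
    have m: "module k (fst u)" "module k (snd u)" using o[OF u] comodule_module by auto
    have "\<exists>!m. cmor k (cunit k) (P (fst u) (fst u), Q u u) m \<and>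
        (\<forall>c \<in> carrier (fst (cunit k)). \<pi> (fst u) (fst u) (fst m c) = scaling k (fst u) c) \<and>
        (\<forall>c \<in> carrier (snd (cunit k)). \<kappa> u u (snd m c) = scaling k (snd u) c)"
      by (rule comod_factor[OF ua[OF u u] um[OF u u]])
        (use o[OF u] cobj_unit[OF k] fk in \<open>simp_all add: cunit_def measures_scaling_coalg measures_scaling_comod\<close>)
    then obtain m where "cmor k (cunit k) (P (fst u) (fst u), Q u u) m"
      "\<forall>c \<in> carrier k. \<pi> (fst u) (fst u) (fst m c) = scaling k (fst u) c"
      "\<forall>c \<in> carrier k. \<kappa> u u (snd m c) = scaling k (snd u) c"
      by (auto simp: cunit_def)
    then show "\<exists>m. cmor k (cunit k) (?hm u u) m \<and>
      fst (\<pi> (fst u) (fst u), \<kappa> u u) (fst m \<one>\<^bsub>k\<^esub>) = (\<lambda>a \<in> carrier (fst u). a) \<and>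
      snd (\<pi> (fst u) (fst u), \<kappa> u u) (snd m \<one>\<^bsub>k\<^esub>) = (\<lambda>a \<in> carrier (snd u). a)"
      using k m by (intro exI[of _ m]) (simp add: scaling_one cring.cring_simprules)
  next
    fix u v w z assume "u \<in> ?Ob" "v \<in> ?Ob" "w \<in> ?Ob" "z \<in> ?Ob"
    then show "?fits (ctensor k (ctensor k (?hm w z) (?hm v w)) (?hm u v))"
      using cobjD(3,4)[OF hm] by (simp add: ft fits_self)
  next
    fix u v assume "u \<in> ?Ob" "v \<in> ?Ob"
    then show "?fits (ctensor k (cunit k) (?hm u v))" "?fits (ctensor k (?hm u v) (cunit k))"
      using cobjD(3,4)[OF hm] k fk by (simp_all add: ft fits_self cunit_def)
  next
    fix u assume "u \<in> ?Ob"
    then show "module k (fst u)" "module k (snd u)" using o comodule_module by auto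
  qed (rule k hm comod_unique[OF ua um], (assumption | rule o | erule conjunct1 conjunct2 | simp)+)+
qed

section \<open>Convolution algebras and modules\<close>

lemma k_algebraI:
  assumes "module k A" "bilin k A A A (mult A)" "\<one>\<^bsub>A\<^esub> \<in> carrier A"
    "\<And>x y z. x \<in> carrier A \<Longrightarrow> y \<in> carrier A \<Longrightarrow> z \<in> carrier A \<Longrightarrow> (x \<otimes>\<^bsub>A\<^esub> y) \<otimes>\<^bsub>A\<^esub> z = x \<otimes>\<^bsub>A\<^esub> (y \<otimes>\<^bsub>A\<^esub> z)"
    "\<And>x. x \<in> carrier A \<Longrightarrow> \<one>\<^bsub>A\<^esub> \<otimes>\<^bsub>A\<^esub> x = x" "\<And>x. x \<in> carrier A \<Longrightarrow> x \<otimes>\<^bsub>A\<^esub> \<one>\<^bsub>A\<^esub> = x"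
  shows "k_algebra k A"
proof -
  interpret module k A by fact
  have l: "lin k A A (\<lambda>x. x \<otimes>\<^bsub>A\<^esub> y)" "lin k A A (mult A y)" if "y \<in> carrier A" for y
    using assms(2) that by (simp_all add: bilin_def)
  have "ring A"
  proof (rule ringI)
    show "abelian_group A" by unfold_locales
    show "Group.monoid A"
      by (rule monoidI) (use assms bilin_closed[OF assms(2)] in simp_all)
  qed (simp_all add: lin_add[OF l(1)] lin_add[OF l(2)])
  then show ?thesis
    using assms(1) by (simp add: k_algebra_def lin_smult[OF l(1)] lin_smult[OF l(2)])
qed

lemma left_moduleI:
  assumes "module k M" "bilin k A M M (act M)"
    "\<And>a b m. a \<in> carrier A \<Longrightarrow> b \<in> carrier A \<Longrightarrow> m \<in> carrier M \<Longrightarrow> act M (a \<otimes>\<^bsub>A\<^esub> b) m = act M a (act M b m)"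
    "\<And>m. m \<in> carrier M \<Longrightarrow> act M \<one>\<^bsub>A\<^esub> m = m"
  shows "left_module k A M"
proof -
  have l: "lin k A M (\<lambda>a. act M a m)" if "m \<in> carrier M" for m
    using assms(2) that by (simp add: bilin_def)
  have r: "lin k M M (act M a)" if "a \<in> carrier A" for a
    using assms(2) that by (simp add: bilin_def)
  show ?thesis unfolding left_module_def
    using assms(1,3,4) by (simp add: bilin_closed[OF assms(2)] lin_add[OF l] lin_smult[OF l] lin_add[OF r] lin_smult[OF r])
qed

lemma k_algebra_assoc:
  "k_algebra k A \<Longrightarrow> x \<in> carrier A \<Longrightarrow> y \<in> carrier A \<Longrightarrow> z \<in> carrier A \<Longrightarrow> (x \<otimes>\<^bsub>A\<^esub> y) \<otimes>\<^bsub>A\<^esub> z = x \<otimes>\<^bsub>A\<^esub> (y \<otimes>\<^bsub>A\<^esub> z)"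
  "k_algebra k A \<Longrightarrow> x \<in> carrier A \<Longrightarrow> \<one>\<^bsub>A\<^esub> \<otimes>\<^bsub>A\<^esub> x = x" "k_algebra k A \<Longrightarrow> x \<in> carrier A \<Longrightarrow> x \<otimes>\<^bsub>A\<^esub> \<one>\<^bsub>A\<^esub> = x"
  by (simp_all add: k_algebra_def ring.ring_simprules monoid.r_one[OF ring.is_monoid])

lemma k_algebra_smult:
  "k_algebra k A \<Longrightarrow> c \<in> carrier k \<Longrightarrow> x \<in> carrier A \<Longrightarrow> y \<in> carrier A \<Longrightarrow> (c \<odot>\<^bsub>A\<^esub> x) \<otimes>\<^bsub>A\<^esub> y = c \<odot>\<^bsub>A\<^esub> (x \<otimes>\<^bsub>A\<^esub> y)"
  "k_algebra k A \<Longrightarrow> c \<in> carrier k \<Longrightarrow> x \<in> carrier A \<Longrightarrow> y \<in> carrier A \<Longrightarrow> x \<otimes>\<^bsub>A\<^esub> (c \<odot>\<^bsub>A\<^esub> y) = c \<odot>\<^bsub>A\<^esub> (x \<otimes>\<^bsub>A\<^esub> y)"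
  by (simp_all add: k_algebra_def)

lemma sp_conv_alg: "sp (conv_alg k H B) = sp (hom_space k H B)"
  by (simp add: conv_alg_def sp_def)

lemma sp_conv_mod: "sp (conv_mod k H X N) = sp (hom_space k X N)"
  by (simp add: conv_mod_def module.defs alg_module.defs sp_def)

lemmas [simp] = sp_eqs[OF sp_conv_alg] sp_eqs[OF sp_conv_mod]

lemma conv_mult: "h \<in> carrier H \<Longrightarrow> (\<alpha> \<otimes>\<^bsub>conv_alg k H B\<^esub> \<beta>) h = tlift k H H B (\<lambda>x y. \<alpha> x \<otimes>\<^bsub>B\<^esub> \<beta> y) (comult H h)"
  "\<alpha> \<otimes>\<^bsub>conv_alg k H B\<^esub> \<beta> \<in> extensional (carrier H)"
  by (simp_all add: conv_alg_def)

lemma conv_one: "h \<in> carrier H \<Longrightarrow> \<one>\<^bsub>conv_alg k H B\<^esub> h = counit H h \<odot>\<^bsub>B\<^esub> \<one>\<^bsub>B\<^esub>"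
  "\<one>\<^bsub>conv_alg k H B\<^esub> \<in> extensional (carrier H)"
  by (simp_all add: conv_alg_def)

lemma conv_act: "x \<in> carrier X \<Longrightarrow> act (conv_mod k H X N) \<alpha> \<zeta> x = tlift k H X N (\<lambda>h y. act N (\<alpha> h) (\<zeta> y)) (coact X x)"
  "act (conv_mod k H X N) \<alpha> \<zeta> \<in> extensional (carrier X)"
  by (simp_all add: conv_mod_def module.defs alg_module.defs)

lemma hom_memD:
  assumes "module k V" "module k W" "f \<in> Lin k V W"
  shows "lin k S V g \<Longrightarrow> lin k S W (\<lambda>s. f (g s))" "v \<in> carrier V \<Longrightarrow> f v \<in> carrier W" "f \<in> extensional (carrier V)"
  using assms by (auto simp: Lin_iff intro: lin_comp lin_closed)

lemma lin_into_hom: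
  assumes "module k X" "module k V" "module k W" "\<And>x. x \<in> carrier X \<Longrightarrow> \<gamma> x \<in> extensional (carrier V)"
    "\<And>v. v \<in> carrier V \<Longrightarrow> lin k X W (\<lambda>x. \<gamma> x v)" "\<And>x. x \<in> carrier X \<Longrightarrow> lin k V W (\<gamma> x)"
  shows "lin k X (hom_space k V W) \<gamma>"
  using assms by (simp add: lin_hom_iff)

lemma conv_mod_bilin:
  assumes H [simp]: "coalgebra k H" and B [simp]: "k_algebra k B" and X: "comodule k H X" and N: "left_module k B N"
  shows "bilin k (hom_space k H B) (hom_space k X N) (hom_space k X N) (act (conv_mod k H X N))"
proof (rule bilinI)
  note [simp] = comodule_module[OF X] left_module_module[OF N] left_module_lin[OF B N] X
  note [simp] = hom_lin_eval[of k H B] hom_lin_eval[of k X N] hom_simps(1) LinD(1)[of _ k H B] hom_memD(2)[of k H B] LinD(1)[of _ k X N] hom_memD(2)[of k X N]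
  have l: "lin k X N (act (conv_mod k H X N) \<alpha> \<beta>)" if a: "\<alpha> \<in> Lin k H B" and b: "\<beta> \<in> Lin k X N" for \<alpha> \<beta>
    by (rule iffD2[OF lin_cong[OF conv_act(1)]])
      (use a b in \<open>simp_all add: hom_memD(1,2)[OF _ _ a] hom_memD(1,2)[OF _ _ b]\<close>)
  show "lin k (hom_space k H B) (hom_space k X N) (\<lambda>\<alpha>. act (conv_mod k H X N) \<alpha> \<beta>)" if "\<beta> \<in> carrier (hom_space k X N)" for \<beta>
  proof -
    have b: "\<beta> \<in> Lin k X N" using that by simp
    note [simp] = hom_memD(1,2)[OF _ _ b]
    show ?thesis by (intro lin_into_hom) (simp_all add: conv_act l b hom_memD(1,2))
  qed
  show "lin k (hom_space k X N) (hom_space k X N) (\<lambda>\<beta>. act (conv_mod k H X N) \<alpha> \<beta>)" if "\<alpha> \<in> carrier (hom_space k H B)" for \<alpha>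
  proof -
    have b: "\<alpha> \<in> Lin k H B" using that by simp
    note [simp] = hom_memD(1,2)[OF _ _ b]
    show ?thesis by (intro lin_into_hom) (simp_all add: conv_act l b hom_memD(1,2))
  qed
qed (use comodule_module[OF X] left_module_module[OF N] in simp_all)

text \<open>The convolution product is literally the action for the regular comodule and the
  self-module, so facts on \<open>conv_mod\<close> specialize to \<open>conv_alg\<close>.\<close>

lemma conv_mod_self: "act (conv_mod k H (regular H) (self_module B)) = mult (conv_alg k H B)"
  by (simp add: conv_mod_def conv_alg_def module.defs alg_module.defs)

lemma conv_bilin:
  assumes "coalgebra k H" "k_algebra k B"
  shows "bilin k (hom_space k H B) (hom_space k H B) (hom_space k H B) (mult (conv_alg k H B))"
  using conv_mod_bilin[OF assms coalgebra_regular[OF assms(1)] left_module_self[OF assms(2)]] by (simp add: conv_mod_self)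

lemma conv_algebra [simp]:
  assumes H [simp]: "coalgebra k H" and B [simp]: "k_algebra k B"
  shows "k_algebra k (conv_alg k H B)"
proof (rule k_algebraI)
  interpret B: module k B by simp
  note [simp] = hom_memD(1,2)[of k H B] hom_simps(1) k_algebra_one[OF B] B.smult_closed
  note cl = bilin_closed[OF conv_bilin[OF H B], unfolded hom_simps(1)]
  note [simp] = bilin_lin[OF k_algebra_bilin[OF B]]
  note ex = extensionalityI[of _ "carrier H"]
  show o: "\<one>\<^bsub>conv_alg k H B\<^esub> \<in> carrier (conv_alg k H B)"
    by (simp add: Lin_iff conv_one lin_cong[OF conv_one(1)])
  fix x assume "x \<in> carrier (conv_alg k H B)"
  then have x [simp]: "x \<in> Lin k H B" by simp
  note [simp] = hom_memD(1,2)[OF _ _ x]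
  show "\<one>\<^bsub>conv_alg k H B\<^esub> \<otimes>\<^bsub>conv_alg k H B\<^esub> x = x"
    using hom_memD(1)[OF _ _ x, of H "\<lambda>h. h"]
    by (intro ex) (simp_all add: conv_mult conv_one hom_memD(3)[OF _ _ x] k_algebra_smult[OF B] k_algebra_assoc[OF B] comult_counit_left)
  show "x \<otimes>\<^bsub>conv_alg k H B\<^esub> \<one>\<^bsub>conv_alg k H B\<^esub> = x"
    using hom_memD(1)[OF _ _ x, of H "\<lambda>h. h"]
    by (intro ex) (simp_all add: conv_mult conv_one hom_memD(3)[OF _ _ x] k_algebra_smult[OF B] k_algebra_assoc[OF B] comult_counit_right)
  fix y z assume "y \<in> carrier (conv_alg k H B)" "z \<in> carrier (conv_alg k H B)"
  then have y [simp]: "y \<in> Lin k H B" "z \<in> Lin k H B" by simp_all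
  note [simp] = hom_memD(1,2)[OF _ _ y(1)] hom_memD(1,2)[OF _ _ y(2)]
  \<comment> \<open>Multiplication by a fixed element moves into a sum. Afterwards associativity of
    convolution is coassociativity of \<open>H\<close> combined with associativity of
    \<open>B\<close>.\<close>
  have p: "tlift k H H B \<beta> t \<otimes>\<^bsub>B\<^esub> b = tlift k H H B (\<lambda>x y. \<beta> x y \<otimes>\<^bsub>B\<^esub> b) t"
    "b \<otimes>\<^bsub>B\<^esub> tlift k H H B \<beta> t = tlift k H H B (\<lambda>x y. b \<otimes>\<^bsub>B\<^esub> \<beta> x y) t"
    if "b \<in> carrier B" "bilin k H H B \<beta>" "t \<in> carrier (tensor k H H)" for b \<beta> t
    using that tlift_push[of k B B "\<lambda>x. x \<otimes>\<^bsub>B\<^esub> b"] tlift_push[of k B B "\<lambda>x. b \<otimes>\<^bsub>B\<^esub> x"] by simp_all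
  show "(x \<otimes>\<^bsub>conv_alg k H B\<^esub> y) \<otimes>\<^bsub>conv_alg k H B\<^esub> z = x \<otimes>\<^bsub>conv_alg k H B\<^esub> (y \<otimes>\<^bsub>conv_alg k H B\<^esub> z)"
    by (intro ex conv_mult(2)) (simp add: conv_mult p comult_coassoc k_algebra_assoc[OF B])
qed (simp_all add: conv_bilin)

lemma conv_left_module:
  assumes H [simp]: "coalgebra k H" and B [simp]: "k_algebra k B" and X [simp]: "comodule k H X" and N [simp]: "left_module k B N"
  shows "left_module k (conv_alg k H B) (conv_mod k H X N)"
proof (rule left_moduleI)
  interpret B: module k B by simp
  note [simp] = comodule_module[OF X] left_module_module[OF N] left_module_lin[OF B N]
  note [simp] = hom_memD(1,2)[of k H B] hom_memD(1,2)[of k X N] hom_simps(1) k_algebra_one[OF B] B.smult_closed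
  note ex = extensionalityI[of _ "carrier X"]
  have m: "act N (c \<odot>\<^bsub>B\<^esub> x) y = c \<odot>\<^bsub>N\<^esub> act N x y" "act N \<one>\<^bsub>B\<^esub> y = y" "x' \<in> carrier B \<Longrightarrow> act N (x \<otimes>\<^bsub>B\<^esub> x') y = act N x (act N x' y)"
    if "c \<in> carrier k" "x \<in> carrier B" "y \<in> carrier N" for c x x' y using N that by (simp_all add: left_module_def)
  show "module k (conv_mod k H X N)" by simp
  show "bilin k (conv_alg k H B) (conv_mod k H X N) (conv_mod k H X N) (act (conv_mod k H X N))"
    by (simp add: conv_mod_bilin[OF H B X N])
  fix z assume "z \<in> carrier (conv_mod k H X N)"
  then have z [simp]: "z \<in> Lin k X N" by simp
  note [simp] = hom_memD(1,2)[OF _ _ z]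
  show "act (conv_mod k H X N) \<one>\<^bsub>conv_alg k H B\<^esub> z = z"
    using hom_memD(1)[OF _ _ z, of X "\<lambda>h. h"] m(2)[OF B.R.zero_closed B.zero_closed]
    by (intro ex) (simp_all add: conv_act conv_one hom_memD(3)[OF _ _ z] m(1) coact_counit)
  fix x y assume "x \<in> carrier (conv_alg k H B)" "y \<in> carrier (conv_alg k H B)"
  then have y [simp]: "y \<in> Lin k H B" "x \<in> Lin k H B" by simp_all
  note [simp] = hom_memD(1,2)[OF _ _ y(1)] hom_memD(1,2)[OF _ _ y(2)]
  have p: "act N (tlift k H H B \<beta> t) n = tlift k H H N (\<lambda>x y. act N (\<beta> x y) n) t"
    if "n \<in> carrier N" "bilin k H H B \<beta>" "t \<in> carrier (tensor k H H)" for n \<beta> t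
    using that tlift_push[of k B N "\<lambda>x. act N x n"] by simp
  have p': "act N b (tlift k H X N \<beta> t) = tlift k H X N (\<lambda>x y. act N b (\<beta> x y)) t"
    if "b \<in> carrier B" "bilin k H X N \<beta>" "t \<in> carrier (tensor k H X)" for b \<beta> t
    using that tlift_push[of k N N "act N b"] by simp
  have m3: "act N (x \<otimes>\<^bsub>B\<^esub> x') y = act N x (act N x' y)" if "x \<in> carrier B" "x' \<in> carrier B" "y \<in> carrier N" for x x' y
    using N that by (simp add: left_module_def)
  show "act (conv_mod k H X N) (x \<otimes>\<^bsub>conv_alg k H B\<^esub> y) z = act (conv_mod k H X N) x (act (conv_mod k H X N) y z)"
    by (intro ex conv_act(2)) (simp add: conv_mult conv_act p p' coact_coassoc m3)
qed

section \<open>Algebra homomorphisms and quotient algebras\<close>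

text \<open>No extensionality is imposed, so composites with quotient projections stay in the
  predicate without restriction.\<close>

definition alg_hom ::
    "('k,'r) ring_scheme \<Rightarrow> ('k,'a,'p) module_scheme \<Rightarrow> ('k,'b,'q) module_scheme \<Rightarrow> ('a \<Rightarrow> 'b) \<Rightarrow> bool" where
  "alg_hom k A B f \<longleftrightarrow> lin k A B f \<and> (\<forall>x \<in> carrier A. \<forall>y \<in> carrier A. f (x \<otimes>\<^bsub>A\<^esub> y) = f x \<otimes>\<^bsub>B\<^esub> f y) \<and> f \<one>\<^bsub>A\<^esub> = \<one>\<^bsub>B\<^esub>"

lemma alg_homD:
  assumes "alg_hom k A B f"
  shows "lin k A B f" "x \<in> carrier A \<Longrightarrow> y \<in> carrier A \<Longrightarrow> f (x \<otimes>\<^bsub>A\<^esub> y) = f x \<otimes>\<^bsub>B\<^esub> f y" "f \<one>\<^bsub>A\<^esub> = \<one>\<^bsub>B\<^esub>"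
  using assms by (auto simp: alg_hom_def)

lemma alg_hom_comp: "alg_hom k A B f \<Longrightarrow> alg_hom k B C g \<Longrightarrow> alg_hom k A C (\<lambda>x. g (f x))"
  unfolding alg_hom_def using lin_closed[of k A B f] by (auto intro: lin_comp)

text \<open>Multiplying by the scalar \<open>c\<close> is multiplying by the element
  \<open>c 1\<close> of the algebra, under which an ideal is closed.\<close>

lemma ideal_submodule:
  assumes A: "k_algebra k A" and I: "ideal I A" shows "submodule I k A"
proof -
  interpret A: module k A using A by simp
  interpret I: ideal I A by fact
  have s: "c \<odot>\<^bsub>A\<^esub> x = (c \<odot>\<^bsub>A\<^esub> \<one>\<^bsub>A\<^esub>) \<otimes>\<^bsub>A\<^esub> x" if "c \<in> carrier k" "x \<in> carrier A" for c x
    using that A by (simp add: k_algebra_smult k_algebra_assoc)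
  show ?thesis
  proof (rule A.submoduleI)
    show "c \<odot>\<^bsub>A\<^esub> x \<in> I" if "c \<in> carrier k" "x \<in> I" for c x
      using that s[of c x] I.I_l_closed[of x "c \<odot>\<^bsub>A\<^esub> \<one>\<^bsub>A\<^esub>"] k_algebra_one[OF A] by simp
  qed (use I.a_subset in auto)
qed

lemma quot_mult:
  assumes "ideal I A" "x \<in> carrier A" "y \<in> carrier A"
  shows "(I +>\<^bsub>A\<^esub> x) \<otimes>\<^bsub>quot A I\<^esub> (I +>\<^bsub>A\<^esub> y) = I +>\<^bsub>A\<^esub> (x \<otimes>\<^bsub>A\<^esub> y)"
  using ideal.rcoset_mult_add[OF assms] by (simp add: quot_def FactRing_def)

lemma quot_one: "\<one>\<^bsub>quot A I\<^esub> = I +>\<^bsub>A\<^esub> \<one>\<^bsub>A\<^esub>"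
  by (simp add: quot_def FactRing_def)

lemma quot_algebra:
  assumes A: "k_algebra k A" and I: "ideal I A"
  shows "k_algebra k (quot A I)" "alg_hom k A (quot A I) (\<lambda>a. I +>\<^bsub>A\<^esub> a)"
proof -
  note S = ideal_submodule[OF A I] and Am = k_algebra_module[OF A]
  note m = quot_mult[OF I] and q = quot_add[OF Am S] quot_smult[OF Am S]
  interpret A: module k A by fact
  interpret R: ring A using A by (simp add: k_algebra_def)
  have M: "module k (quot A I)" by (rule quot_module[OF Am S])
  show "k_algebra k (quot A I)"
  proof (rule k_algebraI)
    show "bilin k (quot A I) (quot A I) (quot A I) (mult (quot A I))"
      by (intro bilinI linI M)
        (auto simp: quot_carrier m q R.l_distr R.r_distr k_algebra_smult[OF A])
  qed (auto simp: M quot_carrier m quot_one R.m_assoc)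
  show "alg_hom k A (quot A I) (\<lambda>a. I +>\<^bsub>A\<^esub> a)"
    unfolding alg_hom_def using lin_coset[OF Am S] by (simp add: m quot_one)
qed

lemma kernel_ideal:
  assumes A: "k_algebra k A" and D: "k_algebra k D" and f: "alg_hom k A D f"
  shows "ideal {x \<in> carrier A. f x = \<zero>\<^bsub>D\<^esub>} A"
proof -
  interpret A: ring A using A by (simp add: k_algebra_def)
  interpret D: ring D using D by (simp add: k_algebra_def)
  note l = alg_homD(1)[OF f]
  show ?thesis
  proof (rule idealI)
    show "subgroup {x \<in> carrier A. f x = \<zero>\<^bsub>D\<^esub>} (add_monoid A)"
      using kernel_submodule[OF l] by (simp add: submodule_def)
  qed (use alg_homD(2)[OF f] lin_closed[OF l] in \<open>auto simp: A.ring_axioms\<close>)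
qed

text \<open>The kernel of \<open>f\<close> is an ideal containing \<open>S\<close>, hence contains
  the ideal generated by \<open>S\<close>.\<close>

lemma quot_alg_lift:
  assumes A: "k_algebra k A" and D: "k_algebra k D" and S: "S \<subseteq> carrier A"
    and f: "alg_hom k A D f" and z: "\<And>s. s \<in> S \<Longrightarrow> f s = \<zero>\<^bsub>D\<^esub>"
  obtains g where "alg_hom k (quot A (Idl\<^bsub>A\<^esub> S)) D g" "\<And>a. a \<in> carrier A \<Longrightarrow> g ((Idl\<^bsub>A\<^esub> S) +>\<^bsub>A\<^esub> a) = f a"
proof -
  interpret A: ring A using A by (simp add: k_algebra_def)
  have I: "ideal (Idl\<^bsub>A\<^esub> S) A" by (rule A.genideal_ideal[OF S])
  have "Idl\<^bsub>A\<^esub> S \<subseteq> {x \<in> carrier A. f x = \<zero>\<^bsub>D\<^esub>}"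
    by (rule A.genideal_minimal[OF kernel_ideal[OF A D f]]) (use S z in auto)
  then obtain g where g: "lin k (quot A (Idl\<^bsub>A\<^esub> S)) D g" "\<And>a. a \<in> carrier A \<Longrightarrow> g ((Idl\<^bsub>A\<^esub> S) +>\<^bsub>A\<^esub> a) = f a"
    using quot_lift[OF ideal_submodule[OF A I] alg_homD(1)[OF f]] by blast
  have "alg_hom k (quot A (Idl\<^bsub>A\<^esub> S)) D g"
    unfolding alg_hom_def using g alg_homD(2,3)[OF f]
    by (auto simp: quot_carrier quot_mult[OF I] quot_one)
  with g that show thesis by blast
qed


lemma Idl_rel:
  assumes A: "k_algebra k A" and S: "S \<subseteq> carrier A" and r: "x \<ominus>\<^bsub>A\<^esub> y \<in> S" and x: "x \<in> carrier A" "y \<in> carrier A"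
  shows "(Idl\<^bsub>A\<^esub> S) +>\<^bsub>A\<^esub> x = (Idl\<^bsub>A\<^esub> S) +>\<^bsub>A\<^esub> y"
proof -
  interpret A: ring A using A by (simp add: k_algebra_def)
  have I: "ideal (Idl\<^bsub>A\<^esub> S) A" by (rule A.genideal_ideal[OF S])
  show ?thesis
    using coset_eq_iff[OF k_algebra_module[OF A] ideal_submodule[OF A I] x] A.genideal_self[OF S] r by blast
qed

section \<open>The tensor algebra\<close>

lemma sp_word_alg: "sp (word_alg k S) = sp (free_space k (lists S))"
  by (simp add: word_alg_def sp_def)

lemmas [simp] = sp_eqs[OF sp_word_alg]

lemma word_mult: "(f \<otimes>\<^bsub>word_alg k S\<^esub> g) w = (\<Oplus>\<^bsub>k\<^esub>i \<in> {..length w}. f (take i w) \<otimes>\<^bsub>k\<^esub> g (drop i w))"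
  by (simp add: word_alg_def)

lemma word_one: "\<one>\<^bsub>word_alg k S\<^esub> = basis_vec k []"
  by (simp add: word_alg_def)

lemma free_simps: "(f \<oplus>\<^bsub>free_space k S\<^esub> g) s = f s \<oplus>\<^bsub>k\<^esub> g s" "(c \<odot>\<^bsub>free_space k S\<^esub> f) s = c \<otimes>\<^bsub>k\<^esub> f s"
  by (simp_all add: free_space_def)

lemma word_bilin:
  fixes k :: "('k,'r) ring_scheme" and S :: "'s set"
  assumes k: "cring k"
  defines "F \<equiv> free_space k (lists S)"
  shows "bilin k F F F (mult (word_alg k S))"
proof -
  interpret K: cring k by fact
  have m [simp]: "module k F" by (simp add: F_def k)
  have fc: "f w \<in> carrier k" if "f \<in> carrier F" for f w using free_carrierD(1)[of f k "lists S" w] that by (simp add: F_def)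
  note [simp] = free_simps[of k "lists S", folded F_def]
  have c: "f \<otimes>\<^bsub>word_alg k S\<^esub> g \<in> carrier F" if f: "f \<in> carrier F" and g: "g \<in> carrier F" for f g
  proof -
    let ?F = "{s. f s \<noteq> \<zero>\<^bsub>k\<^esub>}" and ?G = "{s. g s \<noteq> \<zero>\<^bsub>k\<^esub>}"
    \<comment> \<open>A word at which the product is nonzero is a concatenation of a word in the
      support of \<open>f\<close> and one in the support of \<open>g\<close>; this bounds the
      support by a finite set.\<close>
    have *: "w \<in> (\<lambda>(u,v). u @ v) ` (?F \<times> ?G)" if "(f \<otimes>\<^bsub>word_alg k S\<^esub> g) w \<noteq> \<zero>\<^bsub>k\<^esub>" for w
    proof (rule ccontr)
      assume n: "w \<notin> (\<lambda>(u,v). u @ v) ` (?F \<times> ?G)"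
      have "f (take i w) \<otimes>\<^bsub>k\<^esub> g (drop i w) = \<zero>\<^bsub>k\<^esub>" for i
      proof -
        have "f (take i w) = \<zero>\<^bsub>k\<^esub> \<or> g (drop i w) = \<zero>\<^bsub>k\<^esub>"
          using n by (auto simp: image_iff) (metis append_take_drop_id)
        then show ?thesis using f g by (auto simp: fc)
      qed
      then have "(f \<otimes>\<^bsub>word_alg k S\<^esub> g) w = \<zero>\<^bsub>k\<^esub>" by (simp add: word_mult)
      with that show False by simp
    qed
    have fin: "finite ((\<lambda>(u,v). u @ v) ` (?F \<times> ?G))"
      using f g free_carrierD(3) unfolding F_def by blast
    have sub: "w \<in> lists S" if "w \<in> (\<lambda>(u,v). u @ v) ` (?F \<times> ?G)" for w
      using that f g free_carrierD(2) unfolding F_def by fastforce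
    show ?thesis unfolding F_def
    proof (rule free_carrierI)
      show "(f \<otimes>\<^bsub>word_alg k S\<^esub> g) w \<in> carrier k" for w
        unfolding word_mult by (rule K.finsum_closed) (use f g in \<open>auto simp: fc\<close>)
      show "w \<in> lists S" if "(f \<otimes>\<^bsub>word_alg k S\<^esub> g) w \<noteq> \<zero>\<^bsub>k\<^esub>" for w using sub * that by blast
      show "finite {w. (f \<otimes>\<^bsub>word_alg k S\<^esub> g) w \<noteq> \<zero>\<^bsub>k\<^esub>}"
        by (rule finite_subset[OF _ fin]) (use * in blast)
    qed
  qed
  have add: "(\<Oplus>\<^bsub>k\<^esub>i \<in> {..n}. p i \<oplus>\<^bsub>k\<^esub> q i) = (\<Oplus>\<^bsub>k\<^esub>i \<in> {..n}. p i) \<oplus>\<^bsub>k\<^esub> (\<Oplus>\<^bsub>k\<^esub>i \<in> {..n}. q i)"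
    if "\<And>i. p i \<in> carrier k" "\<And>i. q i \<in> carrier k" for p q and n :: nat
    using that by (intro K.finsum_addf) auto
  have sm: "a \<otimes>\<^bsub>k\<^esub> (\<Oplus>\<^bsub>k\<^esub>i \<in> {..n}. p i) = (\<Oplus>\<^bsub>k\<^esub>i \<in> {..n}. a \<otimes>\<^bsub>k\<^esub> p i)"
    if "\<And>i. p i \<in> carrier k" "a \<in> carrier k" for p a and n :: nat
    using that by (intro K.finsum_rdistr) auto
  show ?thesis
  proof (rule bilinI)
    fix g assume g [simp]: "g \<in> carrier F"
    show "lin k F F (\<lambda>f. f \<otimes>\<^bsub>word_alg k S\<^esub> g)"
    proof (rule linI)
      fix x y assume "x \<in> carrier F" "y \<in> carrier F"
      then show "(x \<oplus>\<^bsub>F\<^esub> y) \<otimes>\<^bsub>word_alg k S\<^esub> g = (x \<otimes>\<^bsub>word_alg k S\<^esub> g) \<oplus>\<^bsub>F\<^esub> (y \<otimes>\<^bsub>word_alg k S\<^esub> g)"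
        by (intro ext) (simp add: word_mult fc[of x] fc[of y] fc[of g] K.l_distr add)
    next
      fix a x assume "a \<in> carrier k" "x \<in> carrier F"
      then show "(a \<odot>\<^bsub>F\<^esub> x) \<otimes>\<^bsub>word_alg k S\<^esub> g = a \<odot>\<^bsub>F\<^esub> (x \<otimes>\<^bsub>word_alg k S\<^esub> g)"
        by (intro ext) (simp add: word_mult fc[of x] fc[of g] sm K.m_assoc)
    qed (simp_all add: c)
    show "lin k F F (\<lambda>f. g \<otimes>\<^bsub>word_alg k S\<^esub> f)"
    proof (rule linI)
      fix x y assume "x \<in> carrier F" "y \<in> carrier F"
      then show "g \<otimes>\<^bsub>word_alg k S\<^esub> (x \<oplus>\<^bsub>F\<^esub> y) = (g \<otimes>\<^bsub>word_alg k S\<^esub> x) \<oplus>\<^bsub>F\<^esub> (g \<otimes>\<^bsub>word_alg k S\<^esub> y)"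
        by (intro ext) (simp add: word_mult fc[of x] fc[of y] fc[of g] K.r_distr add)
    next
      fix a x assume "a \<in> carrier k" "x \<in> carrier F"
      then show "g \<otimes>\<^bsub>word_alg k S\<^esub> (a \<odot>\<^bsub>F\<^esub> x) = a \<odot>\<^bsub>F\<^esub> (g \<otimes>\<^bsub>word_alg k S\<^esub> x)"
        by (intro ext) (simp add: word_mult fc[of x] fc[of g] sm K.m_lcomm)
    qed (simp_all add: c)
  qed simp_all
qed

lemma word_basis_mult:
  assumes k: "cring k"
  shows "basis_vec k u \<otimes>\<^bsub>word_alg k S\<^esub> basis_vec k v = basis_vec k (u @ v)"
proof
  interpret K: cring k by fact
  fix w
  let ?t = "\<lambda>i. basis_vec k u (take i w) \<otimes>\<^bsub>k\<^esub> basis_vec k v (drop i w)"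
  have c: "?t i \<in> carrier k" for i by (simp add: basis_vec_apply)
  \<comment> \<open>The one cut of \<open>w\<close> that can contribute is at position
    \<open>length u\<close>, and it does so exactly for \<open>w = u @ v\<close>.\<close>
  have z: "?t i = \<zero>\<^bsub>k\<^esub>" if "i \<le> length w" "i \<noteq> length u \<or> w \<noteq> u @ v" for i
  proof -
    have "take i w \<noteq> u \<or> drop i w \<noteq> v"
      using that by (metis append_take_drop_id length_take min.absorb2)
    then show ?thesis by (auto simp: basis_vec_apply)
  qed
  show "(basis_vec k u \<otimes>\<^bsub>word_alg k S\<^esub> basis_vec k v) w = basis_vec k (u @ v) w"
  proof (cases "w = u @ v")
    case True
    have "(\<Oplus>\<^bsub>k\<^esub>i \<in> {..length w}. ?t i) = (\<Oplus>\<^bsub>k\<^esub>i \<in> {length u}. ?t i)"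
      by (rule K.add.finprod_mono_neutral_cong_right) (use True z c in auto)
    then show ?thesis using True c by (simp add: word_mult basis_vec_apply)
  next
    case False
    have "(\<Oplus>\<^bsub>k\<^esub>i \<in> {..length w}. ?t i) = (\<Oplus>\<^bsub>k\<^esub>i \<in> {..length w}. \<zero>\<^bsub>k\<^esub>)"
      by (rule K.finsum_cong') (use False z in auto)
    then show ?thesis using False by (simp add: word_mult basis_vec_apply)
  qed
qed

lemma word_algebra:
  assumes k: "cring k" shows "k_algebra k (word_alg k S)"
proof (rule k_algebraI)
  let ?F = "free_space k (lists S)"
  note [simp] = k bilin_lin[OF word_bilin[OF k]]
  have nil: "basis_vec k [] \<in> carrier ?F" by simp
  show "\<one>\<^bsub>word_alg k S\<^esub> \<in> carrier (word_alg k S)" by (simp add: word_one)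
  fix x assume "x \<in> carrier (word_alg k S)"
  then have x [simp]: "x \<in> carrier ?F" by simp
  show "\<one>\<^bsub>word_alg k S\<^esub> \<otimes>\<^bsub>word_alg k S\<^esub> x = x"
    by (rule free_lin_eq[OF k _ _ _ x, where W = ?F]) (simp_all add: word_one word_basis_mult)
  show "x \<otimes>\<^bsub>word_alg k S\<^esub> \<one>\<^bsub>word_alg k S\<^esub> = x"
    by (rule free_lin_eq[OF k _ _ _ x, where W = ?F]) (simp_all add: word_one word_basis_mult)
  fix y z assume "y \<in> carrier (word_alg k S)" "z \<in> carrier (word_alg k S)"
  then have y [simp]: "y \<in> carrier ?F" and z [simp]: "z \<in> carrier ?F" by simp_all
  show "(x \<otimes>\<^bsub>word_alg k S\<^esub> y) \<otimes>\<^bsub>word_alg k S\<^esub> z = x \<otimes>\<^bsub>word_alg k S\<^esub> (y \<otimes>\<^bsub>word_alg k S\<^esub> z)"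
  proof (rule free_lin_eq[OF k _ _ _ x, where W = ?F])
    fix u assume [simp]: "u \<in> lists S"
    show "(basis_vec k u \<otimes>\<^bsub>word_alg k S\<^esub> y) \<otimes>\<^bsub>word_alg k S\<^esub> z = basis_vec k u \<otimes>\<^bsub>word_alg k S\<^esub> (y \<otimes>\<^bsub>word_alg k S\<^esub> z)"
    proof (rule free_lin_eq[OF k _ _ _ y, where W = ?F])
      fix v assume [simp]: "v \<in> lists S"
      show "(basis_vec k u \<otimes>\<^bsub>word_alg k S\<^esub> basis_vec k v) \<otimes>\<^bsub>word_alg k S\<^esub> z = basis_vec k u \<otimes>\<^bsub>word_alg k S\<^esub> (basis_vec k v \<otimes>\<^bsub>word_alg k S\<^esub> z)"
        by (rule free_lin_eq[OF k _ _ _ z, where W = ?F]) (simp_all add: word_basis_mult)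
    qed simp_all
  qed simp_all
qed (simp_all add: k word_bilin)

lemma word_alg_hom:
  assumes D: "k_algebra k D" and g: "\<And>s. s \<in> S \<Longrightarrow> g s \<in> carrier D"
  obtains f where "alg_hom k (word_alg k S) D f" "\<And>s. s \<in> S \<Longrightarrow> f (basis_vec k [s]) = g s"
proof -
  interpret D: ring D using D by (simp add: k_algebra_def)
  interpret DM: module k D using D by simp
  have k: "cring k" by unfold_locales
  let ?F = "free_space k (lists S)"
  \<comment> \<open>A word has to go to the product of the images of its letters. Multiplicativity
    is then \<open>pm\<close> on basis words, extended linearly in each argument.\<close>
  define p where "p w = foldr (\<lambda>s d. g s \<otimes>\<^bsub>D\<^esub> d) w \<one>\<^bsub>D\<^esub>" for w
  have p [simp]: "p w \<in> carrier D" if "w \<in> lists S" for w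
    using that by (induction w) (simp_all add: p_def g)
  have pm: "p (u @ v) = p u \<otimes>\<^bsub>D\<^esub> p v" if "u \<in> lists S" "v \<in> lists S" for u v
    using that(1) by (induction u) (use that(2) p in \<open>simp_all add: p_def g D.m_assoc\<close>)
  define f where "f = free_lift k D p"
  have f: "lin k ?F D f" "\<And>w. w \<in> lists S \<Longrightarrow> f (basis_vec k w) = p w"
    unfolding f_def by (rule free_lift; simp add: DM.module_axioms)+
  note [simp] = k bilin_lin[OF word_bilin[OF k]] lin_comp[OF f(1)] lin_closed[OF f(1)] bilin_lin[OF k_algebra_bilin[OF D]] DM.module_axioms
  have "f (x \<otimes>\<^bsub>word_alg k S\<^esub> y) = f x \<otimes>\<^bsub>D\<^esub> f y" if x: "x \<in> carrier ?F" and y: "y \<in> carrier ?F" for x y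
  proof (rule free_lin_eq[OF k _ _ _ x, where W = D and f = "\<lambda>x. f (x \<otimes>\<^bsub>word_alg k S\<^esub> y)" and g = "\<lambda>x. f x \<otimes>\<^bsub>D\<^esub> f y"])
    fix u assume [simp]: "u \<in> lists S"
    show "f (basis_vec k u \<otimes>\<^bsub>word_alg k S\<^esub> y) = f (basis_vec k u) \<otimes>\<^bsub>D\<^esub> f y"
      by (rule free_lin_eq[OF k _ _ _ y, where W = D and f = "\<lambda>y. f (basis_vec k u \<otimes>\<^bsub>word_alg k S\<^esub> y)"
            and g = "\<lambda>y. f (basis_vec k u) \<otimes>\<^bsub>D\<^esub> f y"]) (simp_all add: word_basis_mult f(2) pm)
  qed (use y in simp_all)
  then have "alg_hom k (word_alg k S) D f"
    unfolding alg_hom_def using f by (simp add: word_one p_def)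
  moreover have "f (basis_vec k [s]) = g s" if "s \<in> S" for s
    using that f(2)[of "[s]"] g by (simp add: p_def)
  ultimately show thesis using that by blast
qed

lemma word_alg_ext:
  assumes k: "cring k" and f: "alg_hom k (word_alg k S) D f" "alg_hom k (word_alg k S) D g"
    and e: "\<And>s. s \<in> S \<Longrightarrow> f (basis_vec k [s]) = g (basis_vec k [s])" and x: "x \<in> carrier (word_alg k S)"
  shows "f x = g x"
proof (rule free_lin_eq[OF k, where S = "lists S" and W = D])
  fix w assume "w \<in> lists S"
  then show "f (basis_vec k w) = g (basis_vec k w)"
  proof (induction w)
    case Nil
    then show ?case using alg_homD(3)[OF f(1)] alg_homD(3)[OF f(2)] by (simp add: word_one)
  next
    case (Cons s w)
    then show ?case
      using alg_homD(2)[OF f(1), of "basis_vec k [s]" "basis_vec k w"] alg_homD(2)[OF f(2), of "basis_vec k [s]" "basis_vec k w"] e k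
      by (simp add: word_basis_mult)
  qed
qed (use alg_homD(1)[OF f(1)] alg_homD(1)[OF f(2)] x in simp_all)

text \<open>Composing with the projection reduces the question to homomorphisms on \<open>A\<close>.
  The premise \<open>e\<close> is handed the fact that these composites are homomorphisms, so that
  uniqueness results for \<open>A\<close> can prove it.\<close>

lemma quot_alg_ext:
  assumes A: "k_algebra k A" and S: "S \<subseteq> carrier A"
    and f: "alg_hom k (quot A (Idl\<^bsub>A\<^esub> S)) D f" and g: "alg_hom k (quot A (Idl\<^bsub>A\<^esub> S)) D g"
    and e: "\<And>a. a \<in> carrier A \<Longrightarrow> alg_hom k A D (\<lambda>a. f ((Idl\<^bsub>A\<^esub> S) +>\<^bsub>A\<^esub> a)) \<Longrightarrow>
      alg_hom k A D (\<lambda>a. g ((Idl\<^bsub>A\<^esub> S) +>\<^bsub>A\<^esub> a)) \<Longrightarrow> f ((Idl\<^bsub>A\<^esub> S) +>\<^bsub>A\<^esub> a) = g ((Idl\<^bsub>A\<^esub> S) +>\<^bsub>A\<^esub> a)"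
    and x: "x \<in> carrier (quot A (Idl\<^bsub>A\<^esub> S))"
  shows "f x = g x"
proof -
  interpret A: ring A using A by (simp add: k_algebra_def)
  have I: "ideal (Idl\<^bsub>A\<^esub> S) A" by (rule A.genideal_ideal[OF S])
  note p = quot_algebra(2)[OF A I]
  obtain a where "a \<in> carrier A" "x = (Idl\<^bsub>A\<^esub> S) +>\<^bsub>A\<^esub> a" using x by (auto simp: quot_carrier)
  then show ?thesis using e alg_hom_comp[OF p f] alg_hom_comp[OF p g] by simp
qed

lemma module_minus_closed: "module k V \<Longrightarrow> x \<in> carrier V \<Longrightarrow> y \<in> carrier V \<Longrightarrow> x \<ominus>\<^bsub>V\<^esub> y \<in> carrier V"
  by (simp add: module_def abelian_group.minus_closed)

context
  fixes k :: "('k,'r) ring_scheme" and V :: "('k,'v,'p) module_scheme"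
  assumes V: "module k V"
begin

private lemma cring_base: "cring k" using V by (simp add: module_def)
private abbreviation (input) "Words \<equiv> word_alg k (carrier V)"
private lemma W_algebra: "k_algebra k Words" by (rule word_algebra[OF cring_base])
private lemma Wm: "module k Words" by (rule k_algebra_module[OF W_algebra])

private lemma letter: "v \<in> carrier V \<Longrightarrow> basis_vec k [v] \<in> carrier Words"
  using cring_base by simp

private lemma rel: "linear_relations k V \<subseteq> carrier Words"
  unfolding linear_relations_def Let_def
  using letter module_minus_closed[OF Wm] module_add_closed[OF Wm] module_smult_closed[OF Wm] module_add_closed[OF V] module_smult_closed[OF V]
  by (intro Un_least subsetI; elim CollectE exE conjE; simp del: sp_eqs)

private lemma W_ideal: "ideal (Idl\<^bsub>Words\<^esub> (linear_relations k V)) Words"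
  using ring.genideal_ideal[OF _ rel] W_algebra by (simp add: k_algebra_def)

lemma tensor_algebra: "k_algebra k (tensor_alg k V)"
  unfolding tensor_alg_def Let_def by (rule quot_algebra(1)[OF W_algebra W_ideal])

private lemma proj: "alg_hom k Words (tensor_alg k V) (\<lambda>a. (Idl\<^bsub>Words\<^esub> (linear_relations k V)) +>\<^bsub>Words\<^esub> a)"
  unfolding tensor_alg_def Let_def by (rule quot_algebra(2)[OF W_algebra W_ideal])

lemma tensor_gen_lin: "lin k V (tensor_alg k V) (tensor_alg_gen k V)"
proof -
  note p = alg_homD(1)[OF proj]
  have g: "tensor_alg_gen k V v = (Idl\<^bsub>Words\<^esub> (linear_relations k V)) +>\<^bsub>Words\<^esub> basis_vec k [v]" for v
    by (simp add: tensor_alg_gen_def Let_def)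
  show ?thesis
  proof (rule linI)
    fix v w assume v: "v \<in> carrier V" "w \<in> carrier V"
    have "basis_vec k [v \<oplus>\<^bsub>V\<^esub> w] \<ominus>\<^bsub>Words\<^esub> (basis_vec k [v] \<oplus>\<^bsub>Words\<^esub> basis_vec k [w]) \<in> linear_relations k V"
      unfolding linear_relations_def Let_def using v by blast
    then have "(Idl\<^bsub>Words\<^esub> (linear_relations k V)) +>\<^bsub>Words\<^esub> basis_vec k [v \<oplus>\<^bsub>V\<^esub> w] =
        (Idl\<^bsub>Words\<^esub> (linear_relations k V)) +>\<^bsub>Words\<^esub> (basis_vec k [v] \<oplus>\<^bsub>Words\<^esub> basis_vec k [w])"
      by (intro Idl_rel[OF W_algebra rel] letter module_add_closed[OF Wm] module_add_closed[OF V] v)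
    then show "tensor_alg_gen k V (v \<oplus>\<^bsub>V\<^esub> w) = tensor_alg_gen k V v \<oplus>\<^bsub>tensor_alg k V\<^esub> tensor_alg_gen k V w"
      unfolding g using lin_add[OF p letter[OF v(1)] letter[OF v(2)]] by metis
  next
    fix c v assume v: "c \<in> carrier k" "v \<in> carrier V"
    have "basis_vec k [c \<odot>\<^bsub>V\<^esub> v] \<ominus>\<^bsub>Words\<^esub> (c \<odot>\<^bsub>Words\<^esub> basis_vec k [v]) \<in> linear_relations k V"
      unfolding linear_relations_def Let_def using v by blast
    then have "(Idl\<^bsub>Words\<^esub> (linear_relations k V)) +>\<^bsub>Words\<^esub> basis_vec k [c \<odot>\<^bsub>V\<^esub> v] =
        (Idl\<^bsub>Words\<^esub> (linear_relations k V)) +>\<^bsub>Words\<^esub> (c \<odot>\<^bsub>Words\<^esub> basis_vec k [v])"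
      by (intro Idl_rel[OF W_algebra rel] letter module_smult_closed[OF Wm] module_smult_closed[OF V] v)
    then show "tensor_alg_gen k V (c \<odot>\<^bsub>V\<^esub> v) = c \<odot>\<^bsub>tensor_alg k V\<^esub> tensor_alg_gen k V v"
      unfolding g using lin_smult[OF p v(1) letter[OF v(2)]] by metis
  next
    fix v assume "v \<in> carrier V"
    then show "tensor_alg_gen k V v \<in> carrier (tensor_alg k V)"
      unfolding g by (rule lin_closed[OF p letter])
  qed (use V lin_module(2)[OF p] in simp_all)
qed

text \<open>Existence half of the universal property of the tensor algebra: the map on words kills
  \<open>linear_relations\<close> exactly because \<open>g\<close> is linear.\<close>

lemma tensor_alg_lift:
  assumes D: "k_algebra k D" and g: "lin k V D g"
  obtains f where "alg_hom k (tensor_alg k V) D f" "\<And>v. v \<in> carrier V \<Longrightarrow> f (tensor_alg_gen k V v) = g v"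
proof -
  obtain h where h: "alg_hom k Words D h" "\<And>v. v \<in> carrier V \<Longrightarrow> h (basis_vec k [v]) = g v"
    using word_alg_hom[OF D, where S = "carrier V" and g = g] lin_closed[OF g] by blast
  note hl = alg_homD(1)[OF h(1)] and Dm = k_algebra_module[OF D]
  have "h s = \<zero>\<^bsub>D\<^esub>" if s: "s \<in> linear_relations k V" for s
    using s unfolding linear_relations_def Let_def
  proof (elim UnE CollectE exE conjE)
    fix v w assume "s = basis_vec k [v \<oplus>\<^bsub>V\<^esub> w] \<ominus>\<^bsub>Words\<^esub> (basis_vec k [v] \<oplus>\<^bsub>Words\<^esub> basis_vec k [w])" and v: "v \<in> carrier V" "w \<in> carrier V"
    then show ?thesis
      using letter[OF v(1)] letter[OF v(2)] letter[OF module_add_closed[OF V v]]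
      by (simp only: lin_minus[OF hl] lin_add[OF hl] module_add_closed[OF Wm] h(2) module_add_closed[OF V] lin_add[OF g]
         module_minus_eq_zero[OF Dm] module_add_closed[OF Dm] lin_closed[OF g])
  next
    fix c v assume "s = basis_vec k [c \<odot>\<^bsub>V\<^esub> v] \<ominus>\<^bsub>Words\<^esub> (c \<odot>\<^bsub>Words\<^esub> basis_vec k [v])" and v: "c \<in> carrier k" "v \<in> carrier V"
    then show ?thesis
      using letter[OF v(2)] letter[OF module_smult_closed[OF V v]]
      by (simp only: lin_minus[OF hl] lin_smult[OF hl] module_smult_closed[OF Wm] h(2) module_smult_closed[OF V] lin_smult[OF g]
         module_minus_eq_zero[OF Dm] module_smult_closed[OF Dm] lin_closed[OF g])
  qed
  then obtain f where f: "alg_hom k (quot Words (Idl\<^bsub>Words\<^esub> (linear_relations k V))) D f"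
    "\<And>a. a \<in> carrier Words \<Longrightarrow> f ((Idl\<^bsub>Words\<^esub> (linear_relations k V)) +>\<^bsub>Words\<^esub> a) = h a"
    using quot_alg_lift[OF W_algebra D rel h(1)] by blast
  show thesis
    by (rule that[of f]) (use f h letter in \<open>simp_all add: tensor_alg_def tensor_alg_gen_def Let_def\<close>)
qed

lemma tensor_alg_ext:
  assumes f: "alg_hom k (tensor_alg k V) D f" "alg_hom k (tensor_alg k V) D g"
    and e: "\<And>v. v \<in> carrier V \<Longrightarrow> f (tensor_alg_gen k V v) = g (tensor_alg_gen k V v)" and x: "x \<in> carrier (tensor_alg k V)"
  shows "f x = g x"
  by (rule quot_alg_ext[OF W_algebra rel f(1)[unfolded tensor_alg_def Let_def] f(2)[unfolded tensor_alg_def Let_def] _ x[unfolded tensor_alg_def Let_def]])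
    (rule word_alg_ext[OF cring_base], use e in \<open>simp_all add: tensor_alg_gen_def Let_def\<close>)

end

section \<open>The algebra \<open>A \<triangleleft> H\<close>\<close>

context
  fixes k :: "('k,'r) ring_scheme" and A :: "('k,'a) module" and H :: "('k,'h) coalg"
  assumes A: "k_algebra k A" and H: "coalgebra k H"
begin

private abbreviation (input) "TA \<equiv> tensor_alg k (tensor k A H)"
private definition "e a h = tensor_alg_gen k (tensor k A H) (tens k A H a h)"
private definition "Rels = 
        {e (a \<otimes>\<^bsub>A\<^esub> a') h \<ominus>\<^bsub>TA\<^esub> tlift k H H TA (\<lambda>x y. e a x \<otimes>\<^bsub>TA\<^esub> e a' y) (comult H h) | a a' h.
           a \<in> carrier A \<and> a' \<in> carrier A \<and> h \<in> carrier H}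
      \<union> {e \<one>\<^bsub>A\<^esub> h \<ominus>\<^bsub>TA\<^esub> counit H h \<odot>\<^bsub>TA\<^esub> \<one>\<^bsub>TA\<^esub> | h. h \<in> carrier H}"

private lemma Am: "module k A" and Hm: "module k H" using A H by simp_all
private lemma T_algebra: "k_algebra k TA" by (rule tensor_algebra[OF tensor_module[OF Am Hm]])
private lemma Tm: "module k TA" by (rule k_algebra_module[OF T_algebra])

private lemma e_bilin: "bilin k A H TA e"
proof -
  note [simp] = Am Hm Tm lin_comp[OF tensor_gen_lin[OF tensor_module[OF Am Hm]]]
  show ?thesis unfolding e_def[abs_def] by simp
qed

private lemma ee_bilin: "a \<in> carrier A \<Longrightarrow> a' \<in> carrier A \<Longrightarrow> bilin k H H TA (\<lambda>x y. e a x \<otimes>\<^bsub>TA\<^esub> e a' y)"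
proof -
  note [simp] = Am Hm Tm bilin_lin[OF e_bilin] bilin_lin[OF k_algebra_bilin[OF T_algebra]] 
  show "a \<in> carrier A \<Longrightarrow> a' \<in> carrier A \<Longrightarrow> bilin k H H TA (\<lambda>x y. e a x \<otimes>\<^bsub>TA\<^esub> e a' y)" by simp
qed

private lemma Amult: "a \<in> carrier A \<Longrightarrow> a' \<in> carrier A \<Longrightarrow> a \<otimes>\<^bsub>A\<^esub> a' \<in> carrier A"
  by (rule bilin_closed[OF k_algebra_bilin[OF A]])

private lemma terms:
  assumes "a \<in> carrier A" "a' \<in> carrier A" "h \<in> carrier H"
  shows "e (a \<otimes>\<^bsub>A\<^esub> a') h \<in> carrier TA" "tlift k H H TA (\<lambda>x y. e a x \<otimes>\<^bsub>TA\<^esub> e a' y) (comult H h) \<in> carrier TA"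
    "e \<one>\<^bsub>A\<^esub> h \<in> carrier TA" "counit H h \<odot>\<^bsub>TA\<^esub> \<one>\<^bsub>TA\<^esub> \<in> carrier TA"
  using assms H by (auto intro!: bilin_closed[OF e_bilin] Amult tlift_closed ee_bilin module_smult_closed[OF Tm] k_algebra_one[OF T_algebra] k_algebra_one[OF A])

private lemma R_subset: "Rels \<subseteq> carrier TA"
proof
  fix s assume "s \<in> Rels"
  then show "s \<in> carrier TA" unfolding Rels_def
  proof (elim UnE CollectE exE conjE)
    fix h assume "s = e \<one>\<^bsub>A\<^esub> h \<ominus>\<^bsub>TA\<^esub> counit H h \<odot>\<^bsub>TA\<^esub> \<one>\<^bsub>TA\<^esub>" "h \<in> carrier H"
    then show ?thesis
      using terms(3,4)[OF k_algebra_one[OF A] k_algebra_one[OF A]] by (simp add: module_minus_closed[OF Tm])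
  qed (simp add: terms module_minus_closed[OF Tm])
qed

private lemma R_ideal: "ideal (Idl\<^bsub>TA\<^esub> Rels) TA"
  using ring.genideal_ideal[OF _ R_subset] T_algebra by (simp add: k_algebra_def)

private lemma tri_eqs: "tri_alg k A H = quot TA (Idl\<^bsub>TA\<^esub> Rels)" "tri_gen k A H a h = (Idl\<^bsub>TA\<^esub> Rels) +>\<^bsub>TA\<^esub> e a h"
  by (simp_all add: tri_alg_def tri_gen_def tri_ideal_def Rels_def e_def Let_def)

lemma tri_algebra: "k_algebra k (tri_alg k A H)"
  unfolding tri_eqs by (rule quot_algebra(1)[OF T_algebra R_ideal])

private lemma tri_proj: "alg_hom k TA (tri_alg k A H) (\<lambda>a. (Idl\<^bsub>TA\<^esub> Rels) +>\<^bsub>TA\<^esub> a)"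
  unfolding tri_eqs by (rule quot_algebra(2)[OF T_algebra R_ideal])

lemma tri_gen_bilin: "bilin k A H (tri_alg k A H) (tri_gen k A H)"
proof -
  note [simp] = Am Hm bilin_lin[OF e_bilin] lin_comp[OF alg_homD(1)[OF tri_proj]] k_algebra_module[OF tri_algebra]
  have "bilin k A H (tri_alg k A H) (\<lambda>a h. (Idl\<^bsub>TA\<^esub> Rels) +>\<^bsub>TA\<^esub> e a h)" by simp
  then show ?thesis by (rule iffD1[OF bilin_cong, rotated]) (simp add: tri_eqs(2))
qed

lemma tri_gen_mult:
  assumes "a \<in> carrier A" "a' \<in> carrier A" "h \<in> carrier H"
  shows "tri_gen k A H (a \<otimes>\<^bsub>A\<^esub> a') h =
    tlift k H H (tri_alg k A H) (\<lambda>x y. tri_gen k A H a x \<otimes>\<^bsub>tri_alg k A H\<^esub> tri_gen k A H a' y) (comult H h)"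
proof -
  have "e (a \<otimes>\<^bsub>A\<^esub> a') h \<ominus>\<^bsub>TA\<^esub> tlift k H H TA (\<lambda>x y. e a x \<otimes>\<^bsub>TA\<^esub> e a' y) (comult H h) \<in> Rels"
    unfolding Rels_def using assms by blast
  then have "tri_gen k A H (a \<otimes>\<^bsub>A\<^esub> a') h = (Idl\<^bsub>TA\<^esub> Rels) +>\<^bsub>TA\<^esub> tlift k H H TA (\<lambda>x y. e a x \<otimes>\<^bsub>TA\<^esub> e a' y) (comult H h)"
    unfolding tri_eqs(2) by (intro Idl_rel[OF T_algebra R_subset] terms assms)
  also have "\<dots> = tlift k H H (tri_alg k A H) (\<lambda>x y. (Idl\<^bsub>TA\<^esub> Rels) +>\<^bsub>TA\<^esub> (e a x \<otimes>\<^bsub>TA\<^esub> e a' y)) (comult H h)"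
    by (rule tlift_push[OF alg_homD(1)[OF tri_proj] ee_bilin]) (use assms H in simp_all)
  also have "\<dots> = tlift k H H (tri_alg k A H) (\<lambda>x y. tri_gen k A H a x \<otimes>\<^bsub>tri_alg k A H\<^esub> tri_gen k A H a' y) (comult H h)"
    using alg_homD(2)[OF tri_proj] bilin_closed[OF e_bilin] assms by (simp add: tri_eqs(2))
  finally show ?thesis .
qed

lemma tri_gen_one:
  assumes "h \<in> carrier H"
  shows "tri_gen k A H \<one>\<^bsub>A\<^esub> h = counit H h \<odot>\<^bsub>tri_alg k A H\<^esub> \<one>\<^bsub>tri_alg k A H\<^esub>"
proof -
  have "e \<one>\<^bsub>A\<^esub> h \<ominus>\<^bsub>TA\<^esub> counit H h \<odot>\<^bsub>TA\<^esub> \<one>\<^bsub>TA\<^esub> \<in> Rels"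
    unfolding Rels_def using assms by blast
  then have "tri_gen k A H \<one>\<^bsub>A\<^esub> h = (Idl\<^bsub>TA\<^esub> Rels) +>\<^bsub>TA\<^esub> (counit H h \<odot>\<^bsub>TA\<^esub> \<one>\<^bsub>TA\<^esub>)"
    unfolding tri_eqs(2) by (intro Idl_rel[OF T_algebra R_subset] terms[OF k_algebra_one[OF A] k_algebra_one[OF A]] assms)
  then show ?thesis
    using lin_smult[OF alg_homD(1)[OF tri_proj] counit_closed[OF H assms] k_algebra_one[OF T_algebra]] alg_homD(3)[OF tri_proj] by simp
qed

text \<open>The two equations required of \<open>\<beta>\<close> say that its extension to the
  tensor algebra kills the two families of generators of the ideal.\<close>

lemma tri_alg_lift:
  assumes D: "k_algebra k D" and b: "bilin k A H D \<beta>"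
    and m: "\<And>a a' h. a \<in> carrier A \<Longrightarrow> a' \<in> carrier A \<Longrightarrow> h \<in> carrier H \<Longrightarrow>
      \<beta> (a \<otimes>\<^bsub>A\<^esub> a') h = tlift k H H D (\<lambda>x y. \<beta> a x \<otimes>\<^bsub>D\<^esub> \<beta> a' y) (comult H h)"
    and o: "\<And>h. h \<in> carrier H \<Longrightarrow> \<beta> \<one>\<^bsub>A\<^esub> h = counit H h \<odot>\<^bsub>D\<^esub> \<one>\<^bsub>D\<^esub>"
  obtains f where "alg_hom k (tri_alg k A H) D f"
    "\<And>a h. a \<in> carrier A \<Longrightarrow> h \<in> carrier H \<Longrightarrow> f (tri_gen k A H a h) = \<beta> a h"
proof -
  note Dm = k_algebra_module[OF D]
  obtain g where g: "alg_hom k TA D g" "\<And>t. t \<in> carrier (tensor k A H) \<Longrightarrow> g (tensor_alg_gen k (tensor k A H) t) = tlift k A H D \<beta> t"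
    using tensor_alg_lift[OF tensor_module[OF Am Hm] D tlift_lin[OF b]] by blast
  note gl = alg_homD(1)[OF g(1)]
  have ge: "g (e a h) = \<beta> a h" if "a \<in> carrier A" "h \<in> carrier H" for a h
    using that Am Hm b by (simp add: e_def g(2))
  have "g s = \<zero>\<^bsub>D\<^esub>" if "s \<in> Rels" for s
    using that unfolding Rels_def
  proof (elim UnE CollectE exE conjE)
    fix a a' h assume s: "s = e (a \<otimes>\<^bsub>A\<^esub> a') h \<ominus>\<^bsub>TA\<^esub> tlift k H H TA (\<lambda>x y. e a x \<otimes>\<^bsub>TA\<^esub> e a' y) (comult H h)"
      and a: "a \<in> carrier A" "a' \<in> carrier A" "h \<in> carrier H"
    have "g (tlift k H H TA (\<lambda>x y. e a x \<otimes>\<^bsub>TA\<^esub> e a' y) (comult H h)) = tlift k H H D (\<lambda>x y. g (e a x \<otimes>\<^bsub>TA\<^esub> e a' y)) (comult H h)"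
      by (rule tlift_push[OF gl ee_bilin]) (use a H in simp_all)
    also have "\<dots> = \<beta> (a \<otimes>\<^bsub>A\<^esub> a') h"
      using a alg_homD(2)[OF g(1)] bilin_closed[OF e_bilin] by (simp add: ge m)
    finally show ?thesis
      unfolding s using terms[OF a] a Amult bilin_closed[OF b] by (simp add: lin_minus[OF gl] ge module_minus_eq_zero[OF Dm])
  next
    fix h assume s: "s = e \<one>\<^bsub>A\<^esub> h \<ominus>\<^bsub>TA\<^esub> counit H h \<odot>\<^bsub>TA\<^esub> \<one>\<^bsub>TA\<^esub>" and h: "h \<in> carrier H"
    have "g (counit H h \<odot>\<^bsub>TA\<^esub> \<one>\<^bsub>TA\<^esub>) = \<beta> \<one>\<^bsub>A\<^esub> h"
      using lin_smult[OF gl counit_closed[OF H h] k_algebra_one[OF T_algebra]] alg_homD(3)[OF g(1)] o[OF h] by simp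
    then show ?thesis
      unfolding s using terms[OF k_algebra_one[OF A] k_algebra_one[OF A] h] h k_algebra_one[OF A] bilin_closed[OF b]
      by (simp add: lin_minus[OF gl] ge module_minus_eq_zero[OF Dm])
  qed
  then obtain f where f: "alg_hom k (quot TA (Idl\<^bsub>TA\<^esub> Rels)) D f" "\<And>a. a \<in> carrier TA \<Longrightarrow> f ((Idl\<^bsub>TA\<^esub> Rels) +>\<^bsub>TA\<^esub> a) = g a"
    using quot_alg_lift[OF T_algebra D R_subset g(1)] by blast
  show thesis
    by (rule that[of f]) (use f ge bilin_closed[OF e_bilin] in \<open>simp_all add: tri_eqs\<close>)
qed

text \<open>The layers of the construction are removed from outside to inside: quotient by the
  ideal, tensor algebra, tensor product of \<open>A\<close> and \<open>H\<close>.\<close>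

lemma tri_alg_ext:
  assumes f: "alg_hom k (tri_alg k A H) D f" "alg_hom k (tri_alg k A H) D g"
    and e: "\<And>a h. a \<in> carrier A \<Longrightarrow> h \<in> carrier H \<Longrightarrow> f (tri_gen k A H a h) = g (tri_gen k A H a h)" and x: "x \<in> carrier (tri_alg k A H)"
  shows "f x = g x"
proof (rule quot_alg_ext[OF T_algebra R_subset f(1)[unfolded tri_eqs] f(2)[unfolded tri_eqs] _ x[unfolded tri_eqs]])
  fix a assume a: "a \<in> carrier TA" and h: "alg_hom k TA D (\<lambda>a. f ((Idl\<^bsub>TA\<^esub> Rels) +>\<^bsub>TA\<^esub> a))" "alg_hom k TA D (\<lambda>a. g ((Idl\<^bsub>TA\<^esub> Rels) +>\<^bsub>TA\<^esub> a))"
  note [simp] = lin_comp[OF alg_homD(1)[OF h(1)]] lin_comp[OF alg_homD(1)[OF h(2)]] Am Hm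
  note gl = tensor_gen_lin[OF tensor_module[OF Am Hm]]
  show "f ((Idl\<^bsub>TA\<^esub> Rels) +>\<^bsub>TA\<^esub> a) = g ((Idl\<^bsub>TA\<^esub> Rels) +>\<^bsub>TA\<^esub> a)"
  proof (rule tensor_alg_ext[OF tensor_module[OF Am Hm] h _ a])
    fix v assume v: "v \<in> carrier (tensor k A H)"
    show "f ((Idl\<^bsub>TA\<^esub> Rels) +>\<^bsub>TA\<^esub> tensor_alg_gen k (tensor k A H) v) = g ((Idl\<^bsub>TA\<^esub> Rels) +>\<^bsub>TA\<^esub> tensor_alg_gen k (tensor k A H) v)"
      by (rule tensor_lin_eq[OF Am Hm _ _ _ v, where U = D]) (use e in \<open>simp_all add: tri_eqs(2) e_def gl\<close>)
  qed
qed

end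

section \<open>Measurings as algebra homomorphisms\<close>

text \<open>After transposition the Sweedler sum in the measuring axiom is the convolution product.
  This brings measurings within reach of the universal property of
  \<open>A \<triangleleft> H\<close>.\<close>

lemma measures_alg_hom:
  assumes m: "measures_alg k A B L \<rho>" and [simp]: "k_algebra k A" "k_algebra k B" "coalgebra k L"
  shows "alg_hom k A (conv_alg k L B) (\<lambda>a. \<lambda>l \<in> carrier L. \<rho> l a)"
proof -
  note b = measures_alg_bilin(1)[OF m]
  note [simp] = bilin_lin[OF b] b k_algebra_one[OF \<open>k_algebra k A\<close>]
  have l: "lin k A (hom_space k L B) (\<lambda>a. \<lambda>l \<in> carrier L. \<rho> l a)" by (rule lin_into_hom) simp_all
  note ex = extensionalityI[of _ "carrier L"]
  have "(\<lambda>l \<in> carrier L. \<rho> l (x \<otimes>\<^bsub>A\<^esub> y)) = (\<lambda>l \<in> carrier L. \<rho> l x) \<otimes>\<^bsub>conv_alg k L B\<^esub> (\<lambda>l \<in> carrier L. \<rho> l y)"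
    if "x \<in> carrier A" "y \<in> carrier A" for x y
    using m that by (intro ex conv_mult(2)) (simp_all add: conv_mult measures_alg_def)
  moreover have "(\<lambda>l \<in> carrier L. \<rho> l \<one>\<^bsub>A\<^esub>) = \<one>\<^bsub>conv_alg k L B\<^esub>"
    using m by (intro ex conv_one(2)) (simp_all add: conv_one measures_alg_def)
  ultimately show ?thesis using l by (simp add: alg_hom_def)
qed

lemma alg_hom_measures:
  assumes f: "alg_hom k A (conv_alg k L B) f" and [simp]: "k_algebra k A" "k_algebra k B" "coalgebra k L"
  shows "measures_alg k A B L (\<lambda>l \<in> carrier L. \<lambda>a \<in> carrier A. f a l)"
proof (rule measures_algI)
  have "lin k A (hom_space k L B) f" using alg_homD(1)[OF f] by simp
  then have b: "bilin k A L B f" by (simp add: lin_hom_iff)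
  have "bilin k L A B (\<lambda>l a. f a l)" by (simp add: bilin_lin[OF b])
  then show "bilin k L A B (\<lambda>l \<in> carrier L. \<lambda>a \<in> carrier A. f a l)" by (rule iffD1[OF bilin_cong, rotated]) simp
qed (simp_all add: alg_homD(2,3)[OF f] conv_mult conv_one
    k_algebra_one[OF \<open>k_algebra k A\<close>] bilin_closed[OF k_algebra_bilin[OF \<open>k_algebra k A\<close>]])

text \<open>Transposed, the two measurings are homomorphisms into \<open>[L,B]\<close> that agree on
  generators, so \<open>tri_alg_ext\<close> applies; extensionality turns pointwise agreement into
  equality.\<close>

lemma measures_tri_eq:
  assumes m: "measures_alg k (tri_alg k A H) B L \<rho>" "measures_alg k (tri_alg k A H) B L \<rho>'"
    and A: "k_algebra k A" "coalgebra k H" and B: "k_algebra k B" "coalgebra k L"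
    and e: "\<And>l a h. l \<in> carrier L \<Longrightarrow> a \<in> carrier A \<Longrightarrow> h \<in> carrier H \<Longrightarrow> \<rho> l (tri_gen k A H a h) = \<rho>' l (tri_gen k A H a h)"
  shows "\<rho> = \<rho>'"
proof -
  note T = tri_algebra[OF A]
  have *: "(\<lambda>l \<in> carrier L. \<rho> l t) = (\<lambda>l \<in> carrier L. \<rho>' l t)" if "t \<in> carrier (tri_alg k A H)" for t
    by (rule tri_alg_ext[OF A measures_alg_hom[OF m(1) T B] measures_alg_hom[OF m(2) T B] _ that])
      (use e in \<open>auto intro!: restrict_ext\<close>)
  have "\<rho> l t = \<rho>' l t" if "l \<in> carrier L" "t \<in> carrier (tri_alg k A H)" for l t
    using fun_cong[OF *[OF that(2)], of l] that by simp
  then have "\<rho> l = \<rho>' l" if "l \<in> carrier L" for l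
    using that measures_alg_bilin(3)[OF m(1) B(2)] measures_alg_bilin(3)[OF m(2) B(2)] T B
    by (intro extensionalityI[of _ "carrier (tri_alg k A H)"]) auto
  then show ?thesis
    using measures_alg_bilin(2)[OF m(1) B(2)] measures_alg_bilin(2)[OF m(2) B(2)] T B
    by (intro extensionalityI[of _ "carrier L"]) auto
qed

section \<open>The module \<open>M \<triangleleft> X\<close>\<close>

lemma hom_bilin_lin:
  assumes b: "bilin k Y N (hom_space k P U) \<delta>" and P: "module k P" and U: "module k U"
  shows "n \<in> carrier N \<Longrightarrow> p \<in> carrier P \<Longrightarrow> lin k S Y g \<Longrightarrow> lin k S U (\<lambda>s. \<delta> (g s) n p)"
    "y \<in> carrier Y \<Longrightarrow> p \<in> carrier P \<Longrightarrow> lin k S N g' \<Longrightarrow> lin k S U (\<lambda>s. \<delta> y (g' s) p)"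
    "y \<in> carrier Y \<Longrightarrow> n \<in> carrier N \<Longrightarrow> lin k S P g'' \<Longrightarrow> lin k S U (\<lambda>s. \<delta> y n (g'' s))"
    "y \<in> carrier Y \<Longrightarrow> n \<in> carrier N \<Longrightarrow> p \<in> carrier P \<Longrightarrow> \<delta> y n p \<in> carrier U"
  using hom_eval_lin[OF P U _ bilin_left[OF b]] hom_eval_lin[OF P U _ bilin_right[OF b]]
    bilin_closed[OF b, unfolded hom_simps(1)] hom_memD(1,2)[OF P U] by blast+

context
  fixes k :: "('k,'r) ring_scheme" and A :: "('k,'a) module" and H :: "('k,'h) coalg"
    and M :: "('k,'a,'m) alg_module" and X :: "('k,'h,'x) comod"
  assumes A [simp]: "k_algebra k A" and H [simp]: "coalgebra k H"
    and M [simp]: "left_module k A M" and X [simp]: "comodule k H X"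
begin

private abbreviation (input) "T \<equiv> tri_alg k A H"
private abbreviation (input) "W \<equiv> tensor k (tri_alg k A H) M"
private abbreviation (input) "V \<equiv> tri_space k A H M X"
private abbreviation (input) "R \<equiv> tri_relations k A H M X"
private abbreviation (input) "ta \<equiv> tri_act k A H M X"
private abbreviation (input) "tt \<equiv> tri_tens k A H M X"

private lemma T_alg [simp]: "k_algebra k T" by (rule tri_algebra[OF A H])
private lemma mods [simp]: "module k M" "module k X" "module k T" "module k W"
  using left_module_module[OF M] comodule_module[OF X] k_algebra_module[OF T_alg] by simp_all

private lemma V_eq: "V = tensor k W X" by (simp add: tri_space_def)
private lemma V_mod [simp]: "module k V" by (simp add: V_eq)

private lemmas T_lin [simp] = bilin_lin[OF k_algebra_bilin[OF T_alg]] k_algebra_one[OF T_alg]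

lemma tri_tens_lin [simp]:
  "m \<in> carrier M \<Longrightarrow> x \<in> carrier X \<Longrightarrow> lin k S T g \<Longrightarrow> lin k S V (\<lambda>s. tt (g s) m x)"
  "t \<in> carrier T \<Longrightarrow> x \<in> carrier X \<Longrightarrow> lin k S M g' \<Longrightarrow> lin k S V (\<lambda>s. tt t (g' s) x)"
  "t \<in> carrier T \<Longrightarrow> m \<in> carrier M \<Longrightarrow> lin k S X g'' \<Longrightarrow> lin k S V (\<lambda>s. tt t m (g'' s))"
  "t \<in> carrier T \<Longrightarrow> m \<in> carrier M \<Longrightarrow> x \<in> carrier X \<Longrightarrow> tt t m x \<in> carrier V"
  by (simp_all add: tri_tens_def V_eq)

private lemma ta_eq: "ta r v = tlift k W X V (\<lambda>w x. tens k W X (tlift k T M W (\<lambda>t m. tens k T M (r \<otimes>\<^bsub>T\<^esub> t) m) w) x) v"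
  by (simp add: tri_act_def Let_def tmap_def V_eq)

lemma tri_act_bilin: "bilin k T V V ta"
  unfolding ta_eq[abs_def] unfolding V_eq by simp

private lemmas ta_lin [simp] = bilin_lin[OF tri_act_bilin]

lemma tri_act_tens [simp]:
  "r \<in> carrier T \<Longrightarrow> t \<in> carrier T \<Longrightarrow> m \<in> carrier M \<Longrightarrow> x \<in> carrier X \<Longrightarrow> ta r (tt t m x) = tt (r \<otimes>\<^bsub>T\<^esub> t) m x"
  unfolding ta_eq tri_tens_def V_eq by simp

lemma tri_space_lin_eq:
  assumes "lin k V U f" "lin k V U g"
    "\<And>t m x. t \<in> carrier T \<Longrightarrow> m \<in> carrier M \<Longrightarrow> x \<in> carrier X \<Longrightarrow> f (tt t m x) = g (tt t m x)" "v \<in> carrier V"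
  shows "f v = g v"
  by (rule tensor3_lin_eq[OF mods(3,1,2) assms(1,2)[unfolded V_eq] _ assms(4)[unfolded V_eq]])
    (use assms(3) in \<open>simp add: tri_tens_def\<close>)

private lemma act_closed: "a \<in> carrier A \<Longrightarrow> m \<in> carrier M \<Longrightarrow> act M a m \<in> carrier M"
  by (rule left_module_lin(3)[OF A M])

private lemma gen_lin [simp]:
  "h \<in> carrier H \<Longrightarrow> lin k S A g \<Longrightarrow> lin k S T (\<lambda>s. tri_gen k A H (g s) h)"
  "a \<in> carrier A \<Longrightarrow> lin k S H g' \<Longrightarrow> lin k S T (\<lambda>s. tri_gen k A H a (g' s))"
  "a \<in> carrier A \<Longrightarrow> h \<in> carrier H \<Longrightarrow> tri_gen k A H a h \<in> carrier T"
  using bilin_lin[OF tri_gen_bilin[OF A H]] by blast+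

private definition "G = {tt \<one>\<^bsub>T\<^esub> (act M a m) x \<ominus>\<^bsub>V\<^esub> tlift k H X V (\<lambda>h y. tt (tri_gen k A H a h) m y) (coact X x) | a m x.
               a \<in> carrier A \<and> m \<in> carrier M \<and> x \<in> carrier X}"

private lemma G_subset: "G \<subseteq> carrier V"
proof
  fix g assume "g \<in> G"
  then show "g \<in> carrier V"
    unfolding G_def by (elim CollectE exE conjE) (simp add: module_minus_closed[OF V_mod] act_closed)
qed

private lemma R_eq: "R = \<Inter>{U. submodule U k V \<and> (\<forall>r \<in> carrier T. \<forall>u \<in> U. ta r u \<in> U) \<and> G \<subseteq> U}"
  by (simp add: tri_relations_def Let_def G_def)

private lemma R_sub: "submodule R k V"
  unfolding R_eq
proof (rule Inter_submodule)
  have "carrier V \<in> {U. submodule U k V \<and> (\<forall>r \<in> carrier T. \<forall>u \<in> U. ta r u \<in> U) \<and> G \<subseteq> U}"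
    using module.carrier_is_submodule[OF V_mod] G_subset by simp
  then show "{U. submodule U k V \<and> (\<forall>r \<in> carrier T. \<forall>u \<in> U. ta r u \<in> U) \<and> G \<subseteq> U} \<noteq> {}" by blast
qed auto

private lemma R_stable: "r \<in> carrier T \<Longrightarrow> u \<in> R \<Longrightarrow> ta r u \<in> R"
  unfolding R_eq by blast

private lemma R_gens: "G \<subseteq> R"
  unfolding R_eq by blast

private lemma R_least: "submodule U k V \<Longrightarrow> (\<And>r u. r \<in> carrier T \<Longrightarrow> u \<in> U \<Longrightarrow> ta r u \<in> U) \<Longrightarrow> G \<subseteq> U \<Longrightarrow> R \<subseteq> U"
  unfolding R_eq by blast

private lemma sp_tri_mod: "sp (tri_mod k A H M X) = sp (quot V R)"
  by (simp add: tri_mod_def Let_def module.defs alg_module.defs sp_def)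

private lemmas tri_mod_sp [simp] = sp_eqs[OF sp_tri_mod]

private lemma Q_mod [simp]: "module k (quot V R)"
  by (rule quot_module[OF V_mod R_sub])

lemma tri_mod_module: "module k (tri_mod k A H M X)"
  by simp

private lemma act_coset: "r \<in> carrier T \<Longrightarrow> v \<in> carrier V \<Longrightarrow> act (tri_mod k A H M X) r (R +>\<^bsub>V\<^esub> v) = R +>\<^bsub>V\<^esub> ta r v"
proof -
  assume r: "r \<in> carrier T" and v: "v \<in> carrier V"
  have "(\<Union>t \<in> R +>\<^bsub>V\<^esub> v. R +>\<^bsub>V\<^esub> ta r t) = R +>\<^bsub>V\<^esub> ta r v"
    by (rule Union_cosets[OF V_mod R_sub]) (use r v R_stable in simp_all)
  then show ?thesis by (simp add: tri_mod_def Let_def module.defs alg_module.defs)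
qed

private lemma ta_assoc:
  assumes "r \<in> carrier T" "r' \<in> carrier T" "v \<in> carrier V"
  shows "ta (r \<otimes>\<^bsub>T\<^esub> r') v = ta r (ta r' v)" "ta \<one>\<^bsub>T\<^esub> v = v"
  by (rule tri_space_lin_eq[OF _ _ _ assms(3), where U = V], use assms in \<open>simp_all add: k_algebra_assoc[OF T_alg]\<close>)+

lemma tri_left_module: "left_module k T (tri_mod k A H M X)"
proof (rule left_moduleI)
  have c: "lin k V (quot V R) (\<lambda>v. R +>\<^bsub>V\<^esub> v)" by (rule lin_coset[OF V_mod R_sub])
  note q = quot_add[OF V_mod R_sub] quot_smult[OF V_mod R_sub]
  have l1: "lin k T V (\<lambda>t. ta t v)" if "v \<in> carrier V" for v using that by simp
  have l2: "lin k V V (ta r)" if "r \<in> carrier T" for r using that by simp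
  show "bilin k T (tri_mod k A H M X) (tri_mod k A H M X) (act (tri_mod k A H M X))"
    by (simp, intro bilinI linI)
      (auto simp: quot_carrier act_coset q lin_add[OF l1] lin_add[OF l2] lin_smult[OF l1] lin_smult[OF l2]
        module_add_closed[OF mods(3)] module_smult_closed[OF mods(3)] module_add_closed[OF V_mod] module_smult_closed[OF V_mod])
qed (auto simp: quot_carrier act_coset ta_assoc(1) ta_assoc(2)[OF k_algebra_one[OF T_alg] k_algebra_one[OF T_alg]])

private lemma gen_eq: "tri_mod_gen k A H M X t m x = R +>\<^bsub>V\<^esub> tt t m x"
  by (simp add: tri_mod_gen_def)

private lemma coset_lin: "lin k S V g \<Longrightarrow> lin k S (quot V R) (\<lambda>s. R +>\<^bsub>V\<^esub> g s)"
  by (rule lin_comp[OF lin_coset[OF V_mod R_sub]])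

lemma tri_mod_gen_lin:
  "m \<in> carrier M \<Longrightarrow> x \<in> carrier X \<Longrightarrow> lin k S T g \<Longrightarrow> lin k S (tri_mod k A H M X) (\<lambda>s. tri_mod_gen k A H M X (g s) m x)"
  "t \<in> carrier T \<Longrightarrow> x \<in> carrier X \<Longrightarrow> lin k S M g' \<Longrightarrow> lin k S (tri_mod k A H M X) (\<lambda>s. tri_mod_gen k A H M X t (g' s) x)"
  "t \<in> carrier T \<Longrightarrow> m \<in> carrier M \<Longrightarrow> lin k S X g'' \<Longrightarrow> lin k S (tri_mod k A H M X) (\<lambda>s. tri_mod_gen k A H M X t m (g'' s))"
  "t \<in> carrier T \<Longrightarrow> m \<in> carrier M \<Longrightarrow> x \<in> carrier X \<Longrightarrow> tri_mod_gen k A H M X t m x \<in> carrier (tri_mod k A H M X)"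
  unfolding gen_eq by (simp_all add: coset_lin quot_carrier)

lemma tri_mod_act_gen:
  "r \<in> carrier T \<Longrightarrow> t \<in> carrier T \<Longrightarrow> m \<in> carrier M \<Longrightarrow> x \<in> carrier X \<Longrightarrow>
    act (tri_mod k A H M X) r (tri_mod_gen k A H M X t m x) = tri_mod_gen k A H M X (r \<otimes>\<^bsub>T\<^esub> t) m x"
  by (simp add: gen_eq act_coset)

lemma tri_mod_gen_act:
  assumes "a \<in> carrier A" "m \<in> carrier M" "x \<in> carrier X"
  shows "tri_mod_gen k A H M X \<one>\<^bsub>T\<^esub> (act M a m) x =
    tlift k H X (tri_mod k A H M X) (\<lambda>h y. tri_mod_gen k A H M X (tri_gen k A H a h) m y) (coact X x)"
proof -
  have b: "bilin k H X V (\<lambda>h y. tt (tri_gen k A H a h) m y)" using assms by simp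
  have "tt \<one>\<^bsub>T\<^esub> (act M a m) x \<ominus>\<^bsub>V\<^esub> tlift k H X V (\<lambda>h y. tt (tri_gen k A H a h) m y) (coact X x) \<in> R"
    using R_gens assms unfolding G_def by blast
  then have "R +>\<^bsub>V\<^esub> tt \<one>\<^bsub>T\<^esub> (act M a m) x = R +>\<^bsub>V\<^esub> tlift k H X V (\<lambda>h y. tt (tri_gen k A H a h) m y) (coact X x)"
    using coset_eq_iff[OF V_mod R_sub] assms b by (simp add: act_closed)
  also have "\<dots> = tlift k H X (quot V R) (\<lambda>h y. R +>\<^bsub>V\<^esub> tt (tri_gen k A H a h) m y) (coact X x)"
    by (rule tlift_push[OF lin_coset[OF V_mod R_sub] b]) (use assms in simp)
  finally show ?thesis unfolding gen_eq by simp
qed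

lemma tri_mod_ext:
  assumes f: "lin k (tri_mod k A H M X) U f" "lin k (tri_mod k A H M X) U g"
    and e: "\<And>t m x. t \<in> carrier T \<Longrightarrow> m \<in> carrier M \<Longrightarrow> x \<in> carrier X \<Longrightarrow>
      f (tri_mod_gen k A H M X t m x) = g (tri_mod_gen k A H M X t m x)"
    and y: "y \<in> carrier (tri_mod k A H M X)"
  shows "f y = g y"
proof -
  note c = lin_coset[OF V_mod R_sub]
  have f': "lin k (quot V R) U f" "lin k (quot V R) U g" using f by simp_all
  obtain v where v: "v \<in> carrier V" "y = R +>\<^bsub>V\<^esub> v" using y by (auto simp: quot_carrier)
  show ?thesis unfolding v(2)
    by (rule tri_space_lin_eq[OF lin_comp[OF f'(1) c] lin_comp[OF f'(2) c] _ v(1)]) (use e in \<open>simp add: gen_eq\<close>)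
qed

text \<open>The kernel of \<open>f\<close> takes part in the intersection defining the relations:
  \<open>z\<close> puts the generators into it and \<open>s\<close> makes it stable under the
  action. No action on \<open>U\<close> is involved, stability being phrased through the
  kernel.\<close>

lemma tri_mod_lift:
  assumes f: "lin k V U f"
    and z: "\<And>a m x. a \<in> carrier A \<Longrightarrow> m \<in> carrier M \<Longrightarrow> x \<in> carrier X \<Longrightarrow>
      f (tt \<one>\<^bsub>T\<^esub> (act M a m) x) = tlift k H X U (\<lambda>h y. f (tt (tri_gen k A H a h) m y)) (coact X x)"
    and s: "\<And>r v. r \<in> carrier T \<Longrightarrow> v \<in> carrier V \<Longrightarrow> f v = \<zero>\<^bsub>U\<^esub> \<Longrightarrow> f (ta r v) = \<zero>\<^bsub>U\<^esub>"
  obtains g where "lin k (tri_mod k A H M X) U g"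
    "\<And>v. v \<in> carrier V \<Longrightarrow> g (R +>\<^bsub>V\<^esub> v) = f v"
proof -
  have "R \<subseteq> {v \<in> carrier V. f v = \<zero>\<^bsub>U\<^esub>}"
  proof (rule R_least[OF kernel_submodule[OF f]])
    show "G \<subseteq> {v \<in> carrier V. f v = \<zero>\<^bsub>U\<^esub>}"
    proof (rule subsetI)
      fix g assume "g \<in> G"
      then obtain a m x where g: "g = tt \<one>\<^bsub>T\<^esub> (act M a m) x \<ominus>\<^bsub>V\<^esub> tlift k H X V (\<lambda>h y. tt (tri_gen k A H a h) m y) (coact X x)"
        and a [simp]: "a \<in> carrier A" "m \<in> carrier M" "x \<in> carrier X"
        unfolding G_def by blast
      have b: "bilin k H X V (\<lambda>h y. tt (tri_gen k A H a h) m y)" by simp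
      have c: "tt \<one>\<^bsub>T\<^esub> (act M a m) x \<in> carrier V"
        "tlift k H X V (\<lambda>h y. tt (tri_gen k A H a h) m y) (coact X x) \<in> carrier V"
        by (simp_all add: act_closed)
      have "f (tlift k H X V (\<lambda>h y. tt (tri_gen k A H a h) m y) (coact X x)) = f (tt \<one>\<^bsub>T\<^esub> (act M a m) x)"
        unfolding z[OF a] by (rule tlift_push[OF f b]) simp
      then have "f g = \<zero>\<^bsub>U\<^esub>"
        unfolding g lin_minus[OF f c] using module_minus_eq_zero[OF lin_module(2)[OF f]] lin_closed[OF f c(1)] by metis
      then show "g \<in> {v \<in> carrier V. f v = \<zero>\<^bsub>U\<^esub>}" using \<open>g \<in> G\<close> G_subset by auto
    qed
  qed (use s in auto)
  then have "\<And>u. u \<in> R \<Longrightarrow> f u = \<zero>\<^bsub>U\<^esub>" by blast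
  then show thesis using quot_lift[OF R_sub f] that by auto
qed

lemma tri_mod_hom:
  assumes D [simp]: "k_algebra k D" and U [simp]: "left_module k D U" and s: "alg_hom k T D s" and d: "bilin k M X U \<delta>"
    and e: "\<And>a m x. a \<in> carrier A \<Longrightarrow> m \<in> carrier M \<Longrightarrow> x \<in> carrier X \<Longrightarrow>
      \<delta> (act M a m) x = tlift k H X U (\<lambda>h y. act U (s (tri_gen k A H a h)) (\<delta> m y)) (coact X x)"
  obtains g where "lin k (tri_mod k A H M X) U g"
    "\<And>t m x. t \<in> carrier T \<Longrightarrow> m \<in> carrier M \<Longrightarrow> x \<in> carrier X \<Longrightarrow> g (tri_mod_gen k A H M X t m x) = act U (s t) (\<delta> m x)"
    "\<And>t u. t \<in> carrier T \<Longrightarrow> u \<in> carrier (tri_mod k A H M X) \<Longrightarrow> g (act (tri_mod k A H M X) t u) = act U (s t) (g u)"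
proof -
  note sl = alg_homD(1)[OF s]
  note [simp] = bilin_lin[OF d] left_module_lin[OF D U] left_module_module[OF U] sl lin_closed[OF sl] lin_comp[OF sl]
  have Ua: "act U (b \<otimes>\<^bsub>D\<^esub> b') n = act U b (act U b' n)" "act U \<one>\<^bsub>D\<^esub> n = n"
    if "b \<in> carrier D" "b' \<in> carrier D" "n \<in> carrier U" for b b' n
    using U that by (simp_all add: left_module_def)
  \<comment> \<open>The value on \<open>t \<otimes> m \<otimes> x\<close> is forced to be
    \<open>s t\<close> acting on \<open>\<delta> m x\<close>. Being semilinear along
    \<open>s\<close>, this map has a kernel stable under the action.\<close>
  define F where "F v = tlift k W X U (\<lambda>w x. tlift k T M U (\<lambda>t m. act U (s t) (\<delta> m x)) w) v" for v
  have Fl: "lin k V U F" unfolding F_def V_eq by (rule tlift_lin) simp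
  have Ft: "F (tt t m x) = act U (s t) (\<delta> m x)" if "t \<in> carrier T" "m \<in> carrier M" "x \<in> carrier X" for t m x
    using that by (simp add: F_def tri_tens_def)
  have Fa: "F (ta r v) = act U (s r) (F v)" if "r \<in> carrier T" "v \<in> carrier V" for r v
    by (rule tri_space_lin_eq[OF _ _ _ that(2), where U = U])
      (use that Fl in \<open>simp_all add: lin_comp[OF Fl] Ft alg_homD(2)[OF s] Ua\<close>)
  have zr: "act U b \<zero>\<^bsub>U\<^esub> = \<zero>\<^bsub>U\<^esub>" if "b \<in> carrier D" for b
    by (rule lin_zero[of k U U "act U b"]) (use that in simp)
  obtain g where g: "lin k (tri_mod k A H M X) U g" "\<And>v. v \<in> carrier V \<Longrightarrow> g (R +>\<^bsub>V\<^esub> v) = F v"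
  proof (rule tri_mod_lift[OF Fl])
    show "F (tt \<one>\<^bsub>T\<^esub> (act M a m) x) = tlift k H X U (\<lambda>h y. F (tt (tri_gen k A H a h) m y)) (coact X x)"
      if "a \<in> carrier A" "m \<in> carrier M" "x \<in> carrier X" for a m x
      using that by (simp add: Ft act_closed alg_homD(3)[OF s] Ua(2)[OF k_algebra_one[OF D] k_algebra_one[OF D]] e)
  qed (simp_all add: Fa zr)
  show thesis
  proof (rule that[OF g(1)])
    show "g (tri_mod_gen k A H M X t m x) = act U (s t) (\<delta> m x)" if "t \<in> carrier T" "m \<in> carrier M" "x \<in> carrier X" for t m x
      using that by (simp add: gen_eq g(2) Ft)
    show "g (act (tri_mod k A H M X) t u) = act U (s t) (g u)" if "t \<in> carrier T" "u \<in> carrier (tri_mod k A H M X)" for t u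
      using that by (auto simp: quot_carrier act_coset g(2) Fa)
  qed
qed

text \<open>A measuring of \<open>M \<triangleleft> X\<close> by \<open>Y\<close> is a homomorphism into the convolution module \<open>[Y,N]\<close>.\<close>

lemma measures_tri_mod_ex:
  fixes L :: "('k,'l) coalg" and Y :: "('k,'l,'y) comod" and B :: "('k,'b) module" and N :: "('k,'b,'n) alg_module"
  assumes L [simp]: "coalgebra k L" and Y [simp]: "comodule k L Y" and B [simp]: "k_algebra k B" and N [simp]: "left_module k B N"
    and s: "measures_alg k T B L \<sigma>"
    and d: "measures_mod k A M (conv_mod k H X N) L \<pi> Y \<delta>" and p: "measures_alg k A (conv_alg k H B) L \<pi>"
    and e: "\<And>l a h. l \<in> carrier L \<Longrightarrow> a \<in> carrier A \<Longrightarrow> h \<in> carrier H \<Longrightarrow> \<sigma> l (tri_gen k A H a h) = \<pi> l a h"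
  obtains \<gamma> where "measures_mod k T (tri_mod k A H M X) N L \<sigma> Y \<gamma>"
    "\<And>y m x. y \<in> carrier Y \<Longrightarrow> m \<in> carrier M \<Longrightarrow> x \<in> carrier X \<Longrightarrow> \<gamma> y (tri_mod_gen k A H M X \<one>\<^bsub>T\<^esub> m x) = \<delta> y m x"
proof -
  note [simp] = left_module_module[OF N] comodule_module[OF Y] left_module_lin[OF B N]
  note sb = measures_alg_bilin(1)[OF s, simplified] and db = measures_mod_bilin(1)[OF d, simplified]
    and pb = measures_alg_bilin(1)[OF p, simplified]
  note [simp] = bilin_lin[OF sb] hom_bilin_lin[OF db mods(2)] hom_bilin_lin[OF pb coalgebra_module[OF H] k_algebra_module[OF B]]
  let ?C = "conv_alg k L B" and ?E = "conv_mod k L Y N"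
  \<comment> \<open>The given maps with their arguments transposed, now valued in
    \<open>[L,B]\<close> and \<open>[Y,N]\<close>.\<close>
  let ?s = "\<lambda>t. \<lambda>l \<in> carrier L. \<sigma> l t" and ?d = "\<lambda>m x. \<lambda>y \<in> carrier Y. \<delta> y m x"
  note sa = measures_alg_hom[OF s T_alg B L]
  have dd: "bilin k M X (hom_space k Y N) ?d"
    by (rule bilinI) (auto intro!: lin_into_hom)
  have E: "left_module k ?C ?E" by (rule conv_left_module) simp_all
  note [simp] = bilin_lin[OF dd] lin_comp[OF alg_homD(1)[OF sa], simplified] lin_closed[OF alg_homD(1)[OF sa], simplified]
    bilin_lin[OF conv_mod_bilin[OF L B Y N]]
  obtain g where g: "lin k (tri_mod k A H M X) ?E g"
    "\<And>t m x. t \<in> carrier T \<Longrightarrow> m \<in> carrier M \<Longrightarrow> x \<in> carrier X \<Longrightarrow> g (tri_mod_gen k A H M X t m x) = act ?E (?s t) (?d m x)"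
    "\<And>t u. t \<in> carrier T \<Longrightarrow> u \<in> carrier (tri_mod k A H M X) \<Longrightarrow> g (act (tri_mod k A H M X) t u) = act ?E (?s t) (g u)"
  proof (rule tri_mod_hom[OF conv_algebra[OF L B] E sa, of ?d])
    fix a m x assume [simp]: "a \<in> carrier A" "m \<in> carrier M" "x \<in> carrier X"
    let ?c = "\<lambda>l z. act (conv_mod k H X N) (\<pi> l a) (\<delta> z m)"
    have cb: "bilin k L Y (hom_space k X N) ?c"
      by (simp add: bilin_lin[OF pb] bilin_lin[OF db] bilin_lin[OF conv_mod_bilin[OF H B X N]])
    have eb: "bilin k H X (hom_space k Y N) (\<lambda>h x'. act ?E (?s (tri_gen k A H a h)) (?d m x'))" by simp
    have "?d (act M a m) x = tlift k H X (hom_space k Y N) (\<lambda>h x'. act ?E (?s (tri_gen k A H a h)) (?d m x')) (coact X x)" (is "_ = ?r")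
    proof (rule extensionalityI[of _ "carrier Y"])
      show "?r \<in> extensional (carrier Y)"
        by (rule hom_memD(3)[of k Y N]) (use tlift_closed[OF eb, of "coact X x"] in \<open>simp_all add: hom_simps\<close>)
      fix y assume [simp]: "y \<in> carrier Y"
      \<comment> \<open>Evaluation at \<open>x\<close> moves inside the sum over \<open>Y\<close>;
        the convolution action contributes a sum over \<open>X\<close>, and the two are interchanged
        so that evaluation at \<open>y\<close> can move out again.\<close>
      have "?d (act M a m) x y = tlift k L Y (hom_space k X N) ?c (coact Y y) x"
        using d by (simp add: measures_mod_def)
      also have "\<dots> = tlift k L Y N (\<lambda>l z. ?c l z x) (coact Y y)"
        by (rule tlift_push[OF hom_lin_eval cb]) simp_all
      also have "\<dots> = tlift k L Y N (\<lambda>l z. tlift k H X N (\<lambda>h x'. act N (\<pi> l a h) (\<delta> z m x')) (coact X x)) (coact Y y)"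
        by (simp add: conv_act)
      also have "\<dots> = tlift k H X N (\<lambda>h x'. tlift k L Y N (\<lambda>l z. act N (\<pi> l a h) (\<delta> z m x')) (coact Y y)) (coact X x)"
        by (rule tlift_swap) simp_all
      also have "\<dots> = tlift k H X N (\<lambda>h x'. act ?E (?s (tri_gen k A H a h)) (?d m x') y) (coact X x)"
        by (simp add: conv_act e)
      also have "\<dots> = ?r y" by (rule tlift_push[OF hom_lin_eval eb, symmetric]) simp_all
      finally show "?d (act M a m) x y = ?r y" .
    qed simp
    then show "?d (act M a m) x = tlift k H X ?E (\<lambda>h x'. act ?E (?s (tri_gen k A H a h)) (?d m x')) (coact X x)" by simp
  qed (use dd in simp_all)
  \<comment> \<open>Transposing back; equivariance of \<open>g\<close> along \<open>?s\<close>
    becomes the measuring property.\<close>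
  let ?g = "\<lambda>y \<in> carrier Y. \<lambda>u \<in> carrier (tri_mod k A H M X). g u y"
  note gb = lin_hom_iff[OF tri_mod_module, of Y N g, simplified, THEN iffD1, THEN conjunct1, OF g(1)[simplified]]
  note gm = tri_mod_gen_lin(4) bilin_closed[OF left_module_bilin[OF T_alg tri_left_module]]
  have "measures_mod k T (tri_mod k A H M X) N L \<sigma> Y ?g"
  proof (rule measures_modI[OF comodule_module[OF Y] tri_mod_module left_module_module[OF N]])
    have "bilin k Y (tri_mod k A H M X) N (\<lambda>y u. g u y)" using gb by (simp add: bilin_def)
    then show "bilin k Y (tri_mod k A H M X) N ?g" by (rule iffD1[OF bilin_cong, rotated]) simp
  qed (use gm in \<open>simp_all add: g(3) conv_act\<close>)
  moreover have "act ?E (?s \<one>\<^bsub>T\<^esub>) (?d m x) = ?d m x" if "m \<in> carrier M" "x \<in> carrier X" for m x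
    using E bilin_closed[OF dd that] by (simp add: left_module_def alg_homD(3)[OF sa])
  ultimately show thesis using that[of ?g] gm(1) g(2) by simp
qed

text \<open>Since \<open>t \<otimes> m \<otimes> x\<close> is \<open>t\<close> acting on
  \<open>1 \<otimes> m \<otimes> x\<close>, the measuring axiom recovers all values from those at
  \<open>1 \<otimes> m \<otimes> x\<close>.\<close>

lemma measures_tri_mod_eq:
  assumes L [simp]: "coalgebra k L" and Y [simp]: "comodule k L Y" and B [simp]: "k_algebra k B" and N [simp]: "left_module k B N"
    and m: "measures_mod k T (tri_mod k A H M X) N L \<sigma> Y \<gamma>" "measures_mod k T (tri_mod k A H M X) N L \<sigma> Y \<gamma>'"
    and e: "\<And>y m x. y \<in> carrier Y \<Longrightarrow> m \<in> carrier M \<Longrightarrow> x \<in> carrier X \<Longrightarrow>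
      \<gamma> y (tri_mod_gen k A H M X \<one>\<^bsub>T\<^esub> m x) = \<gamma>' y (tri_mod_gen k A H M X \<one>\<^bsub>T\<^esub> m x)"
  shows "\<gamma> = \<gamma>'"
proof -
  note b = measures_mod_bilin[OF m(1) Y tri_mod_module left_module_module[OF N]]
    and c = measures_mod_bilin[OF m(2) Y tri_mod_module left_module_module[OF N]]
  have g: "\<gamma> y (tri_mod_gen k A H M X t m x) = \<gamma>' y (tri_mod_gen k A H M X t m x)"
    if [simp]: "y \<in> carrier Y" "t \<in> carrier T" "m \<in> carrier M" "x \<in> carrier X" for y t m x
  proof -
    have t: "tri_mod_gen k A H M X t m x = act (tri_mod k A H M X) t (tri_mod_gen k A H M X \<one>\<^bsub>T\<^esub> m x)"
      by (simp add: tri_mod_act_gen k_algebra_assoc[OF T_alg])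
    have o: "tri_mod_gen k A H M X \<one>\<^bsub>T\<^esub> m x \<in> carrier (tri_mod k A H M X)" by (rule tri_mod_gen_lin(4)) simp_all
    show ?thesis unfolding t
      using m o unfolding measures_mod_def by (simp add: e del: tri_mod_sp)
  qed
  have "\<gamma> y u = \<gamma>' y u" if "y \<in> carrier Y" "u \<in> carrier (tri_mod k A H M X)" for y u
    by (rule tri_mod_ext[OF _ _ _ that(2), where U = N]) (use that g b(1) c(1) in \<open>simp_all add: bilin_def\<close>)
  then have "\<gamma> y = \<gamma>' y" if "y \<in> carrier Y" for y
    using that b(3) c(3) by (intro extensionalityI[of _ "carrier (tri_mod k A H M X)"]) auto
  then show ?thesis using b(2) c(2) by (intro extensionalityI[of _ "carrier Y"]) auto
qed

text \<open>Later arguments treat \<open>M \<triangleleft> X\<close> through \<open>tri_mod\<close>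
  and its generators, so the rewriting to the underlying quotient is withdrawn.\<close>

declare tri_mod_sp [simp del]

end

section \<open>Currying measurings\<close>

text \<open>The order of arguments changes: \<open>f\<close> takes \<open>l\<close> and
  \<open>h\<close> first, as a measuring by \<open>L \<otimes> H\<close> does, while the result
  takes \<open>l\<close> and \<open>a\<close> first, as a measuring from \<open>A\<close> to
  \<open>[H,B]\<close> does.\<close>

definition curry3 :: "'l set \<Rightarrow> 'a set \<Rightarrow> 'h set \<Rightarrow> ('l \<Rightarrow> 'h \<Rightarrow> 'a \<Rightarrow> 'b) \<Rightarrow> 'l \<Rightarrow> 'a \<Rightarrow> 'h \<Rightarrow> 'b" where
  "curry3 L A H f = (\<lambda>l \<in> L. \<lambda>a \<in> A. \<lambda>h \<in> H. f l h a)"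

lemma curry3_simps [simp]:
  "l \<in> L \<Longrightarrow> a \<in> A \<Longrightarrow> h \<in> H \<Longrightarrow> curry3 L A H f l a h = f l h a"
  "curry3 L A H f \<in> extensional L" "l \<in> L \<Longrightarrow> curry3 L A H f l \<in> extensional A"
  "l \<in> L \<Longrightarrow> a \<in> A \<Longrightarrow> curry3 L A H f l a \<in> extensional H"
  by (simp_all add: curry3_def)

text \<open>Converts the equation of functions delivered by a factorization into the elementwise
  relation used to describe the isomorphisms.\<close>

lemma curry3_eq_iff:
  assumes "g \<in> extensional A" "\<And>a. a \<in> A \<Longrightarrow> g a \<in> extensional H" "l \<in> L"
  shows "g = curry3 L A H f l \<longleftrightarrow> (\<forall>a \<in> A. \<forall>h \<in> H. g a h = f l h a)"
proof
  assume e: "\<forall>a \<in> A. \<forall>h \<in> H. g a h = f l h a"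
  have "g a = curry3 L A H f l a" if "a \<in> A" for a
    by (rule extensionalityI[of _ H]) (use assms e that in simp_all)
  then show "g = curry3 L A H f l"
    by (intro extensionalityI[of _ A]) (use assms in simp_all)
qed (use assms in simp)

lemma curry3_bilin:
  assumes m: "module k L" "module k A" "module k H" "module k B"
    and l: "\<And>h a. h \<in> carrier H \<Longrightarrow> a \<in> carrier A \<Longrightarrow> lin k L B (\<lambda>l. f l h a)"
      "\<And>l a. l \<in> carrier L \<Longrightarrow> a \<in> carrier A \<Longrightarrow> lin k H B (\<lambda>h. f l h a)"
      "\<And>l h. l \<in> carrier L \<Longrightarrow> h \<in> carrier H \<Longrightarrow> lin k A B (\<lambda>a. f l h a)"
  shows "bilin k L A (hom_space k H B) (curry3 (carrier L) (carrier A) (carrier H) f)"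
proof (rule bilinI)
  show "lin k L (hom_space k H B) (\<lambda>l. curry3 (carrier L) (carrier A) (carrier H) f l a)" if "a \<in> carrier A" for a
    by (rule lin_into_hom) (use m l that in \<open>simp_all cong: lin_cong\<close>)
  show "lin k A (hom_space k H B) (\<lambda>a. curry3 (carrier L) (carrier A) (carrier H) f l a)" if "l \<in> carrier L" for l
    by (rule lin_into_hom) (use m l that in \<open>simp_all cong: lin_cong\<close>)
qed (use m in simp_all)

definition uncurry3 ::
    "('k,'r) ring_scheme \<Rightarrow> ('k,'l,'p) module_scheme \<Rightarrow> ('k,'h,'q) module_scheme \<Rightarrow> 'a set \<Rightarrow> ('k,'b,'s) module_scheme \<Rightarrow>
      ('l \<Rightarrow> 'a \<Rightarrow> 'h \<Rightarrow> 'b) \<Rightarrow> ('k,'l,'h) tensor \<Rightarrow> 'a \<Rightarrow> 'b" where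
  "uncurry3 k L H A B f = (\<lambda>t \<in> carrier (tensor k L H). \<lambda>a \<in> A. tlift k L H B (\<lambda>l h. f l a h) t)"

lemma uncurry3_tens [simp]:
  "module k L \<Longrightarrow> module k H \<Longrightarrow> l \<in> carrier L \<Longrightarrow> h \<in> carrier H \<Longrightarrow> a \<in> A \<Longrightarrow> bilin k L H B (\<lambda>l h. f l a h) \<Longrightarrow>
    uncurry3 k L H A B f (tens k L H l h) a = f l a h"
  by (simp add: uncurry3_def)

lemma uncurry3_ext:
  "uncurry3 k L H A B f \<in> extensional (carrier (tensor k L H))"
  "t \<in> carrier (tensor k L H) \<Longrightarrow> uncurry3 k L H A B f t \<in> extensional A"
  by (simp_all add: uncurry3_def)

lemma uncurry3_bilin:
  assumes b: "bilin k L A (hom_space k H B) f" and m: "module k H" "module k B"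
  shows "bilin k (tensor k L H) A B (uncurry3 k L H (carrier A) B f)"
proof -
  note [simp] = m bilin_module[OF b] hom_bilin_lin[OF b m]
  have "bilin k (tensor k L H) A B (\<lambda>t a. tlift k L H B (\<lambda>l h. f l a h) t)" by simp
  then show ?thesis by (rule iffD1[OF bilin_cong, rotated]) (simp add: uncurry3_def)
qed

text \<open>The coaction on a tensor product is a double sum over the coactions of \<open>Y\<close>
  and \<open>X\<close>; its inner sum is the action of \<open>[H,B]\<close> on
  \<open>[X,N]\<close>.\<close>

lemma curry_mod:
  assumes g: "measures_mod k A M N (tensor_coalg k L H) \<sigma> (tensor_comod k L H Y X) \<gamma>" and s: "bilin k (tensor k L H) A B \<sigma>"
    and A [simp]: "k_algebra k A" and B [simp]: "k_algebra k B" and L [simp]: "coalgebra k L" and H [simp]: "coalgebra k H"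
    and M [simp]: "left_module k A M" and N [simp]: "left_module k B N" and Y [simp]: "comodule k L Y" and X [simp]: "comodule k H X"
  shows "measures_mod k A M (conv_mod k H X N) L (curry3 (carrier L) (carrier A) (carrier H) (\<lambda>l h. \<sigma> (tens k L H l h)))
    Y (curry3 (carrier Y) (carrier M) (carrier X) (\<lambda>y x. \<gamma> (tens k Y X y x)))"
    (is "measures_mod k A M _ L ?r Y ?g")
proof -
  note [simp] = comodule_module[OF X] comodule_module[OF Y] left_module_module[OF M] left_module_module[OF N]
  note b = measures_mod_bilin[OF g comodule_tensor, simplified]
  note [simp] = bilin_lin[OF b(1)] bilin_lin[OF s] left_module_lin[OF B N] left_module_lin[OF A M]
  have cb: "bilin k L A (hom_space k H B) ?r" and db: "bilin k Y M (hom_space k X N) ?g" by (rule curry3_bilin; simp)+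
  note [simp] = bilin_lin[OF cb] bilin_lin[OF db] bilin_lin[OF conv_mod_bilin[OF H B X N]]
  show ?thesis
  proof (rule measures_modI)
    fix y a m assume [simp]: "y \<in> carrier Y" "a \<in> carrier A" "m \<in> carrier M"
    have pb: "bilin k L Y (hom_space k X N) (\<lambda>l y. act (conv_mod k H X N) (?r l a) (?g y m))" by simp
    have "?g y (act M a m) = tlift k L Y (hom_space k X N) (\<lambda>l y. act (conv_mod k H X N) (?r l a) (?g y m)) (coact Y y)"
    proof (rule extensionalityI[of _ "carrier X"])
      show "tlift k L Y (hom_space k X N) (\<lambda>l y. act (conv_mod k H X N) (?r l a) (?g y m)) (coact Y y) \<in> extensional (carrier X)"
        by (rule hom_memD(3)[of k X N]) (use tlift_closed[OF pb, of "coact Y y"] in \<open>simp_all add: hom_simps\<close>)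
      fix x assume [simp]: "x \<in> carrier X"
      have "?g y (act M a m) x = tlift k (tensor k L H) (tensor k Y X) N (\<lambda>t u. act N (\<sigma> t a) (\<gamma> u m))
          (coact (tensor_comod k L H Y X) (tens k Y X y x))"
        using g by (simp add: measures_mod_def)
      also have "\<dots> = tlift k L Y N (\<lambda>l y. act (conv_mod k H X N) (?r l a) (?g y m) x) (coact Y y)"
        by (simp add: tlift_coact_tensor conv_act)
      also have "\<dots> = tlift k L Y (hom_space k X N) (\<lambda>l y. act (conv_mod k H X N) (?r l a) (?g y m)) (coact Y y) x"
        by (rule tlift_push[OF hom_lin_eval pb, symmetric]) simp_all
      finally show "?g y (act M a m) x = \<dots>" .
    qed simp
    then show "?g y (act M a m) = tlift k L Y (conv_mod k H X N) (\<lambda>l y. act (conv_mod k H X N) (?r l a) (?g y m)) (coact Y y)"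
      by simp
  qed (simp_all add: db)
qed

text \<open>The calculation of \<open>curry_mod\<close> in the opposite direction, carried out on
  pure tensors.\<close>

lemma uncurry_mod:
  assumes g: "measures_mod k A M (conv_mod k H X N) L \<rho> Y \<gamma>" and r: "bilin k L A (hom_space k H B) \<rho>"
    and A [simp]: "k_algebra k A" and B [simp]: "k_algebra k B" and L [simp]: "coalgebra k L" and H [simp]: "coalgebra k H"
    and M [simp]: "left_module k A M" and N [simp]: "left_module k B N" and Y [simp]: "comodule k L Y" and X [simp]: "comodule k H X"
  shows "measures_mod k A M N (tensor_coalg k L H) (uncurry3 k L H (carrier A) B \<rho>)
    (tensor_comod k L H Y X) (uncurry3 k Y X (carrier M) N \<gamma>)" (is "measures_mod k A M N _ ?s _ ?d")
proof -
  note [simp] = comodule_module[OF X] comodule_module[OF Y] left_module_module[OF M] left_module_module[OF N]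
  note b = measures_mod_bilin[OF g, simplified]
  note sb = uncurry3_bilin[OF r coalgebra_module[OF H] k_algebra_module[OF B]]
    and db = uncurry3_bilin[OF b(1) comodule_module[OF X] left_module_module[OF N]]
  note [simp] = hom_bilin_lin[OF r coalgebra_module[OF H] k_algebra_module[OF B]]
    hom_bilin_lin[OF b(1) comodule_module[OF X] left_module_module[OF N]]
    bilin_lin[OF sb] bilin_lin[OF db] bilin_lin[OF b(1)] bilin_lin[OF r] bilin_lin[OF conv_mod_bilin[OF H B X N]]
    left_module_lin[OF B N] left_module_lin[OF A M]
  note [simp] = lin_comp[OF coact_tensor_lin] lin_closed[OF coact_tensor_lin]
  have mult: "\<gamma> y (act M a m) x = tlift k L Y N (\<lambda>l z. tlift k H X N (\<lambda>h w. act N (\<rho> l a h) (\<gamma> z m w)) (coact X x)) (coact Y y)"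
    if [simp]: "y \<in> carrier Y" "x \<in> carrier X" "a \<in> carrier A" "m \<in> carrier M" for y x a m
  proof -
    have pb: "bilin k L Y (hom_space k X N) (\<lambda>l z. act (conv_mod k H X N) (\<rho> l a) (\<gamma> z m))" by simp
    have "\<gamma> y (act M a m) x = tlift k L Y (hom_space k X N) (\<lambda>l z. act (conv_mod k H X N) (\<rho> l a) (\<gamma> z m)) (coact Y y) x"
      using g by (simp add: measures_mod_def)
    also have "\<dots> = tlift k L Y N (\<lambda>l z. act (conv_mod k H X N) (\<rho> l a) (\<gamma> z m) x) (coact Y y)"
      by (rule tlift_push[OF hom_lin_eval pb]) simp_all
    finally show ?thesis by (simp add: conv_act)
  qed
  show ?thesis
  proof (rule measures_modI)
    fix t a m assume "t \<in> carrier (tensor_comod k L H Y X)" and [simp]: "a \<in> carrier A" "m \<in> carrier M"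
    then have t: "t \<in> carrier (tensor k Y X)" by simp
    have "?d t (act M a m) = tlift k (tensor k L H) (tensor k Y X) N (\<lambda>x y. act N (?s x a) (?d y m)) (coact (tensor_comod k L H Y X) t)"
      by (rule tensor_lin_eq[OF _ _ _ _ _ t, where U = N]) (simp_all add: tlift_coact_tensor mult)
    then show "?d t (act M a m) = tlift k (tensor_coalg k L H) (tensor_comod k L H Y X) N (\<lambda>x y. act N (?s x a) (?d y m)) (coact (tensor_comod k L H Y X) t)"
      by simp
  qed (simp_all add: db uncurry3_ext)
qed

text \<open>An instance of \<open>curry_mod\<close> for self-modules and regular comodules, plus a
  direct check of the unit.\<close>

lemma curry_alg:
  assumes s: "measures_alg k A B (tensor_coalg k L H) \<sigma>"
    and A: "k_algebra k A" and B [simp]: "k_algebra k B" and L [simp]: "coalgebra k L" and H [simp]: "coalgebra k H"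
  shows "measures_alg k A (conv_alg k H B) L (curry3 (carrier L) (carrier A) (carrier H) (\<lambda>l h. \<sigma> (tens k L H l h)))"
    (is "measures_alg k A _ L ?r")
proof -
  interpret B: module k B by simp
  have "measures_mod k A (self_module A) (conv_mod k H (regular H) (self_module B)) L ?r (regular L) ?r"
    using curry_mod[of k A "self_module A" "self_module B" L H \<sigma> "regular L" "regular H" \<sigma>] assms measures_alg_bilin(1)[OF s]
    by (simp add: measures_alg_iff tensor_comod_regular coalgebra_regular)
  moreover have "?r l \<one>\<^bsub>A\<^esub> = counit L l \<odot>\<^bsub>hom_space k H B\<^esub> \<one>\<^bsub>conv_alg k H B\<^esub>" if [simp]: "l \<in> carrier L" for l
    using s k_algebra_one[OF A] k_algebra_one[OF B]
    by (intro extensionalityI[of _ "carrier H"]) (simp_all add: measures_alg_def conv_one hom_simps B.smult_assoc1)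
  ultimately show ?thesis by (simp add: measures_alg_iff measures_mod_def conv_mod_self)
qed

lemma uncurry_alg:
  assumes r: "measures_alg k A (conv_alg k H B) L \<rho>"
    and A: "k_algebra k A" and B [simp]: "k_algebra k B" and L [simp]: "coalgebra k L" and H [simp]: "coalgebra k H"
  shows "measures_alg k A B (tensor_coalg k L H) (uncurry3 k L H (carrier A) B \<rho>)" (is "measures_alg k A B _ ?s")
proof -
  interpret B: module k B by simp
  note b = measures_alg_bilin(1)[OF r L k_algebra_module[OF A], simplified]
  note sb = uncurry3_bilin[OF b coalgebra_module[OF H] k_algebra_module[OF B]]
  note [simp] = hom_bilin_lin[OF b coalgebra_module[OF H] k_algebra_module[OF B]] bilin_lin[OF sb] k_algebra_one[OF A] k_algebra_one[OF B]
  have "measures_mod k A (self_module A) (conv_mod k H (regular H) (self_module B)) L \<rho> (regular L) \<rho>"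
    using r by (simp add: measures_alg_iff measures_mod_def conv_mod_self)
  from uncurry_mod[OF this b A B L H left_module_self[OF A] left_module_self[OF B] coalgebra_regular[OF L] coalgebra_regular[OF H]]
  have "measures_mod k A (self_module A) (self_module B) (tensor_coalg k L H) ?s (regular (tensor_coalg k L H)) ?s"
    by (simp add: tensor_comod_regular uncurry3_def)
  moreover have one: "\<rho> l \<one>\<^bsub>A\<^esub> h = (counit L l \<otimes>\<^bsub>k\<^esub> counit H h) \<odot>\<^bsub>B\<^esub> \<one>\<^bsub>B\<^esub>" if "l \<in> carrier L" "h \<in> carrier H" for l h
    using r that by (simp add: measures_alg_def hom_simps conv_one B.smult_assoc1)
  have "?s t \<one>\<^bsub>A\<^esub> = counit (tensor_coalg k L H) t \<odot>\<^bsub>B\<^esub> \<one>\<^bsub>B\<^esub>" if t: "t \<in> carrier (tensor k L H)" for t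
    by (rule tensor_lin_eq[OF _ _ _ _ _ t, where U = B]) (simp_all add: one counit_tensor_lin)
  ultimately show ?thesis by (simp add: measures_alg_iff)
qed

text \<open>With the converse \<open>cmor_measures\<close>, measurings by \<open>(L,Z)\<close> are
  the morphisms out of \<open>(L,Z) \<otimes> (H,X)\<close>; the universal comodule is thus an
  internal hom.\<close>

lemma measures_cmor:
  assumes s: "measures_coalg k H K L \<sigma>" and t: "measures_comod k H X K Y L \<sigma> Z \<theta>"
    and [simp]: "coalgebra k H" "coalgebra k K" "coalgebra k L" "comodule k H X" "comodule k K Y" "comodule k L Z"
  shows "cmor k (ctensor k (L,Z) (H,X)) (K,Y) (tlift k L H K \<sigma>, tlift k Z X Y \<theta>)"
proof -
  note b = measures_coalg_bilin(1)[OF s, simplified] measures_comod_bilin(1)[OF t, simplified]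
  show ?thesis
    using s t comodule_map_tensor_iff[OF assms(3,4,5,6,7,8) b]
    by (simp add: cmor_def ctensor_def measures_coalg_def measures_comod_def)
qed

lemma cmor_measures:
  assumes c: "cmor k (ctensor k (L,Z) (H,X)) (K,Y) m"
    and a [simp]: "coalgebra k H" "coalgebra k K" "coalgebra k L" "comodule k H X" "comodule k K Y" "comodule k L Z"
  defines "\<sigma> \<equiv> \<lambda>l \<in> carrier L. \<lambda>h \<in> carrier H. fst m (tens k L H l h)"
    and "\<theta> \<equiv> \<lambda>z \<in> carrier Z. \<lambda>x \<in> carrier X. snd m (tens k Z X z x)"
  shows "measures_coalg k H K L \<sigma>" "measures_comod k H X K Y L \<sigma> Z \<theta>"
proof -
  note [simp] = comodule_module[OF a(4)] comodule_module[OF a(5)] comodule_module[OF a(6)]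
  have o: "cobj k (L,Z)" "cobj k (H,X)" "cobj k (K,Y)" by (simp_all add: cobj_def)
  note m = cmorD[OF c cobj_tensor[OF o(1,2)] o(3), unfolded ctensor_def, simplified]
  note [simp] = lin_comp[OF m(3)] lin_comp[OF m(4)]
  have sb: "bilin k L H K \<sigma>"
    unfolding \<sigma>_def by (rule iffD2[OF bilin_cong[where \<beta>' = "\<lambda>l h. fst m (tens k L H l h)"]]) simp_all
  have tb: "bilin k Z X Y \<theta>"
    unfolding \<theta>_def by (rule iffD2[OF bilin_cong[where \<beta>' = "\<lambda>l h. snd m (tens k Z X l h)"]]) simp_all
  \<comment> \<open>The lift agrees with \<open>fst m\<close> on pure tensors, hence on the carrier,
    and both are extensional off it.\<close>
  have f: "tlift k L H K \<sigma> = fst m"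
  proof (rule extensionalityI[OF tlift_ext[OF sb]])
    fix t assume t: "t \<in> carrier (tensor k L H)"
    show "tlift k L H K \<sigma> t = fst m t"
    proof (rule tensor_lin_eq[OF _ _ tlift_lin[OF sb] m(3) _ t])
      fix v w assume "v \<in> carrier L" "w \<in> carrier H"
      then show "tlift k L H K \<sigma> (tens k L H v w) = fst m (tens k L H v w)"
        unfolding tlift_tens[OF sb \<open>v \<in> carrier L\<close> \<open>w \<in> carrier H\<close>] by (simp add: \<sigma>_def)
    qed simp_all
  qed (use m in simp)
  have g: "tlift k Z X Y \<theta> = snd m"
  proof (rule extensionalityI[OF tlift_ext[OF tb]])
    fix t assume t: "t \<in> carrier (tensor k Z X)"
    show "tlift k Z X Y \<theta> t = snd m t"
    proof (rule tensor_lin_eq[OF _ _ tlift_lin[OF tb] m(4) _ t])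
      fix v w assume "v \<in> carrier Z" "w \<in> carrier X"
      then show "tlift k Z X Y \<theta> (tens k Z X v w) = snd m (tens k Z X v w)"
        unfolding tlift_tens[OF tb \<open>v \<in> carrier Z\<close> \<open>w \<in> carrier X\<close>] by (simp add: \<theta>_def)
    qed simp_all
  qed (use m in simp)
  show s: "measures_coalg k H K L \<sigma>"
    unfolding measures_coalg_def f using m sb by (simp add: Lin_hom_iff) (simp add: \<sigma>_def)
  show "measures_comod k H X K Y L \<sigma> Z \<theta>"
    using comodule_map_tensor_iff[OF a(1,2,3,4,5,6) sb tb] m tb unfolding f g
    by (simp add: measures_comod_def Lin_hom_iff) (simp add: \<theta>_def)
qed

section \<open>Measurings of \<open>A \<triangleleft> H\<close> and \<open>M \<triangleleft> X\<close>\<close>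

text \<open>The relation in \<open>A \<triangleleft> H\<close> splits \<open>h\<close> and
  multiplicativity of \<open>\<sigma>\<close> splits \<open>l\<close>. Interchanging the two sums
  makes the inner one the convolution product of \<open>[H,B]\<close>.\<close>

lemma tri_measures_alg:
  assumes s: "measures_alg k (tri_alg k A H) B L \<sigma>"
    and A [simp]: "k_algebra k A" and B [simp]: "k_algebra k B" and L [simp]: "coalgebra k L" and H [simp]: "coalgebra k H"
  shows "measures_alg k A (conv_alg k H B) L (curry3 (carrier L) (carrier A) (carrier H) (\<lambda>l h a. \<sigma> l (tri_gen k A H a h)))"
    (is "measures_alg k A _ L ?r")
proof -
  let ?T = "tri_alg k A H"
  note T [simp] = tri_algebra[OF A H]
  note b = measures_alg_bilin[OF s, simplified]
  note [simp] = bilin_lin[OF b(1)] bilin_lin[OF tri_gen_bilin[OF A H]]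
    k_algebra_one[OF A] k_algebra_one[OF B] bilin_closed[OF k_algebra_bilin[OF A]]
  have cb: "bilin k L A (hom_space k H B) ?r" by (rule curry3_bilin) simp_all
  note [simp] = bilin_lin[OF cb] bilin_lin[OF conv_bilin[OF H B]]
  have l: "lin k ?T B (\<sigma> l)" if "l \<in> carrier L" for l using b(1) that by (simp add: bilin_def)
  show ?thesis
  proof (rule measures_algI)
    fix l a a' assume [simp]: "l \<in> carrier L" "a \<in> carrier A" "a' \<in> carrier A"
    have pb: "bilin k L L (hom_space k H B) (\<lambda>x y. ?r x a \<otimes>\<^bsub>conv_alg k H B\<^esub> ?r y a')" by simp
    have "?r l (a \<otimes>\<^bsub>A\<^esub> a') = tlift k L L (hom_space k H B) (\<lambda>x y. ?r x a \<otimes>\<^bsub>conv_alg k H B\<^esub> ?r y a') (comult L l)"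
    proof (rule extensionalityI[of _ "carrier H"])
      show "tlift k L L (hom_space k H B) (\<lambda>x y. ?r x a \<otimes>\<^bsub>conv_alg k H B\<^esub> ?r y a') (comult L l) \<in> extensional (carrier H)"
        by (rule hom_memD(3)[of k H B]) (use tlift_closed[OF pb, of "comult L l"] in \<open>simp_all add: hom_simps\<close>)
      fix h assume [simp]: "h \<in> carrier H"
      have "?r l (a \<otimes>\<^bsub>A\<^esub> a') h = \<sigma> l (tlift k H H ?T (\<lambda>x y. tri_gen k A H a x \<otimes>\<^bsub>?T\<^esub> tri_gen k A H a' y) (comult H h))"
        by (simp add: tri_gen_mult[OF A H])
      also have "\<dots> = tlift k H H B (\<lambda>u v. \<sigma> l (tri_gen k A H a u \<otimes>\<^bsub>?T\<^esub> tri_gen k A H a' v)) (comult H h)"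
        by (rule tlift_push[OF l]) simp_all
      also have "\<dots> = tlift k H H B (\<lambda>u v. tlift k L L B (\<lambda>x y. \<sigma> x (tri_gen k A H a u) \<otimes>\<^bsub>B\<^esub> \<sigma> y (tri_gen k A H a' v)) (comult L l)) (comult H h)"
        using s by (simp add: measures_alg_def)
      also have "\<dots> = tlift k L L B (\<lambda>x y. tlift k H H B (\<lambda>u v. \<sigma> x (tri_gen k A H a u) \<otimes>\<^bsub>B\<^esub> \<sigma> y (tri_gen k A H a' v)) (comult H h)) (comult L l)"
        by (rule tlift_swap) simp_all
      also have "\<dots> = tlift k L L B (\<lambda>x y. (?r x a \<otimes>\<^bsub>conv_alg k H B\<^esub> ?r y a') h) (comult L l)"
        by (simp add: conv_mult)
      also have "\<dots> = tlift k L L (hom_space k H B) (\<lambda>x y. ?r x a \<otimes>\<^bsub>conv_alg k H B\<^esub> ?r y a') (comult L l) h"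
        by (rule tlift_push[OF hom_lin_eval pb, symmetric]) simp_all
      finally show "?r l (a \<otimes>\<^bsub>A\<^esub> a') h = \<dots>" .
    qed simp
    then show "?r l (a \<otimes>\<^bsub>A\<^esub> a') = tlift k L L (conv_alg k H B) (\<lambda>x y. ?r x a \<otimes>\<^bsub>conv_alg k H B\<^esub> ?r y a') (comult L l)"
      by simp
  next
    fix l assume [simp]: "l \<in> carrier L"
    interpret B: module k B by simp
    have "?r l \<one>\<^bsub>A\<^esub> h = (counit L l \<odot>\<^bsub>hom_space k H B\<^esub> \<one>\<^bsub>conv_alg k H B\<^esub>) h" if [simp]: "h \<in> carrier H" for h
    proof -
      have "?r l \<one>\<^bsub>A\<^esub> h = counit H h \<odot>\<^bsub>B\<^esub> \<sigma> l \<one>\<^bsub>?T\<^esub>"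
        using lin_smult[OF l, of l "counit H h" "\<one>\<^bsub>?T\<^esub>"] k_algebra_one[OF T] by (simp add: tri_gen_one[OF A H])
      also have "\<dots> = counit H h \<odot>\<^bsub>B\<^esub> (counit L l \<odot>\<^bsub>B\<^esub> \<one>\<^bsub>B\<^esub>)" using s by (simp add: measures_alg_def)
      finally show ?thesis
        using k_algebra_one[OF B] by (simp add: conv_one hom_simps B.smult_assoc1[symmetric] B.m_comm[of "counit H h" "counit L l"])
    qed
    then have "?r l \<one>\<^bsub>A\<^esub> = counit L l \<odot>\<^bsub>hom_space k H B\<^esub> \<one>\<^bsub>conv_alg k H B\<^esub>"
      by (intro extensionalityI[of _ "carrier H"]) (simp_all add: hom_simps)
    then show "?r l \<one>\<^bsub>A\<^esub> = counit L l \<odot>\<^bsub>conv_alg k H B\<^esub> \<one>\<^bsub>conv_alg k H B\<^esub>" by simp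
  qed (simp_all add: cb)
qed

lemma tri_measures_mod:
  assumes g: "measures_mod k (tri_alg k A H) (tri_mod k A H M X) N L \<sigma> Y \<gamma>" and s: "bilin k L (tri_alg k A H) B \<sigma>"
    and A [simp]: "k_algebra k A" and B [simp]: "k_algebra k B" and L [simp]: "coalgebra k L" and H [simp]: "coalgebra k H"
    and M [simp]: "left_module k A M" and N [simp]: "left_module k B N" and Y [simp]: "comodule k L Y" and X [simp]: "comodule k H X"
  shows "measures_mod k A M (conv_mod k H X N) L (curry3 (carrier L) (carrier A) (carrier H) (\<lambda>l h a. \<sigma> l (tri_gen k A H a h)))
    Y (curry3 (carrier Y) (carrier M) (carrier X) (\<lambda>y x m. \<gamma> y (tri_mod_gen k A H M X \<one>\<^bsub>tri_alg k A H\<^esub> m x)))"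
    (is "measures_mod k A M _ L ?r Y ?g")
proof -
  let ?T = "tri_alg k A H" and ?U = "tri_mod k A H M X"
  note T = tri_algebra[OF A H]
  note [simp] = comodule_module[OF X] comodule_module[OF Y] left_module_module[OF M] left_module_module[OF N] k_algebra_module[OF T]
    k_algebra_one[OF T] tri_mod_module[OF A H M X]
  note b = measures_mod_bilin[OF g, simplified]
  note [simp] = bilin_lin[OF b(1)] bilin_lin[OF s] left_module_lin[OF B N] left_module_lin[OF A M] bilin_lin[OF tri_gen_bilin[OF A H]]
    tri_mod_gen_lin[OF A H M X]
  have cb: "bilin k L A (hom_space k H B) ?r" and db: "bilin k Y M (hom_space k X N) ?g" by (rule curry3_bilin; simp)+
  note [simp] = bilin_lin[OF cb] bilin_lin[OF db] bilin_lin[OF conv_mod_bilin[OF H B X N]]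
  have l: "lin k ?U N (\<gamma> y)" if "y \<in> carrier Y" for y using b(1) that by (simp add: bilin_def)
  show ?thesis
  proof (rule measures_modI)
    fix y a m assume [simp]: "y \<in> carrier Y" "a \<in> carrier A" "m \<in> carrier M"
    have pb: "bilin k L Y (hom_space k X N) (\<lambda>l y. act (conv_mod k H X N) (?r l a) (?g y m))" by simp
    have "?g y (act M a m) = tlift k L Y (hom_space k X N) (\<lambda>l y. act (conv_mod k H X N) (?r l a) (?g y m)) (coact Y y)"
    proof (rule extensionalityI[of _ "carrier X"])
      show "tlift k L Y (hom_space k X N) (\<lambda>l y. act (conv_mod k H X N) (?r l a) (?g y m)) (coact Y y) \<in> extensional (carrier X)"
        by (rule hom_memD(3)[of k X N]) (use tlift_closed[OF pb, of "coact Y y"] in \<open>simp_all add: hom_simps\<close>)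
      fix x assume [simp]: "x \<in> carrier X"
      \<comment> \<open>A generator is rewritten as an algebra element acting on a generator with
        \<open>1\<close>, which is the form to which the measuring axiom for \<open>\<gamma>\<close>
        applies.\<close>
      have tg: "tri_mod_gen k A H M X (tri_gen k A H a h) m x' = act ?U (tri_gen k A H a h) (tri_mod_gen k A H M X \<one>\<^bsub>?T\<^esub> m x')"
        if "h \<in> carrier H" "x' \<in> carrier X" for h x'
        using that by (simp add: tri_mod_act_gen[OF A H M X] k_algebra_assoc[OF T])
      have "?g y (act M a m) x = \<gamma> y (tlift k H X ?U (\<lambda>h x'. tri_mod_gen k A H M X (tri_gen k A H a h) m x') (coact X x))"
        by (simp add: tri_mod_gen_act[OF A H M X])
      also have "\<dots> = tlift k H X N (\<lambda>h x'. \<gamma> y (tri_mod_gen k A H M X (tri_gen k A H a h) m x')) (coact X x)"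
        by (rule tlift_push[OF l]) simp_all
      also have "\<dots> = tlift k H X N (\<lambda>h x'. tlift k L Y N (\<lambda>l z. act N (\<sigma> l (tri_gen k A H a h)) (\<gamma> z (tri_mod_gen k A H M X \<one>\<^bsub>?T\<^esub> m x'))) (coact Y y)) (coact X x)"
        using g by (simp add: measures_mod_def tg)
      also have "\<dots> = tlift k L Y N (\<lambda>l z. tlift k H X N (\<lambda>h x'. act N (\<sigma> l (tri_gen k A H a h)) (\<gamma> z (tri_mod_gen k A H M X \<one>\<^bsub>?T\<^esub> m x'))) (coact X x)) (coact Y y)"
        by (rule tlift_swap) simp_all
      also have "\<dots> = tlift k L Y N (\<lambda>l y. act (conv_mod k H X N) (?r l a) (?g y m) x) (coact Y y)"
        by (simp add: conv_act)
      also have "\<dots> = tlift k L Y (hom_space k X N) (\<lambda>l y. act (conv_mod k H X N) (?r l a) (?g y m)) (coact Y y) x"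
        by (rule tlift_push[OF hom_lin_eval pb, symmetric]) simp_all
      finally show "?g y (act M a m) x = \<dots>" .
    qed simp
    then show "?g y (act M a m) = tlift k L Y (conv_mod k H X N) (\<lambda>l y. act (conv_mod k H X N) (?r l a) (?g y m)) (coact Y y)"
      by simp
  qed (simp_all add: db)
qed

lemma measures_tri_ex:
  assumes r: "measures_alg k A (conv_alg k H B) L \<rho>"
    and A [simp]: "k_algebra k A" and B [simp]: "k_algebra k B" and L [simp]: "coalgebra k L" and H [simp]: "coalgebra k H"
  obtains \<sigma> where "measures_alg k (tri_alg k A H) B L \<sigma>"
    "\<And>l a h. l \<in> carrier L \<Longrightarrow> a \<in> carrier A \<Longrightarrow> h \<in> carrier H \<Longrightarrow> \<sigma> l (tri_gen k A H a h) = \<rho> l a h"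
proof -
  let ?T = "tri_alg k A H" and ?D = "conv_alg k L B"
  note T = tri_algebra[OF A H]
  note b = measures_alg_bilin[OF r, simplified]
  note [simp] = hom_bilin_lin[OF b(1) coalgebra_module[OF H] k_algebra_module[OF B]] bilin_lin[OF b(1)] bilin_lin[OF conv_bilin[OF H B]]
    k_algebra_one[OF A] k_algebra_one[OF B] bilin_closed[OF k_algebra_bilin[OF A]]
  interpret B: module k B by simp
  \<comment> \<open>\<open>\<rho>\<close> transposed to take values in \<open>[L,B]\<close>; the
    next two facts are the hypotheses of \<open>tri_alg_lift\<close> for it.\<close>
  define \<beta> where "\<beta> a h = (\<lambda>l \<in> carrier L. \<rho> l a h)" for a h
  have \<beta>: "bilin k A H (hom_space k L B) \<beta>"
    by (rule bilinI) (auto intro!: lin_into_hom simp: \<beta>_def)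
  note [simp] = bilin_lin[OF \<beta>] bilin_lin[OF conv_bilin[OF L B]]
  have mult: "\<beta> (a \<otimes>\<^bsub>A\<^esub> a') h = tlift k H H (hom_space k L B) (\<lambda>x y. \<beta> a x \<otimes>\<^bsub>?D\<^esub> \<beta> a' y) (comult H h)"
    if [simp]: "a \<in> carrier A" "a' \<in> carrier A" "h \<in> carrier H" for a a' h
  proof (rule extensionalityI[of _ "carrier L"])
    have pb: "bilin k H H (hom_space k L B) (\<lambda>x y. \<beta> a x \<otimes>\<^bsub>?D\<^esub> \<beta> a' y)" by simp
    show "tlift k H H (hom_space k L B) (\<lambda>x y. \<beta> a x \<otimes>\<^bsub>?D\<^esub> \<beta> a' y) (comult H h) \<in> extensional (carrier L)"
      by (rule hom_memD(3)[of k L B]) (use tlift_closed[OF pb, of "comult H h"] in \<open>simp_all add: hom_simps\<close>)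
    fix l assume [simp]: "l \<in> carrier L"
    have pb': "bilin k L L (hom_space k H B) (\<lambda>x y. \<rho> x a \<otimes>\<^bsub>conv_alg k H B\<^esub> \<rho> y a')" by simp
    have "\<beta> (a \<otimes>\<^bsub>A\<^esub> a') h l = tlift k L L (hom_space k H B) (\<lambda>x y. \<rho> x a \<otimes>\<^bsub>conv_alg k H B\<^esub> \<rho> y a') (comult L l) h"
      using r by (simp add: measures_alg_def \<beta>_def)
    also have "\<dots> = tlift k L L B (\<lambda>x y. (\<rho> x a \<otimes>\<^bsub>conv_alg k H B\<^esub> \<rho> y a') h) (comult L l)"
      by (rule tlift_push[OF hom_lin_eval pb']) simp_all
    also have "\<dots> = tlift k L L B (\<lambda>x y. tlift k H H B (\<lambda>u v. \<rho> x a u \<otimes>\<^bsub>B\<^esub> \<rho> y a' v) (comult H h)) (comult L l)"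
      by (simp add: conv_mult)
    also have "\<dots> = tlift k H H B (\<lambda>u v. tlift k L L B (\<lambda>x y. \<rho> x a u \<otimes>\<^bsub>B\<^esub> \<rho> y a' v) (comult L l)) (comult H h)"
      by (rule tlift_swap) simp_all
    also have "\<dots> = tlift k H H B (\<lambda>x y. (\<beta> a x \<otimes>\<^bsub>?D\<^esub> \<beta> a' y) l) (comult H h)"
      by (simp add: conv_mult \<beta>_def)
    also have "\<dots> = tlift k H H (hom_space k L B) (\<lambda>x y. \<beta> a x \<otimes>\<^bsub>?D\<^esub> \<beta> a' y) (comult H h) l"
      by (rule tlift_push[OF hom_lin_eval pb, symmetric]) simp_all
    finally show "\<beta> (a \<otimes>\<^bsub>A\<^esub> a') h l = \<dots>" .
  qed (simp add: \<beta>_def)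
  have one: "\<beta> \<one>\<^bsub>A\<^esub> h = counit H h \<odot>\<^bsub>hom_space k L B\<^esub> \<one>\<^bsub>?D\<^esub>" if [simp]: "h \<in> carrier H" for h
  proof (rule extensionalityI[of _ "carrier L"])
    fix l assume [simp]: "l \<in> carrier L"
    show "\<beta> \<one>\<^bsub>A\<^esub> h l = (counit H h \<odot>\<^bsub>hom_space k L B\<^esub> \<one>\<^bsub>?D\<^esub>) l"
      using r k_algebra_one[OF B] by (simp add: measures_alg_def \<beta>_def hom_simps conv_one B.smult_assoc1[symmetric]
          B.m_comm[of "counit H h" "counit L l"])
  qed (simp_all add: \<beta>_def hom_simps)
  obtain f where f: "alg_hom k ?T ?D f" "\<And>a h. a \<in> carrier A \<Longrightarrow> h \<in> carrier H \<Longrightarrow> f (tri_gen k A H a h) = \<beta> a h"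
    by (rule tri_alg_lift[OF A H conv_algebra[OF L B], of \<beta>]) (use \<beta> mult one in simp_all)
  show thesis
    by (rule that[OF alg_hom_measures[OF f(1) T B L]])
      (use f(2) bilin_closed[OF tri_gen_bilin[OF A H]] in \<open>simp_all add: \<beta>_def\<close>)
qed

section \<open>The adjunction isomorphisms\<close>

lemma ex1_cong: "(\<And>x. P x \<longleftrightarrow> Q x) \<Longrightarrow> (\<exists>!x. P x) \<longleftrightarrow> (\<exists>!x. Q x)"
  by simp

text \<open>The Yoneda lemma, with a relation in place of a natural bijection.\<close>

lemma ciso_of_relation:
  fixes S :: "('k,'u,'u) cobj" and T :: "('k,'u,'u) cobj"
  assumes S: "cobj k S" and T: "cobj k T"
    and fwd: "\<And>U f. cobj k (U :: ('k,'u,'u) cobj) \<Longrightarrow> cmor k U S f \<Longrightarrow>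
      \<exists>!g. cmor k U T g \<and> (\<forall>c \<in> carrier (fst U). R (fst f c) (fst g c)) \<and> (\<forall>x \<in> carrier (snd U). R' (snd f x) (snd g x))"
    and bwd: "\<And>U g. cobj k (U :: ('k,'u,'u) cobj) \<Longrightarrow> cmor k U T g \<Longrightarrow>
      \<exists>!f. cmor k U S f \<and> (\<forall>c \<in> carrier (fst U). R (fst f c) (fst g c)) \<and> (\<forall>x \<in> carrier (snd U). R' (snd f x) (snd g x))"
  shows "\<exists>\<phi>. ciso k S T \<phi> \<and> (\<forall>c \<in> carrier (fst S). R c (fst \<phi> c)) \<and> (\<forall>x \<in> carrier (snd S). R' x (snd \<phi> x))"
proof -
  let ?R = "\<lambda>U f g. (\<forall>c \<in> carrier (fst U). R (fst f c) (fst g c)) \<and> (\<forall>x \<in> carrier (snd U). R' (snd f x) (snd g x))"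
  \<comment> \<open>The two mutually inverse morphisms are the partners of the identities of
    \<open>S\<close> and \<open>T\<close>.\<close>
  obtain \<phi> where \<phi>: "cmor k S T \<phi>" "?R S (cid S) \<phi>" using fwd[OF S cmor_id[OF S]] by blast
  obtain \<psi> where \<psi>: "cmor k T S \<psi>" "?R T \<psi> (cid T)" using bwd[OF T cmor_id[OF T]] by blast
  note p = cmorD[OF \<phi>(1) S T] and q = cmorD[OF \<psi>(1) T S]
  note [simp] = lin_closed[OF p(3)] lin_closed[OF p(4)] lin_closed[OF q(3)] lin_closed[OF q(4)] ccomp_apply cid_def
  have \<phi>R: "c \<in> carrier (fst S) \<Longrightarrow> R c (fst \<phi> c)" "x \<in> carrier (snd S) \<Longrightarrow> R' x (snd \<phi> x)" for c x
    using \<phi>(2) by simp_all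
  have \<psi>R: "c \<in> carrier (fst T) \<Longrightarrow> R (fst \<psi> c) c" "x \<in> carrier (snd T) \<Longrightarrow> R' (snd \<psi> x) x" for c x
    using \<psi>(2) by simp_all
  \<comment> \<open>Both the composite and the identity are partners of \<open>\<phi>\<close>, and
    partners are unique.\<close>
  have "ccomp S \<psi> \<phi> = cid S"
    by (rule ex1_unique[OF bwd[OF S \<phi>(1)]])
      (use cmor_comp[OF \<phi>(1) \<psi>(1) S T S] cmor_id[OF S] \<phi>R \<psi>R in simp_all)
  moreover have "ccomp T \<phi> \<psi> = cid T"
    by (rule ex1_unique[OF fwd[OF T \<psi>(1)]])
      (use cmor_comp[OF \<psi>(1) \<phi>(1) T S T] cmor_id[OF T] \<phi>R \<psi>R in simp_all)
  ultimately have "ciso k S T \<phi>" unfolding ciso_def using \<phi>(1) \<psi>(1) by blast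
  with \<phi>R show ?thesis by blast
qed

section \<open>Three universal objects: index 1 is \<open>Q(X,Q(M,N))\<close>, index 2 is
  \<open>Q(M,[X,N])\<close>, index 3 is \<open>Q(M \<triangleleft> X,N)\<close>\<close>

context
  fixes k :: "('k,'r) ring_scheme"
    and A :: "('k,'a) module" and M :: "('k,'a,'m) alg_module" and B :: "('k,'b) module" and N :: "('k,'b,'n) alg_module"
    and P :: "('k,'u) coalg" and \<pi> :: "'u \<Rightarrow> 'a \<Rightarrow> 'b" and Q :: "('k,'u,'u) comod" and \<kappa> :: "'u \<Rightarrow> 'm \<Rightarrow> 'n"
    and H :: "('k,'h) coalg" and X :: "('k,'h,'x) comod"
    and P1 :: "('k,'u) coalg" and \<pi>1 :: "'u \<Rightarrow> 'h \<Rightarrow> 'u" and Q1 :: "('k,'u,'u) comod" and \<kappa>1 :: "'u \<Rightarrow> 'x \<Rightarrow> 'u"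
    and P2 :: "('k,'u) coalg" and \<pi>2 :: "'u \<Rightarrow> 'a \<Rightarrow> 'h \<Rightarrow> 'b" and Q2 :: "('k,'u,'u) comod" and \<kappa>2 :: "'u \<Rightarrow> 'm \<Rightarrow> 'x \<Rightarrow> 'n"
    and P3 :: "('k,'u) coalg" and \<pi>3 :: "'u \<Rightarrow> ('k,'a,'h) tri \<Rightarrow> 'b" and Q3 :: "('k,'u,'u) comod"
    and \<kappa>3 :: "'u \<Rightarrow> ('k,('k,('k,'a,'h) tri,'m) tensor,'x) tensor set \<Rightarrow> 'n"
  assumes A [simp]: "k_algebra k A" and B [simp]: "k_algebra k B" and M [simp]: "left_module k A M" and N [simp]: "left_module k B N"
    and H [simp]: "coalgebra k H" and X [simp]: "comodule k H X"
begin

private lemma MNX_modules [simp]: "module k M" "module k N" "module k X"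
  using left_module_module[OF M] left_module_module[OF N] comodule_module[OF X] by simp_all

section \<open>From \<open>Q(X,Q(M,N))\<close> to \<open>Q(M,[X,N])\<close>\<close>

context
  assumes inf: "infinite (UNIV :: 'u set)"
    and fits: "fits TYPE('u) (carrier H)" "fits TYPE('u) (carrier X)"
    and UA: "universal_alg k A B P \<pi>" and UM: "universal_mod k A M B N P \<pi> Q \<kappa>"
    and U1: "universal_coalg k H P P1 \<pi>1" and C1: "universal_comod k H X P Q P1 \<pi>1 Q1 \<kappa>1"
    and U2: "universal_alg k A (conv_alg k H B) P2 \<pi>2" and C2: "universal_mod k A M (conv_alg k H B) (conv_mod k H X N) P2 \<pi>2 Q2 \<kappa>2"
begin

private lemma univ [simp]: "coalgebra k P" "comodule k P Q" "coalgebra k P1" "comodule k P1 Q1" "coalgebra k P2" "comodule k P2 Q2"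
  using UA UM U1 C1 U2 C2
  by (simp_all add: universal_alg_def universal_mod_def universal_coalg_def universal_comod_def)

private lemma meas: "measures_alg k A B P \<pi>" "measures_mod k A M N P \<pi> Q \<kappa>"
  "measures_coalg k H P P1 \<pi>1" "measures_comod k H X P Q P1 \<pi>1 Q1 \<kappa>1"
  "measures_alg k A (conv_alg k H B) P2 \<pi>2" "measures_mod k A M (conv_mod k H X N) P2 \<pi>2 Q2 \<kappa>2"
  using UA UM U1 C1 U2 C2
  by (simp_all add: universal_alg_def universal_mod_def universal_coalg_def universal_comod_def)

text \<open>Uncurrying tests universality of \<open>(P,Q)\<close> on tensor products with
  \<open>(H,X)\<close>; the size hypotheses on \<open>H\<close> and \<open>X\<close> make these
  admissible.\<close>

private lemma tensor_fits:
  assumes "cobj k (S :: ('k,'u,'u) cobj)"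
  shows "cobj k (ctensor k S (H,X))" "fits TYPE('u) (carrier (fst (ctensor k S (H,X))))" "fits TYPE('u) (carrier (snd (ctensor k S (H,X))))"
  using cobj_tensor[OF assms, of "(H,X)"] fits_tensor[OF inf _ _ fits_self fits(1), of k "fst S"]
    fits_tensor[OF inf _ _ fits_self fits(2), of k "snd S"] cobjD[OF assms]
  by (simp_all add: cobj_def)

text \<open>A morphism into the first object, uncurried: it yields a measuring of comodules by
  \<open>S\<close>, hence a morphism from \<open>S \<otimes> (H,X)\<close> to
  \<open>(P,Q)\<close>.\<close>

private lemma pull:
  assumes S: "cobj k (S :: ('k,'u,'u) cobj)" and f: "cmor k S (P1,Q1) f"
  shows "bilin k (fst S) H P (\<lambda>c. \<pi>1 (fst f c))" "bilin k (snd S) X Q (\<lambda>z. \<kappa>1 (snd f z))"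
    "cmor k (ctensor k S (H,X)) (P,Q) (tlift k (fst S) H P (\<lambda>c. \<pi>1 (fst f c)), tlift k (snd S) X Q (\<lambda>z. \<kappa>1 (snd f z)))"
proof -
  note [simp] = cobjD[OF S]
  have o: "cobj k (P1,Q1)" by (simp add: cobj_def)
  note f = cmorD[OF f S o, simplified]
  have s: "measures_coalg k H P (fst S) (compose (carrier (fst S)) \<pi>1 (fst f))"
    by (rule measures_coalg_comp[OF meas(3) f(1)]) simp_all
  have t: "measures_comod k H X P Q (fst S) (compose (carrier (fst S)) \<pi>1 (fst f)) (snd S) (compose (carrier (snd S)) \<kappa>1 (snd f))"
    by (rule measures_comod_comp[OF meas(4) f(3,2) measures_coalg_bilin(1)[OF meas(3)]]) simp_all
  show "bilin k (fst S) H P (\<lambda>c. \<pi>1 (fst f c))"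
    by (rule iffD1[OF bilin_cong measures_coalg_bilin(1)[OF s]]) (simp_all add: compose_eq)
  show "bilin k (snd S) X Q (\<lambda>z. \<kappa>1 (snd f z))"
    by (rule iffD1[OF bilin_cong measures_comod_bilin(1)[OF t]]) (simp_all add: compose_eq)
  show "cmor k (ctensor k S (H,X)) (P,Q) (tlift k (fst S) H P (\<lambda>c. \<pi>1 (fst f c)), tlift k (snd S) X Q (\<lambda>z. \<kappa>1 (snd f z)))"
    using measures_cmor[OF s t] by (simp add: compose_eq)
qed

private lemma evs:
  shows "bilin k P A B \<pi>" "bilin k Q M N \<kappa>" "p \<in> carrier P \<Longrightarrow> \<pi> p \<in> extensional (carrier A)" "q \<in> carrier Q \<Longrightarrow> \<kappa> q \<in> extensional (carrier M)"
  using measures_alg_bilin[OF meas(1)] measures_mod_bilin[OF meas(2)] by simp_all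

text \<open>Two layers of structure maps have to be undone, as \<open>\<pi>1\<close> takes values in
  maps to \<open>P\<close>, whose elements are in turn seen through \<open>\<pi>\<close>.
  \<open>mod_unique\<close> compares the uncurried morphisms into \<open>(P,Q)\<close>, and then
  \<open>comod_unique\<close> compares \<open>f\<close> and \<open>g\<close>.\<close>

private lemma unique1:
  assumes S: "cobj k (S :: ('k,'u,'u) cobj)" and f: "cmor k S (P1,Q1) f" "cmor k S (P1,Q1) g"
    and e: "\<And>c h a. c \<in> carrier (fst S) \<Longrightarrow> h \<in> carrier H \<Longrightarrow> a \<in> carrier A \<Longrightarrow> \<pi> (\<pi>1 (fst f c) h) a = \<pi> (\<pi>1 (fst g c) h) a"
      "\<And>z x m. z \<in> carrier (snd S) \<Longrightarrow> x \<in> carrier X \<Longrightarrow> m \<in> carrier M \<Longrightarrow> \<kappa> (\<kappa>1 (snd f z) x) m = \<kappa> (\<kappa>1 (snd g z) x) m"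
  shows "f = g"
proof -
  note [simp] = cobjD[OF S]
  have o: "cobj k (P1,Q1)" by (simp add: cobj_def)
  note F = pull[OF S f(1)] and G = pull[OF S f(2)]
  note f' = cmorD[OF f(1) S o, simplified] and g' = cmorD[OF f(2) S o, simplified]
  note [simp] = bilin_lin[OF evs(1)] bilin_lin[OF evs(2)]
  note [simp] = F(1,2) G(1,2)
  have "(tlift k (fst S) H P (\<lambda>c. \<pi>1 (fst f c)), tlift k (snd S) X Q (\<lambda>z. \<kappa>1 (snd f z))) =
    (tlift k (fst S) H P (\<lambda>c. \<pi>1 (fst g c)), tlift k (snd S) X Q (\<lambda>z. \<kappa>1 (snd g z)))" (is "(?F, ?F') = (?G, ?G')")
  proof (rule mod_unique[OF UA UM A B M N tensor_fits[OF S] F(3) G(3)], unfold fst_conv snd_conv)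
    fix t assume "t \<in> carrier (fst (ctensor k S (H,X)))"
    then have t: "t \<in> carrier (tensor k (fst S) H)" by simp
    show "\<pi> (?F t) = \<pi> (?G t)"
    proof (rule extensionalityI[OF evs(3) evs(3)])
      fix a assume a: "a \<in> carrier A"
      show "\<pi> (?F t) a = \<pi> (?G t) a"
        by (rule tensor_lin_eq[OF _ _ _ _ _ t, where U = B]) (use a e in \<open>simp_all\<close>)
    qed (use t in simp_all)
  next
    fix t assume "t \<in> carrier (snd (ctensor k S (H,X)))"
    then have t: "t \<in> carrier (tensor k (snd S) X)" by simp
    show "\<kappa> (?F' t) = \<kappa> (?G' t)"
    proof (rule extensionalityI[OF evs(4) evs(4)])
      fix a assume a: "a \<in> carrier M"
      show "\<kappa> (?F' t) a = \<kappa> (?G' t) a"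
        by (rule tensor_lin_eq[OF _ _ _ _ _ t, where U = N]) (use a e in \<open>simp_all\<close>)
    qed (use t in simp_all)
  qed
  then have FG: "?F = ?G" "?F' = ?G'" by simp_all
  note b = measures_coalg_bilin[OF meas(3), simplified] and c = measures_comod_bilin[OF meas(4), simplified]
  show ?thesis
  proof (rule comod_unique[OF U1 C1 H univ(1) X univ(2) S fits_self fits_self f])
    fix z assume z: "z \<in> carrier (fst S)"
    show "\<pi>1 (fst f z) = \<pi>1 (fst g z)"
    proof (rule extensionalityI[OF b(3) b(3)])
      fix h assume h: "h \<in> carrier H"
      show "\<pi>1 (fst f z) h = \<pi>1 (fst g z) h"
        using fun_cong[OF FG(1), of "tens k (fst S) H z h"] z h by simp
    qed (use z lin_closed[OF f'(3)] lin_closed[OF g'(3)] in simp_all)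
  next
    fix z assume z: "z \<in> carrier (snd S)"
    show "\<kappa>1 (snd f z) = \<kappa>1 (snd g z)"
    proof (rule extensionalityI[OF c(3) c(3)])
      fix h assume h: "h \<in> carrier X"
      show "\<kappa>1 (snd f z) h = \<kappa>1 (snd g z) h"
        using fun_cong[OF FG(2), of "tens k (snd S) X z h"] z h by simp
    qed (use z lin_closed[OF f'(4)] lin_closed[OF g'(4)] in simp_all)
  qed
qed

private lemma evs2:
  "bilin k P2 A (hom_space k H B) \<pi>2" "bilin k Q2 M (hom_space k X N) \<kappa>2"
  "p \<in> carrier P2 \<Longrightarrow> \<pi>2 p \<in> extensional (carrier A)" "q \<in> carrier Q2 \<Longrightarrow> \<kappa>2 q \<in> extensional (carrier M)"
  "p \<in> carrier P2 \<Longrightarrow> a \<in> carrier A \<Longrightarrow> \<pi>2 p a \<in> extensional (carrier H)"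
  "q \<in> carrier Q2 \<Longrightarrow> m \<in> carrier M \<Longrightarrow> \<kappa>2 q m \<in> extensional (carrier X)"
proof -
  show b: "bilin k P2 A (hom_space k H B) \<pi>2" "bilin k Q2 M (hom_space k X N) \<kappa>2"
    "p \<in> carrier P2 \<Longrightarrow> \<pi>2 p \<in> extensional (carrier A)" "q \<in> carrier Q2 \<Longrightarrow> \<kappa>2 q \<in> extensional (carrier M)"
    using measures_alg_bilin[OF meas(5)] measures_mod_bilin[OF meas(6)] by simp_all
  show "p \<in> carrier P2 \<Longrightarrow> a \<in> carrier A \<Longrightarrow> \<pi>2 p a \<in> extensional (carrier H)"
    using bilin_closed[OF b(1)] hom_memD(3)[of k H B] by (simp add: hom_simps)
  show "q \<in> carrier Q2 \<Longrightarrow> m \<in> carrier M \<Longrightarrow> \<kappa>2 q m \<in> extensional (carrier X)"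
    using bilin_closed[OF b(2)] hom_memD(3)[of k X N] by (simp add: hom_simps)
qed

text \<open>The uncurried morphism composed with the structure maps of \<open>(P,Q)\<close> is a
  measuring from \<open>A\<close> to \<open>B\<close> by \<open>S \<otimes> (H,X)\<close>. Curried,
  it is a measuring into the convolution objects, and its factorization is the partner
  sought.\<close>

lemma convolution_factor:
  assumes S: "cobj k (S :: ('k,'u,'u) cobj)" and f: "cmor k S (P1,Q1) f"
  shows "\<exists>!g. cmor k S (P2,Q2) g \<and>
    (\<forall>c \<in> carrier (fst S). \<forall>a \<in> carrier A. \<forall>h \<in> carrier H. \<pi>2 (fst g c) a h = \<pi> (\<pi>1 (fst f c) h) a) \<and>
    (\<forall>z \<in> carrier (snd S). \<forall>m \<in> carrier M. \<forall>x \<in> carrier X. \<kappa>2 (snd g z) m x = \<kappa> (\<kappa>1 (snd f z) x) m)"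
proof -
  note [simp] = cobjD[OF S]
  note F = pull[OF S f]
  let ?s = "tlift k (fst S) H P (\<lambda>c. \<pi>1 (fst f c))"
    and ?t = "tlift k (snd S) X Q (\<lambda>z. \<kappa>1 (snd f z))"
  let ?T = "carrier (tensor k (fst S) H)" and ?U = "carrier (tensor k (snd S) X)"
  have o: "cobj k (P,Q)" "cobj k (P2,Q2)" by (simp_all add: cobj_def)
  note c = cmorD[OF F(3) tensor_fits(1)[OF S] o(1), unfolded ctensor_def, simplified]
  have s: "measures_alg k A B (tensor_coalg k (fst S) H) (compose ?T \<pi> ?s)"
    using measures_alg_comp[OF meas(1) c(1)] by simp
  have t: "measures_mod k A M N (tensor_coalg k (fst S) H) (compose ?T \<pi> ?s) (tensor_comod k (fst S) H (snd S) X) (compose ?U \<kappa> ?t)"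
    using measures_mod_comp[OF meas(2) _ c(2) evs(1)] c(3) by (simp add: comodule_tensor)
  have sb: "bilin k (tensor k (fst S) H) A B (compose ?T \<pi> ?s)"
    using measures_alg_bilin(1)[OF s] by simp
  let ?r = "curry3 (carrier (fst S)) (carrier A) (carrier H) (\<lambda>l h. compose ?T \<pi> ?s (tens k (fst S) H l h))"
    and ?g = "curry3 (carrier (snd S)) (carrier M) (carrier X) (\<lambda>l h. compose ?U \<kappa> ?t (tens k (snd S) X l h))"
  have r: "measures_alg k A (conv_alg k H B) (fst S) ?r" by (rule curry_alg[OF s]) simp_all
  have g: "measures_mod k A M (conv_mod k H X N) (fst S) ?r (snd S) ?g" by (rule curry_mod[OF t sb]) simp_all
  have ex: "\<exists>!m. cmor k S (P2,Q2) m \<and> (\<forall>c \<in> carrier (fst S). \<pi>2 (fst m c) = ?r c) \<and> (\<forall>x \<in> carrier (snd S). \<kappa>2 (snd m x) = ?g x)"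
    by (rule mod_factor[OF U2 C2 A conv_algebra[OF H B] M conv_left_module[OF H B X N] S fits_self fits_self r g])
  show ?thesis
  proof (rule ex1_cong[THEN iffD1, OF _ ex])
    fix m
    show "cmor k S (P2,Q2) m \<and> (\<forall>c \<in> carrier (fst S). \<pi>2 (fst m c) = ?r c) \<and> (\<forall>x \<in> carrier (snd S). \<kappa>2 (snd m x) = ?g x) \<longleftrightarrow>
      cmor k S (P2,Q2) m \<and>
      (\<forall>c \<in> carrier (fst S). \<forall>a \<in> carrier A. \<forall>h \<in> carrier H. \<pi>2 (fst m c) a h = \<pi> (\<pi>1 (fst f c) h) a) \<and>
      (\<forall>z \<in> carrier (snd S). \<forall>y \<in> carrier M. \<forall>x \<in> carrier X. \<kappa>2 (snd m z) y x = \<kappa> (\<kappa>1 (snd f z) x) y)"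
    proof (cases "cmor k S (P2,Q2) m")
      case True
      note m = cmorD[OF True S o(2), simplified]
      have "\<pi>2 (fst m c) = ?r c \<longleftrightarrow> (\<forall>a \<in> carrier A. \<forall>h \<in> carrier H. \<pi>2 (fst m c) a h = \<pi> (\<pi>1 (fst f c) h) a)"
        if "c \<in> carrier (fst S)" for c
        by (subst curry3_eq_iff) (use that lin_closed[OF m(3)] evs2 F(1) in \<open>simp_all add: compose_def\<close>)
      moreover have "\<kappa>2 (snd m c) = ?g c \<longleftrightarrow> (\<forall>a \<in> carrier M. \<forall>h \<in> carrier X. \<kappa>2 (snd m c) a h = \<kappa> (\<kappa>1 (snd f c) h) a)"
        if "c \<in> carrier (snd S)" for c
        by (subst curry3_eq_iff) (use that lin_closed[OF m(4)] evs2 F(2) in \<open>simp_all add: compose_def\<close>)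
      ultimately show ?thesis by simp
    qed simp
  qed
qed

text \<open>The way back passes through two universal properties: the uncurried measuring factors
  through \<open>(P,Q)\<close>, and that factorization, read as a measuring of comodules, factors
  through \<open>(P1,Q1)\<close>. Uniqueness therefore rests on \<open>unique1\<close>.\<close>

private lemma to1:
  assumes S: "cobj k (S :: ('k,'u,'u) cobj)" and g: "cmor k S (P2,Q2) g"
  shows "\<exists>!f. cmor k S (P1,Q1) f \<and>
    (\<forall>c \<in> carrier (fst S). \<forall>a \<in> carrier A. \<forall>h \<in> carrier H. \<pi>2 (fst g c) a h = \<pi> (\<pi>1 (fst f c) h) a) \<and>
    (\<forall>z \<in> carrier (snd S). \<forall>m \<in> carrier M. \<forall>x \<in> carrier X. \<kappa>2 (snd g z) m x = \<kappa> (\<kappa>1 (snd f z) x) m)"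
proof (rule ex_ex1I)
  note [simp] = cobjD[OF S]
  have o: "cobj k (P,Q)" "cobj k (P2,Q2)" by (simp_all add: cobj_def)
  note g' = cmorD[OF g S o(2), simplified]
  let ?r = "compose (carrier (fst S)) \<pi>2 (fst g)" and ?d = "compose (carrier (snd S)) \<kappa>2 (snd g)"
  have r: "measures_alg k A (conv_alg k H B) (fst S) ?r"
    by (rule measures_alg_comp[OF meas(5) g'(1)]) simp_all
  have d: "measures_mod k A M (conv_mod k H X N) (fst S) ?r (snd S) ?d"
    by (rule measures_mod_comp[OF meas(6) g'(3,2) _ conv_algebra[OF H B] conv_left_module[OF H B X N]]) (use evs2(1) in simp_all)
  have rb: "bilin k (fst S) A (hom_space k H B) ?r" "bilin k (snd S) M (hom_space k X N) ?d"
    using measures_alg_bilin(1)[OF r] measures_mod_bilin(1)[OF d] by simp_all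
  let ?s = "uncurry3 k (fst S) H (carrier A) B ?r" and ?t = "uncurry3 k (snd S) X (carrier M) N ?d"
  have s: "measures_alg k A B (tensor_coalg k (fst S) H) ?s" by (rule uncurry_alg[OF r]) simp_all
  have t: "measures_mod k A M N (tensor_coalg k (fst S) H) ?s (tensor_comod k (fst S) H (snd S) X) ?t"
    by (rule uncurry_mod[OF d rb(1)]) simp_all
  obtain n where n: "cmor k (ctensor k S (H,X)) (P,Q) n" "\<And>c. c \<in> carrier (tensor k (fst S) H) \<Longrightarrow> \<pi> (fst n c) = ?s c"
    "\<And>c. c \<in> carrier (tensor k (snd S) X) \<Longrightarrow> \<kappa> (snd n c) = ?t c"
    using mod_factor[OF UA UM A B M N tensor_fits[OF S], of ?s ?t] s t by (auto simp: ctensor_def)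
  let ?\<sigma> = "\<lambda>l \<in> carrier (fst S). \<lambda>h \<in> carrier H. fst n (tens k (fst S) H l h)"
    and ?\<theta> = "\<lambda>l \<in> carrier (snd S). \<lambda>h \<in> carrier X. snd n (tens k (snd S) X l h)"
  have m: "measures_coalg k H P (fst S) ?\<sigma>" "measures_comod k H X P Q (fst S) ?\<sigma> (snd S) ?\<theta>"
    using cmor_measures[of k "fst S" "snd S" H X P Q n] n(1) by simp_all
  obtain f where f: "cmor k S (P1,Q1) f" "\<And>c. c \<in> carrier (fst S) \<Longrightarrow> \<pi>1 (fst f c) = ?\<sigma> c" "\<And>c. c \<in> carrier (snd S) \<Longrightarrow> \<kappa>1 (snd f c) = ?\<theta> c"
    using comod_factor[OF U1 C1 H univ(1) X univ(2) S fits_self fits_self m] by blast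
  note [simp] = hom_bilin_lin[OF rb(1) coalgebra_module[OF H] k_algebra_module[OF B]] hom_bilin_lin[OF rb(2) MNX_modules(3,2)]
  have "\<pi>2 (fst g c) a h = \<pi> (\<pi>1 (fst f c) h) a" if [simp]: "c \<in> carrier (fst S)" "a \<in> carrier A" "h \<in> carrier H" for c a h
  proof -
    have "\<pi> (\<pi>1 (fst f c) h) a = ?s (tens k (fst S) H c h) a" by (simp add: f(2) n(2))
    also have "\<dots> = ?r c a h" by (rule uncurry3_tens) simp_all
    finally show ?thesis by (simp add: compose_def)
  qed
  moreover have "\<kappa>2 (snd g c) a h = \<kappa> (\<kappa>1 (snd f c) h) a" if [simp]: "c \<in> carrier (snd S)" "a \<in> carrier M" "h \<in> carrier X" for c a h
  proof -
    have "\<kappa> (\<kappa>1 (snd f c) h) a = ?t (tens k (snd S) X c h) a" by (simp add: f(3) n(3))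
    also have "\<dots> = ?d c a h" by (rule uncurry3_tens) simp_all
    finally show ?thesis by (simp add: compose_def)
  qed
  ultimately show "\<exists>f. cmor k S (P1,Q1) f \<and>
    (\<forall>c \<in> carrier (fst S). \<forall>a \<in> carrier A. \<forall>h \<in> carrier H. \<pi>2 (fst g c) a h = \<pi> (\<pi>1 (fst f c) h) a) \<and>
    (\<forall>z \<in> carrier (snd S). \<forall>m \<in> carrier M. \<forall>x \<in> carrier X. \<kappa>2 (snd g z) m x = \<kappa> (\<kappa>1 (snd f z) x) m)"
    using f(1) by blast
qed (rule unique1[OF S], simp_all)

lemma convolution_iso:
  "\<exists>\<phi>. ciso k (P1,Q1) (P2,Q2) \<phi> \<and>
    (\<forall>p \<in> carrier P1. \<forall>a \<in> carrier A. \<forall>h \<in> carrier H. \<pi>2 (fst \<phi> p) a h = \<pi> (\<pi>1 p h) a) \<and>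
    (\<forall>q \<in> carrier Q1. \<forall>m \<in> carrier M. \<forall>x \<in> carrier X. \<kappa>2 (snd \<phi> q) m x = \<kappa> (\<kappa>1 q x) m)"
  using ciso_of_relation[of k "(P1,Q1)" "(P2,Q2)"
      "\<lambda>p p'. \<forall>a \<in> carrier A. \<forall>h \<in> carrier H. \<pi>2 p' a h = \<pi> (\<pi>1 p h) a"
      "\<lambda>q q'. \<forall>m \<in> carrier M. \<forall>x \<in> carrier X. \<kappa>2 q' m x = \<kappa> (\<kappa>1 q x) m"] convolution_factor to1
  by (simp add: cobj_def)

end

section \<open>From \<open>Q(M,[X,N])\<close> to \<open>Q(M \<triangleleft> X,N)\<close>\<close>

context
  assumes U2: "universal_alg k A (conv_alg k H B) P2 \<pi>2" and C2: "universal_mod k A M (conv_alg k H B) (conv_mod k H X N) P2 \<pi>2 Q2 \<kappa>2"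
    and U3: "universal_alg k (tri_alg k A H) B P3 \<pi>3" and C3: "universal_mod k (tri_alg k A H) (tri_mod k A H M X) B N P3 \<pi>3 Q3 \<kappa>3"
begin

private lemma univ3: "coalgebra k P2" "comodule k P2 Q2" "coalgebra k P3" "comodule k P3 Q3"
  using U2 C2 U3 C3 by (simp_all add: universal_alg_def universal_mod_def)

private lemma meas3: 
  "measures_alg k A (conv_alg k H B) P2 \<pi>2" "measures_mod k A M (conv_mod k H X N) P2 \<pi>2 Q2 \<kappa>2"
  "measures_alg k (tri_alg k A H) B P3 \<pi>3" "measures_mod k (tri_alg k A H) (tri_mod k A H M X) N P3 \<pi>3 Q3 \<kappa>3"
  using U2 C2 U3 C3 by (simp_all add: universal_alg_def universal_mod_def)

private lemma cobjs: "cobj k (P2,Q2)" "cobj k (P3,Q3)"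
  using univ3 by (simp_all add: cobj_def)

private lemmas Talg [simp] = tri_algebra[OF A H] and U [simp] = tri_left_module[OF A H M X] and Um [simp] = tri_mod_module[OF A H M X]

private lemma evs3:
  "p \<in> carrier P2 \<Longrightarrow> \<pi>2 p \<in> extensional (carrier A)" "q \<in> carrier Q2 \<Longrightarrow> \<kappa>2 q \<in> extensional (carrier M)"
  "p \<in> carrier P2 \<Longrightarrow> a \<in> carrier A \<Longrightarrow> \<pi>2 p a \<in> extensional (carrier H)"
  "q \<in> carrier Q2 \<Longrightarrow> m \<in> carrier M \<Longrightarrow> \<kappa>2 q m \<in> extensional (carrier X)"
proof -
  note [simp] = univ3
  have b: "bilin k P2 A (hom_space k H B) \<pi>2" "bilin k Q2 M (hom_space k X N) \<kappa>2"
    using measures_alg_bilin[OF meas3(1)] measures_mod_bilin[OF meas3(2)] by simp_all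
  show "p \<in> carrier P2 \<Longrightarrow> \<pi>2 p \<in> extensional (carrier A)" "q \<in> carrier Q2 \<Longrightarrow> \<kappa>2 q \<in> extensional (carrier M)"
    using measures_alg_bilin[OF meas3(1)] measures_mod_bilin[OF meas3(2)] by simp_all
  show "p \<in> carrier P2 \<Longrightarrow> a \<in> carrier A \<Longrightarrow> \<pi>2 p a \<in> extensional (carrier H)"
    using bilin_closed[OF b(1)] hom_memD(3)[of k H B] by (simp add: hom_simps)
  show "q \<in> carrier Q2 \<Longrightarrow> m \<in> carrier M \<Longrightarrow> \<kappa>2 q m \<in> extensional (carrier X)"
    using bilin_closed[OF b(2)] hom_memD(3)[of k X N] by (simp add: hom_simps)
qed

private lemma bilin3: "bilin k P3 (tri_alg k A H) B \<pi>3" "bilin k P2 A (conv_alg k H B) \<pi>2"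
  using measures_alg_bilin(1)[OF meas3(3) univ3(3)] measures_alg_bilin(1)[OF meas3(1) univ3(1)] by simp_all

text \<open>Generators determine measurings by \<open>measures_tri_eq\<close> and
  \<open>measures_tri_mod_eq\<close>, and measurings determine morphisms by
  \<open>mod_unique\<close>.\<close>

private lemma unique3:
  assumes S: "cobj k (S :: ('k,'u,'u) cobj)" and f: "cmor k S (P3,Q3) f" "cmor k S (P3,Q3) g"
    and e: "\<And>c h a. c \<in> carrier (fst S) \<Longrightarrow> a \<in> carrier A \<Longrightarrow> h \<in> carrier H \<Longrightarrow>
        \<pi>3 (fst f c) (tri_gen k A H a h) = \<pi>3 (fst g c) (tri_gen k A H a h)"
      "\<And>z x m. z \<in> carrier (snd S) \<Longrightarrow> m \<in> carrier M \<Longrightarrow> x \<in> carrier X \<Longrightarrow>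
        \<kappa>3 (snd f z) (tri_mod_gen k A H M X \<one>\<^bsub>tri_alg k A H\<^esub> m x) = \<kappa>3 (snd g z) (tri_mod_gen k A H M X \<one>\<^bsub>tri_alg k A H\<^esub> m x)"
  shows "f = g"
proof -
  note [simp] = cobjD[OF S] univ3
  note f' = cmorD[OF f(1) S cobjs(2), simplified] and g' = cmorD[OF f(2) S cobjs(2), simplified]
  let ?C = "carrier (fst S)" and ?Z = "carrier (snd S)"
  have a: "measures_alg k (tri_alg k A H) B (fst S) (compose ?C \<pi>3 (fst h))" if "coalg_map k (fst S) P3 (fst h)" for h :: "('u,'u,'u,'u) cmor"
    by (rule measures_alg_comp[OF meas3(3) that]) simp_all
  have m: "measures_mod k (tri_alg k A H) (tri_mod k A H M X) N (fst S) (compose ?C \<pi>3 (fst h)) (snd S) (compose ?Z \<kappa>3 (snd h))"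
    if "lin k (fst S) P3 (fst h)" "comodule_map_along k (fst S) P3 (fst h) (snd S) Q3 (snd h)" for h :: "('u,'u,'u,'u) cmor"
    by (rule measures_mod_comp[OF meas3(4) that bilin3(1)]) simp_all
  have 1: "compose ?C \<pi>3 (fst f) = compose ?C \<pi>3 (fst g)"
    by (rule measures_tri_eq[OF a[OF f'(1)] a[OF g'(1)] A H B]) (use e in \<open>simp_all add: compose_def\<close>)
  \<comment> \<open>Folding the first equation puts both module measurings over the same algebra
    measuring, as \<open>measures_tri_mod_eq\<close> demands.\<close>
  have 2: "compose ?Z \<kappa>3 (snd f) = compose ?Z \<kappa>3 (snd g)"
    by (rule measures_tri_mod_eq[OF A H M X _ _ B N m[OF f'(3,2)] m[OF g'(3,2), folded 1]]) (use e in \<open>simp_all add: compose_def\<close>)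
  show ?thesis
  proof (rule mod_unique[OF U3 C3 Talg B U N S fits_self fits_self f])
    show "\<pi>3 (fst f c) = \<pi>3 (fst g c)" if "c \<in> ?C" for c using fun_cong[OF 1, of c] that by (simp add: compose_def)
    show "\<kappa>3 (snd f c) = \<kappa>3 (snd g c)" if "c \<in> ?Z" for c using fun_cong[OF 2, of c] that by (simp add: compose_def)
  qed
qed

text \<open>The pulled-back measuring prescribes values on generators;
  \<open>measures_tri_ex\<close> extends it to \<open>A \<triangleleft> H\<close>, and
  \<open>measures_tri_mod_ex\<close> extends the module part over that extension.\<close>

lemma triangle_factor:
  assumes S: "cobj k (S :: ('k,'u,'u) cobj)" and f: "cmor k S (P2,Q2) f"
  shows "\<exists>!g. cmor k S (P3,Q3) g \<and>
    (\<forall>c \<in> carrier (fst S). \<forall>a \<in> carrier A. \<forall>h \<in> carrier H. \<pi>3 (fst g c) (tri_gen k A H a h) = \<pi>2 (fst f c) a h) \<and>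
    (\<forall>z \<in> carrier (snd S). \<forall>m \<in> carrier M. \<forall>x \<in> carrier X.
      \<kappa>3 (snd g z) (tri_mod_gen k A H M X \<one>\<^bsub>tri_alg k A H\<^esub> m x) = \<kappa>2 (snd f z) m x)"
proof (rule ex_ex1I)
  note [simp] = cobjD[OF S] univ3
  note f' = cmorD[OF f S cobjs(1), simplified]
  let ?r = "compose (carrier (fst S)) \<pi>2 (fst f)" and ?d = "compose (carrier (snd S)) \<kappa>2 (snd f)"
  have r: "measures_alg k A (conv_alg k H B) (fst S) ?r"
    by (rule measures_alg_comp[OF meas3(1) f'(1)]) simp_all
  have d: "measures_mod k A M (conv_mod k H X N) (fst S) ?r (snd S) ?d"
    by (rule measures_mod_comp[OF meas3(2) f'(3,2) bilin3(2) conv_algebra[OF H B] conv_left_module[OF H B X N]]) simp_all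
  obtain \<sigma> where s: "measures_alg k (tri_alg k A H) B (fst S) \<sigma>"
    "\<And>l a h. l \<in> carrier (fst S) \<Longrightarrow> a \<in> carrier A \<Longrightarrow> h \<in> carrier H \<Longrightarrow> \<sigma> l (tri_gen k A H a h) = ?r l a h"
    using measures_tri_ex[OF r A B cobjD(1)[OF S] H] by blast
  obtain \<gamma> where g: "measures_mod k (tri_alg k A H) (tri_mod k A H M X) N (fst S) \<sigma> (snd S) \<gamma>"
    "\<And>y m x. y \<in> carrier (snd S) \<Longrightarrow> m \<in> carrier M \<Longrightarrow> x \<in> carrier X \<Longrightarrow>
      \<gamma> y (tri_mod_gen k A H M X \<one>\<^bsub>tri_alg k A H\<^esub> m x) = ?d y m x"
    using measures_tri_mod_ex[OF A H M X cobjD(1,2)[OF S] B N s(1) d r s(2)] by blast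
  obtain n where n: "cmor k S (P3,Q3) n" "\<And>c. c \<in> carrier (fst S) \<Longrightarrow> \<pi>3 (fst n c) = \<sigma> c" "\<And>c. c \<in> carrier (snd S) \<Longrightarrow> \<kappa>3 (snd n c) = \<gamma> c"
    using mod_factor[OF U3 C3 Talg B U N S fits_self fits_self s(1) g(1)] by blast
  then show "\<exists>g. cmor k S (P3,Q3) g \<and>
    (\<forall>c \<in> carrier (fst S). \<forall>a \<in> carrier A. \<forall>h \<in> carrier H. \<pi>3 (fst g c) (tri_gen k A H a h) = \<pi>2 (fst f c) a h) \<and>
    (\<forall>z \<in> carrier (snd S). \<forall>m \<in> carrier M. \<forall>x \<in> carrier X.
      \<kappa>3 (snd g z) (tri_mod_gen k A H M X \<one>\<^bsub>tri_alg k A H\<^esub> m x) = \<kappa>2 (snd f z) m x)"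
    using s(2) g(2) by (intro exI[of _ n]) (simp add: compose_def)
qed (rule unique3[OF S], simp_all)

text \<open>Here the measuring into the convolution objects is prescribed at all elements, so
  \<open>mod_factor\<close> yields existence and uniqueness at once.\<close>

private lemma from3:
  assumes S: "cobj k (S :: ('k,'u,'u) cobj)" and g: "cmor k S (P3,Q3) g"
  shows "\<exists>!f. cmor k S (P2,Q2) f \<and>
    (\<forall>c \<in> carrier (fst S). \<forall>a \<in> carrier A. \<forall>h \<in> carrier H. \<pi>3 (fst g c) (tri_gen k A H a h) = \<pi>2 (fst f c) a h) \<and>
    (\<forall>z \<in> carrier (snd S). \<forall>m \<in> carrier M. \<forall>x \<in> carrier X.
      \<kappa>3 (snd g z) (tri_mod_gen k A H M X \<one>\<^bsub>tri_alg k A H\<^esub> m x) = \<kappa>2 (snd f z) m x)"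
proof -
  note [simp] = cobjD[OF S] univ3
  note g' = cmorD[OF g S cobjs(2), simplified]
  let ?s = "compose (carrier (fst S)) \<pi>3 (fst g)" and ?t = "compose (carrier (snd S)) \<kappa>3 (snd g)"
  have s: "measures_alg k (tri_alg k A H) B (fst S) ?s"
    by (rule measures_alg_comp[OF meas3(3) g'(1)]) simp_all
  have t: "measures_mod k (tri_alg k A H) (tri_mod k A H M X) N (fst S) ?s (snd S) ?t"
    by (rule measures_mod_comp[OF meas3(4) g'(3,2) bilin3(1)]) simp_all
  let ?r = "curry3 (carrier (fst S)) (carrier A) (carrier H) (\<lambda>l h a. ?s l (tri_gen k A H a h))"
    and ?d = "curry3 (carrier (snd S)) (carrier M) (carrier X) (\<lambda>y x m. ?t y (tri_mod_gen k A H M X \<one>\<^bsub>tri_alg k A H\<^esub> m x))"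
  have r: "measures_alg k A (conv_alg k H B) (fst S) ?r" by (rule tri_measures_alg[OF s]) simp_all
  have d: "measures_mod k A M (conv_mod k H X N) (fst S) ?r (snd S) ?d"
    by (rule tri_measures_mod[OF t measures_alg_bilin(1)[OF s]]) simp_all
  have ex: "\<exists>!m. cmor k S (P2,Q2) m \<and> (\<forall>c \<in> carrier (fst S). \<pi>2 (fst m c) = ?r c) \<and> (\<forall>x \<in> carrier (snd S). \<kappa>2 (snd m x) = ?d x)"
    by (rule mod_factor[OF U2 C2 A conv_algebra[OF H B] M conv_left_module[OF H B X N] S fits_self fits_self r d])
  show ?thesis
  proof (rule ex1_cong[THEN iffD1, OF _ ex])
    fix m
    show "cmor k S (P2,Q2) m \<and> (\<forall>c \<in> carrier (fst S). \<pi>2 (fst m c) = ?r c) \<and> (\<forall>x \<in> carrier (snd S). \<kappa>2 (snd m x) = ?d x) \<longleftrightarrow>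
      cmor k S (P2,Q2) m \<and>
      (\<forall>c \<in> carrier (fst S). \<forall>a \<in> carrier A. \<forall>h \<in> carrier H. \<pi>3 (fst g c) (tri_gen k A H a h) = \<pi>2 (fst m c) a h) \<and>
      (\<forall>z \<in> carrier (snd S). \<forall>y \<in> carrier M. \<forall>x \<in> carrier X.
        \<kappa>3 (snd g z) (tri_mod_gen k A H M X \<one>\<^bsub>tri_alg k A H\<^esub> y x) = \<kappa>2 (snd m z) y x)"
    proof (cases "cmor k S (P2,Q2) m")
      case True
      note m = cmorD[OF True S cobjs(1), simplified]
      have "\<pi>2 (fst m c) = ?r c \<longleftrightarrow> (\<forall>a \<in> carrier A. \<forall>h \<in> carrier H. \<pi>3 (fst g c) (tri_gen k A H a h) = \<pi>2 (fst m c) a h)"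
        if "c \<in> carrier (fst S)" for c
        by (subst curry3_eq_iff) (use that lin_closed[OF m(3)] evs3 in \<open>auto simp: compose_def\<close>)
      moreover have "\<kappa>2 (snd m c) = ?d c \<longleftrightarrow> (\<forall>a \<in> carrier M. \<forall>h \<in> carrier X.
          \<kappa>3 (snd g c) (tri_mod_gen k A H M X \<one>\<^bsub>tri_alg k A H\<^esub> a h) = \<kappa>2 (snd m c) a h)"
        if "c \<in> carrier (snd S)" for c
        by (subst curry3_eq_iff) (use that lin_closed[OF m(4)] evs3 in \<open>auto simp: compose_def\<close>)
      ultimately show ?thesis by simp
    qed simp
  qed
qed

lemma triangle_iso:
  "\<exists>\<phi>. ciso k (P2,Q2) (P3,Q3) \<phi> \<and>
    (\<forall>p \<in> carrier P2. \<forall>a \<in> carrier A. \<forall>h \<in> carrier H. \<pi>3 (fst \<phi> p) (tri_gen k A H a h) = \<pi>2 p a h) \<and>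
    (\<forall>q \<in> carrier Q2. \<forall>m \<in> carrier M. \<forall>x \<in> carrier X.
      \<kappa>3 (snd \<phi> q) (tri_mod_gen k A H M X \<one>\<^bsub>tri_alg k A H\<^esub> m x) = \<kappa>2 q m x)"
  using ciso_of_relation[of k "(P2,Q2)" "(P3,Q3)"
      "\<lambda>p p'. \<forall>a \<in> carrier A. \<forall>h \<in> carrier H. \<pi>3 p' (tri_gen k A H a h) = \<pi>2 p a h"
      "\<lambda>q q'. \<forall>m \<in> carrier M. \<forall>x \<in> carrier X. \<kappa>3 q' (tri_mod_gen k A H M X \<one>\<^bsub>tri_alg k A H\<^esub> m x) = \<kappa>2 q m x"]
    cobjs triangle_factor from3
  by simp

end

end

section \<open>Naturality\<close>

text \<open>The axioms are not recomputed: the measuring is read as a morphism out of a tensor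
  product, precomposed with the tensor product of the identity and \<open>m\<close>, and read back
  as a measuring.\<close>

lemma measures_precomp_comod:
  assumes s: "measures_coalg k H' K L \<sigma>" and t: "measures_comod k H' X' K Y L \<sigma> Z \<theta>" and m: "cmor k (H,X) (H',X') m"
    and [simp]: "coalgebra k H" "coalgebra k H'" "coalgebra k K" "coalgebra k L"
      "comodule k H X" "comodule k H' X'" "comodule k K Y" "comodule k L Z"
  defines "\<sigma>' \<equiv> \<lambda>l \<in> carrier L. compose (carrier H) (\<sigma> l) (fst m)" and "\<theta>' \<equiv> \<lambda>z \<in> carrier Z. compose (carrier X) (\<theta> z) (snd m)"
  shows "measures_coalg k H K L \<sigma>'" "measures_comod k H X K Y L \<sigma>' Z \<theta>'"
proof -
  note [simp] = comodule_module[of k H X] comodule_module[of k H' X'] comodule_module[of k K Y] comodule_module[of k L Z]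
  have o [simp]: "cobj k (L,Z)" "cobj k (H,X)" "cobj k (H',X')" "cobj k (K,Y)" by (simp_all add: cobj_def)
  note m' = cmorD[OF m o(2,3), simplified]
  let ?i = "ctensor_mor k (L,Z) (H,X) (L,Z) (H',X') (cid (L,Z)) m"
  let ?e = "(tlift k L H' K \<sigma>, tlift k Z X' Y \<theta>)"
  let ?n = "ccomp (ctensor k (L,Z) (H,X)) ?e ?i"
  have e: "cmor k (ctensor k (L,Z) (H',X')) (K,Y) ?e" by (rule measures_cmor[OF s t]) simp_all
  have i: "cmor k (ctensor k (L,Z) (H,X)) (ctensor k (L,Z) (H',X')) ?i"
    by (rule cmor_tensor[OF cmor_id[OF o(1)] m o(1,1,2,3)])
  have n: "cmor k (ctensor k (L,Z) (H,X)) (K,Y) ?n"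
    by (rule cmor_comp[OF i e]) (simp_all add: cobj_tensor)
  have b: "bilin k L H' K \<sigma>" "bilin k Z X' Y \<theta>"
    using measures_coalg_bilin(1)[OF s] measures_comod_bilin(1)[OF t] by simp_all
  note c = cmorD(3,4)[OF cmor_id[OF o(1)] o(1,1), simplified]
  have s': "\<sigma>' = (\<lambda>l \<in> carrier L. \<lambda>h \<in> carrier H. fst ?n (tens k L H l h))"
    unfolding \<sigma>'_def compose_def using b m' c lin_closed[OF m'(3)]
    by (auto intro!: restrict_ext simp: ccomp_def compose_eq ctensor_mor_def cid_def)
  have t': "\<theta>' = (\<lambda>l \<in> carrier Z. \<lambda>h \<in> carrier X. snd ?n (tens k Z X l h))"
    unfolding \<theta>'_def compose_def using b m' c lin_closed[OF m'(4)]
    by (auto intro!: restrict_ext simp: ccomp_def compose_eq ctensor_mor_def cid_def)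
  show "measures_coalg k H K L \<sigma>'" "measures_comod k H X K Y L \<sigma>' Z \<theta>'"
    using cmor_measures[OF n] unfolding s' t' by simp_all
qed

text \<open>Postcomposition with \<open>conv_map\<close> becomes precomposition after uncurrying:
  uncurry, pull back along the tensor product of the identity and \<open>m\<close>, and curry
  again.\<close>

lemma measures_conv_map:
  assumes r: "measures_alg k A (conv_alg k H' B) L \<rho>" and d: "measures_mod k A M (conv_mod k H' X' N) L \<rho> Y \<gamma>"
    and m: "cmor k (H,X) (H',X') m"
    and A [simp]: "k_algebra k A" and B [simp]: "k_algebra k B" and M [simp]: "left_module k A M" and N [simp]: "left_module k B N"
    and H [simp]: "coalgebra k H" "coalgebra k H'" and L [simp]: "coalgebra k L"
    and X [simp]: "comodule k H X" "comodule k H' X'" and Y [simp]: "comodule k L Y"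
  defines "\<rho>' \<equiv> \<lambda>l \<in> carrier L. compose (carrier A) (fst (conv_map (H,X) m)) (\<rho> l)"
    and "\<gamma>' \<equiv> \<lambda>y \<in> carrier Y. compose (carrier M) (snd (conv_map (H,X) m)) (\<gamma> y)"
  shows "measures_alg k A (conv_alg k H B) L \<rho>'" "measures_mod k A M (conv_mod k H X N) L \<rho>' Y \<gamma>'"
proof -
  note [simp] = comodule_module[OF X(1)] comodule_module[OF X(2)] comodule_module[OF Y] left_module_module[OF M] left_module_module[OF N]
  have o [simp]: "cobj k (L,Y)" "cobj k (H,X)" "cobj k (H',X')" by (simp_all add: cobj_def)
  note m' = cmorD[OF m o(2,3), simplified]
  let ?i = "ctensor_mor k (L,Y) (H,X) (L,Y) (H',X') (cid (L,Y)) m"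
  have i: "cmor k (ctensor k (L,Y) (H,X)) (ctensor k (L,Y) (H',X')) ?i"
    by (rule cmor_tensor[OF cmor_id[OF o(1)] m o(1,1,2,3)])
  note i' = cmorD[OF i cobj_tensor[OF o(1,2)] cobj_tensor[OF o(1,3)], unfolded ctensor_def, simplified]
  have b: "bilin k L A (hom_space k H' B) \<rho>" "bilin k Y M (hom_space k X' N) \<gamma>"
    using measures_alg_bilin(1)[OF r] measures_mod_bilin(1)[OF d] by simp_all
  let ?s = "uncurry3 k L H' (carrier A) B \<rho>" and ?d = "uncurry3 k Y X' (carrier M) N \<gamma>"
  have s: "measures_alg k A B (tensor_coalg k L H') ?s" by (rule uncurry_alg[OF r]) simp_all
  have t: "measures_mod k A M N (tensor_coalg k L H') ?s (tensor_comod k L H' Y X') ?d"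
    by (rule uncurry_mod[OF d b(1)]) simp_all
  let ?T = "carrier (tensor k L H)" and ?U = "carrier (tensor k Y X)"
  have s1: "measures_alg k A B (tensor_coalg k L H) (compose ?T ?s (fst ?i))"
    using measures_alg_comp[OF s i'(1)] by simp
  have t1: "measures_mod k A M N (tensor_coalg k L H) (compose ?T ?s (fst ?i)) (tensor_comod k L H Y X) (compose ?U ?d (snd ?i))"
    using measures_mod_comp[OF t _ i'(2) measures_alg_bilin(1)[OF s]] i'(3) by (simp add: comodule_tensor)
  have sb: "bilin k (tensor k L H) A B (compose ?T ?s (fst ?i))" using measures_alg_bilin(1)[OF s1] by simp
  note s2 = curry_alg[OF s1 A B L H(1)] and t2 = curry_mod[OF t1 sb A B L H(1) M N Y X(1)]
  note [simp] = hom_bilin_lin[OF b(1) coalgebra_module[OF H(2)] k_algebra_module[OF B]]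
    hom_bilin_lin[OF b(2) comodule_module[OF X(2)] left_module_module[OF N]]
  note c = cmorD(3,4)[OF cmor_id[OF o(1)] o(1,1), simplified]
  have s': "\<rho>' = curry3 (carrier L) (carrier A) (carrier H) (\<lambda>l h. compose ?T ?s (fst ?i) (tens k L H l h))"
    unfolding \<rho>'_def curry3_def compose_def using m' c lin_closed[OF m'(3)]
    by (auto intro!: restrict_ext simp: conv_map_def compose_def ctensor_mor_def cid_def)
  have t': "\<gamma>' = curry3 (carrier Y) (carrier M) (carrier X) (\<lambda>l h. compose ?U ?d (snd ?i) (tens k Y X l h))"
    unfolding \<gamma>'_def curry3_def compose_def using m' c lin_closed[OF m'(4)]
    by (auto intro!: restrict_ext simp: conv_map_def compose_def ctensor_mor_def cid_def)
  show "measures_alg k A (conv_alg k H B) L \<rho>'" "measures_mod k A M (conv_mod k H X N) L \<rho>' Y \<gamma>'"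
    using s2 t2 unfolding s' t' by simp_all
qed

text \<open>The pair \<open>g\<close>, \<open>G\<close> is a change of algebra together with a
  semilinear map over it, as provided by \<open>tri_map\<close>; self-modules give the case of
  algebras.\<close>

lemma measures_precomp_mod:
  assumes d: "measures_mod k A' M' N L \<rho> Y \<gamma>" and g: "lin k A A' g" and G: "lin k M M' G"
    and e: "\<And>a m. a \<in> carrier A \<Longrightarrow> m \<in> carrier M \<Longrightarrow> G (act M a m) = act M' (g a) (G m)"
    and A [simp]: "k_algebra k A" and M [simp]: "left_module k A M" and M' [simp]: "module k M'" and N [simp]: "module k N"
    and L [simp]: "coalgebra k L" and Y [simp]: "comodule k L Y"
  shows "measures_mod k A M N L (\<lambda>l \<in> carrier L. compose (carrier A) (\<rho> l) g) Y (\<lambda>y \<in> carrier Y. compose (carrier M) (\<gamma> y) G)"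
proof -
  note [simp] = comodule_module[OF Y] left_module_module[OF M] left_module_lin(3)[OF A M]
  note b = measures_mod_bilin(1)[OF d, simplified]
  note [simp] = bilin_lin[OF b] lin_closed[OF g] lin_closed[OF G] G
  have "bilin k Y M N (\<lambda>l a. \<gamma> l (G a))" by simp
  then have "bilin k Y M N (\<lambda>y \<in> carrier Y. compose (carrier M) (\<gamma> y) G)"
    by (rule iffD1[OF bilin_cong, rotated]) (simp add: compose_eq)
  then show ?thesis
    by (intro measures_modI) (use d in \<open>simp_all add: measures_mod_def compose_eq e\<close>)
qed

lemma measures_precomp_alg:
  assumes r: "measures_alg k A' B L \<rho>" and g: "alg_hom k A A' g"
    and A: "k_algebra k A" "k_algebra k A'" and B: "k_algebra k B" and L: "coalgebra k L"
  shows "measures_alg k A B L (\<lambda>l \<in> carrier L. compose (carrier A) (\<rho> l) g)"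
  using measures_precomp_mod[of k A' "self_module A'" "self_module B" L \<rho> "regular L" \<rho> A g "self_module A" g]
    r A B L k_algebra_one[OF A(1)] alg_homD[OF g] coalgebra_regular[OF L]
  by (simp add: measures_alg_iff compose_eq)

context
  fixes k :: "('k,'r) ring_scheme" and A :: "('k,'a) module" and H :: "('k,'h) coalg" and H' :: "('k,'h1) coalg"
    and M :: "('k,'a,'m) alg_module" and X :: "('k,'h,'x) comod" and X' :: "('k,'h1,'x1) comod" and m :: "('h,'h1,'x,'x1) cmor"
  assumes A [simp]: "k_algebra k A" and M [simp]: "left_module k A M" and H [simp]: "coalgebra k H" "coalgebra k H'"
    and X [simp]: "comodule k H X" "comodule k H' X'" and m: "cmor k (H,X) (H',X') m"
begin

private lemmas Talgs = tri_algebra[OF A H(1)] tri_algebra[OF A H(2)]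
private lemmas m' = cmorD[OF m, unfolded cobj_iff, OF conjI[OF H(1) X(1)] conjI[OF H(2) X(2)], simplified]

text \<open>Justifies the definite description. The first component of \<open>m\<close> is a
  coalgebra map, so it respects both families of relations and \<open>tri_alg_lift\<close> gives
  existence; uniqueness holds since generators are prescribed.\<close>

lemma tri_alg_map:
  "alg_hom k (tri_alg k A H) (tri_alg k A H') (tri_alg_map k A H H' (fst m))"
  "a \<in> carrier A \<Longrightarrow> h \<in> carrier H \<Longrightarrow> tri_alg_map k A H H' (fst m) (tri_gen k A H a h) = tri_gen k A H' a (fst m h)"
proof -
  let ?T = "tri_alg k A H" and ?T' = "tri_alg k A H'"
  note [simp] = Talgs k_algebra_module[OF Talgs(1)] k_algebra_module[OF Talgs(2)]
  note [simp] = bilin_lin[OF tri_gen_bilin[OF A H(2)]] lin_closed[OF m'(3)] m'(3) bilin_lin[OF k_algebra_bilin[OF Talgs(2)]]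
  have b: "bilin k A H ?T' (\<lambda>a h. tri_gen k A H' a (fst m h))" by simp
  obtain f where f: "alg_hom k ?T ?T' f" "\<And>a h. a \<in> carrier A \<Longrightarrow> h \<in> carrier H \<Longrightarrow> f (tri_gen k A H a h) = tri_gen k A H' a (fst m h)"
  proof (rule tri_alg_lift[OF A H(1) Talgs(2) b])
    show "tri_gen k A H' (a \<otimes>\<^bsub>A\<^esub> a') (fst m h) =
      tlift k H H ?T' (\<lambda>x y. tri_gen k A H' a (fst m x) \<otimes>\<^bsub>?T'\<^esub> tri_gen k A H' a' (fst m y)) (comult H h)"
      if [simp]: "a \<in> carrier A" "a' \<in> carrier A" "h \<in> carrier H" for a a' h
      by (simp add: tri_gen_mult[OF A H(2)] tlift_comult_map[OF m'(1)])
    show "tri_gen k A H' \<one>\<^bsub>A\<^esub> (fst m h) = counit H h \<odot>\<^bsub>?T'\<^esub> \<one>\<^bsub>?T'\<^esub>" if "h \<in> carrier H" for h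
      using that by (simp add: tri_gen_one[OF A H(2)] coalg_map_counit[OF m'(1)])
  qed blast
  have gc: "tri_gen k A H a h \<in> carrier ?T" if "a \<in> carrier A" "h \<in> carrier H" for a h
    using bilin_closed[OF tri_gen_bilin[OF A H(1)] that] .
  have alg: "alg_hom k ?T ?T' g" if "g \<in> Lin k ?T ?T'" "g \<in> ring_hom ?T ?T'" for g
    using that by (auto simp: alg_hom_def Lin_iff ring_hom_def)
  let ?P = "\<lambda>g. g \<in> Lin k ?T ?T' \<and> g \<in> ring_hom ?T ?T' \<and>
     (\<forall>a \<in> carrier A. \<forall>h \<in> carrier H. g (tri_gen k A H a h) = tri_gen k A H' a (fst m h))"
  have ring: "ring ?T" using Talgs(1) by (simp add: k_algebra_def)
  have ex: "?P (restrict f (carrier ?T))"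
    using f gc lin_closed[OF alg_homD(1)[OF f(1)]] ring.ring_simprules(5,6)[OF ring] alg_homD[OF f(1)] lin_add[OF alg_homD(1)[OF f(1)]]
    by (auto simp: Lin_iff ring_hom_def ring.ring_simprules[OF ring])
  have "\<exists>!g. ?P g"
  proof (rule ex1I[of ?P, OF ex])
    fix g assume g: "?P g"
    show "g = restrict f (carrier ?T)"
    proof (rule extensionalityI[of _ "carrier ?T"])
      fix t assume "t \<in> carrier ?T"
      then show "g t = restrict f (carrier ?T) t"
        using tri_alg_ext[OF A H(1) alg f(1), of g t] g f(2) by simp
    qed (use g in \<open>simp_all add: Lin_iff\<close>)
  qed
  from theI'[OF this] have p: "?P (tri_alg_map k A H H' (fst m))" unfolding tri_alg_map_def .
  then show "alg_hom k ?T ?T' (tri_alg_map k A H H' (fst m))" using alg by blast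
  show "a \<in> carrier A \<Longrightarrow> h \<in> carrier H \<Longrightarrow> tri_alg_map k A H H' (fst m) (tri_gen k A H a h) = tri_gen k A H' a (fst m h)"
    using p by blast
qed

private abbreviation (input) "g \<equiv> tri_alg_map k A H H' (fst m)"
private abbreviation (input) "U \<equiv> tri_mod k A H M X"
private abbreviation (input) "U' \<equiv> tri_mod k A H' M X'"

private lemma g_lin [simp]: "lin k (tri_alg k A H) (tri_alg k A H') g"
  by (rule alg_homD(1)[OF tri_alg_map(1)])

text \<open>The third conclusion, semilinearity along the algebra map, is what makes precomposition
  with this map preserve measurings of modules.\<close>

lemma tri_mod_map:
  defines "G \<equiv> snd (tri_map k A M (H,X) (H',X') m)"
  shows "lin k U U' G"
    "t \<in> carrier (tri_alg k A H) \<Longrightarrow> y \<in> carrier M \<Longrightarrow> x \<in> carrier X \<Longrightarrow>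
      G (tri_mod_gen k A H M X t y x) = tri_mod_gen k A H' M X' (g t) y (snd m x)"
    "t \<in> carrier (tri_alg k A H) \<Longrightarrow> u \<in> carrier U \<Longrightarrow> G (act U t u) = act U' (g t) (G u)"
proof -
  let ?T = "tri_alg k A H" and ?T' = "tri_alg k A H'"
  note [simp] = k_algebra_module[OF Talgs(1)] k_algebra_module[OF Talgs(2)] left_module_module[OF M] comodule_module[OF X(1)] comodule_module[OF X(2)]
  note Um [simp] = tri_mod_module[OF A H(1) M X(1)] tri_mod_module[OF A H(2) M X(2)]
  note [simp] = tri_mod_gen_lin[OF A H(2) M X(2)] lin_closed[OF m'(4)] lin_closed[OF m'(3)] m'(3,4) lin_closed[OF g_lin]
    bilin_lin[OF tri_gen_bilin[OF A H(2)]]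
    bilin_lin[OF k_algebra_bilin[OF Talgs(1)]] k_algebra_one[OF Talgs(2)]
    left_module_lin[OF A M] left_module_lin[OF Talgs(2) tri_left_module[OF A H(2) M X(2)]]
  let ?gen = "tri_mod_gen k A H M X" and ?gen' = "tri_mod_gen k A H' M X'"
  note U' = tri_left_module[OF A H(2) M X(2)]
  have act: "act U' (g t) (?gen' \<one>\<^bsub>?T'\<^esub> y (snd m x)) = ?gen' (g t) y (snd m x)" if "t \<in> carrier ?T" "y \<in> carrier M" "x \<in> carrier X" for t y x
    using that by (simp add: tri_mod_act_gen[OF A H(2) M X(2)] k_algebra_assoc[OF Talgs(2)])
  have gc: "tri_gen k A H a h \<in> carrier ?T" if "a \<in> carrier A" "h \<in> carrier H" for a h
    using bilin_closed[OF tri_gen_bilin[OF A H(1)] that] .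
  \<comment> \<open>The map is generated by sending \<open>y\<close> and \<open>x\<close> to
    \<open>1 \<otimes> y \<otimes> m x\<close>, with the target acted upon through the algebra map
    \<open>g\<close>. The required relation holds because \<open>snd m\<close> is a comodule map
    along \<open>fst m\<close>.\<close>
  obtain f where f: "lin k U U' f" "\<And>t y x. t \<in> carrier ?T \<Longrightarrow> y \<in> carrier M \<Longrightarrow> x \<in> carrier X \<Longrightarrow> f (?gen t y x) = ?gen' (g t) y (snd m x)"
  proof (rule tri_mod_hom[OF A H(1) M X(1) Talgs(2) U' tri_alg_map(1), of "\<lambda>y x. ?gen' \<one>\<^bsub>?T'\<^esub> y (snd m x)"])
    fix a y x assume [simp]: "a \<in> carrier A" "y \<in> carrier M" "x \<in> carrier X"
    show "?gen' \<one>\<^bsub>?T'\<^esub> (act M a y) (snd m x) = tlift k H X U' (\<lambda>h x. act U' (g (tri_gen k A H a h)) (?gen' \<one>\<^bsub>?T'\<^esub> y (snd m x))) (coact X x)"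
      by (simp add: act gc) (simp add: tri_mod_gen_act[OF A H(2) M X(2)] tlift_coact_map[OF m'(2)] tri_alg_map(2))
  qed (simp_all add: act)
  let ?P = "\<lambda>f. f \<in> Lin k U U' \<and> (\<forall>t \<in> carrier ?T. \<forall>y \<in> carrier M. \<forall>x \<in> carrier X. f (?gen t y x) = ?gen' (g t) y (snd m x))"
  have "\<exists>!f. ?P f"
  proof (rule ex1I[of ?P])
    show "?P (restrict f (carrier U))" using f tri_mod_gen_lin(4)[OF A H(1) M X(1)] by (simp add: Lin_iff)
    fix f' assume f': "?P f'"
    show "f' = restrict f (carrier U)"
    proof (rule extensionalityI[of _ "carrier U"])
      fix u assume u: "u \<in> carrier U"
      show "f' u = restrict f (carrier U) u"
        using tri_mod_ext[OF A H(1) M X(1) _ f(1) _ u, of f'] f' f(2) u by (simp add: Lin_iff)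
    qed (use f' in \<open>simp_all add: Lin_iff\<close>)
  qed
  from theI'[OF this] have p: "?P G" unfolding G_def tri_map_def fst_conv snd_conv .
  then show Gl: "lin k U U' G" by (simp add: Lin_iff)
  show "t \<in> carrier ?T \<Longrightarrow> y \<in> carrier M \<Longrightarrow> x \<in> carrier X \<Longrightarrow> G (?gen t y x) = ?gen' (g t) y (snd m x)" using p by blast
  note [simp] = left_module_lin[OF Talgs(1) tri_left_module[OF A H(1) M X(1)]]
  show "G (act U t u) = act U' (g t) (G u)" if t: "t \<in> carrier ?T" and u: "u \<in> carrier U"
    by (rule tri_mod_ext[OF A H(1) M X(1) _ _ _ u, where U = U'])
      (use t Gl p in \<open>simp_all add: lin_comp[OF Gl] tri_mod_act_gen[OF A H(1) M X(1)] tri_mod_act_gen[OF A H(2) M X(2)] alg_homD(2)[OF tri_alg_map(1)]\<close>)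
qed

end

section \<open>Induced morphisms and naturality of the isomorphisms\<close>

lemma factor_unique:
  assumes "\<exists>!m. cmor k S T m \<and> (\<forall>c \<in> carrier (fst S). fst ev (fst m c) = fst \<mu> c) \<and> (\<forall>x \<in> carrier (snd S). snd ev (snd m x) = snd \<mu> x)"
  shows "cmor k S T (factor k S T ev \<mu>)" "c \<in> carrier (fst S) \<Longrightarrow> fst ev (fst (factor k S T ev \<mu>) c) = fst \<mu> c"
    "x \<in> carrier (snd S) \<Longrightarrow> snd ev (snd (factor k S T ev \<mu>) x) = snd \<mu> x"
  using theI'[OF assms] unfolding factor_def by blast+

text \<open>The components of \<open>\<mu>\<close> are restricted in the hypotheses since measurings
  are extensional, whereas \<open>precomp\<close> and \<open>postcomp\<close> supply unrestricted
  functions.\<close>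

lemma factor_mod:
  fixes P :: "('k,'u) coalg" and S :: "('k,'u,'u) cobj"
  assumes "universal_alg k A B P \<pi>" "universal_mod k A M B N P \<pi> Q \<kappa>"
    and "k_algebra k A" "k_algebra k B" "left_module k A M" "left_module k B N" "cobj k S"
    and "measures_alg k A B (fst S) (\<lambda>c \<in> carrier (fst S). fst \<mu> c)"
      "measures_mod k A M N (fst S) (\<lambda>c \<in> carrier (fst S). fst \<mu> c) (snd S) (\<lambda>x \<in> carrier (snd S). snd \<mu> x)"
  shows "cmor k S (P,Q) (factor k S (P,Q) (\<pi>,\<kappa>) \<mu>)"
    "c \<in> carrier (fst S) \<Longrightarrow> \<pi> (fst (factor k S (P,Q) (\<pi>,\<kappa>) \<mu>) c) = fst \<mu> c"
    "x \<in> carrier (snd S) \<Longrightarrow> \<kappa> (snd (factor k S (P,Q) (\<pi>,\<kappa>) \<mu>) x) = snd \<mu> x"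
  using factor_unique[of k S "(P,Q)" "(\<pi>,\<kappa>)" \<mu>] mod_factor[OF assms(1-7) fits_self fits_self assms(8,9)]
  by (simp_all cong: ball_cong)

lemma factor_comod:
  fixes P :: "('k,'u) coalg" and S :: "('k,'u,'u) cobj"
  assumes "universal_coalg k H K P \<pi>" "universal_comod k H X K Y P \<pi> Q \<kappa>"
    and "coalgebra k H" "coalgebra k K" "comodule k H X" "comodule k K Y" "cobj k S"
    and "measures_coalg k H K (fst S) (\<lambda>c \<in> carrier (fst S). fst \<mu> c)"
      "measures_comod k H X K Y (fst S) (\<lambda>c \<in> carrier (fst S). fst \<mu> c) (snd S) (\<lambda>x \<in> carrier (snd S). snd \<mu> x)"
  shows "cmor k S (P,Q) (factor k S (P,Q) (\<pi>,\<kappa>) \<mu>)"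
    "c \<in> carrier (fst S) \<Longrightarrow> \<pi> (fst (factor k S (P,Q) (\<pi>,\<kappa>) \<mu>) c) = fst \<mu> c"
    "x \<in> carrier (snd S) \<Longrightarrow> \<kappa> (snd (factor k S (P,Q) (\<pi>,\<kappa>) \<mu>) x) = snd \<mu> x"
  using factor_unique[of k S "(P,Q)" "(\<pi>,\<kappa>)" \<mu>] comod_factor[OF assms(1-7) fits_self fits_self assms(8,9)]
  by (simp_all cong: ball_cong)

lemma adjunction_isomorphisms:
  fixes k :: "('k,'r) ring_scheme"
    and A :: "('k,'a) module" and M :: "('k,'a,'m) alg_module" and B :: "('k,'b) module" and N :: "('k,'b,'n) alg_module"
    and P :: "('k,'u) coalg" and Q :: "('k,'u,'u) comod"
    and P1 P2 P3 :: "('k,'h) coalg \<Rightarrow> ('k,'u) coalg" and Q1 Q2 Q3 :: "('k,'h,'x) cobj \<Rightarrow> ('k,'u,'u) comod"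
  assumes inf: "infinite (UNIV :: 'u set)" and inj: "\<exists>\<iota> :: 'h \<Rightarrow> 'u. inj \<iota>" "\<exists>\<iota> :: 'x \<Rightarrow> 'u. inj \<iota>"
    and A: "k_algebra k A" and M: "left_module k A M" and B: "k_algebra k B" and N: "left_module k B N"
    and UA: "universal_alg k A B P \<pi>" and UM: "universal_mod k A M B N P \<pi> Q \<kappa>"
    and U1: "\<And>H. coalgebra k H \<Longrightarrow> universal_coalg k H P (P1 H) (\<pi>1 H)"
    and C1: "\<And>H X. coalgebra k H \<Longrightarrow> comodule k H X \<Longrightarrow>
          universal_comod k H X P Q (P1 H) (\<pi>1 H) (Q1 (H,X)) (\<kappa>1 (H,X))"
    and U2: "\<And>H. coalgebra k H \<Longrightarrow> universal_alg k A (conv_alg k H B) (P2 H) (\<pi>2 H)"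
    and C2: "\<And>H X. coalgebra k H \<Longrightarrow> comodule k H X \<Longrightarrow>
          universal_mod k A M (conv_alg k H B) (conv_mod k H X N) (P2 H) (\<pi>2 H) (Q2 (H,X)) (\<kappa>2 (H,X))"
    and U3: "\<And>H. coalgebra k H \<Longrightarrow> universal_alg k (tri_alg k A H) B (P3 H) (\<pi>3 H)"
    and C3: "\<And>H X. coalgebra k H \<Longrightarrow> comodule k H X \<Longrightarrow>
          universal_mod k (tri_alg k A H) (tri_mod k A H M X) B N (P3 H) (\<pi>3 H) (Q3 (H,X)) (\<kappa>3 (H,X))"
  shows "\<exists>(\<Phi> :: ('k,'h,'x) cobj \<Rightarrow> ('u,'u,'u,'u) cmor) (\<Psi> :: ('k,'h,'x) cobj \<Rightarrow> ('u,'u,'u,'u) cmor).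
          (\<forall>H X. coalgebra k H \<and> comodule k H X \<longrightarrow>
             ciso k (P1 H, Q1 (H,X)) (P2 H, Q2 (H,X)) (\<Phi> (H,X)) \<and>
             (\<forall>p \<in> carrier (P1 H). \<forall>a \<in> carrier A. \<forall>h \<in> carrier H.
                \<pi>2 H (fst (\<Phi> (H,X)) p) a h = \<pi> (\<pi>1 H p h) a) \<and>
             ciso k (P2 H, Q2 (H,X)) (P3 H, Q3 (H,X)) (\<Psi> (H,X)) \<and>
             (\<forall>p \<in> carrier (P2 H). \<forall>a \<in> carrier A. \<forall>h \<in> carrier H.
                \<pi>3 H (fst (\<Psi> (H,X)) p) (tri_gen k A H a h) = \<pi>2 H p a h)) \<and>
          (\<forall>H X H' X' m. coalgebra k H \<and> comodule k H X \<and> coalgebra k H' \<and> comodule k H' X' \<and>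
             cmor k (H,X) (H',X') m \<longrightarrow>
             ccomp (P1 H', Q1 (H',X')) (\<Phi> (H,X))
               (precomp k (P1 H', Q1 (H',X')) (\<pi>1 H', \<kappa>1 (H',X')) (P1 H, Q1 (H,X)) (\<pi>1 H, \<kappa>1 (H,X))
                  (carrier H, carrier X) m) =
             ccomp (P1 H', Q1 (H',X'))
               (postcomp k (P2 H', Q2 (H',X')) (\<pi>2 H', \<kappa>2 (H',X')) (P2 H, Q2 (H,X)) (\<pi>2 H, \<kappa>2 (H,X))
                  (carrier A, carrier M) (conv_map (H,X) m))
               (\<Phi> (H',X')) \<and>
             ccomp (P2 H', Q2 (H',X')) (\<Psi> (H,X))
               (postcomp k (P2 H', Q2 (H',X')) (\<pi>2 H', \<kappa>2 (H',X')) (P2 H, Q2 (H,X)) (\<pi>2 H, \<kappa>2 (H,X))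
                  (carrier A, carrier M) (conv_map (H,X) m)) =
             ccomp (P2 H', Q2 (H',X'))
               (precomp k (P3 H', Q3 (H',X')) (\<pi>3 H', \<kappa>3 (H',X')) (P3 H, Q3 (H,X)) (\<pi>3 H, \<kappa>3 (H,X))
                  (carrier (tri_alg k A H), carrier (tri_mod k A H M X)) (tri_map k A M (H,X) (H',X') m))
               (\<Psi> (H',X')))"
proof -
  have fits: "fits TYPE('u) (S :: 'h set)" "fits TYPE('u) (S' :: 'x set)" "fits TYPE('u) (S'' :: 'u set)" for S S' S''
    using inj unfolding fits_def by (blast intro: inj_on_subset subset_UNIV inj_on_id2)+
  note algs [simp] = A M B N
  \<comment> \<open>Besides what the conclusion asks for, the relation on the comodule components is
    recorded; the proof of naturality relies on it.\<close>
  define phi where "phi H X \<phi> \<longleftrightarrow> ciso k (P1 H, Q1 (H,X)) (P2 H, Q2 (H,X)) \<phi> \<and>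
    (\<forall>p \<in> carrier (P1 H). \<forall>a \<in> carrier A. \<forall>h \<in> carrier H. \<pi>2 H (fst \<phi> p) a h = \<pi> (\<pi>1 H p h) a) \<and>
    (\<forall>q \<in> carrier (Q1 (H,X)). \<forall>m \<in> carrier M. \<forall>x \<in> carrier X. \<kappa>2 (H,X) (snd \<phi> q) m x = \<kappa> (\<kappa>1 (H,X) q x) m)" for H X \<phi>
  define psi where "psi H X \<phi> \<longleftrightarrow> ciso k (P2 H, Q2 (H,X)) (P3 H, Q3 (H,X)) \<phi> \<and>
    (\<forall>p \<in> carrier (P2 H). \<forall>a \<in> carrier A. \<forall>h \<in> carrier H. \<pi>3 H (fst \<phi> p) (tri_gen k A H a h) = \<pi>2 H p a h) \<and>
    (\<forall>q \<in> carrier (Q2 (H,X)). \<forall>m \<in> carrier M. \<forall>x \<in> carrier X.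
      \<kappa>3 (H,X) (snd \<phi> q) (tri_mod_gen k A H M X \<one>\<^bsub>tri_alg k A H\<^esub> m x) = \<kappa>2 (H,X) q m x)" for H X \<phi>
  \<comment> \<open>The isomorphisms are chosen for each object separately. Naturality survives the
    choice because the relation in \<open>phi\<close> pins each of them down on structure
    maps.\<close>
  define \<Phi> where "\<Phi> S = (SOME \<phi>. phi (fst S) (snd S) \<phi>)" for S :: "('k,'h,'x) cobj"
  define \<Psi> where "\<Psi> S = (SOME \<phi>. psi (fst S) (snd S) \<phi>)" for S :: "('k,'h,'x) cobj"
  have \<Phi>: "phi H X (\<Phi> (H,X))" if "coalgebra k H" "comodule k H X" for H X
    unfolding \<Phi>_def fst_conv snd_conv
    by (rule someI_ex) (unfold phi_def, rule convolution_iso[OF A B M N that inf fits(1,2) UA UM U1 C1 U2 C2]; fact)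
  have \<Psi>: "psi H X (\<Psi> (H,X))" if "coalgebra k H" "comodule k H X" for H X
    unfolding \<Psi>_def fst_conv snd_conv
    by (rule someI_ex) (unfold psi_def, rule triangle_iso[OF A B M N that U2 C2 U3 C3]; fact)
  show ?thesis
  proof (rule exI[of _ \<Phi>], rule exI[of _ \<Psi>], rule conjI, goal_cases)
    case 1
    then show ?case using \<Phi> \<Psi> by (simp add: phi_def psi_def)
  next
    case 2
    show ?case
    proof (intro allI impI, elim conjE, goal_cases)
      case (1 H X H' X' m)
      let "ccomp ?S1' _ ?pre = ccomp _ ?post _ \<and> ccomp ?S2' _ _ = ccomp _ ?pre3 _" = ?case
      note H [simp] = 1(1,3) and X [simp] = 1(2,4) and m = 1(5)
      note u = U1[OF H(1)] U1[OF H(2)] U2[OF H(1)] U2[OF H(2)] U3[OF H(1)] U3[OF H(2)]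
      note c = C1[OF H(1) X(1)] C1[OF H(2) X(2)] C2[OF H(1) X(1)] C2[OF H(2) X(2)] C3[OF H(1) X(1)] C3[OF H(2) X(2)]
      have [simp]: "coalgebra k P" "comodule k P Q" "coalgebra k (P1 H)" "comodule k (P1 H) (Q1 (H,X))"
        "coalgebra k (P1 H')" "comodule k (P1 H') (Q1 (H',X'))" "coalgebra k (P2 H)" "comodule k (P2 H) (Q2 (H,X))"
        "coalgebra k (P2 H')" "comodule k (P2 H') (Q2 (H',X'))" "coalgebra k (P3 H)" "comodule k (P3 H) (Q3 (H,X))"
        "coalgebra k (P3 H')" "comodule k (P3 H') (Q3 (H',X'))"
        and ms: "measures_coalg k H' P (P1 H') (\<pi>1 H')" "measures_comod k H' X' P Q (P1 H') (\<pi>1 H') (Q1 (H',X')) (\<kappa>1 (H',X'))"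
          "measures_alg k A (conv_alg k H' B) (P2 H') (\<pi>2 H')"
          "measures_mod k A M (conv_mod k H' X' N) (P2 H') (\<pi>2 H') (Q2 (H',X')) (\<kappa>2 (H',X'))"
          "measures_alg k (tri_alg k A H') B (P3 H') (\<pi>3 H')"
          "measures_mod k (tri_alg k A H') (tri_mod k A H' M X') N (P3 H') (\<pi>3 H') (Q3 (H',X')) (\<kappa>3 (H',X'))"
        using UA UM u c by (simp_all add: universal_alg_def universal_mod_def universal_coalg_def universal_comod_def)
      have o: "cobj k (H,X)" "cobj k (H',X')" "cobj k (P1 H, Q1 (H,X))" "cobj k ?S1'" "cobj k (P2 H, Q2 (H,X))" "cobj k ?S2'"
        "cobj k (P3 H, Q3 (H,X))" "cobj k (P3 H', Q3 (H',X'))"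
        by (simp_all add: cobj_def)
      note T = tri_algebra[OF A H(1)] tri_algebra[OF A H(2)]
      note tm = tri_alg_map[OF A M H X m] tri_mod_map[OF A M H X m]
      \<comment> \<open>\<open>precomp\<close> is a definite description; from here on it is known
        through its composites with the structure maps.\<close>
      have pre: "cmor k ?S1' (P1 H, Q1 (H,X)) ?pre"
        "p \<in> carrier (P1 H') \<Longrightarrow> \<pi>1 H (fst ?pre p) = compose (carrier H) (\<pi>1 H' p) (fst m)"
        "q \<in> carrier (Q1 (H',X')) \<Longrightarrow> \<kappa>1 (H,X) (snd ?pre q) = compose (carrier X) (\<kappa>1 (H',X') q) (snd m)" for p q
        using factor_comod[OF u(1) c(1) H(1) _ X(1) _ o(4), where
            \<mu> = "(\<lambda>p. compose (carrier H) (\<pi>1 H' p) (fst m), \<lambda>q. compose (carrier X) (\<kappa>1 (H',X') q) (snd m))"]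
          measures_precomp_comod[OF ms(1,2) m]
        by (simp_all add: precomp_def)
      \<comment> \<open>The annotation fixes the codomains \<open>'b\<close> and \<open>'n\<close>,
        which are not determined by \<open>m\<close>.\<close>
      let ?cm = "conv_map (H,X) m :: (('h \<Rightarrow> 'b) \<Rightarrow> 'h \<Rightarrow> 'b) \<times> (('x \<Rightarrow> 'n) \<Rightarrow> 'x \<Rightarrow> 'n)"
      have cv: "fst ?cm \<beta> = compose (carrier H) \<beta> (fst m)" "snd ?cm \<zeta> = compose (carrier X) \<zeta> (snd m)"
        for \<beta> :: "'h \<Rightarrow> 'b" and \<zeta> :: "'x \<Rightarrow> 'n"
        by (simp_all add: conv_map_def)
      have cm: "measures_alg k A (conv_alg k H B) (P2 H') (\<lambda>p \<in> carrier (P2 H'). compose (carrier A) (fst ?cm) (\<pi>2 H' p))"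
        "measures_mod k A M (conv_mod k H X N) (P2 H') (\<lambda>p \<in> carrier (P2 H'). compose (carrier A) (fst ?cm) (\<pi>2 H' p))
          (Q2 (H',X')) (\<lambda>q \<in> carrier (Q2 (H',X')). compose (carrier M) (snd ?cm) (\<kappa>2 (H',X') q))"
        by (rule measures_conv_map[OF ms(3,4) m A B M N H _ X]; simp)+
      have post: "cmor k ?S2' (P2 H, Q2 (H,X)) ?post"
        "p \<in> carrier (P2 H') \<Longrightarrow> \<pi>2 H (fst ?post p) = compose (carrier A) (fst ?cm) (\<pi>2 H' p)"
        "q \<in> carrier (Q2 (H',X')) \<Longrightarrow> \<kappa>2 (H,X) (snd ?post q) = compose (carrier M) (snd ?cm) (\<kappa>2 (H',X') q)" for p q
        using factor_mod[OF u(3) c(3) A conv_algebra[OF H(1) B] M conv_left_module[OF H(1) B X(1) N] o(6), where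
            \<mu> = "(\<lambda>p. compose (carrier A) (fst ?cm) (\<pi>2 H' p), \<lambda>q. compose (carrier M) (snd ?cm) (\<kappa>2 (H',X') q))"]
          cm
        by (simp_all add: postcomp_def)
      have g: "fst (tri_map k A M (H,X) (H',X') m) = tri_alg_map k A H H' (fst m)" by (simp add: tri_map_def)
      have pre3: "cmor k (P3 H', Q3 (H',X')) (P3 H, Q3 (H,X)) ?pre3"
        "p \<in> carrier (P3 H') \<Longrightarrow> \<pi>3 H (fst ?pre3 p) = compose (carrier (tri_alg k A H)) (\<pi>3 H' p) (fst (tri_map k A M (H,X) (H',X') m))"
        "q \<in> carrier (Q3 (H',X')) \<Longrightarrow> \<kappa>3 (H,X) (snd ?pre3 q) =
          compose (carrier (tri_mod k A H M X)) (\<kappa>3 (H',X') q) (snd (tri_map k A M (H,X) (H',X') m))" for p q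
        using factor_mod[OF u(5) c(5) T(1) B tri_left_module[OF A H(1) M X(1)] N o(8), where
            \<mu> = "(\<lambda>p. compose (carrier (tri_alg k A H)) (\<pi>3 H' p) (fst (tri_map k A M (H,X) (H',X') m)),
              \<lambda>q. compose (carrier (tri_mod k A H M X)) (\<kappa>3 (H',X') q) (snd (tri_map k A M (H,X) (H',X') m)))"]
          measures_precomp_alg[OF ms(5) tm(1) T B]
          measures_precomp_mod[OF ms(6) alg_homD(1)[OF tm(1)] tm(3,5) T(1) tri_left_module[OF A H(1) M X(1)]
            tri_mod_module[OF A H(2) M X(2)] left_module_module[OF N]]
        by (simp_all add: precomp_def g)
      have p: "phi H X (\<Phi> (H,X))" "phi H' X' (\<Phi> (H',X'))" "psi H X (\<Psi> (H,X))" "psi H' X' (\<Psi> (H',X'))"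
        by (rule \<Phi> \<Psi>; fact)+
      have pm: "cmor k (P1 H, Q1 (H,X)) (P2 H, Q2 (H,X)) (\<Phi> (H,X))" "cmor k ?S1' ?S2' (\<Phi> (H',X'))"
        "cmor k (P2 H, Q2 (H,X)) (P3 H, Q3 (H,X)) (\<Psi> (H,X))" "cmor k ?S2' (P3 H', Q3 (H',X')) (\<Psi> (H',X'))"
        using p by (simp_all add: phi_def psi_def ciso_def)
      note cl [simp] = cmorD(3,4)[OF pre(1) o(4,3), THEN lin_closed, simplified] cmorD(3,4)[OF post(1) o(6,5), THEN lin_closed, simplified]
        cmorD(3,4)[OF pm(2) o(4,6), THEN lin_closed, simplified] cmorD(3,4)[OF pm(4) o(6,8), THEN lin_closed, simplified]
        cmorD(3,4)[OF m o(1,2), THEN lin_closed, simplified]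
      \<comment> \<open>Both composites are partners of \<open>?pre\<close> in the sense of
        \<open>convolution_factor\<close>, whose uniqueness clause makes them equal.\<close>
      have "ccomp ?S1' (\<Phi> (H,X)) ?pre = ccomp ?S1' ?post (\<Phi> (H',X'))"
      proof (rule ex1_unique[OF convolution_factor[OF A B M N H(1) X(1) inf fits(1,2) UA UM u(1) c(1) u(3) c(3) o(4) pre(1)]])
        show "cmor k ?S1' (P2 H, Q2 (H,X)) (ccomp ?S1' (\<Phi> (H,X)) ?pre) \<and>
          (\<forall>c \<in> carrier (fst ?S1'). \<forall>a \<in> carrier A. \<forall>h \<in> carrier H. \<pi>2 H (fst (ccomp ?S1' (\<Phi> (H,X)) ?pre) c) a h = \<pi> (\<pi>1 H (fst ?pre c) h) a) \<and>
          (\<forall>z \<in> carrier (snd ?S1'). \<forall>y \<in> carrier M. \<forall>x \<in> carrier X. \<kappa>2 (H,X) (snd (ccomp ?S1' (\<Phi> (H,X)) ?pre) z) y x = \<kappa> (\<kappa>1 (H,X) (snd ?pre z) x) y)"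
          using cmor_comp[OF pre(1) pm(1) o(4,3,5)] p(1) by (simp add: phi_def ccomp_apply)
        show "cmor k ?S1' (P2 H, Q2 (H,X)) (ccomp ?S1' ?post (\<Phi> (H',X'))) \<and>
          (\<forall>c \<in> carrier (fst ?S1'). \<forall>a \<in> carrier A. \<forall>h \<in> carrier H. \<pi>2 H (fst (ccomp ?S1' ?post (\<Phi> (H',X'))) c) a h = \<pi> (\<pi>1 H (fst ?pre c) h) a) \<and>
          (\<forall>z \<in> carrier (snd ?S1'). \<forall>y \<in> carrier M. \<forall>x \<in> carrier X. \<kappa>2 (H,X) (snd (ccomp ?S1' ?post (\<Phi> (H',X'))) z) y x = \<kappa> (\<kappa>1 (H,X) (snd ?pre z) x) y)"
          using cmor_comp[OF pm(2) post(1) o(4,6,5)] p(2) by (simp add: phi_def ccomp_apply post pre cv compose_eq)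
      qed
      \<comment> \<open>Likewise both composites are partners of \<open>?post\<close> in
        \<open>triangle_factor\<close>. The comparison takes place on generators, where
        \<open>tri_map\<close> replaces \<open>h\<close> and \<open>x\<close> by their images under
        \<open>m\<close> and fixes \<open>1\<close>.\<close>
      moreover have "ccomp ?S2' (\<Psi> (H,X)) ?post = ccomp ?S2' ?pre3 (\<Psi> (H',X'))"
      proof (rule ex1_unique[OF triangle_factor[OF A B M N H(1) X(1) u(3) c(3) u(5) c(5) o(6) post(1)]])
        show "cmor k ?S2' (P3 H, Q3 (H,X)) (ccomp ?S2' (\<Psi> (H,X)) ?post) \<and>
          (\<forall>c \<in> carrier (fst ?S2'). \<forall>a \<in> carrier A. \<forall>h \<in> carrier H. \<pi>3 H (fst (ccomp ?S2' (\<Psi> (H,X)) ?post) c) (tri_gen k A H a h) = \<pi>2 H (fst ?post c) a h) \<and>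
          (\<forall>z \<in> carrier (snd ?S2'). \<forall>y \<in> carrier M. \<forall>x \<in> carrier X.
            \<kappa>3 (H,X) (snd (ccomp ?S2' (\<Psi> (H,X)) ?post) z) (tri_mod_gen k A H M X \<one>\<^bsub>tri_alg k A H\<^esub> y x) = \<kappa>2 (H,X) (snd ?post z) y x)"
          using cmor_comp[OF post(1) pm(3) o(6,5,7)] p(3) by (simp add: psi_def ccomp_apply)
        show "cmor k ?S2' (P3 H, Q3 (H,X)) (ccomp ?S2' ?pre3 (\<Psi> (H',X'))) \<and>
          (\<forall>c \<in> carrier (fst ?S2'). \<forall>a \<in> carrier A. \<forall>h \<in> carrier H. \<pi>3 H (fst (ccomp ?S2' ?pre3 (\<Psi> (H',X'))) c) (tri_gen k A H a h) = \<pi>2 H (fst ?post c) a h) \<and>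
          (\<forall>z \<in> carrier (snd ?S2'). \<forall>y \<in> carrier M. \<forall>x \<in> carrier X.
            \<kappa>3 (H,X) (snd (ccomp ?S2' ?pre3 (\<Psi> (H',X'))) z) (tri_mod_gen k A H M X \<one>\<^bsub>tri_alg k A H\<^esub> y x) = \<kappa>2 (H,X) (snd ?post z) y x)"
          using cmor_comp[OF pm(4) pre3(1) o(6,8,7)] p(4) bilin_closed[OF tri_gen_bilin[OF A H(1)]]
            tri_mod_gen_lin(4)[OF A H(1) M X(1) k_algebra_one[OF T(1)]] k_algebra_one[OF T(1)]
          by (simp add: psi_def ccomp_apply post pre3 cv compose_eq g tm(2,4) alg_homD(3)[OF tm(1)])
      qed
      ultimately show ?case by blast
    qed
  qed
qed

theorem theorem4p16:
  fixes k :: "('k,'r) ring_scheme"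
  assumes "field k"
    and "infinite (UNIV :: 'u set)"
    and "\<exists>\<iota> :: 'k \<Rightarrow> 'u. inj \<iota>"
  shows
    "(\<forall>(P :: ('k,'a) module \<Rightarrow> ('k,'a) module \<Rightarrow> ('k,'u) coalg)
       (\<pi> :: ('k,'a) module \<Rightarrow> ('k,'a) module \<Rightarrow> 'u \<Rightarrow> 'a \<Rightarrow> 'a)
       (Q :: ('k,'a) module \<times> ('k,'a,'m) alg_module \<Rightarrow> ('k,'a) module \<times> ('k,'a,'m) alg_module \<Rightarrow>
          ('k,'u,'u) comod)
       (\<kappa> :: ('k,'a) module \<times> ('k,'a,'m) alg_module \<Rightarrow> ('k,'a) module \<times> ('k,'a,'m) alg_module \<Rightarrow>
          'u \<Rightarrow> 'm \<Rightarrow> 'm).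
       (\<forall>A B. k_algebra k A \<and> k_algebra k B \<longrightarrow> universal_alg k A B (P A B) (\<pi> A B)) \<and>
       (\<forall>A M B N. k_algebra k A \<and> left_module k A M \<and> k_algebra k B \<and> left_module k B N \<longrightarrow>
          universal_mod k A M B N (P A B) (\<pi> A B) (Q (A,M) (B,N)) (\<kappa> (A,M) (B,N))) \<longrightarrow>
       (\<exists>cmp idn.
          comodule_enriched_category k {(A,M). k_algebra k A \<and> left_module k A M}
            (\<lambda>u v. (P (fst u) (fst v), Q u v)) cmp idn \<and>
          induced_by_composition k {(A,M). k_algebra k A \<and> left_module k A M}
            (\<lambda>u. (carrier (fst u), carrier (snd u)))
            (\<lambda>u v. (P (fst u) (fst v), Q u v)) (\<lambda>u v. (\<pi> (fst u) (fst v), \<kappa> u v)) cmp idn))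
     \<and>
     (\<forall>(P :: ('k,'h) coalg \<Rightarrow> ('k,'h) coalg \<Rightarrow> ('k,'u) coalg)
       (\<pi> :: ('k,'h) coalg \<Rightarrow> ('k,'h) coalg \<Rightarrow> 'u \<Rightarrow> 'h \<Rightarrow> 'h)
       (Q :: ('k,'h,'x) cobj \<Rightarrow> ('k,'h,'x) cobj \<Rightarrow> ('k,'u,'u) comod)
       (\<kappa> :: ('k,'h,'x) cobj \<Rightarrow> ('k,'h,'x) cobj \<Rightarrow> 'u \<Rightarrow> 'x \<Rightarrow> 'x).
       (\<forall>H K. coalgebra k H \<and> coalgebra k K \<longrightarrow> universal_coalg k H K (P H K) (\<pi> H K)) \<and>
       (\<forall>H X K Y. coalgebra k H \<and> comodule k H X \<and> coalgebra k K \<and> comodule k K Y \<longrightarrow>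
          universal_comod k H X K Y (P H K) (\<pi> H K) (Q (H,X) (K,Y)) (\<kappa> (H,X) (K,Y))) \<longrightarrow>
       (\<exists>cmp idn.
          comodule_enriched_category k {(H,X). coalgebra k H \<and> comodule k H X}
            (\<lambda>u v. (P (fst u) (fst v), Q u v)) cmp idn \<and>
          induced_by_composition k {(H,X). coalgebra k H \<and> comodule k H X}
            (\<lambda>u. (carrier (fst u), carrier (snd u)))
            (\<lambda>u v. (P (fst u) (fst v), Q u v)) (\<lambda>u v. (\<pi> (fst u) (fst v), \<kappa> u v)) cmp idn))
     \<and>
     (\<forall>(A :: ('k,'a) module) (M :: ('k,'a,'m) alg_module) (B :: ('k,'b) module) (N :: ('k,'b,'n) alg_module)
       (P :: ('k,'u) coalg) \<pi> (Q :: ('k,'u,'u) comod) \<kappa>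
       (P1 :: ('k,'h) coalg \<Rightarrow> ('k,'u) coalg) \<pi>1 (Q1 :: ('k,'h,'x) cobj \<Rightarrow> ('k,'u,'u) comod) \<kappa>1
       (P2 :: ('k,'h) coalg \<Rightarrow> ('k,'u) coalg) \<pi>2 (Q2 :: ('k,'h,'x) cobj \<Rightarrow> ('k,'u,'u) comod) \<kappa>2
       (P3 :: ('k,'h) coalg \<Rightarrow> ('k,'u) coalg) \<pi>3 (Q3 :: ('k,'h,'x) cobj \<Rightarrow> ('k,'u,'u) comod) \<kappa>3.
       (\<exists>\<iota> :: 'h \<Rightarrow> 'u. inj \<iota>) \<and> (\<exists>\<iota> :: 'x \<Rightarrow> 'u. inj \<iota>) \<and>
       k_algebra k A \<and> left_module k A M \<and> k_algebra k B \<and> left_module k B N \<and>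
       universal_alg k A B P \<pi> \<and> universal_mod k A M B N P \<pi> Q \<kappa> \<and>
       (\<forall>H. coalgebra k H \<longrightarrow> universal_coalg k H P (P1 H) (\<pi>1 H)) \<and>
       (\<forall>H X. coalgebra k H \<and> comodule k H X \<longrightarrow>
          universal_comod k H X P Q (P1 H) (\<pi>1 H) (Q1 (H,X)) (\<kappa>1 (H,X))) \<and>
       (\<forall>H. coalgebra k H \<longrightarrow> universal_alg k A (conv_alg k H B) (P2 H) (\<pi>2 H)) \<and>
       (\<forall>H X. coalgebra k H \<and> comodule k H X \<longrightarrow>
          universal_mod k A M (conv_alg k H B) (conv_mod k H X N)
            (P2 H) (\<pi>2 H) (Q2 (H,X)) (\<kappa>2 (H,X))) \<and>
       (\<forall>H. coalgebra k H \<longrightarrow> universal_alg k (tri_alg k A H) B (P3 H) (\<pi>3 H)) \<and>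
       (\<forall>H X. coalgebra k H \<and> comodule k H X \<longrightarrow>
          universal_mod k (tri_alg k A H) (tri_mod k A H M X) B N
            (P3 H) (\<pi>3 H) (Q3 (H,X)) (\<kappa>3 (H,X))) \<longrightarrow>
       (\<exists>(\<Phi> :: ('k,'h,'x) cobj \<Rightarrow> ('u,'u,'u,'u) cmor) (\<Psi> :: ('k,'h,'x) cobj \<Rightarrow> ('u,'u,'u,'u) cmor).
          (\<forall>H X. coalgebra k H \<and> comodule k H X \<longrightarrow>
             ciso k (P1 H, Q1 (H,X)) (P2 H, Q2 (H,X)) (\<Phi> (H,X)) \<and>
             (\<forall>p \<in> carrier (P1 H). \<forall>a \<in> carrier A. \<forall>h \<in> carrier H.
                \<pi>2 H (fst (\<Phi> (H,X)) p) a h = \<pi> (\<pi>1 H p h) a) \<and>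
             ciso k (P2 H, Q2 (H,X)) (P3 H, Q3 (H,X)) (\<Psi> (H,X)) \<and>
             (\<forall>p \<in> carrier (P2 H). \<forall>a \<in> carrier A. \<forall>h \<in> carrier H.
                \<pi>3 H (fst (\<Psi> (H,X)) p) (tri_gen k A H a h) = \<pi>2 H p a h)) \<and>
          (\<forall>H X H' X' m. coalgebra k H \<and> comodule k H X \<and> coalgebra k H' \<and> comodule k H' X' \<and>
             cmor k (H,X) (H',X') m \<longrightarrow>
             ccomp (P1 H', Q1 (H',X')) (\<Phi> (H,X))
               (precomp k (P1 H', Q1 (H',X')) (\<pi>1 H', \<kappa>1 (H',X')) (P1 H, Q1 (H,X)) (\<pi>1 H, \<kappa>1 (H,X))
                  (carrier H, carrier X) m) =
             ccomp (P1 H', Q1 (H',X'))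
               (postcomp k (P2 H', Q2 (H',X')) (\<pi>2 H', \<kappa>2 (H',X')) (P2 H, Q2 (H,X)) (\<pi>2 H, \<kappa>2 (H,X))
                  (carrier A, carrier M) (conv_map (H,X) m))
               (\<Phi> (H',X')) \<and>
             ccomp (P2 H', Q2 (H',X')) (\<Psi> (H,X))
               (postcomp k (P2 H', Q2 (H',X')) (\<pi>2 H', \<kappa>2 (H',X')) (P2 H, Q2 (H,X)) (\<pi>2 H, \<kappa>2 (H,X))
                  (carrier A, carrier M) (conv_map (H,X) m)) =
             ccomp (P2 H', Q2 (H',X'))
               (precomp k (P3 H', Q3 (H',X')) (\<pi>3 H', \<kappa>3 (H',X')) (P3 H, Q3 (H,X)) (\<pi>3 H, \<kappa>3 (H,X))
                  (carrier (tri_alg k A H), carrier (tri_mod k A H M X)) (tri_map k A M (H,X) (H',X') m))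
               (\<Psi> (H',X')))))"
proof -
  have k: "cring k" using \<open>field k\<close> by (simp add: field_def domain_def)
  show ?thesis
  proof (intro conjI allI impI, goal_cases)
    case (1 P \<pi> Q \<kappa>)
    then show ?case by (intro modules_enriched[OF k assms(2,3)]) blast+
  next
    case (2 P \<pi> Q \<kappa>)
    then show ?case by (intro comodules_enriched[OF k assms(2,3)]) blast+
  next
    case 3
    then show ?case by (elim conjE) (rule adjunction_isomorphisms[OF assms(2)]; blast)
  qed
qed

end
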